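(* Let $\alpha,\beta\in(0,1]$, $\lambda,\mu>0$, $K\ge 1$ an integer, and $p_1,\dots,p_K>0$ with $p_1+\dots+p_K=1$; put $P_0=0$, $P_i=p_1+\dots+p_i$ and $\gamma=\max\{\alpha,\beta\}$. Consider the restless multiclass Mittag-Leffler queue with $K$ priority classes, arrival process ${\rm FPP}(\alpha,\lambda)$, class probabilities $p_1,\dots,p_K$, and departure process ${\rm FPP}(\beta,\mu)$. Let $Q_i(t)$ be the number of class $i$ customers present at time $t$ and $Q_{\le i}(t)=\sum_{\ell=1}^iQ_\ell(t)$. Let $Y_\alpha$ and $\widetilde Y_\alpha$ be two independent inverse standard $\alpha$-stable subordinators. Then for any $1\le i\le K$, as $u\to\infty$, we have the weak convergence $$\left\{\frac{Q_{\le i}(ut)}{u^\gamma}\right\}_{t\ge 0}\stackrel{d}{\longrightarrow}\begin{cases}\lambda^\alpha P_iY_\alpha, & \gamma=\alpha>\beta,\\ 0, & \gamma=\beta>\alpha,\\ \Phi\big(\lambda^\alpha P_iY_\alpha-\mu^\alpha\widetilde Y_\alpha\big), & \gamma=\alpha=\beta,\end{cases}$$ in the space $D[0,\infty)$ of real càdlàg functions equipped with the Skorokhod topology $J_1$ (where $0$ denotes the zero function). Moreover, if $\alpha=\beta$, then for any $1\le i\le K$ the individual class queue lengths satisfy, in the same sense, $$\left\{\frac{Q_i(ut)}{u^\gamma}\right\}_{t\ge 0}\stackrel{d}{\longrightarrow}\Phi\big(\lambda^\alpha P_iY_\alpha-\mu^\alpha\widetilde Y_\alpha\big)-\Phi\big(\lambda^\alpha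 P_{i-1}Y_\alpha-\mu^\alpha\widetilde Y_\alpha\big).$$
   Context: Mittag-Leffler function: $E_\theta(z)=\sum_{\ell\ge 0} z^\ell/\Gamma(1+\theta\ell)$. Fractional Poisson process: for $\theta\in(0,1]$ and $\lambda>0$, ${\rm FPP}(\theta,\lambda)$ denotes the law of the counting process $N^{\theta,\lambda}(t)=\max\{n\ge 0: X_1+\dots+X_n\le t\}$, $t\ge 0$, where $X_1,X_2,\dots$ are i.i.d. nonnegative random variables with distribution function $F(x)=1-E_\theta(-\lambda^\theta x^\theta)$, $x\ge 0$. For $\theta=1$ this is a Poisson process of rate $\lambda$. Inverse stable subordinator: a standard $\theta$-stable subordinator $L_\theta$, $\theta\in(0,1]$, is a nondecreasing Lévy process with $\mathbb{E}(e^{-tL_\theta(s)})=e^{-st^\theta}$ for $s,t\ge 0$ (so $L_1(s)=s$). Its inverse is $Y_\theta(t)=\inf\{s>0:L_\theta(s)>t\}$, $t\ge 0$ (so $Y_1(t)=t$). Skorokhod reflection map: for a càdlàg $f:[0,\infty)\to\mathbb{R}$ with $f(0)=0$, $\Phi(f)(t)=f(t)-\inf_{0\le s\le t}f(s)$. Restless multiclass Mittag-Leffler queue: the arrival process $N^{\alpha,\lambda}\sim{\rm FPP}(\alpha,\lambda)$ and the departure process $D^{\beta,\mu}\sim{\rm FPP}(\beta,\mu)$ are independent, and the queue is empty at time $0$. At each jump of $N^{\alpha,\lambda}$ one customer arrives and is placed, independently of everything else, in class $i$ with probability $p_i$ ($1\le i\le K$), so $Q_i$ increases by $1$. At each jump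 of $D^{\beta,\mu}$, if the queue is nonempty, the earliest-arrived customer of the nonempty class with the smallest index leaves (that class's $Q_j$ decreases by $1$); if the queue is empty, nothing happens. The total queue length satisfies $Q(t)=\sum_{i=1}^KQ_i(t)=\Phi(N^{\alpha,\lambda}-D^{\beta,\mu})(t)$. *)

theory Defs
  imports "HOL-Probability.Probability"
begin

definition mittag_leffler :: "real \<Rightarrow> real \<Rightarrow> real" where
  "mittag_leffler \<theta> z = (\<Sum>l. z ^ l / Gamma (1 + \<theta> * real l))"

text \<open>The partial sums \<open>\<Sum>k<n. X k\<close> increase to infinity almost surely, so the maximum below exists
  outside a null set.\<close>

definition fractional_poisson_process ::
    "'a measure \<Rightarrow> real \<Rightarrow> real \<Rightarrow> (real \<Rightarrow> 'a \<Rightarrow> nat) \<Rightarrow> bool" where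
  "fractional_poisson_process M \<theta> lam N \<longleftrightarrow>
     (\<exists>X :: nat \<Rightarrow> 'a \<Rightarrow> real.
        prob_space.indep_vars M (\<lambda>_. borel) X UNIV \<and>
        (\<forall>k. AE \<omega> in M. 0 \<le> X k \<omega>) \<and>
        (\<forall>k. \<forall>x\<ge>0. measure M {\<omega> \<in> space M. X k \<omega> \<le> x} =
                     1 - mittag_leffler \<theta> (- (lam powr \<theta> * x powr \<theta>))) \<and>
        (AE \<omega> in M. \<forall>t\<ge>0. N t \<omega> = Max {n. (\<Sum>k<n. X k \<omega>) \<le> t}))"

definition cadlag :: "(real \<Rightarrow> real) \<Rightarrow> bool" where
  "cadlag f \<longleftrightarrow>
     (\<forall>t\<ge>0. (f \<longlongrightarrow> f t) (at_right t)) \<and> (\<forall>t>0. \<exists>l. (f \<longlongrightarrow> l) (at_left t))"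

definition levy_process :: "'a measure \<Rightarrow> (real \<Rightarrow> 'a \<Rightarrow> real) \<Rightarrow> bool" where
  "levy_process M L \<longleftrightarrow>
     (\<forall>t\<ge>0. L t \<in> borel_measurable M) \<and>
     (AE \<omega> in M. L 0 \<omega> = 0) \<and>
     (AE \<omega> in M. cadlag (\<lambda>t. L t \<omega>)) \<and>
     (\<forall>\<tau> :: nat \<Rightarrow> real. 0 \<le> \<tau> 0 \<and> strict_mono \<tau> \<longrightarrow>
        prob_space.indep_vars M (\<lambda>_. borel) (\<lambda>k \<omega>. L (\<tau> (Suc k)) \<omega> - L (\<tau> k) \<omega>) UNIV) \<and>
     (\<forall>s\<ge>0. \<forall>h\<ge>0. distr M borel (\<lambda>\<omega>. L (s + h) \<omega> - L s \<omega>) = distr M borel (L h))"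

definition standard_stable_subordinator ::
    "'a measure \<Rightarrow> real \<Rightarrow> (real \<Rightarrow> 'a \<Rightarrow> real) \<Rightarrow> bool" where
  "standard_stable_subordinator M \<theta> L \<longleftrightarrow>
     levy_process M L \<and>
     (AE \<omega> in M. mono_on {0..} (\<lambda>s. L s \<omega>)) \<and>
     (\<forall>s\<ge>0. \<forall>t\<ge>0. (\<integral>\<omega>. exp (- (t * L s \<omega>)) \<partial>M) = exp (- (s * t powr \<theta>)))"

definition inverse_stable_subordinator ::
    "'a measure \<Rightarrow> real \<Rightarrow> (real \<Rightarrow> 'a \<Rightarrow> real) \<Rightarrow> bool" where
  "inverse_stable_subordinator M \<theta> Y \<longleftrightarrow>
     (\<exists>L. standard_stable_subordinator M \<theta> L \<and>
          (AE \<omega> in M. \<forall>t\<ge>0. Y t \<omega> = Inf {s. s > 0 \<and> L s \<omega> > t}))"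

definition skorokhod_reflection :: "(real \<Rightarrow> real) \<Rightarrow> real \<Rightarrow> real" where
  "skorokhod_reflection f t = f t - (INF s\<in>{0..t}. f s)"

text \<open>The state \<open>q\<close> gives the number of customers in each class; which customer of the
  class leaves does not affect it.\<close>

definition serve :: "nat \<Rightarrow> (nat \<Rightarrow> nat) \<Rightarrow> nat \<Rightarrow> nat" where
  "serve K q =
     (if \<exists>j\<in>{1..K}. q j > 0
      then let j = (LEAST j. j \<in> {1..K} \<and> q j > 0) in q(j := q j - 1)
      else q)"

definition admit :: "nat \<Rightarrow> (nat \<Rightarrow> nat) \<Rightarrow> nat \<Rightarrow> nat" where
  "admit j q = q(j := Suc (q j))"

text \<open>Queue dynamics along one realisation: \<open>n\<close> and \<open>d\<close> count the jumps of the arrival and the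
  departure process, \<open>c k\<close> is the class of customer \<open>k\<close> (numbered from 0), \<open>q t i\<close> is the
  number of class \<open>i\<close> customers at time \<open>t\<close>.  The three clauses say how \<open>q\<close> changes over an interval
  \<open>(s, t]\<close> containing no event, exactly one arrival, or exactly one departure epoch.  They determine
  \<open>q\<close> when \<open>n\<close> and \<open>d\<close> never jump simultaneously, which is almost surely the case
  for independent fractional Poisson processes.\<close>

definition priority_queue_path ::
    "nat \<Rightarrow> (real \<Rightarrow> nat) \<Rightarrow> (real \<Rightarrow> nat) \<Rightarrow> (nat \<Rightarrow> nat) \<Rightarrow> (real \<Rightarrow> nat \<Rightarrow> nat) \<Rightarrow> bool" where
  "priority_queue_path K n d c q \<longleftrightarrow>
     (\<forall>i\<in>{1..K}. q 0 i = 0) \<and>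
     (\<forall>s t. 0 \<le> s \<and> s \<le> t \<longrightarrow> (\<forall>i\<in>{1..K}.
        (n t = n s \<and> d t = d s \<longrightarrow> q t i = q s i) \<and>
        (n t = Suc (n s) \<and> d t = d s \<longrightarrow> q t i = admit (c (n s)) (q s) i) \<and>
        (n t = n s \<and> d t = Suc (d s) \<longrightarrow> q t i = serve K (q s) i)))"

text \<open>As \<open>indep_var\<close>, whose two random variables must take values in the same type.\<close>

definition indep_random_elements ::
    "'a measure \<Rightarrow> 'b measure \<Rightarrow> ('a \<Rightarrow> 'b) \<Rightarrow> 'c measure \<Rightarrow> ('a \<Rightarrow> 'c) \<Rightarrow> bool" where
  "indep_random_elements M S X T Y \<longleftrightarrow>
     X \<in> measurable M S \<and> Y \<in> measurable M T \<and>
     prob_space.indep_set M {X -` A \<inter> space M | A. A \<in> sets S} {Y -` B \<inter> space M | B. B \<in> sets T}"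

definition restless_mittag_leffler_queue ::
    "'a measure \<Rightarrow> nat \<Rightarrow> (nat \<Rightarrow> real) \<Rightarrow> real \<Rightarrow> real \<Rightarrow> real \<Rightarrow> real \<Rightarrow>
     (real \<Rightarrow> 'a \<Rightarrow> nat) \<Rightarrow> (real \<Rightarrow> 'a \<Rightarrow> nat) \<Rightarrow> (nat \<Rightarrow> 'a \<Rightarrow> nat) \<Rightarrow>
     (nat \<Rightarrow> real \<Rightarrow> 'a \<Rightarrow> nat) \<Rightarrow> bool" where
  "restless_mittag_leffler_queue M K p \<alpha> lam \<beta> \<mu> N D C Q \<longleftrightarrow>
     fractional_poisson_process M \<alpha> lam N \<and>
     fractional_poisson_process M \<beta> \<mu> D \<and>
     prob_space.indep_vars M (\<lambda>_. count_space UNIV) C UNIV \<and>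
     (\<forall>k. \<forall>i\<in>{1..K}. measure M {\<omega> \<in> space M. C k \<omega> = i} = p i) \<and>
     prob_space.indep_var M
       (Pi\<^sub>M {0..} (\<lambda>_. count_space UNIV)) (\<lambda>\<omega>. \<lambda>t\<in>{0..}. N t \<omega>)
       (Pi\<^sub>M {0..} (\<lambda>_. count_space UNIV)) (\<lambda>\<omega>. \<lambda>t\<in>{0..}. D t \<omega>) \<and>
     indep_random_elements M
       (Pi\<^sub>M {0..} (\<lambda>_. count_space UNIV) \<Otimes>\<^sub>M Pi\<^sub>M {0..} (\<lambda>_. count_space UNIV))
         (\<lambda>\<omega>. (\<lambda>t\<in>{0..}. N t \<omega>, \<lambda>t\<in>{0..}. D t \<omega>))
       (Pi\<^sub>M UNIV (\<lambda>_. count_space UNIV)) (\<lambda>\<omega> k. C k \<omega>) \<and>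
     (AE \<omega> in M. priority_queue_path K
        (\<lambda>t. N t \<omega>) (\<lambda>t. D t \<omega>) (\<lambda>k. C k \<omega>) (\<lambda>t i. Q i t \<omega>))"

definition skorokhod_space :: "(real \<Rightarrow> real) set" where
  "skorokhod_space = {f \<in> extensional {0..}. cadlag f}"

definition time_change :: "(real \<Rightarrow> real) \<Rightarrow> bool" where
  "time_change h \<longleftrightarrow> continuous_on {0..} h \<and> strict_mono_on {0..} h \<and> h ` {0..} = {0..}"

text \<open>The sets below, for \<open>T, \<epsilon> > 0\<close>, form a neighbourhood base at \<open>x\<close> of the topology
  \<open>J\<^sub>1\<close> on \<open>D[0,\<infinity>)\<close>: \<open>x\<^sub>n \<rightarrow> x\<close> iff for each \<open>T\<close> there are time changes \<open>h\<^sub>n\<close> with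
  \<open>h\<^sub>n(t) - t\<close> and \<open>x\<^sub>n(t) - x(h\<^sub>n(t))\<close> tending to 0 uniformly on \<open>[0,T]\<close>
  (Ethier and Kurtz, Markov Processes, Proposition 3.5.3).\<close>

definition J1_nbhd :: "(real \<Rightarrow> real) \<Rightarrow> real \<Rightarrow> real \<Rightarrow> (real \<Rightarrow> real) set" where
  "J1_nbhd x T \<epsilon> = {y \<in> skorokhod_space. \<exists>h. time_change h \<and>
     (\<forall>t\<in>{0..T}. \<bar>h t - t\<bar> < \<epsilon> \<and> \<bar>y t - x (h t)\<bar> < \<epsilon>)}"

definition J1_topology :: "(real \<Rightarrow> real) topology" where
  "J1_topology = topology (\<lambda>U. U \<subseteq> skorokhod_space \<and>
     (\<forall>x\<in>U. \<exists>T>0. \<exists>\<epsilon>>0. J1_nbhd x T \<epsilon> \<subseteq> U))"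

lemma J1_nbhd_mono: "T' \<le> T \<Longrightarrow> \<epsilon> \<le> \<epsilon>' \<Longrightarrow> J1_nbhd x T \<epsilon> \<subseteq> J1_nbhd x T' \<epsilon>'"
  unfolding J1_nbhd_def
  by (smt (verit, ccfv_threshold) Collect_mono atLeastAtMost_iff)

lemma time_change_id: "time_change (\<lambda>t. t)"
  by (auto simp: time_change_def strict_mono_on_def)

lemma time_change_compose:
  assumes "time_change g" "time_change h"
  shows "time_change (\<lambda>t. g (h t))"
proof -
  have h0: "h t \<in> {0..}" if "t \<ge> 0" for t using assms(2) that by (auto simp: time_change_def)
  have "continuous_on {0..} (\<lambda>t. g (h t))"
    using assms by (auto simp: time_change_def intro: continuous_on_compose2[of "{0..}" g])
  moreover have "strict_mono_on {0..} (\<lambda>t. g (h t))"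
    using assms h0 by (auto simp: time_change_def strict_mono_on_def)
  moreover have "(\<lambda>t. g (h t)) ` {0..} = g ` h ` {0..}" by auto
  ultimately show ?thesis using assms by (simp add: time_change_def)
qed

lemma openin_J1:
  "openin J1_topology U \<longleftrightarrow>
     U \<subseteq> skorokhod_space \<and> (\<forall>x\<in>U. \<exists>T>0. \<exists>\<epsilon>>0. J1_nbhd x T \<epsilon> \<subseteq> U)"
proof -
  have "istopology (\<lambda>U. U \<subseteq> skorokhod_space \<and>
     (\<forall>x\<in>U. \<exists>T>0. \<exists>\<epsilon>>0. J1_nbhd x T \<epsilon> \<subseteq> U))" (is "istopology ?P")
    unfolding istopology_def
  proof (intro conjI allI impI)
    fix S S' assume S: "?P S" and S': "?P S'"
    show "S \<inter> S' \<subseteq> skorokhod_space" using S by blast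
    show "\<forall>x\<in>S \<inter> S'. \<exists>T>0. \<exists>\<epsilon>>0. J1_nbhd x T \<epsilon> \<subseteq> S \<inter> S'"
    proof
      fix x assume "x \<in> S \<inter> S'"
      with S S' obtain T \<epsilon> T' \<epsilon>' where *: "T > 0" "\<epsilon> > 0" "J1_nbhd x T \<epsilon> \<subseteq> S"
        "T' > 0" "\<epsilon>' > 0" "J1_nbhd x T' \<epsilon>' \<subseteq> S'" by (metis IntE)
      have "J1_nbhd x (max T T') (min \<epsilon> \<epsilon>') \<subseteq> S \<inter> S'"
        using * J1_nbhd_mono[of T "max T T'" "min \<epsilon> \<epsilon>'" \<epsilon> x]
          J1_nbhd_mono[of T' "max T T'" "min \<epsilon> \<epsilon>'" \<epsilon>' x] by auto
      with * show "\<exists>T>0. \<exists>\<epsilon>>0. J1_nbhd x T \<epsilon> \<subseteq> S \<inter> S'"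
        by (intro exI[of _ "max T T'"] conjI exI[of _ "min \<epsilon> \<epsilon>'"]) auto
    qed
  next
    fix \<K> assume K: "\<forall>S\<in>\<K>. ?P S"
    show "\<Union>\<K> \<subseteq> skorokhod_space" using K by blast
    show "\<forall>x\<in>\<Union>\<K>. \<exists>T>0. \<exists>\<epsilon>>0. J1_nbhd x T \<epsilon> \<subseteq> \<Union>\<K>" using K by (meson Union_iff Sup_upper subset_trans)
  qed
  then show ?thesis by (simp add: J1_topology_def topology_inverse')
qed

lemma topspace_J1: "topspace J1_topology = skorokhod_space"
proof -
  have "openin J1_topology skorokhod_space"
    unfolding openin_J1 by (auto simp: J1_nbhd_def intro: exI[of _ "1::real"])
  then show ?thesis
    by (meson openin_J1 openin_subset openin_topspace subset_antisym)
qed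

lemma self_in_J1_nbhd: "x \<in> skorokhod_space \<Longrightarrow> \<epsilon> > 0 \<Longrightarrow> x \<in> J1_nbhd x T \<epsilon>"
  unfolding J1_nbhd_def by (auto intro!: exI[of _ "\<lambda>t. t"] time_change_id)

lemma J1_nbhd_triangle:
  assumes z: "z \<in> J1_nbhd y T (\<epsilon> / 2)"
      and "T > 0" "\<epsilon> > 0" "\<epsilon> \<le> T"
  shows "J1_nbhd z (T + \<epsilon>) (\<epsilon> / 2) \<subseteq> J1_nbhd y (T / 2) \<epsilon>"
proof
  fix w assume w: "w \<in> J1_nbhd z (T + \<epsilon>) (\<epsilon> / 2)"
  obtain g where g: "time_change g"
    "\<And>t. t \<in> {0..T} \<Longrightarrow> \<bar>g t - t\<bar> < \<epsilon> / 2 \<and> \<bar>z t - y (g t)\<bar> < \<epsilon> / 2"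
    using z unfolding J1_nbhd_def by auto
  obtain h where h: "time_change h"
    "\<And>t. t \<in> {0..T + \<epsilon>} \<Longrightarrow> \<bar>h t - t\<bar> < \<epsilon> / 2 \<and> \<bar>w t - z (h t)\<bar> < \<epsilon> / 2"
    using w unfolding J1_nbhd_def by auto
  have "\<bar>g (h t) - t\<bar> < \<epsilon> \<and> \<bar>w t - y (g (h t))\<bar> < \<epsilon>" if t: "t \<in> {0..T / 2}" for t
  proof -
    have ht: "\<bar>h t - t\<bar> < \<epsilon> / 2" "\<bar>w t - z (h t)\<bar> < \<epsilon> / 2"
      using h(2)[of t] t \<open>T > 0\<close> \<open>\<epsilon> > 0\<close> by auto
    have "h t \<ge> 0" using h(1) t unfolding time_change_def by auto
    then have "h t \<in> {0..T}" using ht t \<open>\<epsilon> \<le> T\<close> by (auto simp: abs_if split: if_splits)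
    from g(2)[OF this] ht show ?thesis by linarith
  qed
  then show "w \<in> J1_nbhd y (T / 2) \<epsilon>"
    using w time_change_compose[OF g(1) h(1)] unfolding J1_nbhd_def by auto
qed

lemma limitin_J1:
  "limitin J1_topology f x F \<longleftrightarrow>
     x \<in> skorokhod_space \<and> (\<forall>T>0. \<forall>\<epsilon>>0. \<forall>\<^sub>F n in F. f n \<in> J1_nbhd x T \<epsilon>)"
proof (intro iffI conjI allI impI)
  assume lim: "limitin J1_topology f x F"
  then show x: "x \<in> skorokhod_space" by (simp add: limitin_def topspace_J1)
  fix T \<epsilon> :: real assume T: "T > 0" and \<epsilon>: "\<epsilon> > 0"
  define V where "V = {y \<in> skorokhod_space. \<exists>T'>0. \<exists>\<epsilon>'>0. J1_nbhd y T' \<epsilon>' \<subseteq> J1_nbhd x T \<epsilon>}"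
  have "openin J1_topology V"
    unfolding openin_J1
  proof (intro conjI ballI)
    show "V \<subseteq> skorokhod_space" by (auto simp: V_def)
    fix y assume "y \<in> V"
    then obtain T' \<epsilon>' where 1: "T' > 0" "\<epsilon>' > 0" "J1_nbhd y T' \<epsilon>' \<subseteq> J1_nbhd x T \<epsilon>"
      by (auto simp: V_def)
    define \<delta> where "\<delta> = min \<epsilon>' (2 * T')"
    have \<delta>: "\<delta> > 0" "\<delta> \<le> 2 * T'" "\<delta> \<le> \<epsilon>'" using 1 by (auto simp: \<delta>_def)
    have "z \<in> V" if z: "z \<in> J1_nbhd y (2 * T') (\<delta> / 2)" for z
    proof -
      have "J1_nbhd z (2 * T' + \<delta>) (\<delta> / 2) \<subseteq> J1_nbhd y T' \<delta>"
        using J1_nbhd_triangle[OF z] 1 \<delta> by auto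
      also have "\<dots> \<subseteq> J1_nbhd x T \<epsilon>" using J1_nbhd_mono[of T' T' \<delta> \<epsilon>' y] 1 \<delta> by auto
      finally have "J1_nbhd z (2 * T' + \<delta>) (\<delta> / 2) \<subseteq> J1_nbhd x T \<epsilon>" .
      moreover have "2 * T' + \<delta> > 0" "\<delta> / 2 > 0" "z \<in> skorokhod_space"
        using 1 \<delta> z by (auto simp: J1_nbhd_def)
      ultimately show ?thesis unfolding V_def by blast
    qed
    then have "J1_nbhd y (2 * T') (\<delta> / 2) \<subseteq> V" by blast
    moreover have "2 * T' > 0" "\<delta> / 2 > 0" using 1 \<delta> by auto
    ultimately show "\<exists>T>0. \<exists>\<epsilon>>0. J1_nbhd y T \<epsilon> \<subseteq> V" by blast
  qed
  moreover have "x \<in> V" using x T \<epsilon> by (auto simp: V_def)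
  ultimately have "\<forall>\<^sub>F n in F. f n \<in> V" using lim by (simp add: limitin_def)
  moreover have "V \<subseteq> J1_nbhd x T \<epsilon>" using self_in_J1_nbhd by (auto simp: V_def)
  ultimately show "\<forall>\<^sub>F n in F. f n \<in> J1_nbhd x T \<epsilon>"
    by (auto elim: eventually_mono)
next
  assume *: "x \<in> skorokhod_space \<and> (\<forall>T>0. \<forall>\<epsilon>>0. \<forall>\<^sub>F n in F. f n \<in> J1_nbhd x T \<epsilon>)"
  show "limitin J1_topology f x F"
    unfolding limitin_def topspace_J1
  proof (intro conjI allI impI)
    show "x \<in> skorokhod_space" using * by simp
    fix U assume "openin J1_topology U \<and> x \<in> U"
    then obtain T \<epsilon> where "T > 0" "\<epsilon> > 0" "J1_nbhd x T \<epsilon> \<subseteq> U"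
      unfolding openin_J1 by blast
    moreover from this have "\<forall>\<^sub>F n in F. f n \<in> J1_nbhd x T \<epsilon>" using * by blast
    ultimately show "\<forall>\<^sub>F n in F. f n \<in> U" by (auto elim: eventually_mono)
  qed
qed

definition borel_of_topology :: "'s topology \<Rightarrow> 's measure" where
  "borel_of_topology S = sigma (topspace S) {U. openin S U}"

text \<open>Laws of random elements of a topological space \<open>S\<close>; the element need only be defined up to
  null sets, so \<open>X\<close> may take values outside \<open>S\<close> on a null set.\<close>

definition has_law :: "'a measure \<Rightarrow> ('a \<Rightarrow> 's) \<Rightarrow> 's topology \<Rightarrow> 's measure \<Rightarrow> bool" where
  "has_law M X S \<nu> \<longleftrightarrow>
     (\<exists>X' \<in> measurable M (borel_of_topology S).
        (AE \<omega> in M. X \<omega> = X' \<omega>) \<and> \<nu> = distr M (borel_of_topology S) X')"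

definition converges_weakly ::
    "'s topology \<Rightarrow> 'i filter \<Rightarrow> 'a measure \<Rightarrow> ('i \<Rightarrow> 'a \<Rightarrow> 's) \<Rightarrow> 'b measure \<Rightarrow> ('b \<Rightarrow> 's) \<Rightarrow> bool" where
  "converges_weakly S F M X M' Y \<longleftrightarrow>
     (\<exists>\<nu> \<nu>\<^sub>0. (\<forall>\<^sub>F u in F. has_law M (X u) S (\<nu> u)) \<and> has_law M' Y S \<nu>\<^sub>0 \<and>
        (\<forall>g. continuous_map S euclideanreal g \<and> bounded (g ` topspace S) \<longrightarrow>
           ((\<lambda>u. \<integral>x. g x \<partial>\<nu> u) \<longlongrightarrow> (\<integral>x. g x \<partial>\<nu>\<^sub>0)) F))"

end

theory Submission
  imports Defs "HOL-Complex_Analysis.Complex_Analysis" "HOL-Real_Asymp.Real_Asymp"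
    "HOL-Library.Discrete_Functions"
begin

text \<open>Let \<open>L\<close> be the stable subordinator inverted by \<open>Y\<close> and let \<open>G k\<close> be the partial sums of
  independent exponential variables of rate \<open>c = lam powr \<alpha>\<close>, independent of \<open>L\<close>. For every \<open>u\<close> the increments
  \<open>u * (L (G (k+1) / u powr \<alpha>) - L (G k / u powr \<alpha>))\<close> are independent with Laplace transform
  \<open>c / (c + t powr \<alpha>)\<close>, hence Mittag-Leffler, so the arrival process may be replaced, separately for each
  \<open>u\<close>, by the renewal process with these interarrival times. By the law of large numbers for \<open>G\<close>, the
  coupled process rescaled by \<open>u powr \<alpha>\<close> converges to \<open>c * Y\<close> locally uniformly along almost every path;
  the services are treated alike, and a process with the smaller index vanishes in the limit.

  A service is lost to the classes up to \<open>i\<close> only when they are all empty, so \<open>Q\<^sub>\<le>\<^sub>i\<close> is the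
  reflection of (arrivals of class at most \<open>i\<close>) minus (all services). Class membership thins the
  arrivals by the factor \<open>P i\<close>, and reflection is Lipschitz for the supremum norm, so the queue
  converges locally uniformly almost surely in the coupling. This implies convergence in \<open>J\<^sub>1\<close> and
  hence in law.

  Weak convergence requires the paths to be Borel random elements of \<open>J\<^sub>1\<close>: a path is the \<open>J\<^sub>1\<close>
  limit of step functions of finitely many of its values.\<close>

section \<open>Borel measurability in the Skorokhod topology\<close>

text \<open>For an index below 1 the interarrival times have infinite mean: no law of large numbers
  applies to them and the limit stays random. The coupling moves the averaging to the exponential
  variables, which have finite variance, while the subordinator is common to all \<open>u\<close>
  and produces the limit path. Couplings at different \<open>u\<close> need not reproduce the joint
  law of the rescaled queues, since weak convergence involves one \<open>u\<close> at a time. The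
  law of an interarrival time is given by a Mittag-Leffler series. Integrating it termwise against
  \<open>exp (- (t * x))\<close> converges only for \<open>c < t powr \<theta>\<close>; analytic
  continuation supplies the remaining \<open>t\<close>, and transforms at integers then determine
  the law of the whole sequence. A process with the smaller index vanishes because its partial sums
  have stretched exponential lower tails, so by Borel-Cantelli they outgrow every multiple of
  \<open>n powr (1 / g)\<close> for \<open>g\<close> above the index. A single class is the
  difference of two cumulative queues with the same services, so the limits are stated for a
  difference with indices \<open>i\<close> and \<open>j\<close>: \<open>j = 0\<close> gives the
  cumulative queue, \<open>j = i - 1\<close> one class.\<close>

lemma cadlag_partition:
  assumes f: "cadlag f" and "T \<ge> 0" "\<epsilon> > 0"
  obtains F where "finite F" "F \<subseteq> {0..T}"
    "\<And>s s'. 0 \<le> s \<Longrightarrow> s < s' \<Longrightarrow> s' < T \<Longrightarrow> F \<inter> {s<..s'} = {} \<Longrightarrow> \<bar>f s - f s'\<bar> < \<epsilon>"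
proof -
  \<comment> \<open>The cells are closed on the left and open on the right: \<open>F\<close> must
    miss \<open>{s<..s'}\<close>, so a partition point may begin a cell but not lie inside it. The
    guard \<open>0 \<le> a\<close> is there because \<open>Bolzano\<close> ranges over all
    intervals, also those reaching below 0.\<close>
  define P where "P a b \<longleftrightarrow> (0 \<le> a \<longrightarrow> (\<exists>F. finite F \<and> F \<subseteq> {a..b} \<and>
    (\<forall>s s'. a \<le> s \<and> s < s' \<and> s' < b \<and> F \<inter> {s<..s'} = {} \<longrightarrow> \<bar>f s - f s'\<bar> < \<epsilon>)))" for a b
  have "P 0 T"
  proof (rule Bolzano[OF \<open>T \<ge> 0\<close>, of P])
    fix a b c assume ab: "P a b" and bc: "P b c" and le: "a \<le> b" "b \<le> c"
    show "P a c"
      unfolding P_def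
    proof
    assume "0 \<le> a"
    obtain F where F: "finite F" "F \<subseteq> {a..b}"
      "\<And>s s'. a \<le> s \<and> s < s' \<and> s' < b \<and> F \<inter> {s<..s'} = {} \<Longrightarrow> \<bar>f s - f s'\<bar> < \<epsilon>"
      using ab \<open>0 \<le> a\<close> unfolding P_def by blast
    obtain G where G: "finite G" "G \<subseteq> {b..c}"
      "\<And>s s'. b \<le> s \<and> s < s' \<and> s' < c \<and> G \<inter> {s<..s'} = {} \<Longrightarrow> \<bar>f s - f s'\<bar> < \<epsilon>"
      using bc \<open>0 \<le> a\<close> le unfolding P_def by (meson order_trans)
    show "\<exists>F. finite F \<and> F \<subseteq> {a..c} \<and>
    (\<forall>s s'. a \<le> s \<and> s < s' \<and> s' < c \<and> F \<inter> {s<..s'} = {} \<longrightarrow> \<bar>f s - f s'\<bar> < \<epsilon>)"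
    \<comment> \<open>Adding \<open>b\<close> excludes pairs that straddle it, so every remaining
      pair lies in one of the two halves.\<close>
    proof (intro exI[of _ "F \<union> G \<union> {b}"] conjI allI impI)
      fix s s' assume *: "a \<le> s \<and> s < s' \<and> s' < c \<and> (F \<union> G \<union> {b}) \<inter> {s<..s'} = {}"
      then have "F \<inter> {s<..s'} = {}" "G \<inter> {s<..s'} = {}" "\<not> (s < b \<and> b \<le> s')" by auto
      then show "\<bar>f s - f s'\<bar> < \<epsilon>"
        using F(3)[of s s'] G(3)[of s s'] * by argo
    qed (use F G le in auto)
    qed
  next
    fix x assume x: "0 \<le> x" "x \<le> T"
    have "\<forall>\<^sub>F s in at_right x. dist (f s) (f x) < \<epsilon> / 2"
      using f x \<open>\<epsilon> > 0\<close> unfolding cadlag_def by (intro tendstoD) auto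
    then obtain d1 where d1: "d1 > x" "\<And>s. x < s \<Longrightarrow> s < d1 \<Longrightarrow> \<bar>f s - f x\<bar> < \<epsilon> / 2"
      unfolding eventually_at_right_field dist_real_def by auto
    \<comment> \<open>At \<open>x = 0\<close> there is no left limit; the condition
      \<open>0 \<le> s\<close> makes the claim vacuous there.\<close>
    have "\<exists>l. \<exists>d<x. \<forall>s. d < s \<and> s < x \<and> 0 \<le> s \<longrightarrow> \<bar>f s - l\<bar> < \<epsilon> / 2"
    proof (cases "x > 0")
      case True
      then obtain l where "(f \<longlongrightarrow> l) (at_left x)" using f unfolding cadlag_def by auto
      then have "\<forall>\<^sub>F s in at_left x. dist (f s) l < \<epsilon> / 2" using \<open>\<epsilon> > 0\<close> by (intro tendstoD) auto
      then show ?thesis unfolding eventually_at_left_field dist_real_def by auto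
    next
      case False
      then show ?thesis using x by (auto intro!: exI[of _ "x - 1"])
    qed
    then obtain l d2 where d2: "d2 < x" "\<And>s. d2 < s \<Longrightarrow> s < x \<Longrightarrow> 0 \<le> s \<Longrightarrow> \<bar>f s - l\<bar> < \<epsilon> / 2"
      by blast
    define d where "d = min (d1 - x) (x - d2)"
    have "\<exists>F. finite F \<and> F \<subseteq> {a..b} \<and>
    (\<forall>s s'. a \<le> s \<and> s < s' \<and> s' < b \<and> F \<inter> {s<..s'} = {} \<longrightarrow> \<bar>f s - f s'\<bar> < \<epsilon>)"
      if ab: "a \<le> x \<and> x \<le> b \<and> b - a < d" "0 \<le> a" for a b
    \<comment> \<open>Near \<open>x\<close> one partition point suffices: values before
      \<open>x\<close> are close to the left limit, values from \<open>x\<close> on are close to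
      \<open>f x\<close>.\<close>
    proof (intro exI[of _ "{x}"] conjI allI impI)
      fix s s' assume *: "a \<le> s \<and> s < s' \<and> s' < b \<and> {x} \<inter> {s<..s'} = {}"
      then consider "s' < x" | "x = s" | "x < s" by force
      then show "\<bar>f s - f s'\<bar> < \<epsilon>"
      proof cases
        case 1
        then show ?thesis using d2(2)[of s] d2(2)[of s'] * ab unfolding d_def by linarith
      next
        case 2
        then show ?thesis using d1(2)[of s'] * ab \<open>\<epsilon> > 0\<close> unfolding d_def by (smt (verit) field_sum_of_halves)
      next
        case 3
        then show ?thesis using d1(2)[of s] d1(2)[of s'] * ab unfolding d_def by linarith
      qed
    qed (use ab in auto)
    then show "\<exists>d>0. \<forall>a b. a \<le> x \<and> x \<le> b \<and> b - a < d \<longrightarrow> P a b"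
      using d1(1) d2(1) unfolding P_def d_def by (intro exI[of _ "min (d1 - x) (x - d2)"]) auto
  qed
  then show ?thesis unfolding P_def using that by (metis order_refl)
qed

text \<open>The elementary move on time changes: \<open>[p, p + l]\<close> is stretched onto
  \<open>[p, p + l']\<close> and everything after it is shifted. The inverse has the same shape with
  \<open>l\<close> and \<open>l'\<close> exchanged, which is where the preimage in the surjectivity
  proof comes from.\<close>

lemma time_change_stretch:
  fixes p l l' :: real
  assumes "0 \<le> p" "0 < l" "0 < l'"
  defines "k \<equiv> \<lambda>s. if s \<le> p then s else if s \<le> p + l then p + (s - p) * (l' / l) else s + (l' - l)"
  shows "time_change k"
proof -
  have strict: "strict_mono_on {0..} (\<lambda>s::real. if s \<le> p then s else if s \<le> p + m then p + (s - p) * (m' / m) else s + (m' - m))"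
    (is "strict_mono_on _ ?f") if "0 < m" "0 < m'" for m m' :: real
  proof (rule strict_mono_onI)
    fix r s :: real assume "r < s"
    have *: "(r - p) * (m' / m) < (s - p) * (m' / m)" using \<open>r < s\<close> that by (intro mult_strict_right_mono) auto
    have 1: "(x - p) * (m' / m) \<le> m'" if "x \<le> p + m" for x
      using mult_right_mono[of "x - p" m "m' / m"] that \<open>0 < m\<close> \<open>0 < m'\<close> by simp
    have 2: "0 < (x - p) * (m' / m)" if "p < x" for x
      using that \<open>0 < m\<close> \<open>0 < m'\<close> by simp
    show "?f r < ?f s"
    proof -
      define A B where "A = (r - p) * (m' / m)" and "B = (s - p) * (m' / m)"
      have "A < B" "r \<le> p + m \<Longrightarrow> A \<le> m'" "p < s \<Longrightarrow> 0 < B" using * 1[of r] 2[of s] by (auto simp: A_def B_def)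
      then show ?thesis using \<open>r < s\<close> that unfolding A_def[symmetric] B_def[symmetric] by auto
    qed
  qed
  \<comment> \<open>Minimum and maximum in place of the case distinction make continuity
    immediate.\<close>
  have "k = (\<lambda>s. min s p + (l' / l) * min (max (s - p) 0) l + max (s - p - l) 0)"
  proof
    fix s show "k s = min s p + (l' / l) * min (max (s - p) 0) l + max (s - p - l) 0"
      using assms by (auto simp: min_def max_def)
  qed
  then have "continuous_on {0..} k"
    by (subst \<open>k = _\<close>, intro continuous_intros)
  moreover have "k ` {0..} = {0..}"
  proof
    show "k ` {0..} \<subseteq> {0..}"
    proof safe
      fix s :: real assume "s \<ge> 0"
      moreover have "0 < (s - p) * (l' / l)" if "p < s" using that assms by simp
      ultimately show "k s \<ge> 0" using assms(1-3) unfolding k_def by (auto simp del: times_divide_eq_right)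
    qed
    show "{0..} \<subseteq> k ` {0..}"
    proof
      fix y :: real assume y: "y \<in> {0..}"
      define x where "x = (if y \<le> p then y else if y \<le> p + l' then p + (y - p) * (l / l') else y + (l - l'))"
      have 2: "0 < (y - p) * (l / l')" if "p < y" using that assms by simp
      have 1: "(y - p) * (l / l') \<le> l" if "y \<le> p + l'"
        using mult_right_mono[of "y - p" l' "l / l'"] that assms by simp
      consider "y \<le> p" | "p < y" "y \<le> p + l'" | "p + l' < y" by linarith
      then have "k x = y"
      proof cases
        case 2
        then have "x = p + (y - p) * (l / l')" by (simp add: x_def)
        moreover from this have "p < x" "x \<le> p + l" using 2 \<open>p < y \<Longrightarrow> 0 < (y - p) * (l / l')\<close> 1 by auto
        ultimately show ?thesis using assms by (simp add: k_def)
      qed (use assms in \<open>auto simp: k_def x_def\<close>)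
      moreover have "x \<ge> 0" using 2 y assms unfolding x_def by (auto simp del: times_divide_eq_right)
      ultimately show "y \<in> k ` {0..}" by force
    qed
  qed
  moreover have "strict_mono_on {0..} k" unfolding k_def using strict[of l l'] assms by simp
  ultimately show ?thesis unfolding time_change_def by blast
qed

lemma time_change_less: "time_change h \<Longrightarrow> 0 \<le> s \<Longrightarrow> s < t \<Longrightarrow> h s < h t"
  by (auto simp: time_change_def strict_mono_on_def)

lemma time_change_nonneg: "time_change h \<Longrightarrow> 0 \<le> s \<Longrightarrow> 0 \<le> h s"
  by (auto simp: time_change_def)

text \<open>Induction on the number of nodes. Beyond the last node \<open>b r\<close> the map is a
  translation, so composing it with a stretch that begins at \<open>\<tau> r\<close> puts the next
  node in place and leaves the earlier ones alone. The translation clause is the invariant that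
  keeps this going.\<close>

lemma time_change_interpolate:
  fixes b \<tau> :: "nat \<Rightarrow> real"
  assumes "b 0 = 0" "\<tau> 0 = 0"
    and "\<And>i. i < r \<Longrightarrow> b i < b (Suc i)" "\<And>i. i < r \<Longrightarrow> \<tau> i < \<tau> (Suc i)"
    and "\<And>i. i \<le> r \<Longrightarrow> \<bar>\<tau> i - b i\<bar> < \<delta>"
  shows "\<exists>h. time_change h \<and> (\<forall>i\<le>r. h (b i) = \<tau> i) \<and> (\<forall>s\<ge>b r. h s = s + (\<tau> r - b r)) \<and>
    (\<forall>s\<ge>0. \<bar>h s - s\<bar> < \<delta>)"
  using assms
proof (induction r)
  case 0
  then show ?case by (intro exI[of _ "\<lambda>t. t"]) (auto simp: time_change_id)
next
  case (Suc r)
  then obtain h where h: "time_change h" "\<forall>i\<le>r. h (b i) = \<tau> i" "\<forall>s\<ge>b r. h s = s + (\<tau> r - b r)"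
    "\<forall>s\<ge>0. \<bar>h s - s\<bar> < \<delta>" by auto
  define l l' where "l = b (Suc r) - b r" and "l' = \<tau> (Suc r) - \<tau> r"
  have l: "l > 0" "l' > 0" using Suc.prems(3,4)[of r] by (auto simp: l_def l'_def)
  have b_mono: "b i \<le> b r" if "i \<le> r" for i
    using that
  proof (induction rule: inc_induct)
    case (step n)
    then show ?case using Suc.prems(3)[of n] by simp
  qed simp
  have tau_mono: "\<tau> i \<le> \<tau> r" if "i \<le> r" for i
    using that
  proof (induction rule: inc_induct)
    case (step n)
    then show ?case using Suc.prems(4)[of n] by simp
  qed simp
  have pos: "b r \<ge> 0" "\<tau> r \<ge> 0" using b_mono[of 0] tau_mono[of 0] Suc.prems by auto
  define k where "k s = (if s \<le> \<tau> r then s else if s \<le> \<tau> r + l then \<tau> r + (s - \<tau> r) * (l' / l) else s + (l' - l))" for s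
  have k: "time_change k"
    unfolding k_def using time_change_stretch[OF pos(2) l] .
  have hb: "h (b r) = \<tau> r" using h by simp
  show ?case
  proof (intro exI[of _ "\<lambda>t. k (h t)"] conjI allI impI)
    show "time_change (\<lambda>t. k (h t))" using time_change_compose k h by blast
    show "k (h (b i)) = \<tau> i" if "i \<le> Suc r" for i
    proof (cases "i = Suc r")
      case True
      have "h (b (Suc r)) = \<tau> r + l" using h(3) l by (auto simp: l_def)
      then show ?thesis using l True unfolding k_def by (auto simp: l'_def)
    next
      case False
      then have "i \<le> r" using that by simp
      then show ?thesis using h(2) tau_mono[of i] by (simp add: k_def)
    qed
    show "k (h s) = s + (\<tau> (Suc r) - b (Suc r))" if "b (Suc r) \<le> s" for s
    proof -
      have "h s = s + (\<tau> r - b r)" using h(3) that l by (auto simp: l_def)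
      then show ?thesis using l that unfolding k_def by (auto simp: l'_def l_def)
    qed
    show "\<bar>k (h s) - s\<bar> < \<delta>" if "s \<ge> 0" for s
    proof (cases "s \<le> b r")
      case True
      then have "h s \<le> \<tau> r" using time_change_less[OF h(1) that, of "b r"] hb by (cases "s = b r") auto
      then show ?thesis using h(4) that by (simp add: k_def)
    next
      case False
      then have hs: "h s = s + (\<tau> r - b r)" using h(3) by auto
      have d: "\<bar>\<tau> r - b r\<bar> < \<delta>" "\<bar>\<tau> (Suc r) - b (Suc r)\<bar> < \<delta>" using Suc.prems(5) by auto
      show ?thesis
      proof (cases "s \<le> b (Suc r)")
        case True
        \<comment> \<open>On the new affine piece the displacement is the convex combination, with
          weight \<open>w\<close>, of the displacements at the two end nodes, so it stays below
          \<open>\<delta>\<close>.\<close>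
        define w where "w = (s - b r) / l"
        have w: "0 < w" "w \<le> 1" using False True l by (auto simp: w_def l_def)
        have s: "s - b r = w * l" using l by (simp add: w_def)
        have "k (h s) = \<tau> r + (s - b r) * (l' / l)" using hs True False l by (auto simp: k_def l_def)
        also have "\<dots> = \<tau> r + w * l'" using l by (simp add: s)
        finally have "k (h s) - s = \<tau> r + w * l' - (b r + w * l)" using s by simp
        also have "\<dots> = (1 - w) * (\<tau> r - b r) + w * (\<tau> (Suc r) - b (Suc r))"
          by (simp add: l_def l'_def algebra_simps)
        finally have e: "k (h s) - s = (1 - w) * (\<tau> r - b r) + w * (\<tau> (Suc r) - b (Suc r))" .
        have "\<bar>k (h s) - s\<bar> \<le> (1 - w) * \<bar>\<tau> r - b r\<bar> + w * \<bar>\<tau> (Suc r) - b (Suc r)\<bar>"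
          unfolding e using w by (intro order_trans[OF abs_triangle_ineq]) (simp add: abs_mult)
        also have "\<dots> < (1 - w) * \<delta> + w * \<delta>"
          using w d by (intro add_le_less_mono mult_left_mono mult_strict_left_mono) auto
        finally show ?thesis by (simp add: algebra_simps)
      next
        case False
        then have "k (h s) = s + (\<tau> (Suc r) - b (Suc r))"
          using hs l unfolding k_def by (auto simp: l'_def l_def)
        then show ?thesis using d by simp
      qed
    qed
  qed
qed

text \<open>The value \<open>a k\<close> is held on \<open>[k / m, (k + 1) / m)\<close>. Passing the
  values as a sequence separates the sampling of a path, which is measurable, from the map that
  turns samples into a step path, which is continuous.\<close>

definition J1_step :: "nat \<Rightarrow> (nat \<Rightarrow> real) \<Rightarrow> real \<Rightarrow> real" where
  "J1_step m a = (\<lambda>t\<in>{0..}. a (nat \<lfloor>real m * t\<rfloor>))"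

lemma J1_step_in_space:
  assumes "m > 0"
  shows "J1_step m a \<in> skorokhod_space"
proof -
  have "(J1_step m a \<longlongrightarrow> J1_step m a t) (at_right t)" if "t \<ge> 0" for t
  proof (rule tendsto_eventually)
    have "\<forall>\<^sub>F s in at_right t. s < (real_of_int \<lfloor>real m * t\<rfloor> + 1) / m"
      by (rule order_tendstoD(2)[OF tendsto_ident_at]) (use assms in \<open>simp add: field_simps; linarith\<close>)
    moreover have "\<forall>\<^sub>F s in at_right t. t < s" by (rule eventually_at_right_less)
    ultimately show "\<forall>\<^sub>F s in at_right t. J1_step m a s = J1_step m a t"
    proof eventually_elim
      case (elim s)
      have "real m * s < real_of_int \<lfloor>real m * t\<rfloor> + 1" using elim assms by (simp add: field_simps)
      moreover have "real m * t \<le> real m * s" using elim by (simp add: mult_left_mono)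
      ultimately have "\<lfloor>real m * s\<rfloor> = \<lfloor>real m * t\<rfloor>" by linarith
      then show ?case using elim that by (simp add: J1_step_def)
    qed
  qed
  moreover have "(J1_step m a \<longlongrightarrow> a (nat (\<lceil>real m * t\<rceil> - 1))) (at_left t)" if "t > 0" for t
  proof (rule tendsto_eventually)
    have "\<forall>\<^sub>F s in at_left t. (real_of_int \<lceil>real m * t\<rceil> - 1) / m < s"
      by (rule order_tendstoD(1)[OF tendsto_ident_at]) (use assms in \<open>simp add: field_simps; linarith\<close>)
    moreover have "\<forall>\<^sub>F s in at_left t. s < t" using eventually_at_left_real[OF that] by (auto elim: eventually_mono)
    moreover have "\<forall>\<^sub>F s in at_left t. 0 < s" using eventually_at_left_real[OF that] by (auto elim: eventually_mono)
    ultimately show "\<forall>\<^sub>F s in at_left t. J1_step m a s = a (nat (\<lceil>real m * t\<rceil> - 1))"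
    proof eventually_elim
      case (elim s)
      have "real_of_int \<lceil>real m * t\<rceil> - 1 < real m * s" using elim assms by (simp add: field_simps)
      moreover have "real m * s < real m * t" using elim assms by simp
      ultimately have "\<lfloor>real m * s\<rfloor> = \<lceil>real m * t\<rceil> - 1" by linarith
      then show ?case using elim that by (simp add: J1_step_def)
    qed
  qed
  ultimately show ?thesis unfolding skorokhod_space_def cadlag_def by (auto simp: J1_step_def)
qed

lemma ex_interval_index:
  fixes b :: "nat \<Rightarrow> real"
  assumes "b 0 \<le> t" "t < b r"
  shows "\<exists>i<r. b i \<le> t \<and> t < b (Suc i)"
  using assms
proof (induction r)
  case (Suc r)
  then show ?case by (cases "t < b r") (auto intro: less_SucI)
qed simp

text \<open>The jumps of \<open>x\<close> need not fall on the grid. The time change matches each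
  partition point with the next grid point; then the sampling time and the changed time always lie
  in the same cell of \<open>cadlag_partition\<close>, on which \<open>x\<close> varies by less than
  \<open>\<epsilon>\<close>.\<close>

lemma J1_step_tendsto:
  assumes x: "x \<in> skorokhod_space"
  shows "limitin J1_topology (\<lambda>m. J1_step (Suc m) (\<lambda>k. x (real k / real (Suc m)))) x sequentially"
  unfolding limitin_J1
proof (intro conjI allI impI x)
  fix T \<epsilon> :: real assume T: "T > 0" and \<epsilon>: "\<epsilon> > 0"
  \<comment> \<open>The extra unit of time puts the last node beyond \<open>T\<close>, so that every
    \<open>t \<le> T\<close> falls into a cell.\<close>
  obtain F where F: "finite F" "F \<subseteq> {0..T + 1}"
    "\<And>s s'. 0 \<le> s \<Longrightarrow> s < s' \<Longrightarrow> s' < T + 1 \<Longrightarrow> F \<inter> {s<..s'} = {} \<Longrightarrow> \<bar>x s - x s'\<bar> < \<epsilon>"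
    by (rule cadlag_partition[of x "T + 1" \<epsilon>]) (use x T \<epsilon> in \<open>auto simp: skorokhod_space_def\<close>)
  define G where "G = F \<union> {0, T + 1}"
  define xs where "xs = sorted_list_of_set G"
  define r where "r = length xs - 1"
  define \<tau> where "\<tau> i = xs ! i" for i
  have G: "finite G" "G \<subseteq> {0..T + 1}" using F T by (auto simp: G_def)
  have set_xs: "set xs = G" and xs_sorted: "sorted_wrt (<) xs" using G by (auto simp: xs_def)
  have "xs \<noteq> []" using set_xs by (auto simp: G_def)
  have len: "length xs = Suc r" using \<open>xs \<noteq> []\<close> by (simp add: r_def)
  have tau_less: "\<tau> i < \<tau> j" if "i < j" "j \<le> r" for i j
    using sorted_wrt_nth_less[OF xs_sorted] that len by (simp add: \<tau>_def)
  have tau_G: "\<tau> i \<in> G" if "i \<le> r" for i using that len set_xs by (auto simp: \<tau>_def)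
  have G_tau: "\<exists>i\<le>r. \<tau> i = y" if "y \<in> G" for y
    using that set_xs len by (metis in_set_conv_nth \<tau>_def less_Suc_eq_le)
  have tau0: "\<tau> 0 = 0"
  proof -
    obtain i where "i \<le> r" "\<tau> i = 0" using G_tau[of 0] by (auto simp: G_def)
    then show ?thesis using tau_less[of 0 i] tau_G[of 0] G by (cases "i = 0") fastforce+
  qed
  have taur: "\<tau> r = T + 1"
  proof -
    obtain i where "i \<le> r" "\<tau> i = T + 1" using G_tau[of "T + 1"] by (auto simp: G_def)
    then show ?thesis using tau_less[of i r] tau_G[of r] G by (cases "i = r") fastforce+
  qed
  have r: "r > 0" using tau0 taur T by (cases r) auto
  \<comment> \<open>The shortest cell; a mesh below \<open>g\<close> keeps the rounded nodes
    \<open>b i\<close> strictly increasing.\<close>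
  define g where "g = Min ((\<lambda>i. \<tau> (Suc i) - \<tau> i) ` {..<r})"
  have g: "g > 0" "\<And>i. i < r \<Longrightarrow> g \<le> \<tau> (Suc i) - \<tau> i"
    using r tau_less by (auto simp: g_def Min_gr_iff lessThan_empty_iff)
  have "\<forall>\<^sub>F m in sequentially. 1 / real (Suc m) < min g \<epsilon>"
    by (rule order_tendstoD(2)[OF LIMSEQ_inverse_real_of_nat[unfolded inverse_eq_divide]]) (use g \<epsilon> in simp)
  then show "\<forall>\<^sub>F m in sequentially. J1_step (Suc m) (\<lambda>k. x (real k / real (Suc m))) \<in> J1_nbhd x T \<epsilon>"
  proof eventually_elim
    case (elim m')
    define m where "m = Suc m'"
    have m: "m > 0" "1 / real m < g" "1 / real m < \<epsilon>" using elim by (auto simp: m_def)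
    \<comment> \<open>Rounding up is forced: the sampling time
      \<open>\<lfloor>m * t\<rfloor> / m\<close> is at least \<open>\<tau> i\<close> exactly when
      \<open>t \<ge> b i\<close>, so the samples enter cell \<open>i\<close> at time
      \<open>b i\<close>.\<close>
    define b where "b i = real_of_int \<lceil>real m * \<tau> i\<rceil> / m" for i
    have bt: "\<tau> i \<le> b i" "b i < \<tau> i + 1 / m" for i
    proof -
      have "real m * \<tau> i \<le> real_of_int \<lceil>real m * \<tau> i\<rceil>" "real_of_int \<lceil>real m * \<tau> i\<rceil> < real m * \<tau> i + 1"
        by linarith+
      then show "\<tau> i \<le> b i" "b i < \<tau> i + 1 / m" using m(1) by (auto simp: b_def field_simps)
    qed
    have b_less: "b i < b (Suc i)" if "i < r" for i
      using bt(2)[of i] bt(1)[of "Suc i"] g(2)[OF that] m by linarith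
    have b0: "b 0 = 0" by (simp add: b_def tau0)
    obtain h where h: "time_change h" "\<And>i. i \<le> r \<Longrightarrow> h (b i) = \<tau> i" "\<And>s. s \<ge> 0 \<Longrightarrow> \<bar>h s - s\<bar> < \<epsilon>"
    proof -
      have "\<bar>\<tau> i - b i\<bar> < \<epsilon>" for i using bt[of i] m by linarith
      then show ?thesis using time_change_interpolate[of b \<tau> r \<epsilon>] b0 tau0 b_less tau_less that by auto
    qed
    have "\<bar>J1_step m (\<lambda>k. x (real k / real m)) t - x (h t)\<bar> < \<epsilon>" if t: "t \<in> {0..T}" for t
    proof -
      have "t < b r" using bt(1)[of r] taur t by simp
      then obtain i where i: "i < r" "b i \<le> t" "t < b (Suc i)"
        using ex_interval_index[of b t r] b0 t by auto
      define s where "s = real (nat \<lfloor>real m * t\<rfloor>) / m"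
      have fl: "real (nat \<lfloor>real m * t\<rfloor>) = real_of_int \<lfloor>real m * t\<rfloor>" using t by simp
      have "real_of_int \<lceil>real m * \<tau> i\<rceil> \<le> real m * t" using i(2) m(1) by (simp add: b_def field_simps)
      then have "real_of_int \<lceil>real m * \<tau> i\<rceil> \<le> real_of_int \<lfloor>real m * t\<rfloor>" by (simp add: le_floor_iff)
      then have "b i \<le> s" using m(1) unfolding b_def s_def fl by (simp add: divide_right_mono)
      then have s1: "\<tau> i \<le> s" using bt(1)[of i] by simp
      have "real m * t < real_of_int \<lceil>real m * \<tau> (Suc i)\<rceil>" using i(3) m(1) by (simp add: b_def field_simps)
      then have "\<lfloor>real m * t\<rfloor> < \<lceil>real m * \<tau> (Suc i)\<rceil>" by (simp add: floor_less_iff)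
      then have "real_of_int \<lfloor>real m * t\<rfloor> < real m * \<tau> (Suc i)" by (simp add: less_ceiling_iff)
      then have s2: "s < \<tau> (Suc i)" using m(1) unfolding s_def fl by (simp add: pos_divide_less_eq mult.commute)
      have "b i \<ge> 0" using bt(1)[of i] tau_G[of i] G i by fastforce
      then have h1: "\<tau> i \<le> h t"
        using time_change_less[OF h(1), of "b i" t] h(2)[of i] i by (cases "t = b i") auto
      have h2: "h t < \<tau> (Suc i)"
        using time_change_less[OF h(1), of t "b (Suc i)"] h(2)[of "Suc i"] i t by auto
      have no: "F \<inter> {\<tau> i<..<\<tau> (Suc i)} = {}"
      proof (rule ccontr)
        assume "F \<inter> {\<tau> i<..<\<tau> (Suc i)} \<noteq> {}"
        then obtain y where y: "y \<in> F" "\<tau> i < y" "y < \<tau> (Suc i)" by auto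
        then obtain j where j: "j \<le> r" "\<tau> j = y" using G_tau[of y] by (auto simp: G_def)
        have "i < j" using y j tau_less[of j i] i by (cases j i rule: linorder_cases) auto
        moreover have "j < Suc i" using y j tau_less[of "Suc i" j] i by (cases j "Suc i" rule: linorder_cases) auto
        ultimately show False by simp
      qed
      have tt: "0 \<le> \<tau> i" "\<tau> (Suc i) \<le> T + 1" using tau_G[of i] tau_G[of "Suc i"] i G by auto
      have "\<bar>x s - x (h t)\<bar> < \<epsilon>"
      proof (cases s "h t" rule: linorder_cases)
        case less
        have "F \<inter> {s<..h t} \<subseteq> F \<inter> {\<tau> i<..<\<tau> (Suc i)}" using s1 h2 by auto
        then show ?thesis using F(3)[of s "h t"] no less s1 h2 tt by auto
      next
        case greater
        have "F \<inter> {h t<..s} \<subseteq> F \<inter> {\<tau> i<..<\<tau> (Suc i)}" using s2 h1 by auto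
        then show ?thesis using F(3)[of "h t" s] no greater h1 s2 tt by auto
      qed (use \<epsilon> in simp)
      then show ?thesis using t by (simp add: J1_step_def s_def)
    qed
    then have "J1_step m (\<lambda>k. x (real k / real m)) \<in> J1_nbhd x T \<epsilon>"
      unfolding J1_nbhd_def using h(1) h(3) J1_step_in_space[OF m(1)] by (auto intro!: exI[of _ h])
    then show ?case by (simp add: m_def)
  qed
qed

text \<open>Up to time \<open>T\<close> a step path depends on finitely many entries of
  \<open>a\<close>, and moving these by less than \<open>\<epsilon>\<close> is a J1 perturbation
  with the identity as time change. Hence \<open>J1_step m\<close> is continuous from the product
  topology.\<close>

lemma open_vimage_J1_step:
  assumes "m > 0" and U: "openin J1_topology U"
  shows "open {a. J1_step m a \<in> U}"
proof (subst open_subopen, intro ballI)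
  fix a assume "a \<in> {a. J1_step m a \<in> U}"
  then obtain T \<epsilon> where T: "T > 0" "\<epsilon> > 0" "J1_nbhd (J1_step m a) T \<epsilon> \<subseteq> U"
    using U unfolding openin_J1 by blast
  define B where "B = (\<Inter>k\<in>{..nat \<lceil>m * T\<rceil>}. {a' :: nat \<Rightarrow> real. \<bar>a' k - a k\<bar> < \<epsilon>})"
  have "open {a' :: nat \<Rightarrow> real. \<bar>a' k - a k\<bar> < \<epsilon>}" for k
    by (intro open_Collect_less continuous_intros continuous_on_product_coordinates)
  then have "open B" unfolding B_def by auto
  moreover have "a \<in> B" using T by (auto simp: B_def)
  moreover have "B \<subseteq> {a. J1_step m a \<in> U}"
  proof safe
    fix a' assume a': "a' \<in> B"
    have "\<bar>J1_step m a' t - J1_step m a t\<bar> < \<epsilon>" if t: "t \<in> {0..T}" for t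
    proof -
      have "real m * t \<le> real m * T" using t by (intro mult_left_mono) auto
      then have "nat \<lfloor>real m * t\<rfloor> \<le> nat \<lceil>m * T\<rceil>" by linarith
      then show ?thesis using a' t by (auto simp: B_def J1_step_def)
    qed
    then have "J1_step m a' \<in> J1_nbhd (J1_step m a) T \<epsilon>"
      unfolding J1_nbhd_def using T J1_step_in_space[OF assms(1)] time_change_id
      by (auto intro!: exI[of _ "\<lambda>t. t"])
    then show "J1_step m a' \<in> U" using T by auto
  qed
  ultimately show "\<exists>B. open B \<and> a \<in> B \<and> B \<subseteq> {a. J1_step m a \<in> U}" by blast
qed

text \<open>The basic sets \<open>J1_nbhd\<close> need not be open. Applying
  \<open>limitin_J1\<close> to the identity along the neighbourhood filter of \<open>x\<close>
  produces an open set inside one.\<close>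

lemma J1_nbhd_interior:
  assumes "x \<in> skorokhod_space" "T > 0" "\<epsilon> > 0"
  obtains V where "openin J1_topology V" "x \<in> V" "V \<subseteq> J1_nbhd x T \<epsilon>"
proof -
  have "limitin J1_topology (\<lambda>z. z) x (nhdsin J1_topology x)"
    using assms(1) by (auto simp: limitin_def topspace_J1 eventually_nhdsin)
  then have "\<forall>\<^sub>F z in nhdsin J1_topology x. z \<in> J1_nbhd x T \<epsilon>"
    using assms unfolding limitin_J1 by blast
  then show ?thesis using that assms(1) by (auto simp: eventually_nhdsin topspace_J1)
qed

text \<open>The inverse time change does it. It may carry \<open>[0, T]\<close> beyond
  \<open>T\<close>, but by at most \<open>\<epsilon>\<close>, hence the longer horizon in the
  assumption.\<close>

lemma J1_nbhd_sym:
  assumes "y \<in> J1_nbhd x (T + \<epsilon>) \<epsilon>" "x \<in> skorokhod_space" "T > 0" "\<epsilon> > 0"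
  shows "x \<in> J1_nbhd y T \<epsilon>"
proof -
  obtain h where h: "time_change h"
    and *: "\<And>t. t \<in> {0..T + \<epsilon>} \<Longrightarrow> \<bar>h t - t\<bar> < \<epsilon> \<and> \<bar>y t - x (h t)\<bar> < \<epsilon>"
    using assms(1) unfolding J1_nbhd_def by auto
  define g where "g = the_inv_into {0..} h"
  have inj: "inj_on h {0..}" using h unfolding time_change_def by (auto intro: strict_mono_on_imp_inj_on)
  have im: "h ` {0..} = {0..}" using h unfolding time_change_def by auto
  have hg: "h (g t) = t" "g t \<ge> 0" if "t \<ge> 0" for t
    using f_the_inv_into_f[OF inj, of t] the_inv_into_into[OF inj, of t "{0..}"] that im by (auto simp: g_def)
  have gh: "g (h t) = t" if "t \<ge> 0" for t
    using the_inv_into_f_f[OF inj, of t] that by (simp add: g_def)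
  have mono: "g s < g t" if "0 \<le> s" "s < t" for s t
  proof (rule ccontr)
    assume "\<not> g s < g t"
    then have "h (g t) \<le> h (g s)" using time_change_less[OF h, of "g t" "g s"] hg[of t] that
      by (cases "g t = g s") auto
    then show False using hg that by auto
  qed
  have img: "g ` {0..} = {0..}"
  proof
    show "g ` {0..} \<subseteq> {0..}" using hg by auto
    show "{0..} \<subseteq> g ` {0..}"
    proof
      fix t :: real assume "t \<in> {0..}"
      then show "t \<in> g ` {0..}" using gh[of t] time_change_nonneg[OF h, of t] by (intro image_eqI[of _ _ "h t"]) auto
    qed
  qed
  have cont: "continuous_on {0..} g"
    unfolding continuous_on_iff
  proof (intro ballI allI impI)
    fix t e :: real assume t: "t \<in> {0..}" and e: "e > 0"
    \<comment> \<open>The distances from \<open>t\<close> to the images of \<open>g t + e\<close>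
      and \<open>g t - e\<close>. If \<open>g t - e\<close> is negative the lower estimate is
      automatic and the default 1 serves.\<close>
    define d where "d = min (h (g t + e) - t) (if e \<le> g t then t - h (g t - e) else 1)"
    have up: "t < h (g t + e)" using time_change_less[OF h, of "g t" "g t + e"] hg[of t] t e by auto
    have low: "h (g t - e) < t" if "e \<le> g t" using time_change_less[OF h, of "g t - e" "g t"] hg[of t] t e that by auto
    have "dist (g s) (g t) < e" if s: "s \<in> {0..}" "dist s t < d" for s
    proof -
      have "g s < g t + e"
        using mono[of "h (g t + e)" s] gh[of "g t + e"] hg[of t] t s e up unfolding d_def dist_real_def
        by (smt (verit) atLeast_iff mono)
      moreover have "g t - e < g s"
      proof (cases "e \<le> g t")
        case True
        then have "h (g t - e) < s" using s low unfolding d_def dist_real_def by auto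
        then have "g (h (g t - e)) < g s" using mono[of "h (g t - e)" s] time_change_nonneg[OF h, of "g t - e"] True by auto
        then show ?thesis using gh[of "g t - e"] True by simp
      next
        case False
        then show ?thesis using hg[of s] s by auto
      qed
      ultimately show ?thesis by (auto simp: dist_real_def)
    qed
    moreover have "d > 0" using up low by (auto simp: d_def)
    ultimately show "\<exists>d>0. \<forall>s\<in>{0..}. dist s t < d \<longrightarrow> dist (g s) (g t) < e" by blast
  qed
  have "time_change g" unfolding time_change_def using cont mono img by (auto simp: strict_mono_on_def)
  moreover have "\<bar>g t - t\<bar> < \<epsilon> \<and> \<bar>x t - y (g t)\<bar> < \<epsilon>" if t: "t \<in> {0..T}" for t
  proof -
    have "g t \<le> T + \<epsilon>"
    proof (rule ccontr)
      assume "\<not> g t \<le> T + \<epsilon>"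
      then have "h (T + \<epsilon>) < t" using time_change_less[OF h, of "T + \<epsilon>" "g t"] hg[of t] t assms by auto
      then show False using *[of "T + \<epsilon>"] assms t by auto
    qed
    then show ?thesis using *[of "g t"] hg[of t] t by auto
  qed
  ultimately show ?thesis unfolding J1_nbhd_def using assms(2) by (auto intro!: exI[of _ g])
qed

text \<open>An open \<open>U\<close> is exhausted by open sets \<open>I j\<close> of points that
  have a whole neighbourhood of horizon \<open>j + 1\<close> and tolerance
  \<open>1 / (j + 1)\<close> in \<open>U\<close>, which replaces the distance to the complement. A
  path lies in \<open>U\<close> iff its step approximations eventually stay in one
  \<open>I j\<close>, and this is a countable condition on values at rational times.\<close>

lemma measurable_J1:
  assumes X: "\<And>\<omega>. \<omega> \<in> space M \<Longrightarrow> X \<omega> \<in> skorokhod_space"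
    and meas: "\<And>t. t \<ge> 0 \<Longrightarrow> (\<lambda>\<omega>. X \<omega> t) \<in> borel_measurable M"
  shows "X \<in> measurable M (borel_of_topology J1_topology)"
  unfolding borel_of_topology_def
proof (rule measurable_measure_of)
  show "{U. openin J1_topology U} \<subseteq> Pow (topspace J1_topology)" by (auto dest: openin_subset)
  show "X \<in> space M \<rightarrow> topspace J1_topology" using X by (auto simp: topspace_J1)
  fix U assume "U \<in> {U. openin J1_topology U}"
  then have U: "openin J1_topology U" by simp
  define step where "step m x = J1_step (Suc m) (\<lambda>k. x (real k / real (Suc m)))" for m and x :: "real \<Rightarrow> real"
  define I where "I j = \<Union>{V. openin J1_topology V \<and> (\<forall>z\<in>V. J1_nbhd z (real (Suc j)) (1 / real (Suc j)) \<subseteq> U)}" for j :: nat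
  have I_open: "openin J1_topology (I j)" for j unfolding I_def by (intro openin_Union) auto
  have I_nbhd: "J1_nbhd z (real (Suc j)) (1 / real (Suc j)) \<subseteq> U" if "z \<in> I j" for z j
    using that unfolding I_def by blast
  have I_cover: "\<exists>j. x \<in> I j" if "x \<in> U" for x
  proof -
    have "\<exists>T>0. \<exists>\<epsilon>>0. J1_nbhd x T \<epsilon> \<subseteq> U" using U that by (simp add: openin_J1)
    then obtain T \<epsilon>' where T: "T > 0" "\<epsilon>' > 0" "J1_nbhd x T \<epsilon>' \<subseteq> U" by blast
    define \<epsilon> where "\<epsilon> = min \<epsilon>' (2 * T)"
    have \<epsilon>: "\<epsilon> > 0" "\<epsilon> \<le> 2 * T" "\<epsilon> \<le> \<epsilon>'" using T by (auto simp: \<epsilon>_def)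
    have xs: "x \<in> skorokhod_space" using that U by (auto simp: openin_J1)
    \<comment> \<open>\<open>J1_nbhd_triangle\<close> halves the horizon and doubles the tolerance,
      so the margin is taken at \<open>2 * T\<close> and \<open>\<epsilon> / 2\<close>.\<close>
    obtain V where V: "openin J1_topology V" "x \<in> V" "V \<subseteq> J1_nbhd x (2 * T) (\<epsilon> / 2)"
      using J1_nbhd_interior[OF xs, of "2 * T" "\<epsilon> / 2"] T \<epsilon> by auto
    obtain j where j: "real (Suc j) \<ge> 2 * T + \<epsilon>" "1 / real (Suc j) \<le> \<epsilon> / 2"
    proof -
      obtain j :: nat where "real j \<ge> max (2 * T + \<epsilon>) (2 / \<epsilon>)" using real_arch_simple by blast
      then have "real (Suc j) \<ge> 2 * T + \<epsilon>" "real (Suc j) \<ge> 2 / \<epsilon>" by auto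
      then show ?thesis using that[of j] \<epsilon> by (auto simp: field_simps)
    qed
    have "J1_nbhd z (real (Suc j)) (1 / real (Suc j)) \<subseteq> U" if "z \<in> V" for z
    proof -
      have "J1_nbhd z (real (Suc j)) (1 / real (Suc j)) \<subseteq> J1_nbhd z (2 * T + \<epsilon>) (\<epsilon> / 2)"
        using j by (intro J1_nbhd_mono)
      also have "\<dots> \<subseteq> J1_nbhd x (2 * T / 2) \<epsilon>"
        by (rule J1_nbhd_triangle) (use V that T \<epsilon> in auto)
      also have "\<dots> \<subseteq> J1_nbhd x T \<epsilon>'" using \<epsilon> by (intro J1_nbhd_mono) auto
      finally show ?thesis using T by blast
    qed
    then show ?thesis using V unfolding I_def by blast
  qed
  have key: "x \<in> U \<longleftrightarrow> (\<exists>j n. \<forall>m\<ge>n. step m x \<in> I j)" if x: "x \<in> skorokhod_space" for x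
  proof
    have lim: "limitin J1_topology (\<lambda>m. step m x) x sequentially"
      unfolding step_def by (rule J1_step_tendsto[OF x])
    show "\<exists>j n. \<forall>m\<ge>n. step m x \<in> I j" if "x \<in> U"
    proof -
      obtain j where "x \<in> I j" using I_cover \<open>x \<in> U\<close> by blast
      then have "\<forall>\<^sub>F m in sequentially. step m x \<in> I j" using lim I_open unfolding limitin_def by blast
      then show ?thesis unfolding eventually_sequentially by blast
    qed
    assume "\<exists>j n. \<forall>m\<ge>n. step m x \<in> I j"
    then obtain j n where jn: "\<forall>m\<ge>n. step m x \<in> I j" by blast
    define \<delta> where "\<delta> = 1 / real (Suc j)"
    have "\<delta> > 0" by (simp add: \<delta>_def)
    then have "\<forall>\<^sub>F m in sequentially. step m x \<in> J1_nbhd x (real (Suc j) + \<delta>) \<delta>"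
      using lim unfolding limitin_J1 by (meson add_pos_pos of_nat_0_less_iff zero_less_Suc)
    then obtain m where m: "m \<ge> n" "step m x \<in> J1_nbhd x (real (Suc j) + \<delta>) \<delta>"
      unfolding eventually_sequentially by (meson max.cobounded1 max.cobounded2)
    \<comment> \<open>Symmetry turns an approximation close to \<open>x\<close> into
      \<open>x\<close> lying in a neighbourhood of the approximation, of the size that
      \<open>I j\<close> guarantees to be inside \<open>U\<close>.\<close>
    have "x \<in> J1_nbhd (step m x) (real (Suc j)) \<delta>"
      using J1_nbhd_sym[OF m(2) x] \<open>\<delta> > 0\<close> by simp
    then show "x \<in> U" using I_nbhd[of "step m x" j] jn m by (auto simp: \<delta>_def)
  qed
  have eq: "X -` U \<inter> space M = (\<Union>j. \<Union>n. \<Inter>m\<in>{n..}. {\<omega> \<in> space M. step m (X \<omega>) \<in> I j})"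
  proof (intro set_eqI)
    fix \<omega>
    have "\<omega> \<in> (\<Union>j. \<Union>n. \<Inter>m\<in>{n..}. {\<omega> \<in> space M. step m (X \<omega>) \<in> I j}) \<longleftrightarrow>
        \<omega> \<in> space M \<and> (\<exists>j n. \<forall>m\<ge>n. step m (X \<omega>) \<in> I j)"
      by (simp only: UN_iff INT_iff mem_Collect_eq atLeast_iff) blast
    then show "\<omega> \<in> X -` U \<inter> space M \<longleftrightarrow> \<omega> \<in> (\<Union>j. \<Union>n. \<Inter>m\<in>{n..}. {\<omega> \<in> space M. step m (X \<omega>) \<in> I j})"
      using key[OF X, of \<omega>] by auto
  qed
  have "{\<omega> \<in> space M. step m (X \<omega>) \<in> I j} \<in> sets M" for m j
  proof -
    have "(\<lambda>\<omega> k. X \<omega> (real k / real (Suc m))) \<in> measurable M (Pi\<^sub>M UNIV (\<lambda>_. borel))"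
      by (intro measurable_PiM_single') (auto intro: meas)
    then have 1: "(\<lambda>\<omega> k. X \<omega> (real k / real (Suc m))) \<in> borel_measurable M"
      using measurable_cong_sets[OF refl sets_PiM_equal_borel] by blast
    have "open {a. J1_step (Suc m) a \<in> I j}" by (rule open_vimage_J1_step) (use I_open in auto)
    then have "{a. J1_step (Suc m) a \<in> I j} \<in> sets borel" by simp
    from measurable_sets[OF 1 this]
    show ?thesis by (simp add: vimage_def step_def Int_def conj_commute)
  qed
  then show "X -` U \<inter> space M \<in> sets M" unfolding eq by (intro sets.countable_UN sets.countable_INT') auto
qed

text \<open>The set of paths is not measurable in the uncountable product, so the comparison goes
  through traces: the identity on the trace of the product sigma-algebra is Borel for J1, hence each
  Borel set of paths is the trace of a product-measurable set.\<close>

lemma distr_J1_eqI: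
  assumes [measurable]: "X \<in> measurable M (Pi\<^sub>M {0..} (\<lambda>_. borel))" "Y \<in> measurable N (Pi\<^sub>M {0..} (\<lambda>_. borel))"
    and X: "\<And>\<omega>. \<omega> \<in> space M \<Longrightarrow> X \<omega> \<in> skorokhod_space"
    and Y: "\<And>\<omega>. \<omega> \<in> space N \<Longrightarrow> Y \<omega> \<in> skorokhod_space"
    and eq: "distr M (Pi\<^sub>M {0..} (\<lambda>_. borel)) X = distr N (Pi\<^sub>M {0..} (\<lambda>_. borel)) Y"
  shows "distr M (borel_of_topology J1_topology) X = distr N (borel_of_topology J1_topology) Y"
proof -
  let ?P = "Pi\<^sub>M {0..} (\<lambda>_::real. borel :: real measure)" and ?B = "borel_of_topology J1_topology"
  have mX: "X \<in> measurable M ?B"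
    by (rule measurable_J1[OF X]) (auto intro: measurable_compose[OF assms(1) measurable_component_singleton])
  have mY: "Y \<in> measurable N ?B"
    by (rule measurable_J1[OF Y]) (auto intro: measurable_compose[OF assms(2) measurable_component_singleton])
  have id: "(\<lambda>x. x) \<in> measurable (restrict_space ?P skorokhod_space) ?B"
    by (rule measurable_J1) (auto simp: space_restrict_space intro!: measurable_restrict_space1)
  show ?thesis
  proof (rule measure_eqI)
    fix A assume "A \<in> sets (distr M ?B X)"
    then have A: "A \<in> sets ?B" by simp
    then have "A \<inter> space (restrict_space ?P skorokhod_space) \<in> sets (restrict_space ?P skorokhod_space)"
      using measurable_sets[OF id A] by simp
    then obtain A' where A': "A' \<in> sets ?P" "A \<inter> space (restrict_space ?P skorokhod_space) = skorokhod_space \<inter> A'"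
      unfolding sets_restrict_space by auto
    have pre: "x \<in> A \<longleftrightarrow> x \<in> A'" if "x \<in> skorokhod_space" for x
    proof -
      have "x \<in> space ?P" using that by (auto simp: space_PiM skorokhod_space_def PiE_def)
      then show ?thesis using A'(2) that by (auto simp: space_restrict_space)
    qed
    have 1: "X -` A \<inter> space M = X -` A' \<inter> space M" using X pre by auto
    have 2: "Y -` A \<inter> space N = Y -` A' \<inter> space N" using Y pre by auto
    have "emeasure (distr M ?P X) A' = emeasure (distr N ?P Y) A'" using eq by simp
    then show "emeasure (distr M ?B X) A = emeasure (distr N ?B Y) A"
      using A A'(1) mX mY by (simp add: emeasure_distr 1 2)
  qed simp
qed

section \<open>The reflection map on right-continuous paths with left limits\<close>

text \<open>With tolerance 1, each value on \<open>[0, t]\<close> is close to the value at one of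
  finitely many partition points; 0 is added so that an earlier partition point always
  exists.\<close>

lemma cadlag_bdd_below:
  assumes "cadlag f"
  shows "bdd_below (f ` {0..t})"
proof (cases "t \<ge> 0")
  case True
  obtain F where F: "finite F" "F \<subseteq> {0..t + 1}"
    "\<And>s s'. 0 \<le> s \<Longrightarrow> s < s' \<Longrightarrow> s' < t + 1 \<Longrightarrow> F \<inter> {s<..s'} = {} \<Longrightarrow> \<bar>f s - f s'\<bar> < 1"
    using cadlag_partition[OF assms, of "t + 1" 1] True by auto
  define G where "G = insert 0 F"
  have "Min (f ` G) - 1 \<le> f s" if s: "s \<in> {0..t}" for s
  proof -
    define y where "y = Max (G \<inter> {0..s})"
    have fin: "finite (G \<inter> {0..s})" "G \<inter> {0..s} \<noteq> {}" using F s by (auto simp: G_def)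
    then have y: "y \<in> G" "0 \<le> y" "y \<le> s" using Max_in[OF fin] by (auto simp: y_def)
    have "z \<le> y" if "z \<in> F" "z \<le> s" for z
      unfolding y_def using fin that F(2) by (intro Max_ge) (auto simp: G_def)
    then have "F \<inter> {y<..s} = {}" by force
    then have "\<bar>f y - f s\<bar> < 1" using F(3)[of y s] y s by (cases "y = s") auto
    moreover have "Min (f ` G) \<le> f y" using y F by (intro Min_le) (auto simp: G_def)
    ultimately show ?thesis by linarith
  qed
  then show ?thesis by (intro bdd_belowI2)
qed auto

text \<open>The running infimum is nonincreasing, so its left limit at \<open>t\<close> is the
  infimum over \<open>{0..<t}\<close>. It is right-continuous because just after \<open>t\<close>
  the path cannot fall far below \<open>f t\<close>.\<close>

lemma cadlag_INF:
  assumes f: "cadlag f"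
  shows "cadlag (\<lambda>t. INF s\<in>{0..t}. f s)"
proof -
  define I where "I t = (INF s\<in>{0..t}. f s)" for t
  have bdd: "bdd_below (f ` {0..t})" for t by (rule cadlag_bdd_below[OF f])
  have I_le: "I t \<le> f s" if "0 \<le> s" "s \<le> t" for s t
    unfolding I_def using that bdd by (intro cINF_lower) auto
  have I_mono: "I t \<le> I s" if "0 \<le> s" "s \<le> t" for s t
    unfolding I_def using that bdd by (intro cINF_superset_mono) auto
  have "(I \<longlongrightarrow> I t) (at_right t)" if "t \<ge> 0" for t
  proof (rule tendstoI)
    fix e :: real assume "e > 0"
    have "\<forall>\<^sub>F s in at_right t. dist (f s) (f t) < e / 2"
      using f that \<open>e > 0\<close> unfolding cadlag_def by (intro tendstoD) auto
    then obtain b where b: "b > t" "\<And>s. t < s \<Longrightarrow> s < b \<Longrightarrow> \<bar>f s - f t\<bar> < e / 2"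
      unfolding eventually_at_right_field dist_real_def by auto
    have "dist (I s) (I t) < e" if s: "t < s" "s < b" for s
    proof -
      have "I t - e / 2 \<le> f r" if "r \<in> {0..s}" for r
      proof (cases "r \<le> t")
        case True
        then show ?thesis using I_le[of r t] that \<open>e > 0\<close> by auto
      next
        case False
        then show ?thesis using I_le[of t t] b(2)[of r] that s \<open>t \<ge> 0\<close> unfolding abs_if by (auto split: if_splits)
      qed
      then have "I t - e / 2 \<le> I s" unfolding I_def[of s] using s \<open>t \<ge> 0\<close> by (intro cINF_greatest) auto
      then show ?thesis using I_mono[of t s] s \<open>t \<ge> 0\<close> \<open>e > 0\<close> by (auto simp: dist_real_def)
    qed
    then show "\<forall>\<^sub>F s in at_right t. dist (I s) (I t) < e"
      unfolding eventually_at_right_field using b by blast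
  qed
  moreover have "(I \<longlongrightarrow> (INF s\<in>{0..<t}. f s)) (at_left t)" if "t > 0" for t
  proof (rule tendstoI)
    fix e :: real assume "e > 0"
    define J where "J = (INF s\<in>{0..<t}. f s)"
    have bdd': "bdd_below (f ` {0..<t})" by (rule bdd_below_mono[OF bdd[of t]]) auto
    have "\<exists>s\<in>{0..<t}. f s < J + e"
      using \<open>e > 0\<close> \<open>t > 0\<close> bdd' cINF_less_iff[of "{0..<t}" f "J + e"] by (auto simp: J_def)
    then obtain s0 where s0: "0 \<le> s0" "s0 < t" "f s0 < J + e" by auto
    have "dist (I s) J < e" if s: "s0 < s" "s < t" for s
    proof -
      have "J \<le> I s" unfolding J_def I_def using s s0 bdd' by (intro cINF_superset_mono) auto
      then show ?thesis using I_le[of s0 s] s s0 by (auto simp: dist_real_def)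
    qed
    then show "\<forall>\<^sub>F s in at_left t. dist (I s) (INF s\<in>{0..<t}. f s) < e"
      unfolding eventually_at_left_field J_def using s0 by blast
  qed
  ultimately show ?thesis unfolding cadlag_def I_def by blast
qed

lemma cadlag_diff: "cadlag f \<Longrightarrow> cadlag g \<Longrightarrow> cadlag (\<lambda>t. f t - g t)"
  unfolding cadlag_def by (auto intro: tendsto_diff) (metis tendsto_diff)

lemma cadlag_cmult: "cadlag f \<Longrightarrow> cadlag (\<lambda>t. c * f t)"
  for c :: real
  unfolding cadlag_def by (auto intro: tendsto_mult_left) (metis tendsto_mult_left)

lemma cadlag_cong: "(\<And>t. t \<ge> 0 \<Longrightarrow> f t = g t) \<Longrightarrow> cadlag f \<longleftrightarrow> cadlag g"
proof -
  assume *: "\<And>t. t \<ge> 0 \<Longrightarrow> f t = g t"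
  have 1: "(f \<longlongrightarrow> l) (at_right t) \<longleftrightarrow> (g \<longlongrightarrow> l) (at_right t)" if "t \<ge> 0" for t l
    by (rule filterlim_cong) (use * that in \<open>auto intro: eventually_at_rightI[of t "t + 1"]\<close>)
  have 2: "(f \<longlongrightarrow> l) (at_left t) \<longleftrightarrow> (g \<longlongrightarrow> l) (at_left t)" if "t > 0" for t l
    by (rule filterlim_cong) (use * that in \<open>auto intro: eventually_at_leftI[of 0 t]\<close>)
  show ?thesis unfolding cadlag_def using 1 2 * by auto
qed

lemma cadlag_scale_time:
  assumes "cadlag f" "(u::real) > 0"
  shows "cadlag (\<lambda>t. f (u * t))"
proof -
  have "((\<lambda>s. f (u * s)) \<longlongrightarrow> f (u * t)) (at_right t)" if "t \<ge> 0" for t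
  proof (rule filterlim_compose[of f _ "at_right (u * t)"])
    show "(f \<longlongrightarrow> f (u * t)) (at_right (u * t))" using assms that unfolding cadlag_def by auto
    show "LIM s at_right t. u * s :> at_right (u * t)"
      unfolding filterlim_at using assms that
      by (auto intro!: tendsto_eq_intros eventually_at_rightI[of t "t + 1"])
  qed
  moreover have "\<exists>l. ((\<lambda>s. f (u * s)) \<longlongrightarrow> l) (at_left t)" if "t > 0" for t
  proof -
    have "u * t > 0" using assms that by simp
    then obtain l where l: "(f \<longlongrightarrow> l) (at_left (u * t))" using assms(1) unfolding cadlag_def by blast
    have "LIM s at_left t. u * s :> at_left (u * t)"
      unfolding filterlim_at using assms that
      by (auto intro!: tendsto_eq_intros eventually_at_leftI[of 0 t])
    from filterlim_compose[OF l this] show ?thesis by blast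
  qed
  ultimately show ?thesis unfolding cadlag_def by auto
qed

lemma cadlag_reflection: "cadlag f \<Longrightarrow> cadlag (skorokhod_reflection f)"
  using cadlag_diff[OF _ cadlag_INF, of f f] unfolding skorokhod_reflection_def[abs_def] by simp

lemma reflection_cong: "(\<And>s. 0 \<le> s \<Longrightarrow> s \<le> t \<Longrightarrow> f s = g s) \<Longrightarrow> t \<ge> 0 \<Longrightarrow> skorokhod_reflection f t = skorokhod_reflection g t"
  unfolding skorokhod_reflection_def by (auto intro: arg_cong2[where f="(-)"] INF_cong)

text \<open>The factor 2 collects one error for the path and one for its running infimum.\<close>

lemma reflection_lipschitz:
  assumes f: "bdd_below (f ` {0..t})" and g: "bdd_below (g ` {0..t})" and t: "t \<ge> 0"
    and close: "\<And>s. s \<in> {0..t} \<Longrightarrow> \<bar>f s - g s\<bar> \<le> e"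
  shows "\<bar>skorokhod_reflection f t - skorokhod_reflection g t\<bar> \<le> 2 * e"
proof -
  have *: "(INF s\<in>{0..t}. f s) - e \<le> (INF s\<in>{0..t}. g s)" if "bdd_below (f ` {0..t})"
    "\<And>s. s \<in> {0..t} \<Longrightarrow> \<bar>f s - g s\<bar> \<le> e" for f g
  proof (rule cINF_greatest)
    fix s assume s: "s \<in> {0..t}"
    then show "(INF s\<in>{0..t}. f s) - e \<le> g s"
      using cINF_lower[OF that(1) s] that(2)[OF s] by linarith
  qed (use t in auto)
  have "\<bar>g s - f s\<bar> \<le> e" if "s \<in> {0..t}" for s using close[OF that] by simp
  from *[OF f close] *[OF g this] close[of t] t show ?thesis
    unfolding skorokhod_reflection_def by auto
qed

lemma reflection_scale:
  assumes "cadlag f" and "u > 0" and "w > 0" and "t \<ge> 0"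
  shows "skorokhod_reflection f (u * t) / w = skorokhod_reflection (\<lambda>s. f (u * s) / w) t"
proof -
  have "cadlag (\<lambda>s. (1 / w) * f (u * s))"
    by (rule cadlag_cmult[OF cadlag_scale_time]) (use assms in auto)
  then have b: "bdd_below ((\<lambda>s. f (u * s) / w) ` {0..t})"
    using cadlag_bdd_below[of "\<lambda>s. (1 / w) * f (u * s)" t] by simp
  have "(INF s\<in>{0..u * t}. f s) / w = (INF s\<in>{0..t}. f (u * s) / w)"
  proof (rule antisym)
    show "(INF s\<in>{0..u * t}. f s) / w \<le> (INF s\<in>{0..t}. f (u * s) / w)"
    proof (rule cINF_greatest)
      fix s assume "s \<in> {0..t}"
      then show "(INF s\<in>{0..u * t}. f s) / w \<le> f (u * s) / w"
        using assms by (intro divide_right_mono cINF_lower cadlag_bdd_below) auto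
    qed (use assms in auto)
    have "w * (INF s\<in>{0..t}. f (u * s) / w) \<le> (INF s\<in>{0..u * t}. f s)"
    proof (rule cINF_greatest)
      fix s assume s: "s \<in> {0..u * t}"
      then have "(INF s\<in>{0..t}. f (u * s) / w) \<le> f (u * (s / u)) / w"
        using assms by (intro cINF_lower b) (auto simp: field_simps)
      then show "w * (INF s\<in>{0..t}. f (u * s) / w) \<le> f s" using assms by (simp add: field_simps)
    qed (use assms in auto)
    then show "(INF s\<in>{0..t}. f (u * s) / w) \<le> (INF s\<in>{0..u * t}. f s) / w"
      using assms by (simp add: field_simps)
  qed
  then show ?thesis unfolding skorokhod_reflection_def by (simp add: diff_divide_distrib)
qed

text \<open>The infimum is attained at the current time. This makes the queue with priority index 0
  vanish, whose net input consists of services alone.\<close>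

lemma reflection_antimono:
  assumes "t \<ge> 0" "\<And>s. 0 \<le> s \<Longrightarrow> s \<le> t \<Longrightarrow> f t \<le> f s"
  shows "skorokhod_reflection f t = 0"
proof -
  have "(INF s\<in>{0..t}. f s) = f t"
    using assms by (intro cInf_eq_minimum) auto
  then show ?thesis by (simp add: skorokhod_reflection_def)
qed

text \<open>The infimum is attained at time 0. This covers limits in which the services
  disappear.\<close>

lemma reflection_mono:
  assumes "t \<ge> 0" "\<And>s. 0 \<le> s \<Longrightarrow> s \<le> t \<Longrightarrow> f 0 \<le> f s"
  shows "skorokhod_reflection f t = f t - f 0"
proof -
  have "(INF s\<in>{0..t}. f s) = f 0"
    using assms by (intro cInf_eq_minimum) auto
  then show ?thesis by (simp add: skorokhod_reflection_def)
qed

text \<open>Right continuity reaches each \<open>s < t\<close> through rationals above it;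
  \<open>t\<close> itself has no such neighbours inside \<open>{0..t}\<close> and is added by hand.
  A countable infimum is what makes the reflection measurable.\<close>

lemma INF_rat:
  assumes f: "cadlag f" and t: "t \<ge> 0"
  shows "(INF s\<in>{0..t}. f s) = (INF s\<in>insert t (\<rat> \<inter> {0..t}). f s)" (is "?a = ?b")
proof (rule antisym)
  have b: "bdd_below (f ` {0..t})" by (rule cadlag_bdd_below[OF f])
  show "?a \<le> ?b" using t b by (intro cINF_superset_mono) auto
  have b': "bdd_below (f ` insert t (\<rat> \<inter> {0..t}))" by (rule bdd_below_mono[OF b]) (use t in auto)
  show "?b \<le> ?a"
  proof (rule cINF_greatest)
    fix s assume s: "s \<in> {0..t}"
    show "?b \<le> f s"
    proof (cases "s = t")
      case True
      then show ?thesis using b' by (intro cINF_lower) auto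
    next
      case False
      show ?thesis
      proof (rule field_le_epsilon)
        fix e :: real assume "e > 0"
        have "\<forall>\<^sub>F r in at_right s. dist (f r) (f s) < e"
          using f s \<open>e > 0\<close> unfolding cadlag_def by (intro tendstoD) auto
        then obtain c where c: "c > s" "\<And>r. s < r \<Longrightarrow> r < c \<Longrightarrow> \<bar>f r - f s\<bar> < e"
          unfolding eventually_at_right_field dist_real_def by auto
        obtain q where q: "q \<in> \<rat>" "s < q" "q < min c t" using Rats_dense_in_real[of s "min c t"] c False s by auto
        then have "?b \<le> f q" using s b' by (intro cINF_lower) auto
        then show "?b \<le> f s + e" using c(2)[of q] q by auto
      qed
    qed
  qed (use t in auto)
qed

lemma measurable_reflection:
  assumes "\<And>\<omega>. \<omega> \<in> space M \<Longrightarrow> cadlag (\<lambda>t. f t \<omega>)"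
    and [measurable]: "\<And>t. t \<ge> 0 \<Longrightarrow> f t \<in> borel_measurable M" and t: "t \<ge> 0"
  shows "(\<lambda>\<omega>. skorokhod_reflection (\<lambda>t. f t \<omega>) t) \<in> borel_measurable M"
proof -
  have "(\<lambda>\<omega>. f t \<omega> - (INF s\<in>insert t (\<rat> \<inter> {0..t}). f s \<omega>)) \<in> borel_measurable M"
  proof (intro borel_measurable_diff borel_measurable_cINF)
    show "countable (insert t (\<rat> \<inter> {0..t}))" by (intro countable_insert countable_Int1 countable_rat)
    fix \<omega> assume "\<omega> \<in> space M"
    then have "bdd_below ((\<lambda>t. f t \<omega>) ` {0..t})" by (intro cadlag_bdd_below assms)
    then show "bdd_below ((\<lambda>s. f s \<omega>) ` insert t (\<rat> \<inter> {0..t}))" by (rule bdd_below_mono) (use t in auto)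
  qed (use t in auto)
  then show ?thesis
    unfolding skorokhod_reflection_def
    by (rule measurable_cong[THEN iffD1, rotated]) (use INF_rat assms in auto)
qed

section \<open>Sample paths of the queue\<close>

text \<open>Lindley's recursion: if \<open>f\<close> takes only its two end values on
  \<open>[s, t]\<close>, the new running infimum is the minimum of the old one and
  \<open>f t\<close>.\<close>

lemma reflection_step:
  assumes t: "0 \<le> s" "s \<le> t" and bdd: "bdd_below (f ` {0..s})"
    and two: "\<And>r. s \<le> r \<Longrightarrow> r \<le> t \<Longrightarrow> f r = f s \<or> f r = f t"
  shows "skorokhod_reflection f t = max (skorokhod_reflection f s + (f t - f s)) 0"
proof -
  let ?I = "INF r\<in>{0..s}. f r"
  have Is: "?I \<le> f r" if "r \<in> {0..s}" for r using bdd that by (intro cINF_lower)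
  have fin: "finite (f ` {s..t})"
  proof (rule finite_subset[of _ "{f s, f t}"])
    show "f ` {s..t} \<subseteq> {f s, f t}" using two by fastforce
  qed simp
  have eq: "{0..t} = {0..s} \<union> {s..t}" using t by auto
  have bt: "bdd_below (f ` {0..t})" unfolding eq image_Un using bdd fin by simp
  have "(INF r\<in>{0..t}. f r) = min ?I (f t)"
  proof (rule antisym)
    show "(INF r\<in>{0..t}. f r) \<le> min ?I (f t)"
      using t by (intro min.boundedI cINF_superset_mono cINF_lower bt) auto
    show "min ?I (f t) \<le> (INF r\<in>{0..t}. f r)"
    proof (rule cINF_greatest)
      fix r assume r: "r \<in> {0..t}"
      show "min ?I (f t) \<le> f r"
        using Is[of r] Is[of s] two[of r] r t by (cases "r \<le> s") (auto simp: min_le_iff_disj)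
    qed (use t in auto)
  qed
  then show ?thesis unfolding skorokhod_reflection_def by auto
qed

definition class_count :: "(nat \<Rightarrow> nat) \<Rightarrow> nat \<Rightarrow> nat \<Rightarrow> nat" where
  "class_count c i m = card {k. k < m \<and> c k \<in> {1..i}}"

lemma class_count_0 [simp]: "class_count c i 0 = 0"
  by (simp add: class_count_def)

lemma class_count_Suc: "class_count c i (Suc m) = class_count c i m + (if c m \<in> {1..i} then 1 else 0)"
proof -
  have "{k. k < Suc m \<and> c k \<in> {1..i}} = {k. k < m \<and> c k \<in> {1..i}} \<union> (if c m \<in> {1..i} then {m} else {})"
    by (auto simp: less_Suc_eq)
  then show ?thesis by (auto simp: class_count_def card_insert_if)
qed

lemma class_count_le: "class_count c i m \<le> m"
proof -
  have "card {k. k < m \<and> c k \<in> {1..i}} \<le> card {..<m}" by (intro card_mono) auto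
  then show ?thesis by (simp add: class_count_def)
qed

lemma sum_admit:
  "(\<Sum>l=1..i. admit j q l) = (\<Sum>l=1..i. q l) + (if j \<in> {1..i} then 1 else 0)"
proof -
  have "admit j q l = q l + (if l = j then 1 else 0)" for l by (simp add: admit_def)
  then show ?thesis by (simp add: sum.distrib)
qed

text \<open>A service goes to a class beyond \<open>i\<close> only when the classes up to
  \<open>i\<close> are empty, and then truncated subtraction keeps their sum at 0. So the sum
  evolves without reference to the class that is served.\<close>

lemma sum_serve:
  assumes "i \<le> K"
  shows "(\<Sum>l=1..i. serve K q l) = (\<Sum>l=1..i. q l) - 1"
proof (cases "\<exists>j\<in>{1..K}. q j > 0")
  case True
  define j where "j = (LEAST j. j \<in> {1..K} \<and> q j > 0)"
  have "\<exists>j. j \<in> {1..K} \<and> q j > 0" using True by blast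
  then have "j \<in> {1..K} \<and> q j > 0" unfolding j_def by (rule LeastI_ex)
  then have j: "j \<in> {1..K}" "q j > 0" by auto
  have least: "q l = 0" if "l \<in> {1..K}" "l < j" for l using not_less_Least[of l "\<lambda>j. j \<in> {1..K} \<and> q j > 0"] that by (auto simp: j_def)
  have s: "serve K q = q(j := q j - 1)" using True by (simp add: serve_def j_def Let_def)
  show ?thesis
  proof (cases "j \<le> i")
    case True
    then have "j \<in> {1..i}" using j by auto
    then have "(\<Sum>l=1..i. q l) = q j + sum q ({1..i} - {j})" "(\<Sum>l=1..i. serve K q l) = serve K q j + sum (serve K q) ({1..i} - {j})"
      by (simp_all add: sum.remove)
    moreover have "sum (serve K q) ({1..i} - {j}) = sum q ({1..i} - {j})" by (intro sum.cong) (auto simp: s)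
    ultimately show ?thesis using j s by simp
  next
    case False
    then have "(\<Sum>l=1..i. q l) = 0" "(\<Sum>l=1..i. serve K q l) = 0" using least assms by (auto simp: s)
    then show ?thesis by simp
  qed
next
  case False
  then have "(\<Sum>l=1..i. q l) = 0" "serve K q = q" using assms by (auto simp: serve_def)
  then show ?thesis by simp
qed

text \<open>Induction on the number of events up to \<open>t\<close>. The hypothesis
  \<open>unit\<close> supplies a time \<open>s\<close> at which exactly the last event is missing;
  on \<open>[s, t]\<close> the net input takes only its end values, and one Lindley step leads from
  \<open>s\<close> to \<open>t\<close>.\<close>

lemma priority_queue_reflection:
  assumes n: "\<And>s t. 0 \<le> s \<Longrightarrow> s \<le> t \<Longrightarrow> n s \<le> n t" and d: "\<And>s t. 0 \<le> s \<Longrightarrow> s \<le> t \<Longrightarrow> d s \<le> d t"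
    and unit: "\<And>t k. 0 \<le> t \<Longrightarrow> n t + d t = Suc k \<Longrightarrow> \<exists>s\<in>{0..t}. n s + d s = k"
    and path: "priority_queue_path K n d c q" and i: "i \<le> K" and t: "t \<ge> 0"
  shows "real (\<Sum>l=1..i. q t l) = skorokhod_reflection (\<lambda>s. real (class_count c i (n s)) - real (d s)) t"
proof -
  define f where "f s = real (class_count c i (n s)) - real (d s)" for s
  note pq = path[unfolded priority_queue_path_def, THEN conjunct2, THEN spec, THEN spec, THEN mp, OF conjI, THEN bspec]
  have bdd: "bdd_below (f ` {0..t})" for t
  proof (rule bdd_belowI2)
    fix s assume "s \<in> {0..t}"
    then show "- real (d t) \<le> f s" using d[of s t] by (auto simp: f_def)
  qed
  have "real (\<Sum>l=1..i. q t l) = skorokhod_reflection f t"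
    using t
  proof (induction "n t + d t" arbitrary: t)
    case 0
    have z: "n s = 0 \<and> d s = 0" if "s \<in> {0..t}" for s using n[of s t] d[of s t] that 0 by auto
    have "q t l = 0" if "l \<in> {1..i}" for l
    proof -
      have l: "l \<in> {1..K}" using that i by auto
      have "n t = n 0 \<and> d t = d 0" using z[of 0] z[of t] \<open>t \<ge> 0\<close> by simp
      then have "q t l = q 0 l" using pq[OF _ \<open>t \<ge> 0\<close> l] by simp
      then show ?thesis using path that i unfolding priority_queue_path_def by auto
    qed
    moreover have "(INF s\<in>{0..t}. f s) = 0"
    proof -
      have "f ` {0..t} = {0}" using z \<open>t \<ge> 0\<close> by (auto simp: f_def)
      then show ?thesis by simp
    qed
    ultimately show ?case using z[of t] \<open>t \<ge> 0\<close> by (simp add: skorokhod_reflection_def f_def)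
  next
    case (Suc k)
    from unit[OF \<open>t \<ge> 0\<close>, of k] Suc obtain s where s: "0 \<le> s" "s \<le> t" "n s + d s = k" by auto
    have IH: "real (\<Sum>l=1..i. q s l) = skorokhod_reflection f s" using Suc.hyps(1)[of s] s by simp
    have le: "n s \<le> n t" "d s \<le> d t" using n d s by auto
    have two: "f r = f s \<or> f r = f t" if r: "s \<le> r" "r \<le> t" for r
    proof -
      have "n s \<le> n r" "n r \<le> n t" "d s \<le> d r" "d r \<le> d t" using n d s r by auto
      then have "(n r = n s \<and> d r = d s) \<or> (n r = n t \<and> d r = d t)" using s(3) Suc.hyps(2) by linarith
      then show ?thesis by (auto simp: f_def)
    qed
    have fT: "skorokhod_reflection f t = max (skorokhod_reflection f s + (f t - f s)) 0"
      by (rule reflection_step) (use s bdd two in auto)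
    have step: "(n t = Suc (n s) \<and> d t = d s \<longrightarrow> q t l = admit (c (n s)) (q s) l) \<and>
        (n t = n s \<and> d t = Suc (d s) \<longrightarrow> q t l = serve K (q s) l)" if "l \<in> {1..i}" for l
    proof -
      have "l \<in> {1..K}" using that i by auto
      then show ?thesis using pq[OF s(1,2)] by simp
    qed
    consider "n t = Suc (n s)" "d t = d s" | "n t = n s" "d t = Suc (d s)" using le s(3) Suc.hyps(2) by linarith
    then show ?case
    proof cases
      case 1
      have "(\<Sum>l=1..i. q t l) = (\<Sum>l=1..i. admit (c (n s)) (q s) l)"
        by (intro sum.cong refl) (use 1 step in blast)
      then show ?thesis using 1 unfolding fT sum_admit IH[symmetric]
        by (simp add: f_def class_count_Suc sum_nonneg max_absorb1)
    next
      case 2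
      have "(\<Sum>l=1..i. q t l) = (\<Sum>l=1..i. serve K (q s) l)"
        by (intro sum.cong refl) (use 2 step in blast)
      \<comment> \<open>The truncated subtraction of a lost service is the maximum with 0 in
        Lindley's recursion.\<close>
      moreover have "real (m - 1) = max (real m - 1) 0" for m :: nat by (cases m) auto
      ultimately show ?thesis using 2 unfolding fT sum_serve[OF i] IH[symmetric] by (simp add: f_def del: of_nat_sum)
    qed
  qed
  then show ?thesis by (simp add: f_def[abs_def])
qed

section \<open>Counting paths of deterministic renewal sequences\<close>

definition renewal_count :: "(nat \<Rightarrow> real) \<Rightarrow> real \<Rightarrow> nat" where
  "renewal_count x t = Max {n. (\<Sum>k<n. x k) \<le> t}"

text \<open>Unboundedness is tested against natural numbers only, so that the predicate is a
  countable condition and hence measurable in the sequence.\<close>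

definition renewal_sequence :: "(nat \<Rightarrow> real) \<Rightarrow> bool" where
  "renewal_sequence x \<longleftrightarrow> (\<forall>k. 0 \<le> x k) \<and> (\<forall>m :: nat. \<exists>n. real m < (\<Sum>k<n. x k))"

lemma renewal_nonneg: "renewal_sequence x \<Longrightarrow> 0 \<le> x k"
  unfolding renewal_sequence_def by blast

lemma renewal_sum_nonneg: "renewal_sequence x \<Longrightarrow> 0 \<le> (\<Sum>k<n. x k)"
  by (intro sum_nonneg renewal_nonneg)

lemma renewal_sum_mono:
  assumes "renewal_sequence x" "m \<le> n"
  shows "(\<Sum>k<m. x k) \<le> (\<Sum>k<n. x k)"
  using assms(2) by (intro sum_mono2 renewal_nonneg[OF assms(1)]) auto

lemma renewal_unbounded:
  assumes "renewal_sequence x"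
  shows "\<exists>n. t < (\<Sum>k<n. x k)"
proof -
  obtain m :: nat where "t < real m" using reals_Archimedean2 by blast
  moreover obtain n where "real m < (\<Sum>k<n. x k)" using assms by (auto simp: renewal_sequence_def)
  ultimately show ?thesis by (intro exI[of _ n]) simp
qed

text \<open>Unbounded partial sums leave finitely many candidates, so the maximum exists. From here
  on, statements about counts are statements about partial sums.\<close>

lemma le_renewal_count_iff:
  assumes x: "renewal_sequence x" and t: "t \<ge> 0"
  shows "n \<le> renewal_count x t \<longleftrightarrow> (\<Sum>k<n. x k) \<le> t"
proof -
  obtain m where m: "t < (\<Sum>k<m. x k)" using renewal_unbounded[OF x] by blast
  have "n < m" if "(\<Sum>k<n. x k) \<le> t" for n
    using renewal_sum_mono[OF x, of m n] m that by (meson leI le_less_trans less_irrefl order_trans)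
  then have "{n. (\<Sum>k<n. x k) \<le> t} \<subseteq> {..<m}" by blast
  then have fin: "finite {n. (\<Sum>k<n. x k) \<le> t}" by (rule finite_subset) simp
  have ne: "0 \<in> {n. (\<Sum>k<n. x k) \<le> t}" using t by simp
  have "renewal_count x t \<in> {n. (\<Sum>k<n. x k) \<le> t}"
    unfolding renewal_count_def by (intro Max_in fin) (use ne in blast)
  then have "(\<Sum>k<n. x k) \<le> t" if "n \<le> renewal_count x t"
    using renewal_sum_mono[OF x that] by simp
  moreover have "n \<le> renewal_count x t" if "(\<Sum>k<n. x k) \<le> t"
    unfolding renewal_count_def using that by (intro Max_ge fin) simp
  ultimately show ?thesis by blast
qed

lemma renewal_count_eq_iff:
  assumes "renewal_sequence x" "t \<ge> 0"
  shows "renewal_count x t = n \<longleftrightarrow> (\<Sum>k<n. x k) \<le> t \<and> t < (\<Sum>k<Suc n. x k)"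
  using le_renewal_count_iff[OF assms, of n] le_renewal_count_iff[OF assms, of "Suc n"]
  by (auto simp: not_le[symmetric] not_less_eq_eq)

lemma renewal_count_mono:
  assumes "renewal_sequence x" "0 \<le> s" "s \<le> t"
  shows "renewal_count x s \<le> renewal_count x t"
  using le_renewal_count_iff[of x s "renewal_count x s"] le_renewal_count_iff[of x t "renewal_count x s"] assms by auto

text \<open>Local constancy makes sense for values of any type and survives an arbitrary function of
  two such paths, continuous or not. Class counts are functions of this kind.\<close>

definition step_path :: "(real \<Rightarrow> 'b) \<Rightarrow> bool" where
  "step_path f \<longleftrightarrow> (\<forall>t\<ge>0. \<forall>\<^sub>F s in at_right t. f s = f t) \<and> (\<forall>t>0. \<exists>c. \<forall>\<^sub>F s in at_left t. f s = c)"

lemma step_path_renewal_count: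
  assumes x: "renewal_sequence x"
  shows "step_path (renewal_count x)"
  unfolding step_path_def
proof (intro conjI allI impI)
  fix t :: real assume t: "t \<ge> 0"
  define n where "n = renewal_count x t"
  have n: "(\<Sum>k<n. x k) \<le> t" "t < (\<Sum>k<Suc n. x k)" using renewal_count_eq_iff[OF x t, of n] by (auto simp: n_def)
  show "\<forall>\<^sub>F s in at_right t. renewal_count x s = renewal_count x t"
  proof (rule eventually_at_rightI[OF _ n(2)])
    fix s assume s: "s \<in> {t<..<(\<Sum>k<Suc n. x k)}"
    then show "renewal_count x s = renewal_count x t"
      using renewal_count_eq_iff[OF x, of s n] n t by (auto simp: n_def)
  qed
next
  fix t :: real assume t: "t > 0"
  \<comment> \<open>The index of the first epoch at or after \<open>t\<close>; just before
    \<open>t\<close> the count is one less than \<open>m\<close>.\<close>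
  define m where "m = (LEAST m. t \<le> (\<Sum>k<m. x k))"
  have ex: "\<exists>m. t \<le> (\<Sum>k<m. x k)" using renewal_unbounded[OF x, of t] by (meson less_imp_le)
  have m: "t \<le> (\<Sum>k<m. x k)" unfolding m_def using ex by (rule LeastI_ex)
  have "m \<noteq> 0" using m t by (cases m) auto
  then obtain n where n: "m = Suc n" by (cases m) auto
  have lt: "(\<Sum>k<n. x k) < t" using not_less_Least[of n "\<lambda>m. t \<le> (\<Sum>k<m. x k)"] n by (auto simp: m_def)
  have nn: "0 \<le> (\<Sum>k<n. x k)" by (rule renewal_sum_nonneg[OF x])
  have "\<forall>\<^sub>F s in at_left t. renewal_count x s = n"
  proof (rule eventually_at_leftI[OF _ lt])
    fix s assume s: "s \<in> {(\<Sum>k<n. x k)<..<t}"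
    then show "renewal_count x s = n" using renewal_count_eq_iff[OF x, of s n] nn m n by auto
  qed
  then show "\<exists>c. \<forall>\<^sub>F s in at_left t. renewal_count x s = c" by blast
qed

lemma step_path_compose2:
  assumes "step_path f" "step_path g"
  shows "step_path (\<lambda>t. h (f t) (g t))"
  unfolding step_path_def
proof (intro conjI allI impI)
  fix t :: real
  show "\<forall>\<^sub>F s in at_right t. h (f s) (g s) = h (f t) (g t)" if "t \<ge> 0"
  proof -
    have "\<forall>\<^sub>F s in at_right t. f s = f t" "\<forall>\<^sub>F s in at_right t. g s = g t" using assms that by (auto simp: step_path_def)
    then show ?thesis by eventually_elim simp
  qed
  show "\<exists>c. \<forall>\<^sub>F s in at_left t. h (f s) (g s) = c" if "t > 0"
  proof -
    have "\<exists>a. \<forall>\<^sub>F s in at_left t. f s = a" "\<exists>b. \<forall>\<^sub>F s in at_left t. g s = b" using assms that by (auto simp: step_path_def)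
    then obtain a b where "\<forall>\<^sub>F s in at_left t. f s = a" "\<forall>\<^sub>F s in at_left t. g s = b" by blast
    then have "\<forall>\<^sub>F s in at_left t. h (f s) (g s) = h a b" by eventually_elim simp
    then show ?thesis by blast
  qed
qed

lemma cadlag_step_path: "step_path f \<Longrightarrow> cadlag f"
  unfolding cadlag_def step_path_def by (metis tendsto_eventually)

text \<open>Suppose the last event before \<open>t\<close> belongs to \<open>x\<close>. The time to
  go back to is the later of the preceding epoch of \<open>x\<close> and the last epoch of
  \<open>z\<close>. Positive interarrival times and distinct epochs ensure that only one event is
  lost on the way.\<close>

lemma renewal_unit_steps:
  assumes x: "renewal_sequence x" and z: "renewal_sequence z"
    and x_pos: "\<And>k. x k > 0" and z_pos: "\<And>k. z k > 0"
    and distinct: "\<And>a b. (\<Sum>k<Suc a. x k) \<noteq> (\<Sum>k<Suc b. z k)"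
    and t: "t \<ge> 0" and sum: "renewal_count x t + renewal_count z t = Suc k"
  shows "\<exists>s\<in>{0..t}. renewal_count x s + renewal_count z s = k"
proof -
  have main: "\<exists>s\<in>{0..t}. renewal_count x s + renewal_count z s = k"
    if x: "renewal_sequence x" and z: "renewal_sequence z" and x_pos: "\<And>k. x k > 0" and z_pos: "\<And>k. z k > 0"
      and sum: "renewal_count x t + renewal_count z t = Suc k"
      and a: "renewal_count x t = Suc a" and last: "(\<Sum>k<renewal_count z t. z k) < (\<Sum>k<Suc a. x k)"
    for x z a
  proof -
    define s where "s = max (\<Sum>k<a. x k) (\<Sum>k<renewal_count z t. z k)"
    have tx: "(\<Sum>k<Suc a. x k) \<le> t" using renewal_count_eq_iff[OF x t, of "Suc a"] a by simp
    have tz: "t < (\<Sum>k<Suc (renewal_count z t). z k)" using renewal_count_eq_iff[OF z t] by blast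
    have s0: "0 \<le> s" unfolding s_def using renewal_sum_nonneg[OF x] by (auto simp: le_max_iff_disj)
    have st: "s < (\<Sum>k<Suc a. x k)" using last x_pos[of a] by (auto simp: s_def)
    have "renewal_count x s = a" using renewal_count_eq_iff[OF x s0, of a] st by (auto simp: s_def)
    moreover have "renewal_count z s = renewal_count z t"
      using renewal_count_eq_iff[OF z s0, of "renewal_count z t"] st tx tz by (auto simp: s_def)
    ultimately show ?thesis using s0 st tx sum a by (intro bexI[of _ s]) auto
  qed
  have lx: "\<exists>a. renewal_count x t = Suc a" if "(\<Sum>k<renewal_count z t. z k) < (\<Sum>k<renewal_count x t. x k)"
  proof (cases "renewal_count x t")
    case 0
    have "0 \<le> (\<Sum>k<renewal_count z t. z k)" by (rule renewal_sum_nonneg[OF z])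
    then show ?thesis using that 0 by simp
  qed auto
  have lz: "\<exists>a. renewal_count z t = Suc a" if "(\<Sum>k<renewal_count x t. x k) < (\<Sum>k<renewal_count z t. z k)"
  proof (cases "renewal_count z t")
    case 0
    have "0 \<le> (\<Sum>k<renewal_count x t. x k)" by (rule renewal_sum_nonneg[OF x])
    then show ?thesis using that 0 by simp
  qed auto
  have pos: "(\<Sum>k<Suc a. y k) > 0" if "\<And>k. y k > 0" for y :: "nat \<Rightarrow> real" and a using that by (intro sum_pos) auto
  \<comment> \<open>\<open>distinct\<close> concerns epochs with positive index, hence the shift by
    1; if one count is 0, the other sum is positive.\<close>
  have "(\<Sum>k<renewal_count x t. x k) \<noteq> (\<Sum>k<renewal_count z t. z k)"
    using distinct[of "renewal_count x t - 1" "renewal_count z t - 1"] sum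
      pos[of x "renewal_count x t - 1"] pos[of z "renewal_count z t - 1"] x_pos z_pos
    by (cases "renewal_count x t"; cases "renewal_count z t") (auto simp del: sum.lessThan_Suc)
  then consider "(\<Sum>k<renewal_count z t. z k) < (\<Sum>k<renewal_count x t. x k)" |
    "(\<Sum>k<renewal_count x t. x k) < (\<Sum>k<renewal_count z t. z k)" by linarith
  then show ?thesis
  proof cases
    case 1
    then obtain a where "renewal_count x t = Suc a" using lx by blast
    with main[OF x z x_pos z_pos sum this] 1 show ?thesis by simp
  next
    case 2
    then obtain a where a: "renewal_count z t = Suc a" using lz by blast
    have "\<exists>s\<in>{0..t}. renewal_count z s + renewal_count x s = k"
      by (rule main[OF z x z_pos x_pos _ a]) (use sum 2 a in auto)
    then show ?thesis by (simp add: add.commute)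
  qed
qed

section \<open>Mittag-Leffler distributions\<close>

text \<open>Keep only the part \<open>t \<ge> R\<close> of the Gamma integral. As \<open>R\<close>
  is free, Gamma outgrows every exponential, which gives the Mittag-Leffler series an infinite
  radius of convergence.\<close>

lemma Gamma_lower_bound:
  fixes s R :: real
  assumes "s \<ge> 0" "R > 0"
  shows "R powr s * exp (- R) \<le> Gamma (1 + s)"
proof (rule has_integral_le)
  show "((\<lambda>t. if t \<in> {R..} then R powr s * exp (- 1 * t) else 0) has_integral R powr s * exp (- R)) {0..}"
    using has_integral_mult_right[OF has_integral_exp_minus_to_infinity[of 1 R], of "R powr s"] assms
    by (subst has_integral_restrict) auto
  show "((\<lambda>t. t powr (1 + s - 1) / exp t) has_integral Gamma (1 + s)) {0..}"
    using Gamma_integral_real[of "1 + s"] assms by simp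
  show "(if t \<in> {R..} then R powr s * exp (- 1 * t) else 0) \<le> t powr (1 + s - 1) / exp t" for t
    using assms by (auto simp: exp_minus divide_inverse intro!: mult_right_mono powr_mono2)
qed

lemma summable_mittag_leffler:
  fixes z :: real
  assumes "\<theta> > 0"
  shows "summable (\<lambda>l. 1 / Gamma (1 + \<theta> * real l) * z ^ l)"
proof -
  \<comment> \<open>\<open>R\<close> is chosen with \<open>R powr \<theta> = b\<close>, so that term
    \<open>l\<close> is bounded by \<open>exp R * (\<bar>z\<bar> / b) ^ l\<close> with a ratio of at
    most \<open>1 / 2\<close>.\<close>
  define b where "b = 2 * (\<bar>z\<bar> + 1)"
  define R where "R = b powr (1 / \<theta>)"
  have b: "b > 0" "R > 0" by (auto simp: b_def R_def)
  have Rl: "R powr (\<theta> * real l) = b ^ l" for l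
    using b assms by (simp add: R_def powr_powr powr_realpow)
  have "norm (1 / Gamma (1 + \<theta> * real l) * z ^ l) \<le> exp R * (1 / 2) ^ l" for l
  proof -
    have G: "b ^ l * exp (- R) \<le> Gamma (1 + \<theta> * real l)"
      using Gamma_lower_bound[of "\<theta> * real l" R] b assms by (simp add: Rl)
    have pos: "0 < b ^ l * exp (- R)" "0 < Gamma (1 + \<theta> * real l)" using b G by (simp, smt (verit) exp_gt_zero mult_pos_pos zero_less_power)
    have "norm (1 / Gamma (1 + \<theta> * real l) * z ^ l) = \<bar>z\<bar> ^ l / Gamma (1 + \<theta> * real l)"
      using G pos by (simp add: abs_mult power_abs)
    also have "\<dots> \<le> \<bar>z\<bar> ^ l / (b ^ l * exp (- R))"
      by (rule divide_left_mono[OF G]) (use pos in auto)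
    also have "\<dots> = exp R * (\<bar>z\<bar> / b) ^ l" by (simp add: exp_minus power_divide field_simps)
    also have "\<dots> \<le> exp R * (1 / 2) ^ l"
      by (intro mult_left_mono power_mono) (auto simp: b_def field_simps)
    finally show ?thesis .
  qed
  moreover have "summable (\<lambda>l. exp R * (1 / 2) ^ l :: real)" by (intro summable_mult summable_geometric) auto
  ultimately show ?thesis by (rule summable_comparison_test'[rotated])
qed

lemma mittag_leffler_powser: "mittag_leffler \<theta> z = (\<Sum>l. 1 / Gamma (1 + \<theta> * real l) * z ^ l)"
  by (simp add: mittag_leffler_def)

lemma mittag_leffler_0: "mittag_leffler \<theta> 0 = 1"
proof -
  have "mittag_leffler \<theta> 0 = (\<Sum>l. if l = 0 then 1 else 0 :: real)"
    unfolding mittag_leffler_powser by (intro suminf_cong) auto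
  then show ?thesis by (simp add: suminf_eq_zero_iff sums_unique[OF sums_single, symmetric])
qed

lemma isCont_mittag_leffler:
  assumes "\<theta> > 0"
  shows "isCont (mittag_leffler \<theta>) z"
  unfolding mittag_leffler_powser[abs_def]
  by (rule isCont_powser[OF summable_mittag_leffler[OF assms, of "\<bar>z\<bar> + 1"]]) auto

locale mittag_leffler_variable = prob_space M for M :: "'a measure" +
  fixes X :: "'a \<Rightarrow> real" and \<theta> c :: real
  assumes meas [measurable]: "X \<in> borel_measurable M"
    and nonneg: "AE \<omega> in M. 0 \<le> X \<omega>"
    and th: "\<theta> > 0" "\<theta> \<le> 1" and c: "c > 0"
    and cdf: "\<And>x. x \<ge> 0 \<Longrightarrow> prob {\<omega> \<in> space M. X \<omega> \<le> x} = 1 - mittag_leffler \<theta> (- (c * x powr \<theta>))"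
begin

text \<open>Continuity of the Mittag-Leffler function excludes atoms. Positive interarrival times
  and the absence of simultaneous jumps both rest on this.\<close>

lemma atomless: "prob {\<omega> \<in> space M. X \<omega> = a} = 0"
proof -
  consider "a < 0" | "a = 0" | "a > 0" by linarith
  then show ?thesis
  proof cases
    case 1
    have "AE \<omega> in M. X \<omega> \<noteq> a" by (rule AE_mp[OF nonneg]) (use 1 in auto)
    then show ?thesis by (subst prob_eq_0) auto
  next
    case 2
    have "prob {\<omega> \<in> space M. X \<omega> = a} \<le> prob {\<omega> \<in> space M. X \<omega> \<le> 0}"
      using 2 by (intro finite_measure_mono) auto
    then show ?thesis using cdf[of 0] by (simp add: mittag_leffler_0 measure_le_0_iff)
  next
    case 3
    define G where "G x = mittag_leffler \<theta> (- (c * x powr \<theta>))" for x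
    have "prob {\<omega> \<in> space M. X \<omega> = a} \<le> G b - G a" if b: "0 \<le> b" "b < a" for b
    proof -
      have "prob {\<omega> \<in> space M. X \<omega> = a} \<le> prob ({\<omega> \<in> space M. X \<omega> \<le> a} - {\<omega> \<in> space M. X \<omega> \<le> b})"
        using b by (intro finite_measure_mono) auto
      also have "\<dots> = prob {\<omega> \<in> space M. X \<omega> \<le> a} - prob {\<omega> \<in> space M. X \<omega> \<le> b}"
        using b by (intro finite_measure_Diff) auto
      finally show ?thesis using cdf[of a] cdf[of b] b by (simp add: G_def)
    qed
    then have ev: "\<forall>\<^sub>F b in at_left a. prob {\<omega> \<in> space M. X \<omega> = a} \<le> G b - G a"
      using 3 by (intro eventually_at_leftI[of 0 a]) auto
    have "isCont G a"
      unfolding G_def using 3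
      by (intro continuous_within_compose3[OF isCont_mittag_leffler[OF th(1)]] continuous_intros) auto
    then have "(G \<longlongrightarrow> G a) (at_left a)" by (auto simp: isCont_def intro: filterlim_mono at_le)
    then have "((\<lambda>b. G b - G a) \<longlongrightarrow> G a - G a) (at_left a)" by (intro tendsto_intros)
    then have "prob {\<omega> \<in> space M. X \<omega> = a} \<le> G a - G a"
      by (rule tendsto_lowerbound) (use ev in auto)
    then show ?thesis by (simp add: measure_le_0_iff)
  qed
qed

text \<open>Write \<open>1 - exp (- (t * X))\<close> as the integral of
  \<open>t * exp (- (t * x))\<close> over \<open>0 < x < X\<close>, exchange the integrals and
  expand the tail probability. Each term is a Gamma integral that cancels its coefficient and leaves
  \<open>(- (c / t powr \<theta>)) ^ l\<close>; the geometric series converges absolutely because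
  \<open>c < t powr \<theta>\<close>.\<close>

lemma Laplace_large:
  assumes t: "t > 0" "c < t powr \<theta>"
  shows "expectation (\<lambda>\<omega>. exp (- (t * X \<omega>))) = c / (c + t powr \<theta>)"
proof -
  define f where "f l x = indicator {0<..} x * (t * exp (- (t * x)) * (1 / Gamma (1 + \<theta> * real l) * (- (c * x powr \<theta>)) ^ l))" for l :: nat and x :: real
  define a where "a x = indicator {0<..} x * (t * exp (- (t * x)) * mittag_leffler \<theta> (- (c * x powr \<theta>)))" for x :: real
  have tth: "t powr \<theta> > 0" using t by simp
  have pw: "(x powr \<theta>) ^ l = x powr (\<theta> * real l)" if "x > 0" for x and l :: nat
    using that by (simp add: powr_realpow[symmetric] powr_powr)
  have f_meas [measurable]: "f l \<in> borel_measurable lborel" for l unfolding f_def by measurable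
  have nn: "(\<integral>\<^sup>+x. ennreal (norm (f l x)) \<partial>lborel) = ennreal ((c / t powr \<theta>) ^ l)" for l
  proof -
    define s where "s = 1 + \<theta> * real l"
    have s: "s > 0" "Gamma s > 0" using th by (auto simp: s_def intro!: add_pos_nonneg Gamma_real_pos)
    \<comment> \<open>The integrand of \<open>Gamma s\<close>. Up to sign, \<open>f l x\<close> is a
      multiple of \<open>h (t * x)\<close>.\<close>
    define h where "h y = indicator {0..} y * (y powr (s - 1) / exp y)" for y :: real
    have [measurable]: "h \<in> borel_measurable borel" unfolding h_def by measurable
    have h_nonneg: "0 \<le> h y" for y by (simp add: h_def)
    have "(\<integral>\<^sup>+x. ennreal (h x) \<partial>lborel) = ennreal (Gamma s)"
    proof (rule nn_integral_has_integral_lborel)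
      have "h = (\<lambda>x. if x \<in> {0..} then x powr (s - 1) / exp x else 0)" by (auto simp: h_def)
      then show "(h has_integral Gamma s) UNIV" using Gamma_integral_real[OF s(1)] by (simp add: has_integral_restrict_UNIV del: atLeast_iff)
    qed (use h_nonneg in auto)
    then have 1: "ennreal t * (\<integral>\<^sup>+x. ennreal (h (t * x)) \<partial>lborel) = ennreal (Gamma s)"
      using nn_integral_real_affine[of "\<lambda>x. ennreal (h x)" t 0] t by simp
    have norm_f: "norm (f l x) = t * (c ^ l / (Gamma s * t powr (s - 1)) * h (t * x))" for x
    proof (cases "x > 0")
      case True
      then have "norm (f l x) = t * exp (- (t * x)) * (1 / Gamma s * (c * x powr \<theta>) ^ l)"
        using t s c by (simp add: f_def s_def abs_mult power_abs)
      moreover have "(t * x) powr (s - 1) = t powr (s - 1) * x powr (s - 1)" using t True by (simp add: powr_mult)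
      moreover have "(c * x powr \<theta>) ^ l = c ^ l * x powr (s - 1)" using pw[OF True] by (simp add: power_mult_distrib s_def)
      ultimately show ?thesis using t True by (simp add: h_def exp_minus field_simps)
    next
      case False
      then have "h (t * x) = 0" using t by (auto simp: h_def indicator_def zero_le_mult_iff)
      then show ?thesis using False by (simp add: f_def)
    qed
    define k where "k = c ^ l / (Gamma s * t powr (s - 1))"
    have k: "k \<ge> 0" using c s by (simp add: k_def)
    have "(\<integral>\<^sup>+x. ennreal (norm (f l x)) \<partial>lborel) = (\<integral>\<^sup>+x. ennreal k * (ennreal t * ennreal (h (t * x))) \<partial>lborel)"
      unfolding norm_f k_def[symmetric] using t k h_nonneg
      by (intro nn_integral_cong) (simp add: ennreal_mult[symmetric] mult_ac)
    also have "\<dots> = ennreal k * (ennreal t * (\<integral>\<^sup>+x. ennreal (h (t * x)) \<partial>lborel))"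
      by (simp add: nn_integral_cmult)
    also have "\<dots> = ennreal (k * Gamma s)" unfolding 1 using k s by (simp add: ennreal_mult)
    also have "k * Gamma s = (c / t powr \<theta>) ^ l"
      using s(2) pw[OF t(1), of l] by (simp add: k_def s_def power_divide)
    finally show ?thesis .
  qed
  have f_int: "integrable lborel (f l)" for l
    by (rule integrableI_bounded) (simp_all add: nn[unfolded real_norm_def])
  have q: "0 \<le> c / t powr \<theta>" "c / t powr \<theta> < 1" using t c tth by auto
  have norm_f: "(\<integral>x. norm (f l x) \<partial>lborel) = (c / t powr \<theta>) ^ l" for l
    by (rule integral_eq_nn_integral[THEN trans]) (use q in \<open>auto simp: nn[unfolded real_norm_def]\<close>)
  have f_eq: "(\<integral>x. f l x \<partial>lborel) = (- (c / t powr \<theta>)) ^ l" for l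
  proof -
    have "f l x = (- 1) ^ l * norm (f l x)" for x
    proof -
      have "Gamma (1 + \<theta> * real l) > 0" using th by (intro Gamma_real_pos add_pos_nonneg) auto
      then show ?thesis using t c by (auto simp: f_def abs_mult power_abs indicator_def power_minus[of "c * x powr \<theta>"])
    qed
    then have "(\<integral>x. f l x \<partial>lborel) = (\<integral>x. (- 1) ^ l * norm (f l x) \<partial>lborel)" by (intro Bochner_Integration.integral_cong) auto
    also have "\<dots> = (- 1) ^ l * (c / t powr \<theta>) ^ l" by (simp add: norm_f[unfolded real_norm_def])
    also have "\<dots> = (- (c / t powr \<theta>)) ^ l" by (subst power_minus) simp
    finally show ?thesis .
  qed
  have sumf: "(\<Sum>l. f l x) = a x" and sumn: "summable (\<lambda>l. norm (f l x))" for x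
  proof -
    have s: "summable (\<lambda>l. 1 / Gamma (1 + \<theta> * real l) * z ^ l)" for z by (rule summable_mittag_leffler[OF th(1)])
    show "(\<Sum>l. f l x) = a x"
      unfolding f_def a_def mittag_leffler_powser by (subst suminf_mult | intro summable_mult s)+ simp
    have G: "Gamma (1 + \<theta> * real l) > 0" for l :: nat using th by (intro Gamma_real_pos add_pos_nonneg) auto
    have "norm (f l x) = indicator {0<..} x * (t * exp (- (t * x))) * (1 / Gamma (1 + \<theta> * real l) * (c * x powr \<theta>) ^ l)" for l
      using G[of l] t c by (auto simp: f_def abs_mult power_abs indicator_def)
    then show "summable (\<lambda>l. norm (f l x))" using summable_mult[OF s] by simp
  qed
  have geo: "summable (\<lambda>l. (c / t powr \<theta>) ^ l)" using q by (intro summable_geometric) auto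
  have a_int: "integrable lborel a"
    using integrable_suminf[of lborel f, OF f_int] sumn geo by (simp add: norm_f[unfolded real_norm_def] sumf)
  have "(\<lambda>l. \<integral>x. f l x \<partial>lborel) sums (\<integral>x. (\<Sum>l. f l x) \<partial>lborel)"
    by (rule sums_integral) (use f_int sumn geo in \<open>simp_all add: norm_f[unfolded real_norm_def]\<close>)
  then have "(\<lambda>l. (- (c / t powr \<theta>)) ^ l) sums (\<integral>x. a x \<partial>lborel)" by (simp add: f_eq sumf)
  moreover have "(\<lambda>l. (- (c / t powr \<theta>)) ^ l) sums (1 / (1 - (- (c / t powr \<theta>))))"
    using q by (intro geometric_sums) auto
  ultimately have int_a: "(\<integral>x. a x \<partial>lborel) = 1 / (1 + c / t powr \<theta>)" using sums_unique2 by fastforce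
  have tail: "prob {\<omega> \<in> space M. x < X \<omega>} = mittag_leffler \<theta> (- (c * x powr \<theta>))" if "x \<ge> 0" for x
  proof -
    have "{\<omega> \<in> space M. x < X \<omega>} = space M - {\<omega> \<in> space M. X \<omega> \<le> x}" by auto
    then show ?thesis using cdf[OF that] by (simp add: prob_compl)
  qed
  have a_nonneg: "0 \<le> a x" for x
    unfolding a_def using tail[of x] t by (cases "x > 0") (auto simp: tail[symmetric])
  interpret P: pair_sigma_finite lborel M ..
  have "(\<integral>\<^sup>+\<omega>. ennreal (1 - exp (- (t * X \<omega>))) \<partial>M) = (\<integral>\<^sup>+\<omega>. (\<integral>\<^sup>+x. ennreal (indicator {0<..} x * (t * exp (- (t * x)))) * indicator {x. x < X \<omega>} x \<partial>lborel) \<partial>M)"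
  proof (rule nn_integral_cong_AE)
    show "AE \<omega> in M. ennreal (1 - exp (- (t * X \<omega>))) =
      (\<integral>\<^sup>+x. ennreal (indicator {0<..} x * (t * exp (- (t * x)))) * indicator {x. x < X \<omega>} x \<partial>lborel)"
      using nonneg
    proof eventually_elim
      case (elim \<omega>)
      have "(\<integral>\<^sup>+x. ennreal (indicator {0<..} x * (t * exp (- (t * x)))) * indicator {x. x < X \<omega>} x \<partial>lborel)
        = (\<integral>\<^sup>+x. ennreal (t * exp (- (t * x))) * indicator {0..X \<omega>} x \<partial>lborel)"
        by (rule nn_integral_cong_AE, rule AE_mp[OF AE_lborel_singleton[of "X \<omega>"]], rule AE_mp[OF AE_lborel_singleton[of 0]])
             (auto simp: indicator_def)
      also have "\<dots> = ennreal (- exp (- (t * X \<omega>)) - (- exp (- (t * 0))))"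
        by (rule nn_integral_FTC_Icc) (use t elim in \<open>auto intro!: derivative_eq_intros\<close>)
      finally show ?case by simp
    qed
  qed
  also have "\<dots> = (\<integral>\<^sup>+x. (\<integral>\<^sup>+\<omega>. ennreal (indicator {0<..} x * (t * exp (- (t * x)))) * indicator {x. x < X \<omega>} x \<partial>M) \<partial>lborel)"
    by (rule P.Fubini') measurable
  also have "\<dots> = (\<integral>\<^sup>+x. ennreal (a x) \<partial>lborel)"
  proof (rule nn_integral_cong)
    fix x :: real
    have "(\<integral>\<^sup>+\<omega>. ennreal (indicator {0<..} x * (t * exp (- (t * x)))) * indicator {x. x < X \<omega>} x \<partial>M)
      = (\<integral>\<^sup>+\<omega>. ennreal (indicator {0<..} x * (t * exp (- (t * x)))) * indicator {\<omega> \<in> space M. x < X \<omega>} \<omega> \<partial>M)"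
      by (rule nn_integral_cong) (auto simp: indicator_def)
    also have "\<dots> = ennreal (indicator {0<..} x * (t * exp (- (t * x)))) * ennreal (prob {\<omega> \<in> space M. x < X \<omega>})"
      by (subst nn_integral_cmult_indicator) (auto simp: emeasure_eq_measure)
    also have "\<dots> = ennreal (a x)"
      using tail[of x] t by (cases "x > 0") (auto simp: a_def ennreal_mult'[symmetric])
    finally show "(\<integral>\<^sup>+\<omega>. ennreal (indicator {0<..} x * (t * exp (- (t * x)))) * indicator {x. x < X \<omega>} x \<partial>M) = ennreal (a x)" .
  qed
  also have "\<dots> = ennreal (\<integral>x. a x \<partial>lborel)" by (rule nn_integral_eq_integral[OF a_int]) (use a_nonneg in auto)
  finally have E: "(\<integral>\<^sup>+\<omega>. ennreal (1 - exp (- (t * X \<omega>))) \<partial>M) = ennreal (1 / (1 + c / t powr \<theta>))" by (simp add: int_a)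
  have "expectation (\<lambda>\<omega>. 1 - exp (- (t * X \<omega>))) = 1 / (1 + c / t powr \<theta>)"
    by (rule integral_eq_nn_integral[THEN trans]) (use E nonneg t q in \<open>auto elim!: eventually_mono\<close>)
  moreover have "integrable M (\<lambda>\<omega>. exp (- (t * X \<omega>)))"
    by (rule integrable_const_bound[where B = 1]) (use nonneg t in \<open>auto elim!: eventually_mono\<close>)
  ultimately have "1 - expectation (\<lambda>\<omega>. exp (- (t * X \<omega>))) = 1 / (1 + c / t powr \<theta>)" by (simp add: prob_space)
  moreover have "1 - 1 / (1 + c / t powr \<theta>) = c / (c + t powr \<theta>)"
  proof -
    define T where "T = t powr \<theta>"
    have "T > 0" using tth by (simp add: T_def)
    then show ?thesis using c unfolding T_def[symmetric] by (simp add: field_simps)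
  qed
  ultimately show ?thesis by linarith
qed

text \<open>Expand \<open>exp (- (w * X))\<close> about \<open>r\<close>. The absolute values of the
  terms add up to \<open>exp ((\<rho> - r) * X)\<close>, which is at most 1 since
  \<open>\<rho> < r\<close>; this bound justifies exchanging sum and expectation on the whole
  disc.\<close>

lemma Laplace_power_series:
  assumes r: "r > 0" and w: "w \<in> ball (complex_of_real r) r"
  shows "(\<lambda>k. complex_of_real (expectation (\<lambda>\<omega>. (- X \<omega>) ^ k / fact k * exp (- (r * X \<omega>)))) * (w - complex_of_real r) ^ k) sums
    (CLINT \<omega>|M. exp (- (w * complex_of_real (X \<omega>))))"
proof -
  define \<rho> where "\<rho> = cmod (w - complex_of_real r)"
  have rho: "0 \<le> \<rho>" "\<rho> < r" using w by (auto simp: \<rho>_def dist_norm norm_minus_commute)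
  define g where "g k \<omega> = (- X \<omega>) ^ k / fact k * exp (- (r * X \<omega>))" for k \<omega>
  define f where "f k \<omega> = complex_of_real (g k \<omega>) * (w - complex_of_real r) ^ k" for k \<omega>
  have [measurable]: "g k \<in> borel_measurable M" for k unfolding g_def by measurable
  have [measurable]: "f k \<in> borel_measurable M" for k unfolding f_def by measurable
  have norm_f: "norm (f k \<omega>) = (\<rho> * X \<omega>) ^ k / fact k * exp (- (r * X \<omega>))" if "0 \<le> X \<omega>" for k \<omega>
    using that by (simp add: f_def g_def norm_mult norm_power \<rho>_def power_mult_distrib abs_mult power_abs norm_divide)
  have partial: "(\<Sum>k<n. norm (f k \<omega>)) \<le> 1" if X: "0 \<le> X \<omega>" for n \<omega>
  proof -
    have "(\<Sum>k<n. (\<rho> * X \<omega>) ^ k / fact k) \<le> exp (\<rho> * X \<omega>)"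
      using sum_le_suminf[OF summable_exp_generic[of "\<rho> * X \<omega>"], of "{..<n}"] X rho
      by (simp add: exp_def divide_inverse mult.commute)
    then have "(\<Sum>k<n. (\<rho> * X \<omega>) ^ k / fact k) * exp (- (r * X \<omega>)) \<le> exp (\<rho> * X \<omega>) * exp (- (r * X \<omega>))"
      by (rule mult_right_mono) simp
    then have "(\<Sum>k<n. norm (f k \<omega>)) \<le> exp (\<rho> * X \<omega>) * exp (- (r * X \<omega>))"
      by (simp only: norm_f[OF X] sum_distrib_right)
    also have "\<dots> \<le> 1" using rho X by (simp add: exp_add[symmetric] mult_right_mono)
    finally show ?thesis .
  qed
  have term_le: "norm (f k \<omega>) \<le> 1" if "0 \<le> X \<omega>" for k \<omega>
    using partial[OF that, of "Suc k"] sum_nonneg[of "{..<k}" "\<lambda>k. norm (f k \<omega>)"] by simp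
  have f_int: "integrable M (f k)" for k
    by (rule integrable_const_bound[of _ 1]) (use nonneg term_le in \<open>auto elim!: eventually_mono\<close>)
  have summ: "summable (\<lambda>k. norm (f k \<omega>))" if "0 \<le> X \<omega>" for \<omega>
    by (rule summableI_nonneg_bounded[of _ 1]) (use partial[OF that] in auto)
  have "summable (\<lambda>k. expectation (\<lambda>\<omega>. norm (f k \<omega>)))"
  proof (rule summableI_nonneg_bounded[of _ 1])
    fix n
    have "(\<Sum>k<n. expectation (\<lambda>\<omega>. norm (f k \<omega>))) = expectation (\<lambda>\<omega>. \<Sum>k<n. norm (f k \<omega>))"
      using f_int by (intro Bochner_Integration.integral_sum[symmetric] integrable_norm)
    also have "\<dots> \<le> expectation (\<lambda>\<omega>. 1)"
      by (rule integral_mono_AE) (use nonneg partial f_int in \<open>auto elim!: eventually_mono\<close>)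
    finally show "(\<Sum>k<n. expectation (\<lambda>\<omega>. norm (f k \<omega>))) \<le> 1" by (simp add: prob_space)
  qed simp
  then have "(\<lambda>k. integral\<^sup>L M (f k)) sums (CLINT \<omega>|M. (\<Sum>k. f k \<omega>))"
    using f_int nonneg summ by (intro sums_integral) (auto elim!: eventually_mono)
  also have "(CLINT \<omega>|M. (\<Sum>k. f k \<omega>)) = (CLINT \<omega>|M. exp (- (w * complex_of_real (X \<omega>))))"
  proof (rule integral_cong_AE)
    show "AE \<omega> in M. (\<Sum>k. f k \<omega>) = exp (- (w * complex_of_real (X \<omega>)))"
      using nonneg
    proof eventually_elim
      case (elim \<omega>)
      define v where "v = - (w - complex_of_real r) * complex_of_real (X \<omega>)"
      have pm: "(complex_of_real r - w) ^ k = (- 1) ^ k * (w - complex_of_real r) ^ k" for k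
        using power_minus[of "w - complex_of_real r" k] by simp
      have "f k \<omega> = exp (- (r * X \<omega>)) * (v ^ k /\<^sub>R fact k)" for k
        by (simp add: f_def g_def v_def scaleR_conv_of_real divide_inverse power_mult_distrib power_minus[of "complex_of_real (X \<omega>)"]
            power_minus[of "w - complex_of_real r"] power_minus[of "(w - complex_of_real r) * complex_of_real (X \<omega>)"] of_real_exp pm)
      moreover have "(\<lambda>k. complex_of_real (exp (- (r * X \<omega>))) * (v ^ k /\<^sub>R fact k)) sums (complex_of_real (exp (- (r * X \<omega>))) * exp v)"
        by (intro sums_mult exp_converges)
      ultimately have "(\<lambda>k. f k \<omega>) sums (complex_of_real (exp (- (r * X \<omega>))) * exp v)" by simp
      moreover have "complex_of_real (exp (- (r * X \<omega>))) * exp v = exp (- (w * complex_of_real (X \<omega>)))"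
        unfolding v_def exp_of_real[symmetric] exp_add[symmetric] by (simp add: algebra_simps)
      ultimately show ?case by (simp add: sums_iff)
    qed
  qed measurable
  finally have *: "(\<lambda>k. integral\<^sup>L M (f k)) sums (CLINT \<omega>|M. exp (- (w * complex_of_real (X \<omega>))))" .
  have "integral\<^sup>L M (f k) = complex_of_real (expectation (g k)) * (w - complex_of_real r) ^ k" for k
    unfolding f_def by (simp only: integral_mult_left_zero integral_complex_of_real)
  then show ?thesis using * by (simp only: g_def[abs_def])
qed

text \<open>Both sides extend holomorphically to a disc in the right half plane, and they agree on a
  real segment through its centre by \<open>Laplace_large\<close>.\<close>

lemma Laplace:
  assumes t: "t > 0"
  shows "expectation (\<lambda>\<omega>. exp (- (t * X \<omega>))) = c / (c + t powr \<theta>)"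
proof -
  \<comment> \<open>\<open>t0 powr \<theta>\<close> is \<open>2 * c\<close>, so beyond
    \<open>t0\<close> the series argument applies. The disc with centre and radius
    \<open>t + t0\<close> contains \<open>t\<close>, and its centre lies beyond
    \<open>t0\<close>.\<close>
  define t0 where "t0 = (2 * c) powr (1 / \<theta>)"
  define r where "r = t + t0"
  have t0: "t0 > 0" "c < s powr \<theta>" if "s \<ge> t0" for s
  proof -
    show "t0 > 0" using c by (simp add: t0_def)
    have "c < 2 * c" using c by simp
    also have "\<dots> = t0 powr \<theta>" using c th by (simp add: t0_def powr_powr)
    also have "\<dots> \<le> s powr \<theta>" using that \<open>t0 > 0\<close> th by (intro powr_mono2) auto
    finally show "c < s powr \<theta>" .
  qed
  have t0_pos: "t0 > 0" by (rule t0(1)[OF order_refl])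
  have r: "r > 0" using t t0_pos by (simp add: r_def)
  define S where "S = ball (complex_of_real r) r"
  define F where "F z = (CLINT \<omega>|M. exp (- (z * complex_of_real (X \<omega>))))" for z
  define G where "G z = of_real c / (of_real c + z powr of_real \<theta>)" for z :: complex
  have Re_pos: "Re z > 0" if "z \<in> S" for z
  proof -
    have "\<bar>Re (complex_of_real r - z)\<bar> \<le> cmod (complex_of_real r - z)" by (rule abs_Re_le_cmod)
    then show ?thesis using that by (auto simp: S_def dist_norm)
  qed
  have F_hol: "F holomorphic_on S"
    unfolding S_def F_def by (rule power_series_holomorphic, rule Laplace_power_series[OF r])
  \<comment> \<open>Because \<open>\<theta> \<le> 1\<close>, the power keeps the argument below
    \<open>pi / 2\<close> in absolute value, so the denominator has positive real part.\<close>
  have den: "of_real c + z powr of_real \<theta> \<noteq> 0" if "z \<in> S" for z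
  proof -
    have z: "z \<noteq> 0" "Re z > 0" using Re_pos[OF that] by auto
    have "\<bar>Im (Ln z)\<bar> < pi / 2" using z Re_Ln_pos_lt[OF z(1)] by simp
    then have "\<bar>\<theta> * Im (Ln z)\<bar> < pi / 2"
      using th by (simp add: abs_mult) (smt (verit) abs_ge_zero mult_left_le_one_le)
    then have "cos (\<theta> * Im (Ln z)) > 0" by (intro cos_gt_zero_pi) auto
    then have "Re (z powr of_real \<theta>) > 0" using z by (simp add: powr_def Re_exp)
    then have "Re (of_real c + z powr of_real \<theta>) > 0" using c by simp
    then show ?thesis by (metis less_irrefl zero_complex.simps(1))
  qed
  have G_hol: "G holomorphic_on S"
    unfolding G_def
  proof (intro holomorphic_intros)
    show "z \<notin> \<real>\<^sub>\<le>\<^sub>0" if "z \<in> S" for z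
      using Re_pos[OF that] by (auto simp: complex_nonpos_Reals_iff)
  qed (use den in auto)
  have Freal: "F (complex_of_real s) = complex_of_real (expectation (\<lambda>\<omega>. exp (- (s * X \<omega>))))" for s
    unfolding F_def by (subst integral_complex_of_real[symmetric]) (simp add: exp_of_real[symmetric])
  have Greal: "G (complex_of_real s) = complex_of_real (c / (c + s powr \<theta>))" if "s > 0" for s
    using that by (simp add: G_def powr_of_real)
  have "F (complex_of_real t) - G (complex_of_real t) = 0"
  proof (rule analytic_continuation[of "\<lambda>z. F z - G z" S "complex_of_real ` {t0<..<2 * r}" "complex_of_real r"])
    show "(\<lambda>z. F z - G z) holomorphic_on S" by (intro holomorphic_intros F_hol G_hol)
    show "open S" "connected S" by (auto simp: S_def)
    show "complex_of_real ` {t0<..<2 * r} \<subseteq> S"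
      using t0_pos r by (auto simp: S_def dist_norm of_real_diff[symmetric] simp del: of_real_diff)
    show "complex_of_real r \<in> S" using r by (simp add: S_def)
    have "r islimpt {t0<..<2 * r}" using t t0_pos by (intro interior_limit_point) (auto simp: r_def)
    then have "\<exists>f. (\<forall>n. f n \<in> {t0<..<2 * r} - {r}) \<and> f \<longlonglongrightarrow> r" unfolding islimpt_sequential .
    then obtain f where "\<And>n. f n \<in> {t0<..<2 * r} - {r}" "f \<longlonglongrightarrow> r" by blast
    then show "complex_of_real r islimpt complex_of_real ` {t0<..<2 * r}"
      unfolding islimpt_sequential by (intro exI[of _ "\<lambda>n. complex_of_real (f n)"]) (auto intro: tendsto_of_real)
    show "F z - G z = 0" if "z \<in> complex_of_real ` {t0<..<2 * r}" for z
      using that t0_pos t0(2) Laplace_large by (auto simp: Freal Greal)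
    show "complex_of_real t \<in> S" using t t0_pos by (simp add: S_def r_def dist_norm)
  qed
  then show ?thesis using Greal[OF t] Freal[of t] by (simp add: of_real_eq_iff del: of_real_divide of_real_add)
qed

end

section \<open>Uniqueness of Laplace transforms\<close>

text \<open>In the variable \<open>y = exp (- x)\<close> the hypothesis compares moments on
  \<open>[0, 1]\<close>. Bernstein polynomials pass to continuous functions, and these decrease to
  indicators of half lines. The measures are merely finite because
  \<open>Laplace_sequence_unique\<close> applies the result to measures with densities.\<close>

lemma Laplace_finite_measure_unique:
  fixes \<mu> \<nu> :: "real measure"
  assumes "finite_measure \<mu>" "finite_measure \<nu>"
    and sets_mu [simp]: "sets \<mu> = sets borel" and sets_nu [simp]: "sets \<nu> = sets borel"
    and nonneg: "AE x in \<mu>. 0 \<le> x" "AE x in \<nu>. 0 \<le> x"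
    and eq: "\<And>j :: nat. (\<integral>x. exp (- (real j * x)) \<partial>\<mu>) = (\<integral>x. exp (- (real j * x)) \<partial>\<nu>)"
  shows "\<mu> = \<nu>"
proof -
  interpret m: finite_measure \<mu> by fact
  interpret n: finite_measure \<nu> by fact
  have int_m: "integrable \<mu> f" if "f \<in> borel_measurable borel" "\<And>x. 0 \<le> x \<Longrightarrow> \<bar>f x\<bar> \<le> B" for f :: "real \<Rightarrow> real" and B
    by (rule m.integrable_const_bound[of _ B])
       (use that nonneg(1) measurable_cong_sets[OF sets_mu refl] in \<open>auto elim!: eventually_mono\<close>)
  have int_n: "integrable \<nu> f" if "f \<in> borel_measurable borel" "\<And>x. 0 \<le> x \<Longrightarrow> \<bar>f x\<bar> \<le> B" for f :: "real \<Rightarrow> real" and B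
    by (rule n.integrable_const_bound[of _ B])
       (use that nonneg(2) measurable_cong_sets[OF sets_nu refl] in \<open>auto elim!: eventually_mono\<close>)
  \<comment> \<open>The Bernstein monomials \<open>y ^ k * (1 - y) ^ l\<close>; their integrals
    follow from the moments by induction on \<open>l\<close>.\<close>
  define b where "b k l x = exp (- x) ^ k * (1 - exp (- x)) ^ l" for k l :: nat and x :: real
  have b_meas: "b k l \<in> borel_measurable borel" for k l unfolding b_def by measurable
  have b_bound: "\<bar>b k l x\<bar> \<le> 1" if "0 \<le> x" for k l x
    using that unfolding b_def abs_mult power_abs by (intro mult_le_one power_le_one) auto
  have b_eq: "(\<integral>x. b k l x \<partial>\<mu>) = (\<integral>x. b k l x \<partial>\<nu>)" for k l
  proof (induction l arbitrary: k)
    case 0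
    have "b k 0 x = exp (- (real k * x))" for x by (simp add: b_def exp_of_nat_mult[symmetric])
    then show ?case using eq[of k] by simp
  next
    case (Suc l)
    have "b k (Suc l) x = b k l x - b (Suc k) l x" for x by (simp add: b_def algebra_simps)
    then show ?case
      using Suc int_m[OF b_meas b_bound] int_n[OF b_meas b_bound] by simp
  qed
  have total: "measure \<mu> (space \<mu>) = measure \<nu> (space \<nu>)" using eq[of 0] by simp
  have cont: "(\<integral>x. f (exp (- x)) \<partial>\<mu>) = (\<integral>x. f (exp (- x)) \<partial>\<nu>)"
    if f: "continuous_on {0..1} f" and f_meas [measurable]: "f \<in> borel_measurable borel" for f :: "real \<Rightarrow> real"
  proof -
    have "bounded (f ` {0..1})" by (intro compact_imp_bounded compact_continuous_image f) auto
    then obtain B where "\<forall>z\<in>f ` {0..1}. norm z \<le> B" unfolding bounded_iff by blast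
    then have B: "\<And>y. y \<in> {0..1} \<Longrightarrow> \<bar>f y\<bar> \<le> B" by auto
    have f_m: "integrable \<mu> (\<lambda>x. f (exp (- x)))" by (rule int_m[of _ B]) (use B in auto)
    have f_n: "integrable \<nu> (\<lambda>x. f (exp (- x)))" by (rule int_n[of _ B]) (use B in auto)
    define C where "C = measure \<mu> (space \<mu>)"
    have "\<bar>(\<integral>x. f (exp (- x)) \<partial>\<mu>) - (\<integral>x. f (exp (- x)) \<partial>\<nu>)\<bar> \<le> 0"
    proof (rule field_le_epsilon)
      fix e' :: real assume "e' > 0"
      \<comment> \<open>Each of the two approximations costs \<open>e * C\<close>; the added 1 keeps
        the quotient meaningful when the total mass is 0.\<close>
      define e where "e = e' / (2 * C + 1)"
      have C: "C \<ge> 0" by (simp add: C_def)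
      then have e: "e > 0" using \<open>e' > 0\<close> by (simp add: e_def)
      obtain N where N: "\<And>n x. N \<le> n \<Longrightarrow> x \<in> {0..1} \<Longrightarrow> \<bar>f x - (\<Sum>k\<le>n. f (real k / real n) * Bernstein n k x)\<bar> < e"
        using Bernstein_Weierstrass[OF f e] by blast
      define p where "p y = (\<Sum>k\<le>N. f (real k / real N) * Bernstein N k y)" for y
      have pb: "p (exp (- x)) = (\<Sum>k\<le>N. f (real k / real N) * real (N choose k) * b k (N - k) x)" for x
        by (simp add: p_def Bernstein_def b_def mult_ac)
      have close: "\<bar>f (exp (- x)) - p (exp (- x))\<bar> \<le> e" if "0 \<le> x" for x
        using N[of N "exp (- x)"] that by (simp add: p_def less_imp_le)
      have p_m: "integrable \<mu> (\<lambda>x. p (exp (- x)))" and p_n: "integrable \<nu> (\<lambda>x. p (exp (- x)))"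
        unfolding pb using int_m[OF b_meas b_bound] int_n[OF b_meas b_bound] by auto
      have p_eq: "(\<integral>x. p (exp (- x)) \<partial>\<mu>) = (\<integral>x. p (exp (- x)) \<partial>\<nu>)"
        unfolding pb using int_m[OF b_meas b_bound] int_n[OF b_meas b_bound] b_eq by simp
      have 1: "\<bar>(\<integral>x. f (exp (- x)) \<partial>\<mu>) - (\<integral>x. p (exp (- x)) \<partial>\<mu>)\<bar> \<le> e * C"
      proof -
        have "\<bar>(\<integral>x. f (exp (- x)) - p (exp (- x)) \<partial>\<mu>)\<bar> \<le> (\<integral>x. \<bar>f (exp (- x)) - p (exp (- x))\<bar> \<partial>\<mu>)"
          by (rule integral_abs_bound)
        also have "\<dots> \<le> (\<integral>x. e \<partial>\<mu>)"
          by (rule integral_mono_AE) (use nonneg(1) close f_m p_m in \<open>auto elim!: eventually_mono\<close>)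
        finally show ?thesis using f_m p_m by (simp add: C_def mult.commute)
      qed
      have 2: "\<bar>(\<integral>x. f (exp (- x)) \<partial>\<nu>) - (\<integral>x. p (exp (- x)) \<partial>\<nu>)\<bar> \<le> e * C"
      proof -
        have "\<bar>(\<integral>x. f (exp (- x)) - p (exp (- x)) \<partial>\<nu>)\<bar> \<le> (\<integral>x. \<bar>f (exp (- x)) - p (exp (- x))\<bar> \<partial>\<nu>)"
          by (rule integral_abs_bound)
        also have "\<dots> \<le> (\<integral>x. e \<partial>\<nu>)"
          by (rule integral_mono_AE) (use nonneg(2) close f_n p_n in \<open>auto elim!: eventually_mono\<close>)
        finally show ?thesis using f_n p_n by (simp add: C_def mult.commute total)
      qed
      have "e * (2 * C + 1) = e'" using C by (simp add: e_def)
      then have "e * C + e * C \<le> e'" using e by (simp add: algebra_simps)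
      then show "\<bar>(\<integral>x. f (exp (- x)) \<partial>\<mu>) - (\<integral>x. f (exp (- x)) \<partial>\<nu>)\<bar> \<le> 0 + e'"
        using 1 2 p_eq by linarith
    qed
    then show ?thesis by simp
  qed
  have "measure \<mu> {..a} = measure \<nu> {..a}" for a
  proof (cases "a < 0")
    case True
    have "AE x in \<mu>. x \<notin> {..a}" by (rule AE_mp[OF nonneg(1)]) (use True in auto)
    then have "{..a} \<in> null_sets \<mu>" by (subst AE_iff_null_sets) auto
    moreover have "AE x in \<nu>. x \<notin> {..a}" by (rule AE_mp[OF nonneg(2)]) (use True in auto)
    then have "{..a} \<in> null_sets \<nu>" by (subst AE_iff_null_sets) auto
    ultimately show ?thesis by (auto simp: measure_def null_sets_def)
  next
    case False
    \<comment> \<open>In the variable \<open>y\<close> the half line \<open>x \<le> a\<close> is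
      \<open>y \<ge> exp (- a)\<close>. The function is 1 there and drops to 0 with slope
      \<open>n\<close> below it.\<close>
    define f where "f n y = max 0 (1 - real n * max 0 (exp (- a) - y))" for n :: nat and y :: real
    have f_bound: "\<bar>f n y\<bar> \<le> 1" for n y by (auto simp: f_def)
    have f_meas: "(\<lambda>x. f n (exp (- x))) \<in> borel_measurable borel" for n unfolding f_def by measurable
    have lim: "(\<lambda>n. f n (exp (- x))) \<longlonglongrightarrow> indicator {..a} x" for x
    proof (cases "x \<le> a")
      case True
      then show ?thesis by (simp add: f_def)
    next
      case False
      define d where "d = exp (- a) - exp (- x)"
      have d: "d > 0" using False by (simp add: d_def)
      obtain n0 :: nat where n0: "real n0 > 1 / d" using reals_Archimedean2 by blast
      have "f n (exp (- x)) = 0" if "n \<ge> n0" for n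
      proof -
        have "1 / d < real n" using n0 that by linarith
        then have "real n * d \<ge> 1" using d by (simp add: pos_divide_less_eq)
        then show ?thesis using d by (simp add: f_def d_def[symmetric])
      qed
      then have "\<forall>\<^sub>F n in sequentially. f n (exp (- x)) = indicator {..a} x"
        using False by (auto simp: eventually_sequentially)
      then show ?thesis by (rule tendsto_eventually)
    qed
    have "(\<lambda>n. \<integral>x. f n (exp (- x)) \<partial>\<mu>) \<longlonglongrightarrow> (\<integral>x. indicator {..a} x \<partial>\<mu>)"
      by (rule integral_dominated_convergence[where w = "\<lambda>_. 1"])
         (use f_bound f_meas lim in \<open>auto simp: measurable_cong_sets[OF sets_mu refl]\<close>)
    moreover have "(\<lambda>n. \<integral>x. f n (exp (- x)) \<partial>\<nu>) \<longlonglongrightarrow> (\<integral>x. indicator {..a} x \<partial>\<nu>)"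
      by (rule integral_dominated_convergence[where w = "\<lambda>_. 1"])
         (use f_bound f_meas lim in \<open>auto simp: measurable_cong_sets[OF sets_nu refl]\<close>)
    moreover have "(\<integral>x. f n (exp (- x)) \<partial>\<mu>) = (\<integral>x. f n (exp (- x)) \<partial>\<nu>)" for n
      by (rule cont) (auto simp: f_def intro!: continuous_intros)
    ultimately have "(\<integral>x. indicator {..a} x \<partial>\<mu>) = (\<integral>x. indicator {..a} x \<partial>\<nu> :: real)"
      using LIMSEQ_unique by fastforce
    then show ?thesis using sets_eq_imp_space_eq[OF sets_mu] sets_eq_imp_space_eq[OF sets_nu] by simp
  qed
  then have "cdf \<mu> = cdf \<nu>" by (auto simp: cdf_def)
  moreover have "finite_borel_measure \<mu>" "finite_borel_measure \<nu>"
    by (auto simp: finite_borel_measure_def finite_borel_measure_axioms_def assms)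
  ultimately show ?thesis by (intro cdf_unique')
qed

text \<open>Exponentials are exchanged for indicators one coordinate at a time:
  \<open>W m n A t\<close> has \<open>m\<close> indicators followed by exponentials. With all other
  factors put into a density \<open>V\<close>, coordinate \<open>m\<close> has a finite law on the
  line, and the induction hypothesis knows its Laplace transform at every integer.\<close>

lemma Laplace_sequence_unique:
  fixes P P' :: "(nat \<Rightarrow> real) measure"
  assumes "prob_space P" "prob_space P'"
    and sets_P [simp, measurable_cong]: "sets P = sets (Pi\<^sub>M UNIV (\<lambda>_. borel))"
    and sets_P' [simp, measurable_cong]: "sets P' = sets (Pi\<^sub>M UNIV (\<lambda>_. borel))"
    and nonneg: "\<And>k. AE x in P. 0 \<le> x k" "\<And>k. AE x in P'. 0 \<le> x k"
    and eq: "\<And>n (t :: nat \<Rightarrow> nat). (\<integral>x. (\<Prod>k<n. exp (- (real (t k) * x k))) \<partial>P) = (\<integral>x. (\<Prod>k<n. exp (- (real (t k) * x k))) \<partial>P')"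
  shows "P = P'"
proof -
  interpret P: prob_space P by fact
  interpret P': prob_space P' by fact
  define W where "W m n A t x = (\<Prod>k<m. indicator (A k) (x k)) * (\<Prod>k\<in>{m..<n}. exp (- (real (t k) * x k)))"
    for m n :: nat and A :: "nat \<Rightarrow> real set" and t :: "nat \<Rightarrow> nat" and x :: "nat \<Rightarrow> real"
  have coord [measurable]: "(\<lambda>x :: nat \<Rightarrow> real. x k) \<in> borel_measurable (Pi\<^sub>M UNIV (\<lambda>_. borel))" for k
    by (rule measurable_component_singleton) simp
  have claim: "(\<integral>x. W m n A t x \<partial>P) = (\<integral>x. W m n A t x \<partial>P')"
    if "m \<le> n" "\<And>k. A k \<in> sets borel" for m n A t
    using that
  proof (induction m arbitrary: t)
    case 0
    then show ?case using eq[of t n] by (simp add: W_def atLeast0LessThan)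
  next
    case (Suc m)
    have [measurable]: "A k \<in> sets borel" for k by fact
    define V where "V x = (\<Prod>k<m. indicator (A k) (x k)) * (\<Prod>k\<in>{Suc m..<n}. exp (- (real (t k) * x k)))" for x :: "nat \<Rightarrow> real"
    have V_meas [measurable]: "V \<in> borel_measurable (Pi\<^sub>M UNIV (\<lambda>_. borel))" unfolding V_def by measurable
    have V_nonneg: "0 \<le> V x" for x by (auto simp: V_def intro!: mult_nonneg_nonneg prod_nonneg)
    have V_le: "V x \<le> 1" if "\<And>k. 0 \<le> x k" for x
      unfolding V_def using that by (intro mult_le_one prod_le_1 prod_nonneg) (auto simp: indicator_def)
    have Vj: "exp (- (real j * x m)) * V x = W m n A (t(m := j)) x" for j x
    proof -
      have "{m..<n} = insert m {Suc m..<n}" using Suc.prems by auto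
      then show ?thesis by (simp add: W_def V_def mult_ac)
    qed
    have VA: "indicator (A m) (x m) * V x = W (Suc m) n A t x" for x
      by (simp add: W_def V_def mult_ac)
    have all: "AE x in P. \<forall>k. 0 \<le> x k" "AE x in P'. \<forall>k. 0 \<le> x k" using nonneg by (auto simp: AE_all_countable)
    define \<mu> where "\<mu> R = distr (density R (\<lambda>x. ennreal (V x))) borel (\<lambda>x. x m)" for R
    have mu: "finite_measure (\<mu> R)" "sets (\<mu> R) = sets borel" "AE y in \<mu> R. 0 \<le> y"
      "(\<integral>y. g y \<partial>\<mu> R) = (\<integral>x. g (x m) * V x \<partial>R)"
      if R: "prob_space R" "sets R = sets (Pi\<^sub>M UNIV (\<lambda>_. borel))" and all: "AE x in R. \<forall>k. 0 \<le> x k"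
        and g: "g \<in> borel_measurable borel"
      for R and g :: "real \<Rightarrow> real"
    proof -
      interpret R: prob_space R by fact
      note R(2)[measurable_cong]
      note g[measurable]
      have "(\<integral>\<^sup>+x. ennreal (V x) \<partial>R) \<le> (\<integral>\<^sup>+x. 1 \<partial>R)"
        by (rule nn_integral_mono_AE) (use all V_le in \<open>auto elim!: eventually_mono\<close>)
      then have "emeasure (\<mu> R) (space (\<mu> R)) \<le> 1"
        unfolding \<mu>_def by (simp add: emeasure_distr emeasure_density R.emeasure_space_1 space_density)
      then show "finite_measure (\<mu> R)" by (intro finite_measureI) (auto simp: top_unique)
      show "sets (\<mu> R) = sets borel" by (simp add: \<mu>_def)
      show "AE y in \<mu> R. 0 \<le> y" unfolding \<mu>_def
        by (subst AE_distr_iff) (use all in \<open>auto simp: AE_density elim!: eventually_mono\<close>)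
      show "(\<integral>y. g y \<partial>\<mu> R) = (\<integral>x. g (x m) * V x \<partial>R)"
        unfolding \<mu>_def by (subst integral_distr) (auto simp: integral_density V_nonneg mult.commute)
    qed
    have "\<mu> P = \<mu> P'"
    proof (rule Laplace_finite_measure_unique)
      fix j :: nat
      have "(\<integral>x. exp (- (real j * x)) \<partial>\<mu> P) = (\<integral>x. W m n A (t(m := j)) x \<partial>P)"
        by (subst mu(4)) (use assms all in \<open>auto simp: Vj\<close>)
      also have "\<dots> = (\<integral>x. W m n A (t(m := j)) x \<partial>P')" using Suc by simp
      also have "\<dots> = (\<integral>x. exp (- (real j * x)) \<partial>\<mu> P')"
        by (subst mu(4)) (use assms all in \<open>auto simp: Vj\<close>)
      finally show "(\<integral>x. exp (- (real j * x)) \<partial>\<mu> P) = (\<integral>x. exp (- (real j * x)) \<partial>\<mu> P')" .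
    qed (use mu[of P "\<lambda>_. 0"] mu[of P' "\<lambda>_. 0"] assms all in auto)
    then have "(\<integral>y. indicator (A m) y \<partial>\<mu> P) = (\<integral>y. indicator (A m) y \<partial>\<mu> P' :: real)" by simp
    then show ?case
      using mu(4)[of P "indicator (A m)"] mu(4)[of P' "indicator (A m)"] assms all by (simp add: VA)
  qed
  show ?thesis
  proof (rule measure_eqI_PiM_infinite[OF sets_P sets_P'])
    show "finite_measure P" by (rule P.finite_measure_axioms)
    fix A :: "nat \<Rightarrow> real set" and J :: "nat set" assume J: "finite J" "J \<subseteq> UNIV" and A: "\<And>i. i \<in> J \<Longrightarrow> A i \<in> sets borel"
    \<comment> \<open>The finite set \<open>J\<close> need not be an initial segment; coordinates
      outside it get the trivial constraint.\<close>
    define B where "B k = (if k \<in> J then A k else UNIV)" for k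
    obtain n where n: "J \<subseteq> {..<n}" using J finite_nat_iff_bounded by blast
    have B: "B k \<in> sets borel" for k using A by (auto simp: B_def)
    have "emeasure R (prod_emb UNIV (\<lambda>_. borel) J (Pi\<^sub>E J A)) = ennreal (\<integral>x. W n n B (\<lambda>_. 0) x \<partial>R)"
      if R: "prob_space R" "sets R = sets (Pi\<^sub>M UNIV (\<lambda>_. borel))" for R
    proof -
      interpret R: prob_space R by fact
      note R(2)[measurable_cong]
      have sp: "space R = UNIV" using sets_eq_imp_space_eq[OF R(2)] by (simp add: space_PiM)
      have "W n n B (\<lambda>_. 0) x = indicator (prod_emb UNIV (\<lambda>_. borel) J (Pi\<^sub>E J A)) x" for x
      proof (cases "\<forall>k\<in>J. x k \<in> A k")
        case True
        then have "(\<Prod>k<n. indicator (B k) (x k) :: real) = 1" by (intro prod.neutral) (auto simp: B_def)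
        then show ?thesis using True by (auto simp: W_def prod_emb_def indicator_def space_PiM PiE_def)
      next
        case False
        then obtain k where k: "k \<in> J" "x k \<notin> A k" by blast
        then have "(\<Prod>k<n. indicator (B k) (x k) :: real) = 0" using n by (intro prod_zero bexI[of _ k]) (auto simp: B_def)
        then show ?thesis using k by (auto simp: W_def prod_emb_def indicator_def PiE_def restrict_def Pi_def split: if_splits)
      qed
      moreover have "prod_emb UNIV (\<lambda>_. borel) J (Pi\<^sub>E J A) \<in> sets R"
        unfolding R(2) using J A by (intro sets_PiM_I) auto
      ultimately show ?thesis by (simp add: R.emeasure_eq_measure)
    qed
    from this[OF assms(1) sets_P] this[OF assms(2) sets_P'] claim[of n n B "\<lambda>_. 0"] B
    show "emeasure P (prod_emb UNIV (\<lambda>_. borel) J (Pi\<^sub>E J A)) = emeasure P' (prod_emb UNIV (\<lambda>_. borel) J (Pi\<^sub>E J A))" by simp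
  qed
qed

section \<open>A strong law of large numbers\<close>

text \<open>Chebyshev's inequality along the squares, then monotone interpolation.\<close>

lemma tendsto_average_from_squares:
  fixes S :: "nat \<Rightarrow> real"
  assumes mono: "incseq S" and S0: "0 \<le> S 0" and m: "m \<ge> 0"
    and sq: "(\<lambda>j. S (Suc j ^ 2) / real (Suc j ^ 2)) \<longlonglongrightarrow> m"
  shows "(\<lambda>n. S n / real n) \<longlonglongrightarrow> m"
proof -
  \<comment> \<open>\<open>n\<close> lies between \<open>r n ^ 2\<close> and
    \<open>Suc (r n) ^ 2\<close>, so the average at \<open>n\<close> is trapped between averages at
    consecutive squares, up to factors that tend to 1.\<close>
  define r where "r n = floor_sqrt n" for n
  have r_top: "filterlim r at_top sequentially"
    unfolding filterlim_at_top
  proof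
    fix Z
    have "Z \<le> r n" if "n \<ge> Z ^ 2" for n
      using that by (simp add: r_def le_floor_sqrt_iff)
    then show "\<forall>\<^sub>F n in sequentially. Z \<le> r n" by (auto simp: eventually_sequentially)
  qed
  define a where "a j = S (j ^ 2) / real (j ^ 2)" for j
  have "(\<lambda>j. a (Suc j)) \<longlonglongrightarrow> m" using sq by (simp add: a_def)
  then have a: "a \<longlonglongrightarrow> m" by (rule LIMSEQ_imp_Suc)
  have up: "((\<lambda>n. a (Suc (r n)) * (real (Suc (r n)) / real (r n)) ^ 2) \<longlonglongrightarrow> m * 1 ^ 2)"
  proof (intro tendsto_intros)
    show "(\<lambda>n. a (Suc (r n))) \<longlonglongrightarrow> m"
      using filterlim_compose[OF LIMSEQ_Suc[OF a] r_top] .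
    have "(\<lambda>j. real (Suc j) / real j) \<longlonglongrightarrow> 1" by real_asymp
    from filterlim_compose[OF this r_top] show "(\<lambda>n. real (Suc (r n)) / real (r n)) \<longlonglongrightarrow> 1" .
  qed
  have low: "((\<lambda>n. a (r n) * (real (r n) / real (Suc (r n))) ^ 2) \<longlonglongrightarrow> m * 1 ^ 2)"
  proof (intro tendsto_intros)
    show "(\<lambda>n. a (r n)) \<longlonglongrightarrow> m" using filterlim_compose[OF a r_top] .
    have "(\<lambda>j. real j / real (Suc j)) \<longlonglongrightarrow> 1" by real_asymp
    from filterlim_compose[OF this r_top] show "(\<lambda>n. real (r n) / real (Suc (r n))) \<longlonglongrightarrow> 1" .
  qed
  have S_nonneg: "0 \<le> S n" for n using incseqD[OF mono, of 0 n] S0 by simp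
  have "\<forall>\<^sub>F n in sequentially. r n \<ge> 1" using r_top by (auto simp: filterlim_at_top)
  then have "\<forall>\<^sub>F n in sequentially. a (r n) * (real (r n) / real (Suc (r n))) ^ 2 \<le> S n / real n"
    and "\<forall>\<^sub>F n in sequentially. S n / real n \<le> a (Suc (r n)) * (real (Suc (r n)) / real (r n)) ^ 2"
  proof -
    show "\<forall>\<^sub>F n in sequentially. a (r n) * (real (r n) / real (Suc (r n))) ^ 2 \<le> S n / real n"
      using \<open>\<forall>\<^sub>F n in sequentially. r n \<ge> 1\<close>
    proof eventually_elim
      case (elim n)
      have n: "(r n) ^ 2 \<le> n" "n < (Suc (r n)) ^ 2" by (simp_all add: r_def Suc_floor_sqrt_power2_gt)
      have "n > 0" using n elim by (metis gr0I le_zero_eq not_one_le_zero zero_eq_power2)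
      have "a (r n) * (real (r n) / real (Suc (r n))) ^ 2 = S ((r n) ^ 2) / real ((Suc (r n)) ^ 2)"
        using elim by (simp add: a_def power_divide)
      also have "\<dots> \<le> S n / real n"
        by (rule frac_le[OF S_nonneg incseqD[OF mono n(1)]])
           (use \<open>n > 0\<close> n(2) in \<open>simp_all only: of_nat_le_iff of_nat_0_less_iff less_imp_le\<close>)
      finally show ?case .
    qed
    show "\<forall>\<^sub>F n in sequentially. S n / real n \<le> a (Suc (r n)) * (real (Suc (r n)) / real (r n)) ^ 2"
      using \<open>\<forall>\<^sub>F n in sequentially. r n \<ge> 1\<close>
    proof eventually_elim
      case (elim n)
      have n: "(r n) ^ 2 \<le> n" "n < (Suc (r n)) ^ 2" by (simp_all add: r_def Suc_floor_sqrt_power2_gt)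
      have "S n / real n \<le> S ((Suc (r n)) ^ 2) / real ((r n) ^ 2)"
        using n incseqD[OF mono, of n "(Suc (r n)) ^ 2"] elim S_nonneg by (intro frac_le) auto
      also have "\<dots> = a (Suc (r n)) * (real (Suc (r n)) / real (r n)) ^ 2"
        by (simp add: a_def power_divide del: of_nat_Suc)
      finally show ?case .
    qed
  qed
  from tendsto_sandwich[OF this low up] show ?thesis by simp
qed

text \<open>Finite variance makes deviations along the squares have probability of order
  \<open>1 / j ^ 2\<close>, hence summable. The result serves the exponential variables and the
  class indicators.\<close>

lemma (in prob_space) strong_law_nonneg:
  fixes X :: "nat \<Rightarrow> 'a \<Rightarrow> real"
  assumes indep: "indep_vars (\<lambda>_. borel) X UNIV"
    and nonneg: "\<And>k. AE \<omega> in M. 0 \<le> X k \<omega>"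
    and sq_int: "\<And>k. integrable M (\<lambda>\<omega>. (X k \<omega>)\<^sup>2)"
    and mean: "\<And>k. expectation (X k) = m"
    and var: "\<And>k. variance (X k) = v"
  shows "AE \<omega> in M. (\<lambda>n. (\<Sum>k<n. X k \<omega>) / real n) \<longlonglongrightarrow> m"
proof -
  have [measurable]: "X k \<in> borel_measurable M" for k using indep by (auto simp: indep_vars_def)
  have int: "integrable M (X k)" for k by (rule square_integrable_imp_integrable[OF _ sq_int]) simp
  have m: "m \<ge> 0" using integral_nonneg_AE[OF nonneg[of 0]] mean[of 0] by simp
  define S where "S n \<omega> = (\<Sum>k<n. X k \<omega>)" for n \<omega>
  have [measurable]: "S n \<in> borel_measurable M" for n unfolding S_def by measurable
  have ES: "expectation (S n) = real n * m" for n
    unfolding S_def using int mean by simp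
  \<comment> \<open>The second moment of a sum grows by one variable at a time; independence of the
    new variable from the partial sum evaluates the mixed term.\<close>
  have S_sq: "integrable M (\<lambda>\<omega>. (S n \<omega>)\<^sup>2) \<and> expectation (\<lambda>\<omega>. (S n \<omega>)\<^sup>2) = real n * v + (real n * m)\<^sup>2" for n
  proof (induction n)
    case (Suc n)
    have S_int: "integrable M (S n)" unfolding S_def using int by auto
    have "indep_vars (\<lambda>_. borel) X (insert n {..<n})" by (rule indep_vars_subset[OF indep]) auto
    then have ind: "indep_var borel (X n) borel (S n)" unfolding S_def by (rule indep_vars_sum[rotated 2]) auto
    have prod_int: "integrable M (\<lambda>\<omega>. X n \<omega> * S n \<omega>)" by (rule indep_var_integrable[OF ind int S_int])
    have prod: "expectation (\<lambda>\<omega>. X n \<omega> * S n \<omega>) = m * (real n * m)"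
      using indep_var_lebesgue_integral[OF ind int S_int] by (simp add: mean ES)
    have Xsq: "expectation (\<lambda>\<omega>. (X n \<omega>)\<^sup>2) = v + m\<^sup>2"
      using variance_eq[OF int[of n] sq_int[of n]] var[of n] by (simp add: mean)
    have eq: "(S (Suc n) \<omega>)\<^sup>2 = (S n \<omega>)\<^sup>2 + (X n \<omega>)\<^sup>2 + 2 * (X n \<omega> * S n \<omega>)" for \<omega>
      by (simp add: S_def power2_eq_square algebra_simps)
    show ?case
      unfolding eq using Suc sq_int[of n] prod_int prod Xsq by (simp add: power2_eq_square algebra_simps)
  qed (simp add: S_def)
  have VS: "variance (S n) = real n * v" for n
  proof -
    have "integrable M (S n)" unfolding S_def using int by auto
    from variance_eq[OF this conjunct1[OF S_sq[of n]]] show ?thesis using S_sq[of n] by (simp add: ES)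
  qed
  have all_nonneg: "AE \<omega> in M. \<forall>k. 0 \<le> X k \<omega>" using nonneg by (simp add: AE_all_countable)
  have dev: "AE \<omega> in M. \<forall>\<^sub>F j in sequentially. \<bar>S (Suc j ^ 2) \<omega> / real (Suc j ^ 2) - m\<bar> < 1 / real (Suc i)" for i
  proof -
    define A where "A j = {\<omega> \<in> space M. 1 / real (Suc i) * real (Suc j ^ 2) \<le> \<bar>S (Suc j ^ 2) \<omega> - expectation (S (Suc j ^ 2))\<bar>}" for j
    have A [measurable]: "A j \<in> sets M" for j unfolding A_def by measurable
    have bound: "prob (A j) \<le> v * real (Suc i) ^ 2 * (1 / real (Suc j ^ 2))" for j
    proof -
      have "prob (A j) \<le> variance (S (Suc j ^ 2)) / (1 / real (Suc i) * real (Suc j ^ 2))\<^sup>2"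
        unfolding A_def by (rule Chebyshev_inequality) (use S_sq in auto)
      also have "\<dots> = v * real (Suc i) ^ 2 * (1 / real (Suc j ^ 2))"
        unfolding VS by (simp add: power_divide power2_eq_square del: of_nat_Suc)
      finally show ?thesis .
    qed
    have "summable (\<lambda>j. v * real (Suc i) ^ 2 * (1 / real (Suc j ^ 2)))"
    proof (rule summable_mult)
      have "summable (\<lambda>n. inverse (real n ^ 2))" by (rule inverse_power_summable) simp
      then have "summable (\<lambda>j. inverse (real (Suc j) ^ 2))" by (subst summable_Suc_iff)
      then show "summable (\<lambda>j. 1 / real (Suc j ^ 2))" by (simp add: inverse_eq_divide)
    qed
    then have "summable (\<lambda>j. prob (A j))" by (rule summable_comparison_test'[where N = 0]) (use bound in auto)
    then have "AE \<omega> in M. \<forall>\<^sub>F j in sequentially. \<omega> \<in> space M - A j"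
      by (intro borel_cantelli_AE1) (auto simp: less_top[symmetric])
    then show ?thesis
    proof eventually_elim
      case (elim \<omega>)
      then show ?case
      proof eventually_elim
        case (elim j)
        then have "\<bar>S (Suc j ^ 2) \<omega> - real (Suc j ^ 2) * m\<bar> < 1 / real (Suc i) * real (Suc j ^ 2)"
          by (auto simp: A_def ES not_le simp del: of_nat_Suc)
        moreover have "S (Suc j ^ 2) \<omega> / real (Suc j ^ 2) - m = (S (Suc j ^ 2) \<omega> - real (Suc j ^ 2) * m) / real (Suc j ^ 2)"
          by (simp add: diff_divide_distrib del: of_nat_Suc)
        ultimately show ?case by (simp add: abs_divide pos_divide_less_eq del: of_nat_Suc)
      qed
    qed
  qed
  then have "AE \<omega> in M. \<forall>i. \<forall>\<^sub>F j in sequentially. \<bar>S (Suc j ^ 2) \<omega> / real (Suc j ^ 2) - m\<bar> < 1 / real (Suc i)"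
    by (simp add: AE_all_countable)
  with all_nonneg show ?thesis
  proof eventually_elim
    case (elim \<omega>)
    have "(\<lambda>j. S (Suc j ^ 2) \<omega> / real (Suc j ^ 2)) \<longlonglongrightarrow> m"
    proof (rule tendstoI)
      fix e :: real assume "e > 0"
      then obtain i where "1 / real (Suc i) < e" using nat_approx_posE by blast
      then show "\<forall>\<^sub>F j in sequentially. dist (S (Suc j ^ 2) \<omega> / real (Suc j ^ 2)) m < e"
        using elim(2)[rule_format, of i] by (auto simp: dist_real_def elim: eventually_mono)
    qed
    then show ?case
      unfolding S_def[symmetric]
      by (intro tendsto_average_from_squares) (use m elim(1) in \<open>auto simp: S_def incseq_Suc_iff\<close>)
  qed
qed

section \<open>Renewal processes\<close>

text \<open>By Fubini, fix the value of \<open>V\<close> first: the section of the event is then a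
  single point, which is null under the law of \<open>U\<close>.\<close>

lemma (in prob_space) indep_atomless:
  assumes indep: "indep_var borel U borel V" and atomless: "\<And>a. prob {\<omega> \<in> space M. U \<omega> = a} = 0"
    and [measurable]: "h \<in> borel_measurable borel"
  shows "AE \<omega> in M. U \<omega> \<noteq> (h (V \<omega>) :: real)"
proof -
  have [measurable]: "U \<in> borel_measurable M" "V \<in> borel_measurable M"
    using indep by (auto dest: indep_var_rv1 indep_var_rv2)
  interpret DU: prob_space "distr M borel U" by (rule prob_space_distr) simp
  interpret DV: prob_space "distr M borel V" by (rule prob_space_distr) simp
  interpret P: pair_sigma_finite "distr M borel U" "distr M borel V" ..
  define A where "A = {p :: real \<times> real. fst p = h (snd p)}"
  have A [measurable]: "A \<in> sets (borel \<Otimes>\<^sub>M borel)"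
  proof -
    have "A = {p \<in> space (borel \<Otimes>\<^sub>M borel). fst p = h (snd p)}" by (auto simp: A_def space_pair_measure)
    also have "\<dots> \<in> sets (borel \<Otimes>\<^sub>M borel)" by measurable
    finally show ?thesis .
  qed
  have "emeasure M {\<omega> \<in> space M. U \<omega> = h (V \<omega>)} = emeasure (distr M (borel \<Otimes>\<^sub>M borel) (\<lambda>\<omega>. (U \<omega>, V \<omega>))) A"
    by (subst emeasure_distr[OF _ A]) (auto simp: A_def intro!: arg_cong[where f = "emeasure M"])
  also have "\<dots> = emeasure (distr M borel U \<Otimes>\<^sub>M distr M borel V) A"
    using indep_var_distribution_eq[THEN iffD1, OF indep] by simp
  also have "\<dots> = (\<integral>\<^sup>+y. emeasure (distr M borel U) ((\<lambda>x. (x, y)) -` A) \<partial>distr M borel V)"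
    by (rule P.emeasure_pair_measure_alt2) simp
  also have "\<dots> = (\<integral>\<^sup>+y. 0 \<partial>distr M borel V)"
  proof (rule nn_integral_cong)
    fix y
    have "(\<lambda>x. (x, y)) -` A = {h y}" by (auto simp: A_def)
    moreover have "emeasure (distr M borel U) {h y} = 0"
      using atomless[of "h y"] by (subst emeasure_distr) (auto simp: emeasure_eq_measure vimage_def Int_def conj_commute)
    ultimately show "emeasure (distr M borel U) ((\<lambda>x. (x, y)) -` A) = 0" by simp
  qed
  finally have "emeasure M {\<omega> \<in> space M. U \<omega> = h (V \<omega>)} = 0" by simp
  then show ?thesis by (subst AE_iff_measurable[OF _ refl]) auto
qed

lemma distr_indep_random_elements:
  assumes M: "prob_space M" and indep: "indep_random_elements M S X T Y"
  shows "distr M (S \<Otimes>\<^sub>M T) (\<lambda>\<omega>. (X \<omega>, Y \<omega>)) = distr M S X \<Otimes>\<^sub>M distr M T Y"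
proof -
  interpret prob_space M by fact
  have [measurable]: "X \<in> measurable M S" "Y \<in> measurable M T" using indep by (auto simp: indep_random_elements_def)
  interpret DX: prob_space "distr M S X" by (rule prob_space_distr) simp
  interpret DY: prob_space "distr M T Y" by (rule prob_space_distr) simp
  show ?thesis
  proof (rule pair_measure_eqI[symmetric])
    fix A B assume A: "A \<in> sets (distr M S X)" and B: "B \<in> sets (distr M T Y)"
    then have [measurable]: "A \<in> sets S" "B \<in> sets T" by auto
    have "prob ((X -` A \<inter> space M) \<inter> (Y -` B \<inter> space M)) = prob (X -` A \<inter> space M) * prob (Y -` B \<inter> space M)"
      using indep A B by (intro indep_setD) (auto simp: indep_random_elements_def)
    moreover have "(\<lambda>\<omega>. (X \<omega>, Y \<omega>)) -` (A \<times> B) \<inter> space M = (X -` A \<inter> space M) \<inter> (Y -` B \<inter> space M)" by auto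
    ultimately show "emeasure (distr M S X) A * emeasure (distr M T Y) B = emeasure (distr M (S \<Otimes>\<^sub>M T) (\<lambda>\<omega>. (X \<omega>, Y \<omega>))) (A \<times> B)"
      by (simp add: emeasure_distr emeasure_eq_measure ennreal_mult)
  next
    show "sigma_finite_measure (distr M S X)" by (rule DX.sigma_finite_measure_axioms)
    show "sigma_finite_measure (distr M T Y)" by (rule DY.sigma_finite_measure_axioms)
    show "sets (distr M S X \<Otimes>\<^sub>M distr M T Y) = sets (distr M (S \<Otimes>\<^sub>M T) (\<lambda>\<omega>. (X \<omega>, Y \<omega>)))"
      using sets_pair_measure_cong[OF sets_distr[of M S X] sets_distr[of M T Y]] by simp
  qed
qed

text \<open>The time of the \<open>k\<close>-th jump, read off from the path alone. Independence in
  the model is stated for counting paths, whereas interarrival times occur only under an existential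
  quantifier, so they must be recovered as measurable functions of the path. Rationals keep the
  infimum countable; extended reals give it a value when level \<open>k\<close> is never
  reached.\<close>

definition epoch :: "(real \<Rightarrow> nat) \<Rightarrow> nat \<Rightarrow> real" where
  "epoch n k = real_of_ereal (INF q\<in>\<rat> \<inter> {0..}. if k \<le> n q then ereal q else \<infinity>)"

lemma epoch_renewal_count:
  assumes x: "renewal_sequence x" and n: "\<And>t. t \<ge> 0 \<Longrightarrow> n t = renewal_count x t"
  shows "epoch n k = (\<Sum>j<k. x j)"
proof -
  define s where "s = (\<Sum>j<k. x j)"
  have s0: "s \<ge> 0" unfolding s_def by (rule renewal_sum_nonneg[OF x])
  have iff: "k \<le> n q \<longleftrightarrow> s \<le> q" if "q \<ge> 0" for q
    using le_renewal_count_iff[OF x that] n[OF that] by (simp add: s_def)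
  have "(INF q\<in>\<rat> \<inter> {0..}. if k \<le> n q then ereal q else \<infinity>) = ereal s"
  proof (rule INF_eqI)
    fix q :: real assume "q \<in> \<rat> \<inter> {0..}"
    then show "ereal s \<le> (if k \<le> n q then ereal q else \<infinity>)" using iff by auto
  next
    fix y assume y: "\<And>q :: real. q \<in> \<rat> \<inter> {0..} \<Longrightarrow> y \<le> (if k \<le> n q then ereal q else \<infinity>)"
    show "y \<le> ereal s"
    \<comment> \<open>The epoch itself may be irrational; rationals just above it suffice for the
      infimum.\<close>
    proof (rule ereal_le_epsilon2)
      fix e :: real assume "0 < e"
      then obtain q where q: "q \<in> \<rat>" "s < q" "q < s + e" using Rats_dense_in_real[of s "s + e"] by auto
      then have "y \<le> ereal q" using y[of q] iff[of q] s0 by auto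
      also have "ereal q \<le> ereal s + ereal e" using q by simp
      finally show "y \<le> ereal s + ereal e" .
    qed
  qed
  then show ?thesis by (simp add: epoch_def s_def)
qed

definition interarrivals :: "(real \<Rightarrow> nat) \<Rightarrow> nat \<Rightarrow> real" where
  "interarrivals n k = epoch n (Suc k) - epoch n k"

lemma interarrivals_renewal_count:
  assumes "renewal_sequence x" "\<And>t. t \<ge> 0 \<Longrightarrow> n t = renewal_count x t"
  shows "interarrivals n = x"
  using epoch_renewal_count[OF assms] by (auto simp: interarrivals_def)

lemma measurable_interarrivals:
  "interarrivals \<in> measurable (Pi\<^sub>M {0..} (\<lambda>_. count_space UNIV)) (Pi\<^sub>M UNIV (\<lambda>_. borel))"
proof -
  have "(\<lambda>n. epoch n k) \<in> borel_measurable (Pi\<^sub>M {0..} (\<lambda>_. count_space UNIV))" for k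
  proof -
    have c: "countable (\<rat> \<inter> {0..} :: real set)" by (intro countable_Int1 countable_rat)
    have "(\<lambda>n. if k \<le> n q then ereal q else \<infinity>) \<in> borel_measurable (Pi\<^sub>M {0..} (\<lambda>_. count_space UNIV))"
      if q: "q \<in> \<rat> \<inter> {0..}" for q :: real
    proof -
      have [measurable]: "(\<lambda>n. n q) \<in> measurable (Pi\<^sub>M {0..} (\<lambda>_. count_space UNIV)) (count_space UNIV)"
        using q by (intro measurable_component_singleton) auto
      show ?thesis by measurable
    qed
    then show ?thesis
      unfolding epoch_def by (intro borel_measurable_real_of_ereal borel_measurable_INF c)
  qed
  then show ?thesis
    by (intro measurable_PiM_single') (auto simp: interarrivals_def intro!: borel_measurable_diff)
qed

text \<open>\<open>c\<close> is the rate raised to the power \<open>\<theta>\<close>. With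
  \<open>\<theta> = 1\<close> the locale also covers exponential interarrival times.\<close>

locale renewal_process = prob_space M for M :: "'a measure" +
  fixes X :: "nat \<Rightarrow> 'a \<Rightarrow> real" and \<theta> c :: real
  assumes indep: "indep_vars (\<lambda>_. borel) X UNIV"
    and nonneg: "\<And>k. AE \<omega> in M. 0 \<le> X k \<omega>"
    and th: "\<theta> > 0" "\<theta> \<le> 1" and c: "c > 0"
    and cdf: "\<And>k x. x \<ge> 0 \<Longrightarrow> prob {\<omega> \<in> space M. X k \<omega> \<le> x} = 1 - mittag_leffler \<theta> (- (c * x powr \<theta>))"
begin

lemma X_meas [measurable]: "X k \<in> borel_measurable M"
  using indep by (auto simp: indep_vars_def)

sublocale ml: mittag_leffler_variable M "X k" \<theta> c for k
  by unfold_locales (use nonneg th c cdf in auto)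

lemma joint_Laplace:
  assumes t: "\<And>k. t k \<ge> 0"
  shows "expectation (\<lambda>\<omega>. \<Prod>k<n. exp (- (t k * X k \<omega>))) = (\<Prod>k<n. c / (c + t k powr \<theta>))"
proof (cases "n = 0")
  case False
  have "indep_vars (\<lambda>_. borel) (\<lambda>k. (\<lambda>x. exp (- (t k * x))) \<circ> X k) {..<n}"
    by (rule indep_vars_compose[OF indep_vars_subset[OF indep]]) auto
  then have ind: "indep_vars (\<lambda>_. borel) (\<lambda>k \<omega>. exp (- (t k * X k \<omega>))) {..<n}" by (simp add: comp_def)
  have "integrable M (\<lambda>\<omega>. exp (- (t k * X k \<omega>)))" for k
    by (rule integrable_const_bound[of _ 1]) (use nonneg[of k] t in \<open>auto elim!: eventually_mono\<close>)
  then have "expectation (\<lambda>\<omega>. \<Prod>k<n. exp (- (t k * X k \<omega>))) = (\<Prod>k<n. expectation (\<lambda>\<omega>. exp (- (t k * X k \<omega>))))"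
    by (intro indep_vars_lebesgue_integral ind) auto
  moreover have "expectation (\<lambda>\<omega>. exp (- (t k * X k \<omega>))) = c / (c + t k powr \<theta>)" for k
    using ml.Laplace[of "t k" k] t[of k] c by (cases "t k = 0") (auto simp: prob_space)
  ultimately show ?thesis by simp
qed (simp add: prob_space)

lemma all_nonneg: "AE \<omega> in M. \<forall>k. 0 \<le> X k \<omega>"
  using nonneg by (simp add: AE_all_countable)

text \<open>Chernoff's bound at the parameter \<open>1 / s\<close>, for which the exponential
  prefactor is the constant \<open>exp 1\<close>.\<close>

lemma sum_tail:
  assumes s: "s > 0"
  shows "prob {\<omega> \<in> space M. (\<Sum>k<n. X k \<omega>) \<le> s} \<le> exp 1 * (c / (c + (1 / s) powr \<theta>)) ^ n"
proof -
  have int: "integrable M (\<lambda>\<omega>. exp (- ((1 / s) * (\<Sum>k<n. X k \<omega>))))"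
    by (rule integrable_const_bound[of _ 1]) (use s all_nonneg in \<open>auto elim!: eventually_mono intro!: divide_nonneg_pos sum_nonneg\<close>)
  have "prob {\<omega> \<in> space M. (\<Sum>k<n. X k \<omega>) \<le> s} = expectation (indicator {\<omega> \<in> space M. (\<Sum>k<n. X k \<omega>) \<le> s})"
    by simp
  also have "\<dots> \<le> expectation (\<lambda>\<omega>. exp 1 * exp (- ((1 / s) * (\<Sum>k<n. X k \<omega>))))"
  proof (rule integral_mono)
    fix \<omega> assume "\<omega> \<in> space M"
    have "1 \<le> exp 1 * exp (- ((1 / s) * (\<Sum>k<n. X k \<omega>)))" if "(\<Sum>k<n. X k \<omega>) \<le> s"
      using that s by (simp add: exp_add[symmetric])
    then show "indicator {\<omega> \<in> space M. (\<Sum>k<n. X k \<omega>) \<le> s} \<omega> \<le> exp 1 * exp (- ((1 / s) * (\<Sum>k<n. X k \<omega>)))"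
      by (auto simp: indicator_def)
  next
    show "integrable M (indicator {\<omega> \<in> space M. (\<Sum>k<n. X k \<omega>) \<le> s} :: 'a \<Rightarrow> real)"
      by (rule integrable_const_bound[of _ 1]) (auto simp: indicator_def)
  qed (use int in \<open>auto intro!: integrable_mult_right\<close>)
  also have "\<dots> = exp 1 * expectation (\<lambda>\<omega>. \<Prod>k<n. exp (- ((1 / s) * X k \<omega>)))"
    by (simp add: exp_sum[symmetric] sum_negf sum_distrib_left sum_divide_distrib)
  also have "\<dots> = exp 1 * (c / (c + (1 / s) powr \<theta>)) ^ n"
    using joint_Laplace[of "\<lambda>_. 1 / s" n] s by simp
  finally show ?thesis .
qed

text \<open>At \<open>s = B * n powr (1 / g)\<close> the Chernoff factor is
  \<open>1 / (1 + y)\<close> with \<open>y\<close> of order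
  \<open>n powr (- (\<theta> / g))\<close>. Its \<open>n\<close>-th power is at most
  \<open>exp (- a * n powr \<delta>)\<close> with \<open>\<delta> = 1 - \<theta> / g\<close>
  positive, which is summable, and Borel-Cantelli applies.\<close>

lemma sum_growth:
  assumes g: "\<theta> < g" and B: "B > 0"
  shows "AE \<omega> in M. \<forall>\<^sub>F n in sequentially. B * real n powr (1 / g) < (\<Sum>k<n. X k \<omega>)"
proof -
  define b where "b = B powr (- \<theta>) / c"
  define \<delta> where "\<delta> = 1 - \<theta> / g"
  have g0: "g > 0" using g th by simp
  have b: "b > 0" using B c by (simp add: b_def)
  have \<delta>: "\<delta> > 0" "\<delta> < 1" using g g0 th by (auto simp: \<delta>_def)
  define A where "A n = {\<omega> \<in> space M. (\<Sum>k<n. X k \<omega>) \<le> B * real n powr (1 / g)}" for n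
  have A [measurable]: "A n \<in> sets M" for n unfolding A_def by measurable
  have bound: "prob (A n) \<le> exp 1 * exp (- (b / (1 + b)) * real n powr \<delta>)" if n: "n \<ge> 1" for n
  proof -
    define s where "s = B * real n powr (1 / g)"
    define y where "y = b * real n powr (- (\<theta> / g))"
    have s: "s > 0" using B n by (simp add: s_def)
    have y: "y > 0" using b n by (simp add: y_def)
    have "real n powr (- (\<theta> / g)) \<le> real n powr 0" using n g0 th by (intro powr_mono) auto
    then have "real n powr (- (\<theta> / g)) \<le> 1" using n by simp
    then have "y \<le> b" using b by (simp add: y_def)
    have sth: "(1 / s) powr \<theta> = c * y"
    proof -
      have "(1 / s) powr \<theta> = s powr (- \<theta>)" using s by (simp add: powr_divide powr_minus_divide)
      also have "\<dots> = B powr (- \<theta>) * real n powr (- (\<theta> / g))"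
        using B by (simp add: s_def powr_mult powr_powr)
      also have "\<dots> = c * y" using c by (simp add: y_def b_def)
      finally show ?thesis .
    qed
    have "c / (c + (1 / s) powr \<theta>) = 1 / (1 + y)"
    proof -
      have "c + c * y = c * (1 + y)" by (simp add: algebra_simps)
      then show ?thesis unfolding sth using c by simp
    qed
    also have "1 / (1 + y) = 1 + - (y / (1 + y))" using y by (simp add: field_simps)
    also have "\<dots> \<le> exp (- (y / (1 + y)))" by (rule exp_ge_add_one_self)
    also have "\<dots> \<le> exp (- (y / (1 + b)))" using y \<open>y \<le> b\<close> by (simp add: frac_le)
    finally have "c / (c + (1 / s) powr \<theta>) \<le> exp (- (y / (1 + b)))" .
    then have "(c / (c + (1 / s) powr \<theta>)) ^ n \<le> exp (- (y / (1 + b))) ^ n"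
      using c by (intro power_mono) (auto intro!: divide_nonneg_nonneg)
    also have "\<dots> = exp (- (real n * y / (1 + b)))" by (simp add: exp_of_nat_mult[symmetric])
    also have "real n * y = b * real n powr \<delta>"
      using n by (simp add: y_def \<delta>_def powr_diff powr_minus field_simps)
    finally have "(c / (c + (1 / s) powr \<theta>)) ^ n \<le> exp (- (b / (1 + b)) * real n powr \<delta>)" by simp
    then have "exp 1 * (c / (c + (1 / s) powr \<theta>)) ^ n \<le> exp 1 * exp (- (b / (1 + b)) * real n powr \<delta>)"
      by (rule mult_left_mono) simp
    with sum_tail[OF s, of n] show ?thesis unfolding A_def s_def by (rule order_trans)
  qed
  define a where "a = b / (1 + b)"
  have a: "a > 0" using b by (simp add: a_def)
  \<comment> \<open>A single term of the exponential series,
    \<open>x ^ k / fact k \<le> exp x\<close>, brings the stretched exponential below a multiple of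
    \<open>1 / n ^ 2\<close> as soon as \<open>\<delta> * k \<ge> 2\<close>.\<close>
  obtain k :: nat where k: "2 / \<delta> \<le> real k" using real_arch_simple by blast
  have "norm (exp 1 * exp (- a * real n powr \<delta>)) \<le> exp 1 * (fact k / a ^ k) * (1 / real n ^ 2)" if n: "n \<ge> 1" for n
  proof -
    define x where "x = a * real n powr \<delta>"
    have x: "x > 0" using a n by (simp add: x_def)
    have "x ^ k / fact k \<le> exp x"
      using sum_le_suminf[OF summable_exp_generic[of x], of "{k}"] x by (simp add: exp_def divide_inverse mult.commute)
    then have "exp (- x) \<le> fact k / x ^ k" using x by (simp add: exp_minus field_simps)
    also have "x ^ k = a ^ k * real n powr (\<delta> * real k)"
      using n by (simp add: x_def power_mult_distrib powr_realpow[symmetric] powr_powr)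
    also have "fact k / (a ^ k * real n powr (\<delta> * real k)) \<le> fact k / (a ^ k * real n ^ 2)"
    proof -
      have "2 \<le> \<delta> * real k" using k \<delta> by (simp add: pos_divide_le_eq mult.commute)
      then have "real n powr 2 \<le> real n powr (\<delta> * real k)" using n by (intro powr_mono) auto
      then have "real n ^ 2 \<le> real n powr (\<delta> * real k)" using n by simp
      then show ?thesis using a n by (intro divide_left_mono mult_left_mono mult_pos_pos) auto
    qed
    finally have "exp 1 * exp (- x) \<le> exp 1 * (fact k / (a ^ k * real n ^ 2))" by (rule mult_left_mono) simp
    then show ?thesis by (simp add: x_def)
  qed
  moreover have "summable (\<lambda>n. exp 1 * (fact k / a ^ k) * (1 / real n ^ 2))"
    using inverse_power_summable[of 2, where 'a = real] by (intro summable_mult) (simp add: inverse_eq_divide)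
  ultimately have "summable (\<lambda>n. exp 1 * exp (- a * real n powr \<delta>))"
    by (rule summable_comparison_test'[rotated])
  then have "summable (\<lambda>n. exp 1 * exp (- (b / (1 + b)) * real n powr \<delta>))" by (simp only: a_def)
  then have "summable (\<lambda>n. prob (A n))"
    by (rule summable_comparison_test'[where N = 1]) (use bound in auto)
  then have "AE \<omega> in M. \<forall>\<^sub>F n in sequentially. \<omega> \<in> space M - A n"
    by (intro borel_cantelli_AE1) (auto simp: less_top[symmetric])
  then show ?thesis by eventually_elim (auto simp: A_def not_le elim: eventually_mono)
qed

lemma renewal_sequence_AE: "AE \<omega> in M. renewal_sequence (\<lambda>k. X k \<omega>)"
proof -
  \<comment> \<open>The index \<open>\<theta> + 1\<close> is an arbitrary choice above
    \<open>\<theta>\<close>; any positive power of \<open>n\<close> tends to infinity.\<close>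
  have "AE \<omega> in M. \<forall>\<^sub>F n in sequentially. 1 * real n powr (1 / (\<theta> + 1)) < (\<Sum>k<n. X k \<omega>)"
    by (rule sum_growth) auto
  with all_nonneg show ?thesis
  proof eventually_elim
    case (elim \<omega>)
    have "\<exists>n. real m < (\<Sum>k<n. X k \<omega>)" for m
    proof -
      have "filterlim (\<lambda>n. real n powr (1 / (\<theta> + 1))) at_top sequentially" using th by real_asymp
      then have "\<forall>\<^sub>F n in sequentially. real m < real n powr (1 / (\<theta> + 1))" by (simp add: filterlim_at_top_dense)
      with elim(2) have "\<forall>\<^sub>F n in sequentially. real m < (\<Sum>k<n. X k \<omega>)" by eventually_elim simp
      then show ?thesis by (auto simp: eventually_sequentially)
    qed
    then show ?case using elim(1) by (auto simp: renewal_sequence_def)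
  qed
qed

lemma positive_AE: "AE \<omega> in M. \<forall>k. 0 < X k \<omega>"
proof -
  have "AE \<omega> in M. X k \<omega> \<noteq> 0" for k
    using ml.atomless[of k 0] by (subst (asm) prob_eq_0) auto
  then have "AE \<omega> in M. \<forall>k. X k \<omega> \<noteq> 0" by (simp add: AE_all_countable)
  with all_nonneg show ?thesis by eventually_elim (auto simp: less_le)
qed

lemma sum_atomless: "prob {\<omega> \<in> space M. (\<Sum>k<Suc n. X k \<omega>) = s} = 0"
proof -
  have "indep_vars (\<lambda>_. borel) X (insert n {..<n})" by (rule indep_vars_subset[OF indep]) auto
  then have ind: "indep_var borel (X n) borel (\<lambda>\<omega>. \<Sum>k<n. X k \<omega>)" by (rule indep_vars_sum[rotated 2]) auto
  have "AE \<omega> in M. X n \<omega> \<noteq> s - (\<Sum>k<n. X k \<omega>)"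
    by (rule indep_atomless[OF ind, of "\<lambda>r. s - r"]) (use ml.atomless in auto)
  then have "AE \<omega> in M. (\<Sum>k<Suc n. X k \<omega>) \<noteq> s" by eventually_elim auto
  then show ?thesis by (subst prob_eq_0) auto
qed

text \<open>If \<open>n\<close> is the count at \<open>u\<close>, the sum of the first
  \<open>n\<close> variables is at most \<open>u\<close>, so for large \<open>n\<close> the growth
  bound yields \<open>B * n powr (1 / g) < u\<close>, that is
  \<open>n < u powr g / B powr g\<close>. Here \<open>B\<close> is as large as desired.\<close>

lemma count_small:
  assumes g: "\<theta> < g"
  shows "AE \<omega> in M. ((\<lambda>u. real (renewal_count (\<lambda>k. X k \<omega>) u) / u powr g) \<longlongrightarrow> 0) at_top"
proof -
  have g0: "g > 0" using g th by simp
  have "AE \<omega> in M. \<forall>i :: nat. \<forall>\<^sub>F n in sequentially. real (Suc i) * real n powr (1 / g) < (\<Sum>k<n. X k \<omega>)"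
    unfolding AE_all_countable by (intro allI sum_growth[OF g]) simp?
  with renewal_sequence_AE show ?thesis
  proof eventually_elim
    case (elim \<omega>)
    define x where "x k = X k \<omega>" for k
    have x: "renewal_sequence x" using elim(1) by (simp add: x_def[abs_def])
    show ?case
      unfolding x_def[symmetric]
    proof (rule tendstoI)
      fix e :: real assume e: "e > 0"
      have "filterlim (\<lambda>i. real (Suc i) powr g) at_top sequentially" using g0 by real_asymp
      then have "\<forall>\<^sub>F i in sequentially. 1 / e < real (Suc i) powr g" by (simp add: filterlim_at_top_dense)
      then obtain i where i: "1 / e < real (Suc i) powr g" by (auto simp: eventually_sequentially)
      define B where "B = real (Suc i)"
      have B: "B > 0" "1 / e < B powr g" using i by (auto simp: B_def)
      obtain n0 where n0: "\<And>n. n \<ge> n0 \<Longrightarrow> B * real n powr (1 / g) < (\<Sum>k<n. x k)"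
        using elim(2)[rule_format, of i] by (auto simp: eventually_sequentially x_def B_def)
      have "filterlim (\<lambda>u :: real. u powr g) at_top at_top" using g0 by real_asymp
      then have "\<forall>\<^sub>F u :: real in at_top. real n0 / e < u powr g" by (simp add: filterlim_at_top_dense)
      then show "\<forall>\<^sub>F u in at_top. dist (real (renewal_count x u) / u powr g) 0 < e"
        using eventually_gt_at_top[of 0]
      proof eventually_elim
        case (elim u)
        define n where "n = renewal_count x u"
        have ug: "u powr g > 0" using elim by simp
        have "real n < e * u powr g"
        proof (cases "n \<ge> n0")
          case True
          have "(\<Sum>k<n. x k) \<le> u" using le_renewal_count_iff[OF x, of u n] elim by (simp add: n_def)
          then have "B * real n powr (1 / g) < u" using n0[OF True] by simp
          then have "(B * real n powr (1 / g)) powr g < u powr g" using g0 B by (intro powr_less_mono2) auto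
          moreover have "(B * real n powr (1 / g)) powr g = B powr g * real n"
            using B g0 by (simp add: powr_mult powr_powr)
          ultimately have 1: "B powr g * real n < u powr g" by simp
          have "1 \<le> e * B powr g" using B(2) e by (simp add: field_simps)
          then have "real n \<le> e * B powr g * real n" by (simp add: mult_right_le_one_le mult_le_cancel_right1)
          also have "\<dots> < e * u powr g" using 1 e by (simp add: mult.assoc)
          finally show ?thesis .
        next
          case False
          then have "real n < real n0" by simp
          also have "real n0 < e * u powr g" using elim(1) e by (simp add: pos_divide_less_eq mult.commute)
          finally show ?thesis .
        qed
        then show ?case using ug by (simp add: n_def[symmetric] field_simps)
      qed
    qed
  qed
qed

end

section \<open>Inverses of subordinator paths\<close>

text \<open>Positivity after time 0 makes the inverse start at 0, and unboundedness keeps the set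
  under its infimum nonempty.\<close>

definition subordinator_path :: "(real \<Rightarrow> real) \<Rightarrow> bool" where
  "subordinator_path l \<longleftrightarrow> l 0 = 0 \<and> mono_on {0..} l \<and> cadlag l \<and> (\<forall>s>0. 0 < l s) \<and> (\<forall>m :: nat. \<exists>s>0. real m < l s)"

definition path_inverse :: "(real \<Rightarrow> real) \<Rightarrow> real \<Rightarrow> real" where
  "path_inverse l t = Inf {s. s > 0 \<and> l s > t}"

lemma subordinator_path_mono: "subordinator_path l \<Longrightarrow> 0 \<le> s \<Longrightarrow> s \<le> t \<Longrightarrow> l s \<le> l t"
  by (auto simp: subordinator_path_def intro: mono_onD)

lemma subordinator_path_unbounded:
  assumes "subordinator_path l"
  shows "\<exists>s>0. t < l s"
proof -
  obtain m :: nat where "t < real m" using reals_Archimedean2 by blast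
  moreover obtain s where "s > 0" "real m < l s" using assms by (auto simp: subordinator_path_def)
  ultimately show ?thesis by (intro exI[of _ s]) auto
qed

lemma path_inverse_le: "t < l g \<Longrightarrow> 0 < g \<Longrightarrow> path_inverse l t \<le> g"
  unfolding path_inverse_def by (rule cInf_lower) (auto intro: bdd_belowI[of _ 0])

lemma le_path_inverse:
  assumes l: "subordinator_path l" and "l g \<le> t" "0 \<le> g"
  shows "g \<le> path_inverse l t"
  unfolding path_inverse_def
proof (rule cInf_greatest)
  show "{s. s > 0 \<and> l s > t} \<noteq> {}" using subordinator_path_unbounded[OF l, of t] by auto
  fix s assume "s \<in> {s. s > 0 \<and> l s > t}"
  then show "g \<le> s" using subordinator_path_mono[OF l, of s g] assms by force
qed

text \<open>By monotonicity a level that is exceeded before \<open>a\<close> is exceeded at some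
  rational time before \<open>a\<close>. This makes the inverse measurable in the underlying
  point.\<close>

lemma path_inverse_less_iff:
  assumes l: "subordinator_path l"
  shows "path_inverse l t < a \<longleftrightarrow> (\<exists>q\<in>\<rat>. 0 < q \<and> q < a \<and> t < l q)"
proof
  assume "path_inverse l t < a"
  then obtain s where s: "s > 0" "l s > t" "s < a"
    using cInf_lessD[of "{s. s > 0 \<and> l s > t}" a] subordinator_path_unbounded[OF l, of t] unfolding path_inverse_def by auto
  then obtain q where "q \<in> \<rat>" "s < q" "q < a" using Rats_dense_in_real by blast
  moreover from this s have "t < l q" using subordinator_path_mono[OF l, of s q] by auto
  ultimately show "\<exists>q\<in>\<rat>. 0 < q \<and> q < a \<and> t < l q" using s by (intro bexI[of _ q]) auto
next
  assume "\<exists>q\<in>\<rat>. 0 < q \<and> q < a \<and> t < l q"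
  then show "path_inverse l t < a" using path_inverse_le by force
qed

lemma path_inverse_0: "subordinator_path l \<Longrightarrow> path_inverse l 0 = 0"
proof -
  assume l: "subordinator_path l"
  then have "{s. s > 0 \<and> l s > 0} = {0<..}" by (auto simp: subordinator_path_def)
  then show ?thesis by (simp add: path_inverse_def)
qed

lemma path_inverse_mono:
  assumes l: "subordinator_path l" and "t \<le> t'"
  shows "path_inverse l t \<le> path_inverse l t'"
  unfolding path_inverse_def
  by (rule cInf_superset_mono) (use assms subordinator_path_unbounded[OF l, of t'] in \<open>auto intro: bdd_belowI[of _ 0]\<close>)

lemma path_inverse_nonneg: "subordinator_path l \<Longrightarrow> t \<ge> 0 \<Longrightarrow> 0 \<le> path_inverse l t"
  using path_inverse_mono[of l 0 t] path_inverse_0[of l] by simp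

text \<open>Left limits of a nondecreasing function are suprema, and for right continuity a single
  point \<open>b\<close> per tolerance controls the whole interval up to it.\<close>

lemma cadlag_mono:
  fixes f :: "real \<Rightarrow> real"
  assumes mono: "\<And>s t. 0 \<le> s \<Longrightarrow> s \<le> t \<Longrightarrow> f s \<le> f t"
    and right: "\<And>t e. 0 \<le> t \<Longrightarrow> 0 < e \<Longrightarrow> \<exists>b>t. f b < f t + e"
  shows "cadlag f"
  unfolding cadlag_def
proof (intro conjI allI impI)
  fix t :: real assume t: "t \<ge> 0"
  show "(f \<longlongrightarrow> f t) (at_right t)"
  proof (rule tendstoI)
    fix e :: real assume "e > 0"
    then obtain b where b: "b > t" "f b < f t + e" using right[OF t] by blast
    show "\<forall>\<^sub>F s in at_right t. dist (f s) (f t) < e"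
    proof (rule eventually_at_rightI[OF _ b(1)])
      fix s assume "s \<in> {t<..<b}"
      then show "dist (f s) (f t) < e" using mono[of t s] mono[of s b] b t by (auto simp: dist_real_def)
    qed
  qed
next
  fix t :: real assume t: "t > 0"
  define J where "J = (SUP s\<in>{0..<t}. f s)"
  have bdd: "bdd_above (f ` {0..<t})" by (rule bdd_aboveI2[of _ _ "f t"]) (use mono in auto)
  have "(f \<longlongrightarrow> J) (at_left t)"
  proof (rule tendstoI)
    fix e :: real assume "e > 0"
    have "\<exists>s\<in>{0..<t}. J - e < f s"
      using \<open>e > 0\<close> t bdd less_cSUP_iff[of "{0..<t}" f "J - e"] by (auto simp: J_def)
    then obtain a where a: "0 \<le> a" "a < t" "J - e < f a" by auto
    show "\<forall>\<^sub>F s in at_left t. dist (f s) J < e"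
    proof (rule eventually_at_leftI[OF _ a(2)])
      fix s assume s: "s \<in> {a<..<t}"
      then have "f s \<le> J" unfolding J_def using a bdd by (intro cSUP_upper) auto
      then show "dist (f s) J < e" using mono[of a s] s a by (auto simp: dist_real_def)
    qed
  qed
  then show "\<exists>l. (f \<longlongrightarrow> l) (at_left t)" by blast
qed

lemma cadlag_path_inverse:
  assumes l: "subordinator_path l"
  shows "cadlag (path_inverse l)"
proof (rule cadlag_mono)
  fix t e :: real assume "0 \<le> t" "0 < e"
  then have "path_inverse l t < path_inverse l t + e / 2" by simp
  then obtain q where q: "0 < q" "q < path_inverse l t + e / 2" "t < l q"
    using path_inverse_less_iff[OF l] by blast
  \<comment> \<open>A level strictly between \<open>t\<close> and \<open>l q\<close> is still
    exceeded at time \<open>q\<close>; the midpoint is one.\<close>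
  have "path_inverse l ((t + l q) / 2) \<le> q" using q by (intro path_inverse_le) auto
  then show "\<exists>b>t. path_inverse l b < path_inverse l t + e"
    using q \<open>0 < e\<close> by (intro exI[of _ "(t + l q) / 2"]) auto
qed (use path_inverse_mono[OF l] in auto)

text \<open>The constant \<open>B\<close> absorbs the finitely many early terms, so the estimate
  holds at every index. It will be used at indices that vary with \<open>u\<close> and
  \<open>t\<close>.\<close>

lemma average_linear_bound:
  fixes a :: "nat \<Rightarrow> real"
  assumes lim: "(\<lambda>n. a n / real n) \<longlonglongrightarrow> m" and d: "d > 0"
  obtains B where "B \<ge> 0" "\<And>n. \<bar>a n - m * real n\<bar> \<le> d * real n + B"
proof -
  have "\<forall>\<^sub>F n in sequentially. dist (a n / real n) m < d" using lim d by (rule tendstoD)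
  then obtain n0 where n0: "\<And>n. n \<ge> n0 \<Longrightarrow> \<bar>a n / real n - m\<bar> < d"
    by (auto simp: eventually_sequentially dist_real_def)
  define B where "B = (\<Sum>n\<le>n0. \<bar>a n - m * real n\<bar>)"
  have B: "B \<ge> 0" by (simp add: B_def sum_nonneg)
  have "\<bar>a n - m * real n\<bar> \<le> d * real n + B" for n
  proof (cases "n \<le> n0")
    case True
    have "\<bar>a n - m * real n\<bar> \<le> B" unfolding B_def using True by (intro member_le_sum) auto
    then show ?thesis using d by (smt (verit) of_nat_0_le_iff mult_nonneg_nonneg)
  next
    case False
    then have n: "real n > 0" by simp
    have "a n - m * real n = (a n / real n - m) * real n" using n by (simp add: left_diff_distrib)
    then have "\<bar>a n - m * real n\<bar> = \<bar>a n / real n - m\<bar> * real n" by (simp add: abs_mult)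
    also have "\<dots> \<le> d * real n" using n0[of n] False by (intro mult_right_mono) auto
    finally show ?thesis using B by simp
  qed
  with B show ?thesis using that by blast
qed

text \<open>Rescaled increments of \<open>l\<close> over the cells cut out by the partial sums of
  \<open>g\<close>. They telescope, so the renewal epochs are values of
  \<open>u * l\<close>.\<close>

definition sampled_path :: "(real \<Rightarrow> real) \<Rightarrow> (nat \<Rightarrow> real) \<Rightarrow> real \<Rightarrow> real \<Rightarrow> nat \<Rightarrow> real" where
  "sampled_path l g \<alpha> u k = u * (l ((\<Sum>j<Suc k. g j) / u powr \<alpha>) - l ((\<Sum>j<k. g j) / u powr \<alpha>))"

lemma sum_sampled_path: "l 0 = 0 \<Longrightarrow> (\<Sum>k<n. sampled_path l g \<alpha> u k) = u * l ((\<Sum>j<n. g j) / u powr \<alpha>)"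
  by (induction n) (auto simp: sampled_path_def algebra_simps)

lemma renewal_sequence_sampled_path:
  assumes l: "subordinator_path l" and g: "\<And>k. g k > 0" and lim: "(\<lambda>n. (\<Sum>j<n. g j) / real n) \<longlonglongrightarrow> 1 / c" and c: "c > 0" and u: "u > 0"
  shows "renewal_sequence (sampled_path l g \<alpha> u)"
  unfolding renewal_sequence_def
proof (intro conjI allI)
  have l0: "l 0 = 0" using l by (simp add: subordinator_path_def)
  have U: "u powr \<alpha> > 0" using u by simp
  have G0: "0 \<le> (\<Sum>j<k. g j)" for k using g by (intro sum_nonneg) (auto intro: less_imp_le)
  fix k
  have "(\<Sum>j<k. g j) / u powr \<alpha> \<le> (\<Sum>j<Suc k. g j) / u powr \<alpha>"
    using g[of k] U by (intro divide_right_mono) auto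
  then have "l ((\<Sum>j<k. g j) / u powr \<alpha>) \<le> l ((\<Sum>j<Suc k. g j) / u powr \<alpha>)"
    using G0[of k] U by (intro subordinator_path_mono[OF l]) auto
  then show "0 \<le> sampled_path l g \<alpha> u k" using u unfolding sampled_path_def by (intro mult_nonneg_nonneg) auto
next
  fix m :: nat
  have l0: "l 0 = 0" using l by (simp add: subordinator_path_def)
  obtain s where s: "s > 0" "real m / u < l s" using subordinator_path_unbounded[OF l] by blast
  obtain B where B: "B \<ge> 0" "\<And>n. \<bar>(\<Sum>j<n. g j) - 1 / c * real n\<bar> \<le> 1 / (2 * c) * real n + B"
    using average_linear_bound[OF lim, of "1 / (2 * c)"] c by auto
  \<comment> \<open>The sum of the first \<open>n\<close> terms of \<open>g\<close> is at least
    \<open>n / (2 * c) - B\<close>; this \<open>n\<close> pushes it past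
    \<open>s * u powr \<alpha>\<close>, where \<open>l\<close> exceeds \<open>m / u\<close>.\<close>
  obtain n :: nat where n: "real n \<ge> 2 * c * (s * u powr \<alpha> + B)" using real_arch_simple by blast
  then have "real n / (2 * c) \<ge> s * u powr \<alpha> + B" using c by (simp add: field_simps)
  moreover have "1 / c * real n - 1 / (2 * c) * real n = real n / (2 * c)" using c by (simp add: field_simps)
  ultimately have "(\<Sum>j<n. g j) \<ge> s * u powr \<alpha>" using B(2)[of n] by linarith
  then have "s \<le> (\<Sum>j<n. g j) / u powr \<alpha>" using u by (simp add: field_simps)
  then have "real m / u < l ((\<Sum>j<n. g j) / u powr \<alpha>)"
    using subordinator_path_mono[OF l, of s] s by (meson less_imp_le less_le_trans)
  then have "real m < (\<Sum>k<n. sampled_path l g \<alpha> u k)"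
    unfolding sum_sampled_path[of l, OF l0] using u by (simp add: field_simps)
  then show "\<exists>n. real m < (\<Sum>k<n. sampled_path l g \<alpha> u k)" by blast
qed

text \<open>Let \<open>G n\<close> be the partial sums of \<open>g\<close> and
  \<open>U = u powr \<alpha>\<close>. A count of \<open>n\<close> at time \<open>u * t\<close> means
  that \<open>l\<close> is at most \<open>t\<close> at \<open>G n / U\<close> and above
  \<open>t\<close> at \<open>G (n + 1) / U\<close>, so the inverse of \<open>l\<close> at
  \<open>t\<close> lies between these arguments. The averages of \<open>G\<close> then place
  \<open>n / U\<close> near \<open>c\<close> times this inverse, with constants that depend on
  \<open>t\<close> only through \<open>T\<close>.\<close>

lemma sampled_path_count_convergence:
  assumes l: "subordinator_path l" and g: "\<And>k. g k > 0" and lim: "(\<lambda>n. (\<Sum>j<n. g j) / real n) \<longlonglongrightarrow> 1 / c" and c: "c > 0"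
    and \<alpha>: "\<alpha> > 0" and T: "T \<ge> 0" and e: "e > 0"
  shows "\<forall>\<^sub>F u in at_top. \<forall>t\<in>{0..T}.
    \<bar>real (renewal_count (sampled_path l g \<alpha> u) (u * t)) / u powr \<alpha> - c * path_inverse l t\<bar> < e"
proof -
  have l0: "l 0 = 0" using l by (simp add: subordinator_path_def)
  define y0 where "y0 = path_inverse l T"
  have y0: "y0 \<ge> 0" unfolding y0_def by (rule path_inverse_nonneg[OF l T])
  \<comment> \<open>Chosen so that the relative error satisfies
    \<open>2 * d * (c * y0) \<le> e / 2\<close>, while \<open>d \<le> 1 / 2\<close> allows
    \<open>n\<close> to be bounded by \<open>2 * (A + K)\<close>. The added 1 covers
    \<open>y0 = 0\<close>.\<close>
  define d where "d = min (1 / 2) (e / (4 * (c * y0 + 1)))"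
  have d: "d > 0" using e c y0 by (auto simp: d_def intro!: divide_pos_pos add_nonneg_pos)
  have d2: "d \<le> 1 / 2" unfolding d_def by (rule min.cobounded1)
  note d = d d2
  have "d * (4 * (c * y0 + 1)) \<le> e"
  proof -
    have "d \<le> e / (4 * (c * y0 + 1))" by (simp add: d_def)
    moreover have "4 * (c * y0 + 1) > 0" using c y0 by (auto intro!: add_nonneg_pos)
    ultimately show ?thesis by (simp add: pos_le_divide_eq)
  qed
  then have dy: "2 * d * (c * y0) \<le> e / 2" using d by (simp add: algebra_simps)
  obtain B where B: "B \<ge> 0" "\<And>n. \<bar>(\<Sum>j<n. g j) - 1 / c * real n\<bar> \<le> d / c * real n + B"
    using average_linear_bound[OF lim, of "d / c"] c d by auto
  define K where "K = c * B"
  have K: "K \<ge> 0" using B c by (simp add: K_def)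
  have KB: "\<bar>c * (\<Sum>j<n. g j) - real n\<bar> \<le> d * real n + K" for n
  proof -
    have "c * (\<Sum>j<n. g j) - real n = c * ((\<Sum>j<n. g j) - 1 / c * real n)" using c by (simp add: algebra_simps)
    then have "\<bar>c * (\<Sum>j<n. g j) - real n\<bar> = c * \<bar>(\<Sum>j<n. g j) - 1 / c * real n\<bar>" using c by (simp add: abs_mult)
    also have "\<dots> \<le> c * (d / c * real n + B)" using B(2)[of n] c by (intro mult_left_mono) auto
    also have "\<dots> = d * real n + K" using c by (simp add: K_def algebra_simps)
    finally show ?thesis .
  qed
  have "filterlim (\<lambda>u :: real. u powr \<alpha>) at_top at_top" using \<alpha> by real_asymp
  \<comment> \<open>The additive error is at most \<open>2 * K + 3\<close>, where the 3 pays for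
    passing from \<open>n\<close> to \<open>n + 1\<close>; division by
    \<open>u powr \<alpha>\<close> brings it below \<open>e / 2\<close>.\<close>
  then have "\<forall>\<^sub>F u :: real in at_top. (2 * K + 3) / (e / 2) < u powr \<alpha>" by (simp add: filterlim_at_top_dense)
  then show ?thesis using eventually_gt_at_top[of 0]
  proof eventually_elim
    case (elim u)
    define U where "U = u powr \<alpha>"
    have U: "U > 0" "(2 * K + 3) / U < e / 2" using elim e by (auto simp: U_def field_simps)
    have x: "renewal_sequence (sampled_path l g \<alpha> u)"
      by (rule renewal_sequence_sampled_path[OF l g lim c]) (use elim in auto)
    show ?case
    proof
      fix t assume t: "t \<in> {0..T}"
      define n where "n = renewal_count (sampled_path l g \<alpha> u) (u * t)"
      define y where "y = path_inverse l t"
      have y: "0 \<le> y" "y \<le> y0" unfolding y_def y0_def using t path_inverse_nonneg[OF l] path_inverse_mono[OF l] by auto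
      have ut: "u * t \<ge> 0" using t elim by simp
      have "(\<Sum>k<n. sampled_path l g \<alpha> u k) \<le> u * t \<and> u * t < (\<Sum>k<Suc n. sampled_path l g \<alpha> u k)"
        using renewal_count_eq_iff[OF x ut, of n] by (simp add: n_def)
      then have ln: "l ((\<Sum>j<n. g j) / U) \<le> t" "t < l ((\<Sum>j<Suc n. g j) / U)"
        unfolding sum_sampled_path[of l, OF l0] U_def using elim by auto
      have "0 < (\<Sum>j<Suc n. g j)" by (intro sum_pos g) auto
      moreover have "0 \<le> (\<Sum>j<n. g j)" using g by (intro sum_nonneg) (auto intro: less_imp_le)
      ultimately have Gpos: "0 \<le> (\<Sum>j<n. g j)" "0 < (\<Sum>j<Suc n. g j)" by auto
      have "(\<Sum>j<n. g j) / U \<le> y" unfolding y_def using ln Gpos U by (intro le_path_inverse[OF l]) auto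
      then have 1: "(\<Sum>j<n. g j) \<le> U * y" using U by (simp add: field_simps)
      have "y \<le> (\<Sum>j<Suc n. g j) / U" unfolding y_def using ln Gpos U by (intro path_inverse_le divide_pos_pos) auto
      then have 2: "U * y \<le> (\<Sum>j<Suc n. g j)" using U by (simp add: field_simps)
      have lower: "real n * (1 - d) - K \<le> c * (U * y)"
      proof -
        have "real n - (d * real n + K) \<le> c * (\<Sum>j<n. g j)" using KB[of n] by (simp add: abs_le_iff)
        also have "\<dots> \<le> c * (U * y)" using 1 c by (intro mult_left_mono) auto
        finally show ?thesis by (simp add: algebra_simps)
      qed
      have upper: "c * (U * y) \<le> (real n + 1) * (1 + d) + K"
      proof -
        have "c * (U * y) \<le> c * (\<Sum>j<Suc n. g j)" using 2 c by (intro mult_left_mono) auto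
        also have "\<dots> \<le> real (Suc n) + (d * real (Suc n) + K)" using KB[of "Suc n"] unfolding abs_le_iff by linarith
        finally show ?thesis by (simp add: algebra_simps)
      qed
      define A where "A = c * (U * y)"
      have A: "0 \<le> A" using c U y by (simp add: A_def)
      have n_le: "real n \<le> 2 * (A + K)"
      proof -
        have "real n * (1 / 2) \<le> real n * (1 - d)" using d by (intro mult_left_mono) auto
        moreover have "real n * (1 - d) \<le> A + K" using lower by (simp add: A_def)
        ultimately have "real n * (1 / 2) \<le> A + K" by (rule order_trans)
        then show ?thesis by simp
      qed
      have dn: "d * real n \<le> 2 * d * (A + K)" using mult_left_mono[OF n_le, of d] d by simp
      have dK: "2 * d * K \<le> K" using mult_right_mono[of "2 * d" 1 K] d K by simp
      have up: "real n - A \<le> 2 * d * A + 2 * K"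
        using lower dn dK unfolding A_def[symmetric] by (simp add: algebra_simps)
      have lo: "A - real n \<le> 2 * d * A + 2 * K + 3"
        using upper dn dK d unfolding A_def[symmetric] by (simp add: algebra_simps)
      have "\<bar>real n - A\<bar> \<le> 2 * d * A + (2 * K + 3)" using up lo by (simp add: abs_le_iff)
      then have "\<bar>real n - A\<bar> / U \<le> (2 * d * A + (2 * K + 3)) / U" using U by (intro divide_right_mono) auto
      also have "\<dots> = 2 * d * (c * y) + (2 * K + 3) / U" using U by (simp add: A_def add_divide_distrib)
      also have "2 * d * (c * y) \<le> 2 * d * (c * y0)" using d c y by (intro mult_left_mono) auto
      finally have "\<bar>real n - A\<bar> / U < e" using dy U by linarith
      moreover have "real n / U - c * y = (real n - A) / U" using U by (simp add: A_def diff_divide_distrib)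
      ultimately show "\<bar>real (renewal_count (sampled_path l g \<alpha> u) (u * t)) / u powr \<alpha> - c * path_inverse l t\<bar> < e"
        using U by (simp add: n_def[symmetric] y_def[symmetric] U_def[symmetric] abs_divide)
    qed
  qed
qed

text \<open>The class count among the first \<open>m\<close> customers is within
  \<open>d * m + B\<close> of \<open>p * m\<close> for every \<open>m\<close>, so it may be
  evaluated at \<open>m = n u t\<close>. The constants give \<open>e / 4\<close> to each of three
  errors: the slope \<open>d\<close>, the offset \<open>B\<close>, and the convergence of the
  counts.\<close>

lemma class_count_convergence:
  fixes n :: "real \<Rightarrow> real \<Rightarrow> nat"
  assumes lim: "(\<lambda>m. real (class_count c i m) / real m) \<longlonglongrightarrow> p" and p: "0 \<le> p" and g: "g > 0"
    and conv: "\<And>e. e > 0 \<Longrightarrow> \<forall>\<^sub>F u in at_top. \<forall>t\<in>{0..T}. \<bar>real (n u t) / u powr g - y t\<bar> < e"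
    and y: "\<And>t. t \<in> {0..T} \<Longrightarrow> y t \<le> Y0" and Y0: "Y0 \<ge> 0" and e: "e > 0"
  shows "\<forall>\<^sub>F u in at_top. \<forall>t\<in>{0..T}. \<bar>real (class_count c i (n u t)) / u powr g - p * y t\<bar> < e"
proof -
  define d where "d = e / (4 * (Y0 + 1))"
  have d: "d > 0" "d * (Y0 + 1) = e / 4" using e Y0 by (auto simp: d_def field_simps intro!: divide_pos_pos)
  obtain B where B: "B \<ge> 0" "\<And>m. \<bar>real (class_count c i m) - p * real m\<bar> \<le> d * real m + B"
    using average_linear_bound[OF lim d(1)] by blast
  define e1 where "e1 = min 1 (e / (4 * (p + 1)))"
  have e1: "e1 > 0" "e1 \<le> 1" using e p by (auto simp: e1_def)
  have "e1 \<le> e / (4 * (p + 1))" by (simp add: e1_def)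
  then have pe: "p * e1 \<le> e / 4" using p e1 e by (simp add: pos_le_divide_eq) (simp add: algebra_simps)
  have "filterlim (\<lambda>u :: real. u powr g) at_top at_top" using g by real_asymp
  then have "\<forall>\<^sub>F u :: real in at_top. B / (e / 4) < u powr g" by (simp add: filterlim_at_top_dense)
  with conv[OF e1(1)] eventually_gt_at_top[of 0] show ?thesis
  proof eventually_elim
    case (elim u)
    define U where "U = u powr g"
    have U: "U > 0" "B / U < e / 4" using elim e by (auto simp: U_def field_simps)
    show ?case
    proof
      fix t assume t: "t \<in> {0..T}"
      define m where "m = n u t"
      have 1: "\<bar>real m / U - y t\<bar> < e1" using elim t by (auto simp: m_def U_def)
      have m: "real m / U \<le> Y0 + 1" using 1 e1 y[OF t] by linarith
      have "real (class_count c i m) / U - p * y t = (real (class_count c i m) - p * real m) / U + p * (real m / U - y t)"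
        by (simp add: diff_divide_distrib algebra_simps)
      then have "\<bar>real (class_count c i m) / U - p * y t\<bar> \<le> \<bar>real (class_count c i m) - p * real m\<bar> / U + p * \<bar>real m / U - y t\<bar>"
        using U p abs_triangle_ineq[of "(real (class_count c i m) - p * real m) / U" "p * (real m / U - y t)"]
        by (simp add: abs_mult abs_divide)
      also have "\<dots> \<le> (d * real m + B) / U + p * e1"
        using B(2)[of m] U p 1 by (intro add_mono divide_right_mono mult_left_mono) auto
      also have "(d * real m + B) / U = d * (real m / U) + B / U" by (simp add: add_divide_distrib)
      also have "d * (real m / U) \<le> d * (Y0 + 1)" using m d by (intro mult_left_mono) auto
      finally have "\<bar>real (class_count c i m) / U - p * y t\<bar> < e" using d(2) pe U e by linarith
      then show "\<bar>real (class_count c i (n u t)) / u powr g - p * y t\<bar> < e" by (simp add: m_def U_def)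
    qed
  qed
qed

section \<open>Coupling arrivals with a stable subordinator\<close>

text \<open>Exponential variables become an instance of \<open>renewal_process\<close> with index 1,
  so positivity and joint Laplace transforms are available for them.\<close>

lemma mittag_leffler_1: "mittag_leffler 1 z = exp z"
proof -
  have "1 / Gamma (1 + 1 * real l) * z ^ l = z ^ l /\<^sub>R fact l" for l
    using Gamma_fact[of l, where 'a = real] by (simp add: add.commute divide_inverse mult.commute)
  then show ?thesis unfolding mittag_leffler_powser exp_def by simp
qed

text \<open>Replace the random time by grid points to its right: these take countably many values,
  and right continuity recovers the value at \<open>T w\<close>.\<close>

lemma borel_measurable_random_time:
  fixes f :: "real \<Rightarrow> 'w \<Rightarrow> real"
  assumes f: "\<And>s. s \<ge> 0 \<Longrightarrow> f s \<in> borel_measurable W"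
    and right: "\<And>s w. s \<ge> 0 \<Longrightarrow> w \<in> space W \<Longrightarrow> ((\<lambda>s. f s w) \<longlongrightarrow> f s w) (at_right s)"
    and T [measurable]: "T \<in> borel_measurable W" and T_nonneg: "\<And>w. w \<in> space W \<Longrightarrow> 0 \<le> T w"
  shows "(\<lambda>w. f (T w) w) \<in> borel_measurable W"
proof (rule borel_measurable_LIMSEQ_real)
  \<comment> \<open>The approximation is \<open>(r m w + 1) / Suc m\<close>; the added 1 keeps it
    strictly above \<open>T w\<close>, as the one-sided limit requires.\<close>
  define r where "r m w = nat \<lfloor>real (Suc m) * T w\<rfloor>" for m w
  fix w assume w: "w \<in> space W"
  have "(\<lambda>m. (real (r m w) + 1) / real (Suc m)) \<longlonglongrightarrow> T w"
  proof (rule tendsto_sandwich)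
    have fl: "real (r m w) = real_of_int \<lfloor>real (Suc m) * T w\<rfloor>" for m
      using T_nonneg[OF w] by (simp add: r_def)
    show "\<forall>\<^sub>F m in sequentially. T w \<le> (real (r m w) + 1) / real (Suc m)"
    proof (rule always_eventually, rule allI)
      fix m
      have "real (Suc m) * T w \<le> real (r m w) + 1" unfolding fl by linarith
      then show "T w \<le> (real (r m w) + 1) / real (Suc m)" by (simp add: pos_le_divide_eq mult.commute del: of_nat_Suc)
    qed
    show "\<forall>\<^sub>F m in sequentially. (real (r m w) + 1) / real (Suc m) \<le> T w + 1 / real (Suc m)"
    proof (rule always_eventually, rule allI)
      fix m
      have "real (r m w) \<le> real (Suc m) * T w" unfolding fl by linarith
      then have "real (r m w) / real (Suc m) \<le> T w" by (simp add: pos_divide_le_eq mult.commute del: of_nat_Suc)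
      then show "(real (r m w) + 1) / real (Suc m) \<le> T w + 1 / real (Suc m)" by (simp add: add_divide_distrib del: of_nat_Suc)
    qed
    show "(\<lambda>m. T w + 1 / real (Suc m)) \<longlonglongrightarrow> T w"
      using tendsto_add[OF tendsto_const LIMSEQ_inverse_real_of_nat, of "T w"] by (simp add: inverse_eq_divide del: of_nat_Suc)
  qed simp
  moreover have "T w < (real (r m w) + 1) / real (Suc m)" for m
  proof -
    have "real (Suc m) * T w < real (r m w) + 1" using T_nonneg[OF w] unfolding r_def by simp
    then show ?thesis by (simp add: pos_less_divide_eq mult.commute del: of_nat_Suc)
  qed
  ultimately have "filterlim (\<lambda>m. (real (r m w) + 1) / real (Suc m)) (at_right (T w)) sequentially"
    unfolding filterlim_at by (intro conjI always_eventually allI) (auto simp: less_imp_neq[symmetric] simp del: of_nat_Suc)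
  from filterlim_compose[OF right[OF T_nonneg[OF w] w] this]
  show "(\<lambda>m. f ((real (r m w) + 1) / real (Suc m)) w) \<longlonglongrightarrow> f (T w) w" .
next
  fix m
  have [measurable]: "(\<lambda>w. nat \<lfloor>real (Suc m) * T w\<rfloor>) \<in> measurable W (count_space UNIV)" by measurable
  show "(\<lambda>w. f ((real (nat \<lfloor>real (Suc m) * T w\<rfloor>) + 1) / real (Suc m)) w) \<in> borel_measurable W"
    by (rule measurable_compose_countable[where f = "\<lambda>k w. f ((real k + 1) / real (Suc m)) w"]) (auto intro!: f)
qed

text \<open>A version of the subordinator all of whose paths are regular; on the exceptional null set it is
  replaced by the identity path.\<close>

lemma regular_subordinator:
  fixes M :: "'b measure"
  assumes M: "prob_space M" and Y: "inverse_stable_subordinator M \<theta> Y" and th: "\<theta> > 0"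
  obtains L :: "'b \<Rightarrow> real \<Rightarrow> real" where
    "\<forall>\<omega>. subordinator_path (L \<omega>)"
    "\<forall>s\<ge>0. (\<lambda>\<omega>. L \<omega> s) \<in> borel_measurable M"
    "AE \<omega> in M. \<forall>t\<ge>0. Y t \<omega> = path_inverse (L \<omega>) t"
    "\<forall>\<tau> t n. 0 \<le> \<tau> 0 \<longrightarrow> strict_mono \<tau> \<longrightarrow> (\<forall>k. 0 \<le> t k) \<longrightarrow>
      (\<integral>\<omega>. (\<Prod>k<n. exp (- (t k * (L \<omega> (\<tau> (Suc k)) - L \<omega> (\<tau> k))))) \<partial>M) =
      (\<Prod>k<(n::nat). exp (- ((\<tau> (Suc k) - \<tau> k) * t k powr \<theta>)))"
proof -
  interpret prob_space M by fact
  obtain L where L: "standard_stable_subordinator M \<theta> L"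
    and YL: "AE \<omega> in M. \<forall>t\<ge>0. Y t \<omega> = Inf {s. s > 0 \<and> L s \<omega> > t}"
    using Y by (auto simp: inverse_stable_subordinator_def)
  have meas: "L s \<in> borel_measurable M" if "s \<ge> 0" for s
    using L that by (auto simp: standard_stable_subordinator_def levy_process_def)
  have L0: "AE \<omega> in M. L 0 \<omega> = 0" and cad: "AE \<omega> in M. cadlag (\<lambda>t. L t \<omega>)" and mono: "AE \<omega> in M. mono_on {0..} (\<lambda>s. L s \<omega>)"
    using L by (auto simp: standard_stable_subordinator_def levy_process_def)
  have Lap: "expectation (\<lambda>\<omega>. exp (- (t * L s \<omega>))) = exp (- (s * t powr \<theta>))" if "s \<ge> 0" "t \<ge> 0" for s t
    using L that by (auto simp: standard_stable_subordinator_def)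
  \<comment> \<open>The integral of a non-integrable function would be 0, but the transform is an
    exponential and therefore nonzero.\<close>
  have Lap_int: "integrable M (\<lambda>\<omega>. exp (- (t * L s \<omega>)))" if "s \<ge> 0" "t \<ge> 0" for s t
    using Lap[OF that] not_integrable_integral_eq[of M "\<lambda>\<omega>. exp (- (t * L s \<omega>))"] by (metis exp_not_eq_zero)
  \<comment> \<open>Chernoff's bound. With \<open>a = 0\<close> and \<open>t\<close> tending to
    infinity it gives positivity after time 0; with \<open>t = 1\<close> and \<open>s\<close>
    tending to infinity it gives unboundedness.\<close>
  have markov: "prob {\<omega> \<in> space M. L s \<omega> \<le> a} \<le> exp (t * a) * exp (- (s * t powr \<theta>))" if "s \<ge> 0" "t \<ge> 0" for s t a
  proof -
    note [measurable] = meas[OF that(1)]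
    have "prob {\<omega> \<in> space M. L s \<omega> \<le> a} = expectation (indicator {\<omega> \<in> space M. L s \<omega> \<le> a})" by simp
    also have "\<dots> \<le> expectation (\<lambda>\<omega>. exp (t * a) * exp (- (t * L s \<omega>)))"
    proof (rule integral_mono)
      fix \<omega>
      have "1 \<le> exp (t * a) * exp (- (t * L s \<omega>))" if "L s \<omega> \<le> a"
        using that \<open>t \<ge> 0\<close> by (simp add: exp_add[symmetric] mult_left_mono)
      then show "indicator {\<omega> \<in> space M. L s \<omega> \<le> a} \<omega> \<le> exp (t * a) * exp (- (t * L s \<omega>))"
        by (auto simp: indicator_def)
    next
      show "integrable M (indicator {\<omega> \<in> space M. L s \<omega> \<le> a} :: 'b \<Rightarrow> real)"
        by (rule integrable_const_bound[of _ 1]) (auto simp: indicator_def)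
    qed (use Lap_int that in \<open>auto intro!: integrable_mult_right\<close>)
    finally show ?thesis using Lap[OF that] by simp
  qed
  have pos: "AE \<omega> in M. 0 < L (1 / real (Suc j)) \<omega>" for j
  proof -
    define s where "s = 1 / real (Suc j)"
    have s: "s > 0" by (simp add: s_def)
    note [measurable] = meas[of s]
    have "(\<lambda>n. exp (- (s * real n powr \<theta>))) \<longlonglongrightarrow> 0" using s th by real_asymp
    then have "prob {\<omega> \<in> space M. L s \<omega> \<le> 0} \<le> 0"
      by (rule tendsto_lowerbound) (use markov[of s _ 0] s in \<open>auto intro!: always_eventually\<close>)
    then have "prob {\<omega> \<in> space M. L s \<omega> \<le> 0} = 0" by (simp add: measure_le_0_iff)
    then have "AE \<omega> in M. \<omega> \<notin> {\<omega> \<in> space M. L s \<omega> \<le> 0}" using s by (subst (asm) prob_eq_0) auto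
    then show ?thesis unfolding s_def[symmetric] using AE_space by eventually_elim auto
  qed
  have unb: "AE \<omega> in M. \<exists>n. real m < L (real (Suc n)) \<omega>" for m :: nat
  proof -
    define A where "A = {\<omega> \<in> space M. \<forall>n. L (real (Suc n)) \<omega> \<le> real m}"
    have A [measurable]: "A \<in> sets M" unfolding A_def using meas by (intro sets.sets_Collect_countable_All) (auto simp del: of_nat_Suc)
    have "prob A \<le> exp (real m) * exp (- real (Suc n))" for n
    proof -
      have "prob A \<le> prob {\<omega> \<in> space M. L (real (Suc n)) \<omega> \<le> real m}"
        using meas[of "real (Suc n)"] by (intro finite_measure_mono) (auto simp: A_def simp del: of_nat_Suc)
      then show ?thesis using markov[of "real (Suc n)" 1 "real m"] by simp
    qed
    moreover have "(\<lambda>n. exp (real m) * exp (- real (Suc n))) \<longlonglongrightarrow> 0" by real_asymp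
    ultimately have "prob A \<le> 0" using LIMSEQ_le_const by blast
    then have "prob A = 0" by (simp add: measure_le_0_iff)
    then have "AE \<omega> in M. \<omega> \<notin> A" by (subst (asm) prob_eq_0) auto
    then show ?thesis using AE_space by eventually_elim (auto simp: A_def not_le)
  qed
  define good where "good \<omega> \<longleftrightarrow> subordinator_path (\<lambda>s. L s \<omega>) \<and> (\<forall>t\<ge>0. Y t \<omega> = path_inverse (\<lambda>s. L s \<omega>) t)" for \<omega>
  have "AE \<omega> in M. \<forall>j. 0 < L (1 / real (Suc j)) \<omega>" using pos unfolding AE_all_countable by blast
  moreover have "AE \<omega> in M. \<forall>m. \<exists>n. real m < L (real (Suc n)) \<omega>" using unb unfolding AE_all_countable by blast
  ultimately have "AE \<omega> in M. good \<omega>"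
    using YL L0 cad mono
  proof eventually_elim
    case (elim \<omega>)
    have "0 < L s \<omega>" if s: "s > 0" for s
    proof -
      obtain j where j: "1 / real (Suc j) < s" using nat_approx_posE[OF s] by blast
      have "0 < L (1 / real (Suc j)) \<omega>" using elim(1) by blast
      also have "\<dots> \<le> L s \<omega>" using j s by (intro mono_onD[OF elim(6)]) auto
      finally show ?thesis .
    qed
    moreover have "\<exists>s>0. real m < L s \<omega>" for m :: nat
      using elim(2)[rule_format, of m] by (metis of_nat_0_less_iff zero_less_Suc)
    ultimately show ?case unfolding good_def subordinator_path_def path_inverse_def using elim by auto
  qed
  then obtain Z where Z: "{\<omega> \<in> space M. \<not> good \<omega>} \<subseteq> Z" "Z \<in> sets M" "emeasure M Z = 0" by (auto elim: AE_E)
  define G where "G = space M - Z"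
  have G [measurable]: "G \<in> sets M" using Z by (auto simp: G_def)
  have G_AE: "AE \<omega> in M. \<omega> \<in> G"
    using Z AE_not_in[of Z M] AE_space by (auto simp: G_def null_sets_def)
  have G_good: "good \<omega>" if "\<omega> \<in> G" for \<omega> using that Z by (auto simp: G_def)
  define L' where "L' \<omega> s = (if \<omega> \<in> G then L s \<omega> else s)" for \<omega> s
  have id_path: "subordinator_path (\<lambda>s. s)"
    unfolding subordinator_path_def cadlag_def
  proof (intro conjI allI impI)
    show "\<exists>s>0. real m < s" for m :: nat by (intro exI[of _ "real m + 1"]) auto
    show "\<exists>l. ((\<lambda>s. s) \<longlongrightarrow> l) (at_left t)" for t :: real by (intro exI[of _ t] tendsto_ident_at)
  qed (auto intro: mono_onI tendsto_ident_at)
  show ?thesis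
  proof
    have "subordinator_path (L' \<omega>)" for \<omega>
      using G_good[of \<omega>] id_path by (cases "\<omega> \<in> G") (auto simp: L'_def[abs_def] good_def)
    then show "\<forall>\<omega>. subordinator_path (L' \<omega>)" by blast
  next
    have "(\<lambda>\<omega>. L' \<omega> s) \<in> borel_measurable M" if "s \<ge> 0" for s
    proof -
      note [measurable] = meas[OF that]
      show ?thesis unfolding L'_def by measurable
    qed
    then show "\<forall>s\<ge>0. (\<lambda>\<omega>. L' \<omega> s) \<in> borel_measurable M" by blast
  next
    show "AE \<omega> in M. \<forall>t\<ge>0. Y t \<omega> = path_inverse (L' \<omega>) t"
      using G_AE by eventually_elim (use G_good in \<open>auto simp: L'_def[abs_def] good_def\<close>)
  next
    show "\<forall>\<tau> t n. 0 \<le> \<tau> 0 \<longrightarrow> strict_mono \<tau> \<longrightarrow> (\<forall>k. 0 \<le> t k) \<longrightarrow>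
      (\<integral>\<omega>. (\<Prod>k<n. exp (- (t k * (L' \<omega> (\<tau> (Suc k)) - L' \<omega> (\<tau> k))))) \<partial>M) =
      (\<Prod>k<(n::nat). exp (- ((\<tau> (Suc k) - \<tau> k) * t k powr \<theta>)))"
    proof (intro allI impI)
    fix \<tau> t :: "nat \<Rightarrow> real" and n :: nat assume tau: "0 \<le> \<tau> 0" "strict_mono \<tau>" and t': "\<forall>k. 0 \<le> t k"
    then have t: "0 \<le> t k" for k by blast
    have tau_nonneg: "0 \<le> \<tau> k" for k using tau strict_mono_less_eq[OF tau(2), of 0 k] by (meson le0 order_trans)
    have tau_less: "\<tau> k < \<tau> (Suc k)" for k using tau(2) by (simp add: strict_mono_Suc_iff)
    have "(\<integral>\<omega>. (\<Prod>k<n. exp (- (t k * (L' \<omega> (\<tau> (Suc k)) - L' \<omega> (\<tau> k))))) \<partial>M) =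
      (\<integral>\<omega>. (\<Prod>k<n. exp (- (t k * (L (\<tau> (Suc k)) \<omega> - L (\<tau> k) \<omega>)))) \<partial>M)"
    proof (rule integral_cong_AE)
      note [measurable] = meas[OF tau_nonneg]
      show "(\<lambda>\<omega>. \<Prod>k<n. exp (- (t k * (L' \<omega> (\<tau> (Suc k)) - L' \<omega> (\<tau> k))))) \<in> borel_measurable M"
        unfolding L'_def by measurable
      show "(\<lambda>\<omega>. \<Prod>k<n. exp (- (t k * (L (\<tau> (Suc k)) \<omega> - L (\<tau> k) \<omega>)))) \<in> borel_measurable M" by measurable
      show "AE \<omega> in M. (\<Prod>k<n. exp (- (t k * (L' \<omega> (\<tau> (Suc k)) - L' \<omega> (\<tau> k))))) =
        (\<Prod>k<n. exp (- (t k * (L (\<tau> (Suc k)) \<omega> - L (\<tau> k) \<omega>))))"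
        using G_AE by eventually_elim (simp add: L'_def)
    qed
    also have "\<dots> = (\<Prod>k<n. exp (- ((\<tau> (Suc k) - \<tau> k) * t k powr \<theta>)))"
    proof (cases "n = 0")
      case False
      have "indep_vars (\<lambda>_. borel) (\<lambda>k \<omega>. L (\<tau> (Suc k)) \<omega> - L (\<tau> k) \<omega>) UNIV"
        using L tau by (auto simp: standard_stable_subordinator_def levy_process_def)
      then have "indep_vars (\<lambda>_. borel) (\<lambda>k. (\<lambda>x. exp (- (t k * x))) \<circ> (\<lambda>\<omega>. L (\<tau> (Suc k)) \<omega> - L (\<tau> k) \<omega>)) {..<n}"
        by (intro indep_vars_compose[OF indep_vars_subset]) auto
      then have ind: "indep_vars (\<lambda>_. borel) (\<lambda>k \<omega>. exp (- (t k * (L (\<tau> (Suc k)) \<omega> - L (\<tau> k) \<omega>)))) {..<n}"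
        by (simp add: comp_def)
      \<comment> \<open>Stationarity replaces the increment by the value at time \<open>h\<close>,
        whose transform is part of the definition of the subordinator.\<close>
      have one: "has_bochner_integral M (\<lambda>\<omega>. exp (- (t k * (L (\<tau> (Suc k)) \<omega> - L (\<tau> k) \<omega>)))) (exp (- ((\<tau> (Suc k) - \<tau> k) * t k powr \<theta>)))" for k
      proof -
        define h where "h = \<tau> (Suc k) - \<tau> k"
        have h: "h \<ge> 0" using tau_less[of k] by (simp add: h_def)
        note [measurable] = meas[OF tau_nonneg] meas[OF h]
        have D: "distr M borel (\<lambda>\<omega>. L (\<tau> k + h) \<omega> - L (\<tau> k) \<omega>) = distr M borel (L h)"
          using L tau_nonneg[of k] h by (auto simp: standard_stable_subordinator_def levy_process_def)
        have tk: "\<tau> k + h = \<tau> (Suc k)" by (simp add: h_def)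
        have "has_bochner_integral (distr M borel (L h)) (\<lambda>x. exp (- (t k * x))) (exp (- (h * t k powr \<theta>)))"
          using Lap[OF h t[of k]] Lap_int[OF h t[of k]]
          by (simp add: has_bochner_integral_iff integrable_distr_eq integral_distr)
        then show ?thesis unfolding D[symmetric] tk h_def[symmetric]
          by (simp add: has_bochner_integral_iff integrable_distr_eq integral_distr)
      qed
      have "(\<integral>\<omega>. (\<Prod>k<n. exp (- (t k * (L (\<tau> (Suc k)) \<omega> - L (\<tau> k) \<omega>)))) \<partial>M) =
          (\<Prod>k<n. (\<integral>\<omega>. exp (- (t k * (L (\<tau> (Suc k)) \<omega> - L (\<tau> k) \<omega>))) \<partial>M))"
        by (rule indep_vars_lebesgue_integral[OF _ ind]) (use one in \<open>auto simp: has_bochner_integral_iff\<close>)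
      then show ?thesis using one by (simp add: has_bochner_integral_iff)
    qed (simp add: prob_space)
    finally show "(\<integral>\<omega>. (\<Prod>k<n. exp (- (t k * (L' \<omega> (\<tau> (Suc k)) - L' \<omega> (\<tau> k))))) \<partial>M) =
      (\<Prod>k<n. exp (- ((\<tau> (Suc k) - \<tau> k) * t k powr \<theta>)))" .
    qed
  qed
qed

text \<open>The coordinates of a product space, altered on a null set so that positivity and
  convergence of averages hold at every point. The substitute is the constant sequence
  \<open>1 / c\<close>, whose averages equal the mean.\<close>

lemma exponential_sequence:
  fixes c :: real
  assumes c: "c > 0"
  obtains E :: "(nat \<Rightarrow> real) measure" and e :: "nat \<Rightarrow> (nat \<Rightarrow> real) \<Rightarrow> real" where
    "prob_space E" "\<forall>k. e k \<in> borel_measurable E" "\<forall>k x. 0 < e k x"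
    "\<forall>x. (\<lambda>n. (\<Sum>k<n. e k x) / real n) \<longlonglongrightarrow> 1 / c"
    "\<forall>t n. (\<forall>k. 0 \<le> t k) \<longrightarrow> (\<integral>x. (\<Prod>k<(n::nat). exp (- (t k * e k x))) \<partial>E) = (\<Prod>k<n. c / (c + t k))"
proof -
  define D where "D = density lborel (exponential_density c)"
  interpret D: prob_space D unfolding D_def by (rule prob_space_exponential_density[OF c])
  interpret E: product_prob_space "\<lambda>_. D" UNIV ..
  define E where "E = Pi\<^sub>M (UNIV :: nat set) (\<lambda>_. D)"
  interpret P: prob_space E unfolding E_def by (rule E.P.prob_space_axioms)
  have sets_D [measurable_cong, simp]: "sets D = sets borel" by (simp add: D_def)
  have coord: "(\<lambda>x. x k) \<in> borel_measurable E" for k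
    unfolding E_def using measurable_component_singleton[of k UNIV "\<lambda>_. D"] measurable_cong_sets[OF refl sets_D] by auto
  note [measurable] = coord
  have distr_k: "distr E borel (\<lambda>x. x k) = D" for k
    using E.PiM_component[of k] unfolding E_def by (subst distr_cong[OF refl, of borel D]) auto
  have dist: "distributed E lborel (\<lambda>x. x k) (exponential_density c)" for k
  proof -
    have "distr E lborel (\<lambda>x. x k) = distr E borel (\<lambda>x. x k)" by (rule distr_cong) auto
    then show ?thesis using distr_k[of k] c by (simp add: distributed_def D_def exponential_density_nonneg)
  qed
  have indep: "P.indep_vars (\<lambda>_. borel) (\<lambda>k x. x k) UNIV"
  proof (subst P.indep_vars_iff_distr_eq_PiM)
    have "distr E (Pi\<^sub>M UNIV (\<lambda>_. borel)) (\<lambda>x. \<lambda>i\<in>UNIV. x i) = distr E E (\<lambda>x. x)"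
      by (rule distr_cong) (auto simp: E_def intro!: sets_PiM_cong)
    also have "\<dots> = E" by (rule distr_id)
    finally show "distr E (Pi\<^sub>M UNIV (\<lambda>_. borel)) (\<lambda>x. \<lambda>i\<in>UNIV. x i) = Pi\<^sub>M UNIV (\<lambda>i. distr E borel (\<lambda>x. x i))"
      unfolding distr_k by (simp only: E_def[symmetric])
  qed auto
  have cdf: "P.prob {x \<in> space E. x k \<le> a} = 1 - mittag_leffler 1 (- (c * a powr 1))" if "a \<ge> 0" for k a
    using P.exponential_distributedD_le[OF dist[of k] that c] that by (simp add: mittag_leffler_1 mult.commute)
  have nn: "AE x in E. 0 \<le> x k" for k
  proof (rule AE_distrD[OF coord])
    have "AE x in D. 0 \<le> x" unfolding D_def by (subst AE_density) (auto simp: exponential_density_def)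
    then show "AE x in distr E borel (\<lambda>x. x k). 0 \<le> x" unfolding distr_k .
  qed
  interpret R: renewal_process E "\<lambda>k x. x k" 1 c
    by (intro renewal_process.intro renewal_process_axioms.intro P.prob_space_axioms indep nn cdf c) auto
  have "AE x in E. (\<lambda>n. (\<Sum>k<n. x k) / real n) \<longlonglongrightarrow> 1 / c"
  proof (rule P.strong_law_nonneg[OF indep nn])
    show "integrable E (\<lambda>x. (x k)\<^sup>2)" for k by (rule P.erlang_ith_moment_integrable[OF c dist])
    show "P.expectation (\<lambda>x. x k) = 1 / c" for k by (rule P.exponential_distributed_expectation[OF c dist])
    show "P.variance (\<lambda>x. x k) = 1 / c\<^sup>2" for k by (rule P.exponential_distributed_variance[OF c dist])
  qed
  with R.positive_AE have good_AE: "AE x in E. (\<forall>k. 0 < x k) \<and> (\<lambda>n. (\<Sum>k<n. x k) / real n) \<longlonglongrightarrow> 1 / c"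
    by eventually_elim auto
  then obtain Z where Z: "{x \<in> space E. \<not> ((\<forall>k. 0 < x k) \<and> (\<lambda>n. (\<Sum>k<n. x k) / real n) \<longlonglongrightarrow> 1 / c)} \<subseteq> Z"
    "emeasure E Z = 0" "Z \<in> sets E" by (rule AE_E)
  define G where "G = space E - Z"
  have G [measurable]: "G \<in> sets E" using Z by (auto simp: G_def)
  have G_AE: "AE x in E. x \<in> G" using Z AE_not_in[of Z E] AE_space by (auto simp: G_def null_sets_def)
  have G_good: "0 < x k" "(\<lambda>n. (\<Sum>k<n. x k) / real n) \<longlonglongrightarrow> 1 / c" if "x \<in> G" for x k
    using that Z by (auto simp: G_def)
  define e where "e k x = (if x \<in> G then x k else 1 / c)" for k x
  have e_meas [measurable]: "e k \<in> borel_measurable E" for k unfolding e_def by measurable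
  show ?thesis
  proof
    show "prob_space E" by (rule P.prob_space_axioms)
    show "\<forall>k. e k \<in> borel_measurable E" using e_meas by blast
    show "\<forall>k x. 0 < e k x" using G_good(1) c by (simp add: e_def)
    have "(\<lambda>n. (\<Sum>k<n. e k x) / real n) \<longlonglongrightarrow> 1 / c" for x
    proof (cases "x \<in> G")
      case True
      then show ?thesis using G_good(2) by (simp add: e_def)
    next
      case False
      have "\<forall>\<^sub>F n in sequentially. (\<Sum>k<n. e k x) / real n = 1 / c"
        using eventually_gt_at_top[of 0] by eventually_elim (use False in \<open>simp add: e_def\<close>)
      then show ?thesis by (rule tendsto_eventually)
    qed
    then show "\<forall>x. (\<lambda>n. (\<Sum>k<n. e k x) / real n) \<longlonglongrightarrow> 1 / c" by blast
    show "\<forall>t n. (\<forall>k. 0 \<le> t k) \<longrightarrow> (\<integral>x. (\<Prod>k<(n::nat). exp (- (t k * e k x))) \<partial>E) = (\<Prod>k<n. c / (c + t k))"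
    proof (intro allI impI)
    fix t :: "nat \<Rightarrow> real" and n :: nat assume t: "\<forall>k. 0 \<le> t k"
    have "(\<integral>x. (\<Prod>k<n. exp (- (t k * e k x))) \<partial>E) = (\<integral>x. (\<Prod>k<n. exp (- (t k * x k))) \<partial>E)"
      by (rule integral_cong_AE) (use G_AE in \<open>auto elim!: eventually_mono simp: e_def\<close>)
    then show "(\<integral>x. (\<Prod>k<n. exp (- (t k * e k x))) \<partial>E) = (\<Prod>k<n. c / (c + t k))"
      using R.joint_Laplace[of t n] t by simp
    qed
  qed
qed

text \<open>The coupling space is \<open>M\<close> times a space of exponential variables. The limit
  path depends on the first component only, so it keeps the law it has on \<open>M\<close>, and one
  limit path serves all \<open>u\<close>.\<close>

lemma arrival_coupling:
  fixes M :: "'b measure"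
  assumes M: "prob_space M" and Y: "inverse_stable_subordinator M \<alpha> Y" and \<alpha>: "0 < \<alpha>" "\<alpha> \<le> 1" and c: "c > 0"
  obtains W :: "('b \<times> (nat \<Rightarrow> real)) measure" and x :: "real \<Rightarrow> 'b \<times> (nat \<Rightarrow> real) \<Rightarrow> nat \<Rightarrow> real"
    and y :: "'b \<Rightarrow> real \<Rightarrow> real" where
    "prob_space W" "fst \<in> measurable W M" "distr W M fst = M"
    "\<forall>u. x u \<in> measurable W (Pi\<^sub>M UNIV (\<lambda>_. borel))"
    "\<forall>u t n. u > 0 \<longrightarrow> (\<forall>k. 0 \<le> t k) \<longrightarrow>
      (\<integral>w. (\<Prod>k<(n::nat). exp (- (t k * x u w k))) \<partial>W) = (\<Prod>k<n. c / (c + t k powr \<alpha>))"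
    "\<forall>u>0. \<forall>w. renewal_sequence (x u w)"
    "\<forall>w. \<forall>T\<ge>0. \<forall>e>0. \<forall>\<^sub>F u in at_top. \<forall>t\<in>{0..T}.
      \<bar>real (renewal_count (x u w) (u * t)) / u powr \<alpha> - c * y (fst w) t\<bar> < e"
    "\<forall>\<omega>. cadlag (y \<omega>)" "\<forall>\<omega> s t. 0 \<le> s \<longrightarrow> s \<le> t \<longrightarrow> y \<omega> s \<le> y \<omega> t" "\<forall>\<omega>. y \<omega> 0 = 0"
    "\<forall>t. (\<lambda>\<omega>. y \<omega> t) \<in> borel_measurable M" "AE \<omega> in M. \<forall>t\<ge>0. Y t \<omega> = y \<omega> t"
proof -
  interpret M: prob_space M by fact
  obtain L :: "'b \<Rightarrow> real \<Rightarrow> real" where L': "\<forall>\<omega>. subordinator_path (L \<omega>)"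
    "\<forall>s\<ge>0. (\<lambda>\<omega>. L \<omega> s) \<in> borel_measurable M"
    "AE \<omega> in M. \<forall>t\<ge>0. Y t \<omega> = path_inverse (L \<omega>) t"
    "\<forall>\<tau> t n. 0 \<le> \<tau> 0 \<longrightarrow> strict_mono \<tau> \<longrightarrow> (\<forall>k. 0 \<le> t k) \<longrightarrow>
      (\<integral>\<omega>. (\<Prod>k<n. exp (- (t k * (L \<omega> (\<tau> (Suc k)) - L \<omega> (\<tau> k))))) \<partial>M) =
      (\<Prod>k<(n::nat). exp (- ((\<tau> (Suc k) - \<tau> k) * t k powr \<alpha>)))"
    by (rule regular_subordinator[OF M Y \<alpha>(1)])
  note L = L'[rule_format]
  obtain E :: "(nat \<Rightarrow> real) measure" and e :: "nat \<Rightarrow> (nat \<Rightarrow> real) \<Rightarrow> real" where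
    E': "prob_space E" "\<forall>k. e k \<in> borel_measurable E" "\<forall>k x. 0 < e k x"
    "\<forall>x. (\<lambda>n. (\<Sum>k<n. e k x) / real n) \<longlonglongrightarrow> 1 / c"
    "\<forall>t n. (\<forall>k. 0 \<le> t k) \<longrightarrow> (\<integral>x. (\<Prod>k<(n::nat). exp (- (t k * e k x))) \<partial>E) = (\<Prod>k<n. c / (c + t k))"
    by (rule exponential_sequence[OF c])
  note E = E'[rule_format]
  interpret E: prob_space E by (rule E(1))
  interpret P: pair_prob_space M E ..
  note [measurable] = E(2)
  define g where "g w k = e k (snd w)" for w :: "'b \<times> (nat \<Rightarrow> real)" and k
  define x where "x u w = sampled_path (L (fst w)) (g w) \<alpha> u" for u w
  define y where "y \<omega> = path_inverse (L \<omega>)" for \<omega>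
  have g_pos: "g w k > 0" for w k using E(3) by (simp add: g_def)
  have g_lim: "(\<lambda>n. (\<Sum>k<n. g w k) / real n) \<longlonglongrightarrow> 1 / c" for w using E(4) by (simp add: g_def)
  have g_meas [measurable]: "(\<lambda>w. g w k) \<in> borel_measurable (M \<Otimes>\<^sub>M E)" for k unfolding g_def by measurable
  have Lt_meas: "(\<lambda>w. L (fst w) (T w)) \<in> borel_measurable (M \<Otimes>\<^sub>M E)"
    if "T \<in> borel_measurable (M \<Otimes>\<^sub>M E)" "\<And>w. w \<in> space (M \<Otimes>\<^sub>M E) \<Longrightarrow> 0 \<le> T w" for T
  proof (rule borel_measurable_random_time[where f = "\<lambda>s w. L (fst w) s"])
    show "(\<lambda>w. L (fst w) s) \<in> borel_measurable (M \<Otimes>\<^sub>M E)" if "s \<ge> 0" for s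
      using measurable_compose[OF measurable_fst L(2)[OF that]] .
    show "(L (fst w) \<longlongrightarrow> L (fst w) s) (at_right s)" if "s \<ge> 0" for s w
      using L(1)[of "fst w"] that by (auto simp: subordinator_path_def cadlag_def)
  qed (use that in auto)
  have G_nonneg: "0 \<le> (\<Sum>j<k. g w j) / u powr \<alpha>" for k w u
    by (intro divide_nonneg_nonneg sum_nonneg less_imp_le[OF g_pos]) auto
  have xk_meas [measurable]: "(\<lambda>w. x u w k) \<in> borel_measurable (M \<Otimes>\<^sub>M E)" for u k
    unfolding x_def sampled_path_def by (intro borel_measurable_times borel_measurable_diff borel_measurable_const Lt_meas G_nonneg) measurable
  have x_nonneg: "0 \<le> x u w k" if "u > 0" for u w k
    unfolding x_def by (rule renewal_nonneg[OF renewal_sequence_sampled_path[OF L(1) g_pos g_lim c that]])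
  have Laplace: "(\<integral>w. (\<Prod>k<n. exp (- (t k * x u w k))) \<partial>(M \<Otimes>\<^sub>M E)) = (\<Prod>k<n. c / (c + t k powr \<alpha>))"
    if u: "u > 0" and t: "\<And>k. 0 \<le> t k" for u t and n :: nat
  proof -
    have int: "integrable (M \<Otimes>\<^sub>M E) (\<lambda>w. \<Prod>k<n. exp (- (t k * x u w k)))"
    proof (rule P.integrable_const_bound[of _ 1])
      have "(\<Prod>k<n. exp (- (t k * x u w k))) \<le> 1" for w
        using t x_nonneg[OF u] by (intro prod_le_1) auto
      then show "AE w in M \<Otimes>\<^sub>M E. norm (\<Prod>k<n. exp (- (t k * x u w k))) \<le> 1" by (auto simp: abs_prod)
    qed measurable
    \<comment> \<open>For a fixed exponential sequence the sampling times form a deterministic grid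
      with steps \<open>e k z / u powr \<alpha>\<close>. The stable exponent contributes
      \<open>(t k * u) powr \<alpha>\<close>, so \<open>u\<close> cancels.\<close>
    have inner: "(\<integral>\<omega>. (\<Prod>k<n. exp (- (t k * x u (\<omega>, z) k))) \<partial>M) = (\<Prod>k<n. exp (- (t k powr \<alpha> * e k z)))" for z
    proof -
      define \<tau> where "\<tau> k = (\<Sum>j<k. e j z) / u powr \<alpha>" for k
      have step: "\<tau> (Suc k) - \<tau> k = e k z / u powr \<alpha>" for k by (simp add: \<tau>_def add_divide_distrib)
      have tau: "0 \<le> \<tau> 0" "strict_mono \<tau>"
        using E(3)[of _ z] u by (auto simp: strict_mono_Suc_iff \<tau>_def intro!: divide_strict_right_mono)
      have "x u (\<omega>, z) k = u * (L \<omega> (\<tau> (Suc k)) - L \<omega> (\<tau> k))" for \<omega> k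
        by (simp add: x_def sampled_path_def \<tau>_def g_def)
      then have "(\<integral>\<omega>. (\<Prod>k<n. exp (- (t k * x u (\<omega>, z) k))) \<partial>M) =
          (\<integral>\<omega>. (\<Prod>k<n. exp (- (t k * u * (L \<omega> (\<tau> (Suc k)) - L \<omega> (\<tau> k))))) \<partial>M)" by (simp add: mult.assoc)
      also have "\<dots> = (\<Prod>k<n. exp (- ((\<tau> (Suc k) - \<tau> k) * (t k * u) powr \<alpha>)))"
        using L(4)[OF tau, of "\<lambda>k. t k * u" n] t u by simp
      also have "\<dots> = (\<Prod>k<n. exp (- (t k powr \<alpha> * e k z)))"
        using u t by (intro prod.cong refl) (simp add: step powr_mult)
      finally show ?thesis .
    qed
    have "(\<integral>w. (\<Prod>k<n. exp (- (t k * x u w k))) \<partial>(M \<Otimes>\<^sub>M E)) = (\<integral>z. (\<integral>\<omega>. (\<Prod>k<n. exp (- (t k * x u (\<omega>, z) k))) \<partial>M) \<partial>E)"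
      using P.integral_snd[of "\<lambda>\<omega> z. \<Prod>k<n. exp (- (t k * x u (\<omega>, z) k))"] int by (simp add: split_beta')
    also have "\<dots> = (\<Prod>k<n. c / (c + t k powr \<alpha>))"
      unfolding inner using E(5)[of "\<lambda>k. t k powr \<alpha>" n] by simp
    finally show ?thesis .
  qed
  have y_meas: "(\<lambda>\<omega>. y \<omega> t) \<in> borel_measurable M" for t
  proof -
    have "{\<omega> \<in> space M. path_inverse (L \<omega>) t < a} \<in> sets M" for a
    proof -
      have eq: "{\<omega> \<in> space M. path_inverse (L \<omega>) t < a} = (\<Union>q\<in>\<rat> \<inter> {0<..<a}. {\<omega> \<in> space M. t < L \<omega> q})"
        unfolding path_inverse_less_iff[OF L(1)] by auto
      have m: "{\<omega> \<in> space M. t < L \<omega> q} \<in> sets M" if "q \<in> \<rat> \<inter> {0<..<a}" for q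
      proof -
        have [measurable]: "(\<lambda>\<omega>. L \<omega> q) \<in> borel_measurable M" using that by (intro L(2)) auto
        show ?thesis by measurable
      qed
      show ?thesis unfolding eq by (intro sets.countable_UN' countable_Int1 countable_rat) (use m in auto)
    qed
    then show ?thesis by (simp add: borel_measurable_iff_less y_def)
  qed
  show ?thesis
  proof (rule that[of "M \<Otimes>\<^sub>M E" x y])
    show "prob_space (M \<Otimes>\<^sub>M E)" by (rule P.prob_space_axioms)
    show "fst \<in> measurable (M \<Otimes>\<^sub>M E) M" by (rule measurable_fst)
    show "distr (M \<Otimes>\<^sub>M E) M fst = M" by (rule E.distr_pair_fst)
    have "x u \<in> measurable (M \<Otimes>\<^sub>M E) (Pi\<^sub>M UNIV (\<lambda>_. borel))" for u
      by (rule measurable_PiM_single') auto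
    then show "\<forall>u. x u \<in> measurable (M \<Otimes>\<^sub>M E) (Pi\<^sub>M UNIV (\<lambda>_. borel))" by blast
    show "\<forall>u t n. u > 0 \<longrightarrow> (\<forall>k. 0 \<le> t k) \<longrightarrow>
      (\<integral>w. (\<Prod>k<(n::nat). exp (- (t k * x u w k))) \<partial>(M \<Otimes>\<^sub>M E)) = (\<Prod>k<n. c / (c + t k powr \<alpha>))"
      using Laplace by blast
    show "\<forall>u>0. \<forall>w. renewal_sequence (x u w)"
      unfolding x_def by (intro allI impI renewal_sequence_sampled_path[OF L(1) g_pos g_lim c])
    show "\<forall>w. \<forall>T\<ge>0. \<forall>e>0. \<forall>\<^sub>F u in at_top. \<forall>t\<in>{0..T}.
      \<bar>real (renewal_count (x u w) (u * t)) / u powr \<alpha> - c * y (fst w) t\<bar> < e"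
      unfolding x_def y_def by (intro allI impI sampled_path_count_convergence[OF L(1) g_pos g_lim c \<alpha>(1)])
    show "\<forall>\<omega>. cadlag (y \<omega>)" unfolding y_def by (intro allI cadlag_path_inverse[OF L(1)])
    show "\<forall>\<omega> s t. 0 \<le> s \<longrightarrow> s \<le> t \<longrightarrow> y \<omega> s \<le> y \<omega> t" unfolding y_def by (intro allI impI path_inverse_mono[OF L(1)])
    show "\<forall>\<omega>. y \<omega> 0 = 0" unfolding y_def by (intro allI path_inverse_0[OF L(1)])
    show "\<forall>t. (\<lambda>\<omega>. y \<omega> t) \<in> borel_measurable M" using y_meas by blast
    show "AE \<omega> in M. \<forall>t\<ge>0. Y t \<omega> = y \<omega> t" using L'(3) by (simp add: y_def)
  qed
qed

section \<open>Weak convergence by coupling\<close>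

lemma measurable_continuous_map_borel_of_topology:
  assumes "continuous_map S euclideanreal g"
  shows "g \<in> borel_measurable (borel_of_topology S)"
proof (rule borel_measurableI)
  fix U :: "real set" assume "open U"
  have sp: "space (borel_of_topology S) = topspace S" by (simp add: borel_of_topology_def space_measure_of_conv)
  have "openin S {x \<in> topspace S. g x \<in> U}"
    using assms \<open>open U\<close> by (intro openin_continuous_map_preimage[of S euclideanreal]) auto
  moreover have "{U. openin S U} \<subseteq> Pow (topspace S)" by (auto dest: openin_subset)
  ultimately have "{x \<in> topspace S. g x \<in> U} \<in> sets (borel_of_topology S)"
    by (simp add: borel_of_topology_def)
  moreover have "g -` U \<inter> space (borel_of_topology S) = {x \<in> topspace S. g x \<in> U}" by (auto simp: sp)
  ultimately show "g -` U \<inter> space (borel_of_topology S) \<in> sets (borel_of_topology S)" by simp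
qed

lemma space_borel_J1: "space (borel_of_topology J1_topology) = skorokhod_space"
  by (simp add: borel_of_topology_def space_measure_of_conv topspace_J1)

text \<open>Each \<open>X u\<close> enters only through its law and may be realised anew as
  \<open>V u\<close> on a common space. Locally uniform convergence there is J1 convergence with the
  identity as time change, and dominated convergence transfers it to integrals of bounded continuous
  functions.\<close>

lemma converges_weakly_coupling:
  fixes X X' :: "real \<Rightarrow> 'a \<Rightarrow> real \<Rightarrow> real" and V :: "real \<Rightarrow> 'w \<Rightarrow> real \<Rightarrow> real"
  assumes W: "prob_space W"
    and X: "\<And>u. u > 0 \<Longrightarrow> X' u \<in> measurable M (borel_of_topology J1_topology)" "\<And>u. u > 0 \<Longrightarrow> AE \<omega> in M. X u \<omega> = X' u \<omega>"
    and Y: "Y' \<in> measurable M' (borel_of_topology J1_topology)" "AE \<omega> in M'. Y \<omega> = Y' \<omega>"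
    and V: "\<And>u. u > 0 \<Longrightarrow> V u \<in> measurable W (borel_of_topology J1_topology)"
      "\<And>u. u > 0 \<Longrightarrow> distr W (borel_of_topology J1_topology) (V u) = distr M (borel_of_topology J1_topology) (X' u)"
    and Z: "Z \<in> measurable W (borel_of_topology J1_topology)"
      "distr W (borel_of_topology J1_topology) Z = distr M' (borel_of_topology J1_topology) Y'"
    and conv: "AE w in W. \<forall>T>0. \<forall>e>0. \<forall>\<^sub>F u in at_top. \<forall>t\<in>{0..T}. \<bar>V u w t - Z w t\<bar> < e"
  shows "converges_weakly J1_topology at_top M X M' Y"
  unfolding converges_weakly_def
proof (intro exI conjI allI impI)
  interpret W: prob_space W by fact
  let ?J = "borel_of_topology J1_topology"
  show "\<forall>\<^sub>F u :: real in at_top. has_law M (X u) J1_topology (distr M ?J (X' u))"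
    using eventually_gt_at_top[of 0] by eventually_elim (use X in \<open>auto simp: has_law_def\<close>)
  show "has_law M' Y J1_topology (distr M' ?J Y')" using Y by (auto simp: has_law_def)
  fix g :: "(real \<Rightarrow> real) \<Rightarrow> real" assume g: "continuous_map J1_topology euclideanreal g \<and> bounded (g ` topspace J1_topology)"
  have [measurable]: "g \<in> borel_measurable ?J" using g by (intro measurable_continuous_map_borel_of_topology) auto
  have "bounded (g ` topspace J1_topology)" using g by blast
  then obtain B where "\<forall>z\<in>g ` topspace J1_topology. norm z \<le> B" unfolding bounded_iff by blast
  then have B: "\<bar>g z\<bar> \<le> B" if "z \<in> skorokhod_space" for z using that by (simp add: topspace_J1)
  have V_sp: "V u w \<in> skorokhod_space" if "u > 0" "w \<in> space W" for u w
    using measurable_space[OF V(1)[OF that(1)] that(2)] by (simp add: space_borel_J1)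
  have V0_sp: "Z w \<in> skorokhod_space" if "w \<in> space W" for w
    using measurable_space[OF Z(1) that] by (simp add: space_borel_J1)
  \<comment> \<open>Nothing is assumed about \<open>V u\<close> for \<open>u \<le> 0\<close>. The
    default \<open>Z w\<close> keeps the integrand measurable and bounded for all \<open>u\<close>
    and leaves the limit at infinity unchanged.\<close>
  have "((\<lambda>u. \<integral>w. g (if u > 0 then V u w else Z w) \<partial>W) \<longlongrightarrow> (\<integral>w. g (Z w) \<partial>W)) at_top"
  proof (rule integral_dominated_convergence_at_top[where w = "\<lambda>_. B"])
    show "(\<lambda>w. g (Z w)) \<in> borel_measurable W" using Z(1) by measurable
    show "(\<lambda>w. g (if u > 0 then V u w else Z w)) \<in> borel_measurable W" for u
      using V(1)[of u] Z(1) by (cases "u > 0") (auto intro: measurable_compose[where g = g])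
    show "integrable W (\<lambda>_. B)" by simp
    show "\<forall>\<^sub>F u in at_top. AE w in W. norm (g (if u > 0 then V u w else Z w)) \<le> B"
      by (intro always_eventually allI AE_I2) (use B V_sp V0_sp in auto)
    show "AE w in W. ((\<lambda>u. g (if u > 0 then V u w else Z w)) \<longlongrightarrow> g (Z w)) at_top"
      using conv AE_space
    proof eventually_elim
      case (elim w)
      have "limitin J1_topology (\<lambda>u. if u > 0 then V u w else Z w) (Z w) at_top"
        unfolding limitin_J1
      proof (intro conjI allI impI)
        show "Z w \<in> skorokhod_space" using V0_sp elim by simp
        fix T e :: real assume "T > 0" "e > 0"
        then have "\<forall>\<^sub>F u in at_top. \<forall>t\<in>{0..T}. \<bar>V u w t - Z w t\<bar> < e" using elim by blast
        then show "\<forall>\<^sub>F u in at_top. (if u > 0 then V u w else Z w) \<in> J1_nbhd (Z w) T e"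
          using eventually_gt_at_top[of 0]
        proof eventually_elim
          case (elim u)
          then show ?case
            using V_sp[of u w] \<open>w \<in> space W\<close> \<open>e > 0\<close> time_change_id unfolding J1_nbhd_def
            by (auto intro!: exI[of _ "\<lambda>t. t"])
        qed
      qed
      from continuous_map_limit[OF conjunct1[OF g] this] show ?case by (simp add: comp_def)
    qed
  qed
  moreover have "\<forall>\<^sub>F u :: real in at_top. (\<integral>w. g (if u > 0 then V u w else Z w) \<partial>W) = (\<integral>x. g x \<partial>distr M ?J (X' u))"
    using eventually_gt_at_top[of 0]
  proof eventually_elim
    case (elim u)
    then have "(\<integral>w. g (if u > 0 then V u w else Z w) \<partial>W) = (\<integral>x. g x \<partial>distr W ?J (V u))"
      by (subst integral_distr[OF V(1)]) auto
    then show ?case using V(2)[OF elim] by simp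
  qed
  ultimately have "((\<lambda>u. \<integral>x. g x \<partial>distr M ?J (X' u)) \<longlongrightarrow> (\<integral>w. g (Z w) \<partial>W)) at_top"
    by (rule Lim_transform_eventually)
  moreover have "(\<integral>w. g (Z w) \<partial>W) = (\<integral>x. g x \<partial>distr M' ?J Y')"
    using Z integral_distr[OF Z(1), of g] by simp
  ultimately show "((\<lambda>u. \<integral>x. g x \<partial>distr M ?J (X' u)) \<longlongrightarrow> (\<integral>x. g x \<partial>distr M' ?J Y')) at_top" by simp
qed

abbreviation (input) sequence_space :: "(nat \<Rightarrow> real) measure" where
  "sequence_space \<equiv> Pi\<^sub>M UNIV (\<lambda>_. borel)"

abbreviation (input) class_space :: "(nat \<Rightarrow> nat) measure" where
  "class_space \<equiv> Pi\<^sub>M UNIV (\<lambda>_. count_space UNIV)"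

text \<open>The rescaled queue is a functional of interarrival times and classes alone, so that
  equality of the laws of these data carries over to it. The value 0 at irregular sequences makes
  every path right-continuous with left limits.\<close>

definition netput :: "nat \<Rightarrow> real \<Rightarrow> real \<Rightarrow> ((nat \<Rightarrow> real) \<times> (nat \<Rightarrow> real)) \<times> (nat \<Rightarrow> nat) \<Rightarrow> real \<Rightarrow> real" where
  "netput i g u d s = (if renewal_sequence (fst (fst d)) \<and> renewal_sequence (snd (fst d))
     then real (class_count (snd d) i (renewal_count (fst (fst d)) (u * s))) / u powr g
       - real (renewal_count (snd (fst d)) (u * s)) / u powr g
     else 0)"

text \<open>\<open>j = 0\<close> yields all classes up to \<open>i\<close>, because a net input
  without arrivals reflects to 0; \<open>j = i - 1\<close> yields class \<open>i\<close>
  alone.\<close>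

definition queue_path :: "nat \<Rightarrow> nat \<Rightarrow> real \<Rightarrow> real \<Rightarrow> ((nat \<Rightarrow> real) \<times> (nat \<Rightarrow> real)) \<times> (nat \<Rightarrow> nat) \<Rightarrow> real \<Rightarrow> real" where
  "queue_path i j g u d = (\<lambda>t\<in>{0..}. skorokhod_reflection (netput i g u d) t - skorokhod_reflection (netput j g u d) t)"

lemma cadlag_const: "cadlag (\<lambda>_. c)"
  unfolding cadlag_def by (auto intro: tendsto_const)

lemma cadlag_netput:
  assumes "u > 0"
  shows "cadlag (netput i g u d)"
proof (cases "renewal_sequence (fst (fst d)) \<and> renewal_sequence (snd (fst d))")
  case True
  define h where "h a b = real (class_count (snd d) i a) / u powr g - real b / u powr g" for a b
  have "cadlag (\<lambda>s. h (renewal_count (fst (fst d)) s) (renewal_count (snd (fst d)) s))"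
    by (rule cadlag_step_path[OF step_path_compose2[OF step_path_renewal_count step_path_renewal_count]]) (use True in auto)
  from cadlag_scale_time[OF this assms] show ?thesis
    using True by (simp add: netput_def[abs_def] h_def)
next
  case False
  then show ?thesis by (auto simp: netput_def[abs_def] intro: cadlag_const)
qed

lemma measurable_renewal_sequence [measurable]: "Measurable.pred sequence_space renewal_sequence"
proof -
  have [measurable]: "(\<lambda>x. x k) \<in> borel_measurable sequence_space" for k
    by (rule measurable_component_singleton) simp
  show ?thesis unfolding renewal_sequence_def by measurable
qed

lemma measurable_renewal_count:
  assumes t: "t \<ge> 0"
  shows "(\<lambda>x. if renewal_sequence x then renewal_count x t else 0) \<in> measurable sequence_space (count_space UNIV)"
proof -
  have [measurable]: "(\<lambda>x. x k) \<in> borel_measurable sequence_space" for k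
    by (rule measurable_component_singleton) simp
  have "{x \<in> space sequence_space. (if renewal_sequence x then renewal_count x t else 0) = n} \<in> sets sequence_space" for n
  proof -
    have "{x \<in> space sequence_space. (if renewal_sequence x then renewal_count x t else 0) = n} =
      {x \<in> space sequence_space. if renewal_sequence x then (\<Sum>k<n. x k) \<le> t \<and> t < (\<Sum>k<Suc n. x k) else 0 = n}"
      using renewal_count_eq_iff[OF _ t] by auto
    also have "\<dots> \<in> sets sequence_space" by measurable
    finally show ?thesis .
  qed
  then show ?thesis by (subst measurable_count_space_eq2_countable) (auto simp: vimage_def Int_def conj_commute)
qed

lemma measurable_class_count:
  "(\<lambda>c. real (class_count c i m)) \<in> borel_measurable class_space"
proof -
  have [measurable]: "(\<lambda>c. c k) \<in> measurable class_space (count_space UNIV)" for k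
    by (rule measurable_component_singleton) simp
  have "real (class_count c i m) = (\<Sum>k<m. indicator {1..i} (c k))" for c
    by (induction m) (auto simp: class_count_Suc indicator_def)
  moreover have "(\<lambda>c. \<Sum>k<m. indicator {1..i} (c k) :: real) \<in> borel_measurable class_space"
  proof (rule borel_measurable_sum)
    fix k
    have "(\<lambda>c. c k) \<in> measurable class_space (count_space UNIV)" by measurable
    then show "(\<lambda>c. indicator {1..i} (c k) :: real) \<in> borel_measurable class_space"
      by (rule measurable_compose) simp
  qed
  ultimately show ?thesis by simp
qed

lemma measurable_netput:
  assumes "u > 0" "s \<ge> 0"
  shows "(\<lambda>d. netput i g u d s) \<in> borel_measurable ((sequence_space \<Otimes>\<^sub>M sequence_space) \<Otimes>\<^sub>M class_space)"
proof -
  let ?D = "(sequence_space \<Otimes>\<^sub>M sequence_space) \<Otimes>\<^sub>M class_space"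
  have us: "u * s \<ge> 0" using assms by simp
  define n where "n x = (if renewal_sequence x then renewal_count x (u * s) else 0)" for x
  have [measurable]: "n \<in> measurable sequence_space (count_space UNIV)"
    unfolding n_def by (rule measurable_renewal_count[OF us])
  note measurable_class_count[measurable]
  \<comment> \<open>The index of the class count is itself random, but it takes countably many
    values.\<close>
  have A: "(\<lambda>d. real (class_count (snd d) i (n (fst (fst d))))) \<in> borel_measurable ?D"
    by (rule measurable_compose_countable[where f = "\<lambda>m d. real (class_count (snd d) i m)" and g = "\<lambda>d. n (fst (fst d))"]) measurable
  have B: "(\<lambda>d. real (n (snd (fst d)))) \<in> borel_measurable ?D" by measurable
  have "(\<lambda>d. if renewal_sequence (fst (fst d)) \<and> renewal_sequence (snd (fst d))
     then real (class_count (snd d) i (n (fst (fst d)))) / u powr g - real (n (snd (fst d))) / u powr g else 0) \<in> borel_measurable ?D"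
    using A B by measurable
  also have "(\<lambda>d. if renewal_sequence (fst (fst d)) \<and> renewal_sequence (snd (fst d))
     then real (class_count (snd d) i (n (fst (fst d)))) / u powr g - real (n (snd (fst d))) / u powr g else 0) = (\<lambda>d. netput i g u d s)"
    by (auto simp: netput_def n_def)
  finally show ?thesis .
qed

lemma skorokhod_space_restrict: "cadlag f \<Longrightarrow> (\<lambda>t\<in>{0..}. f t) \<in> skorokhod_space"
  using cadlag_cong[of f "\<lambda>t\<in>{0..}. f t"] by (simp add: skorokhod_space_def)

lemma queue_path_in_space: "u > 0 \<Longrightarrow> queue_path i j g u d \<in> skorokhod_space"
  unfolding queue_path_def
  by (intro skorokhod_space_restrict cadlag_diff cadlag_reflection cadlag_netput)

lemma measurable_queue_path:
  assumes "u > 0"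
  shows "queue_path i j g u \<in> measurable ((sequence_space \<Otimes>\<^sub>M sequence_space) \<Otimes>\<^sub>M class_space) (borel_of_topology J1_topology)"
proof (rule measurable_J1[OF queue_path_in_space[OF assms]])
  fix t :: real assume t: "t \<ge> 0"
  have "(\<lambda>d. skorokhod_reflection (netput i g u d) t - skorokhod_reflection (netput j g u d) t)
    \<in> borel_measurable ((sequence_space \<Otimes>\<^sub>M sequence_space) \<Otimes>\<^sub>M class_space)"
    by (intro borel_measurable_diff measurable_reflection[where f = "\<lambda>t d. netput i g u d t" for i] cadlag_netput assms measurable_netput t)
  then show "(\<lambda>d. queue_path i j g u d t) \<in> borel_measurable ((sequence_space \<Otimes>\<^sub>M sequence_space) \<Otimes>\<^sub>M class_space)"
    using t by (simp add: queue_path_def)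
qed

lemma reflection_locally_uniform:
  assumes T: "T \<ge> 0" and e: "e > 0" and f: "\<And>u. u > 0 \<Longrightarrow> cadlag (f u)" and l: "cadlag l"
    and conv: "\<And>e. e > 0 \<Longrightarrow> \<forall>\<^sub>F u :: real in at_top. \<forall>t\<in>{0..T}. \<bar>f u t - l t\<bar> < e"
  shows "\<forall>\<^sub>F u in at_top. \<forall>t\<in>{0..T}. \<bar>skorokhod_reflection (f u) t - skorokhod_reflection l t\<bar> < e"
proof -
  \<comment> \<open>Reflection doubles the error; \<open>e / 3\<close> leaves room for a strict
    inequality.\<close>
  have "\<forall>\<^sub>F u in at_top. \<forall>t\<in>{0..T}. \<bar>f u t - l t\<bar> < e / 3" using e by (intro conv) auto
  then show ?thesis using eventually_gt_at_top[of 0]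
  proof eventually_elim
    case (elim u)
    show ?case
    proof
      fix t assume t: "t \<in> {0..T}"
      have "\<bar>skorokhod_reflection (f u) t - skorokhod_reflection l t\<bar> \<le> 2 * (e / 3)"
        by (intro reflection_lipschitz cadlag_bdd_below f l) (use elim t in \<open>auto intro: less_imp_le\<close>)
      also have "\<dots> < e" using e by simp
      finally show "\<bar>skorokhod_reflection (f u) t - skorokhod_reflection l t\<bar> < e" .
    qed
  qed
qed

text \<open>Over extended reals the infimum exists and is measurable on all paths, including those
  unbounded below. This allows the reflection to be treated as a functional on the whole product
  space.\<close>

lemma reflection_ereal:
  assumes "cadlag f" "t \<ge> 0"
  shows "skorokhod_reflection f t = f t - real_of_ereal (INF s\<in>insert t (\<rat> \<inter> {0..t}). ereal (f s))"
proof -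
  have "bdd_below (f ` insert t (\<rat> \<inter> {0..t}))"
    by (rule bdd_below_mono[OF cadlag_bdd_below[OF assms(1), of t]]) (use assms in auto)
  then have "ereal (INF s\<in>insert t (\<rat> \<inter> {0..t}). f s) = (INF s\<in>insert t (\<rat> \<inter> {0..t}). ereal (f s))"
    by (subst ereal_Inf') (auto simp: image_comp comp_def)
  then have "real_of_ereal (INF s\<in>insert t (\<rat> \<inter> {0..t}). ereal (f s)) = (INF s\<in>insert t (\<rat> \<inter> {0..t}). f s)"
    by (metis real_of_ereal.simps(1))
  then show ?thesis using INF_rat[OF assms] by (simp add: skorokhod_reflection_def)
qed

section \<open>Laws and null sets on product spaces\<close>

lemma AE_pair_fst:
  assumes "prob_space B" "AE x in A. P x"
  shows "AE w in A \<Otimes>\<^sub>M B. P (fst w)"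
proof -
  interpret B: prob_space B by fact
  show ?thesis using assms(2) by (intro AE_distrD[OF measurable_fst]) (subst B.distr_pair_fst)
qed

lemma distr_pair_snd:
  assumes "prob_space A" "prob_space B"
  shows "distr (A \<Otimes>\<^sub>M B) B snd = B"
proof -
  interpret A: prob_space A by fact
  interpret B: prob_space B by fact
  show ?thesis
  proof (rule measure_eqI)
    fix X assume "X \<in> sets (distr (A \<Otimes>\<^sub>M B) B snd)"
    then have X: "X \<in> sets B" by simp
    have "snd -` X \<inter> space (A \<Otimes>\<^sub>M B) = space A \<times> X" using sets.sets_into_space[OF X] by (auto simp: space_pair_measure)
    then show "emeasure (distr (A \<Otimes>\<^sub>M B) B snd) X = emeasure B X"
      using X by (simp add: emeasure_distr B.emeasure_pair_measure_Times A.emeasure_space_1)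
  qed simp
qed

lemma AE_pair_snd:
  assumes "prob_space A" "prob_space B" "AE x in B. P x"
  shows "AE w in A \<Otimes>\<^sub>M B. P (snd w)"
  using assms(3) by (intro AE_distrD[OF measurable_snd]) (subst distr_pair_snd[OF assms(1,2)])

lemma distr_product:
  assumes "prob_space A" "prob_space B" and f: "f \<in> measurable A S" and g: "g \<in> measurable B T"
  shows "distr (A \<Otimes>\<^sub>M B) (S \<Otimes>\<^sub>M T) (\<lambda>w. (f (fst w), g (snd w))) = distr A S f \<Otimes>\<^sub>M distr B T g"
proof -
  interpret B: prob_space B by fact
  interpret D: prob_space "distr B T g" by (rule B.prob_space_distr[OF g])
  have "distr A S f \<Otimes>\<^sub>M distr B T g = distr (A \<Otimes>\<^sub>M B) (S \<Otimes>\<^sub>M T) (\<lambda>(x, y). (f x, g y))"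
    by (rule pair_measure_distr[OF f g]) (rule D.sigma_finite_measure_axioms)
  then show ?thesis by (simp add: case_prod_beta')
qed

section \<open>The queue in law\<close>

locale mittag_leffler_queue = prob_space M for M :: "'a measure" +
  fixes K :: nat and p P :: "nat \<Rightarrow> real" and \<alpha> lam \<beta> \<mu> :: real
    and N D :: "real \<Rightarrow> 'a \<Rightarrow> nat" and C :: "nat \<Rightarrow> 'a \<Rightarrow> nat" and Q :: "nat \<Rightarrow> real \<Rightarrow> 'a \<Rightarrow> nat"
  assumes \<alpha>: "0 < \<alpha>" "\<alpha> \<le> 1" and \<beta>: "0 < \<beta>" "\<beta> \<le> 1" and lam: "lam > 0" and \<mu>: "\<mu> > 0"
    and p: "\<And>i. i \<in> {1..K} \<Longrightarrow> p i > 0" "(\<Sum>i=1..K. p i) = 1"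
    and P_def: "\<And>i. P i = (\<Sum>l=1..i. p l)"
    and queue: "restless_mittag_leffler_queue M K p \<alpha> lam \<beta> \<mu> N D C Q"
begin

definition arrivals :: "'a \<Rightarrow> nat \<Rightarrow> real" where
  "arrivals \<omega> = interarrivals (\<lambda>t\<in>{0..}. N t \<omega>)"

definition services :: "'a \<Rightarrow> nat \<Rightarrow> real" where
  "services \<omega> = interarrivals (\<lambda>t\<in>{0..}. D t \<omega>)"

definition classes :: "'a \<Rightarrow> nat \<Rightarrow> nat" where
  "classes \<omega> = (\<lambda>k. C k \<omega>)"

lemma indep_ND: "indep_var (Pi\<^sub>M {0..} (\<lambda>_. count_space UNIV)) (\<lambda>\<omega>. \<lambda>t\<in>{0..}. N t \<omega>)
       (Pi\<^sub>M {0..} (\<lambda>_. count_space UNIV)) (\<lambda>\<omega>. \<lambda>t\<in>{0..}. D t \<omega>)"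
  using queue by (simp add: restless_mittag_leffler_queue_def)

lemma indep_arrivals_services: "indep_var sequence_space arrivals sequence_space services"
  using indep_var_compose[OF indep_ND measurable_interarrivals measurable_interarrivals]
  by (simp add: comp_def arrivals_def[abs_def] services_def[abs_def])

lemma measurable_data [measurable]:
  "arrivals \<in> measurable M sequence_space" "services \<in> measurable M sequence_space" "classes \<in> measurable M class_space"
proof -
  show "arrivals \<in> measurable M sequence_space" "services \<in> measurable M sequence_space"
    using indep_arrivals_services by (auto dest: indep_var_rv1 indep_var_rv2)
  show "classes \<in> measurable M class_space"
    using queue unfolding restless_mittag_leffler_queue_def indep_random_elements_def classes_def[abs_def] by simp
qed

text \<open>The variables under the existential quantifier of
  \<open>fractional_poisson_process\<close> reappear, almost surely, as the interarrival times of
  the path, which are the ones whose independence is known.\<close>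

lemma renewal_structure:
  assumes "fractional_poisson_process M \<theta> r A" "0 < \<theta>" "\<theta> \<le> 1" "r > 0"
  obtains X where "renewal_process M X \<theta> (r powr \<theta>)"
    "AE \<omega> in M. \<forall>t\<ge>0. A t \<omega> = renewal_count (\<lambda>k. X k \<omega>) t"
    "AE \<omega> in M. interarrivals (\<lambda>t\<in>{0..}. A t \<omega>) = (\<lambda>k. X k \<omega>)"
proof -
  obtain X where X: "indep_vars (\<lambda>_. borel) X UNIV" "\<forall>k. AE \<omega> in M. 0 \<le> X k \<omega>"
    "\<forall>k. \<forall>x\<ge>0. prob {\<omega> \<in> space M. X k \<omega> \<le> x} = 1 - mittag_leffler \<theta> (- (r powr \<theta> * x powr \<theta>))"
    "AE \<omega> in M. \<forall>t\<ge>0. A t \<omega> = Max {n. (\<Sum>k<n. X k \<omega>) \<le> t}"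
    using assms(1) unfolding fractional_poisson_process_def by auto
  have R: "renewal_process M X \<theta> (r powr \<theta>)"
    by (intro renewal_process.intro renewal_process_axioms.intro prob_space_axioms) (use X assms in auto)
  interpret R: renewal_process M X \<theta> "r powr \<theta>" by (rule R)
  have A: "AE \<omega> in M. \<forall>t\<ge>0. A t \<omega> = renewal_count (\<lambda>k. X k \<omega>) t"
    using X(4) by (simp add: renewal_count_def)
  moreover have "AE \<omega> in M. interarrivals (\<lambda>t\<in>{0..}. A t \<omega>) = (\<lambda>k. X k \<omega>)"
    using A R.renewal_sequence_AE by eventually_elim (rule interarrivals_renewal_count, auto)
  ultimately show ?thesis using R that by blast
qed

lemma transfer_renewal_process:
  assumes R: "renewal_process M X \<theta> c" and AE: "AE \<omega> in M. F \<omega> = (\<lambda>k. X k \<omega>)"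
    and F: "F \<in> measurable M sequence_space"
  shows "\<And>t n. (\<And>k. 0 \<le> t k) \<Longrightarrow> (\<integral>x. (\<Prod>k<(n::nat). exp (- (t k * x k))) \<partial>distr M sequence_space F) = (\<Prod>k<n. c / (c + t k powr \<theta>))"
    "\<And>k. AE x in distr M sequence_space F. 0 \<le> x k"
proof -
  interpret R: renewal_process M X \<theta> c by (rule R)
  have [measurable]: "(\<lambda>x. x k) \<in> borel_measurable sequence_space" for k
    by (rule measurable_component_singleton) simp
  note F[measurable]
  show "(\<integral>x. (\<Prod>k<n. exp (- (t k * x k))) \<partial>distr M sequence_space F) = (\<Prod>k<n. c / (c + t k powr \<theta>))"
    if "\<And>k. 0 \<le> t k" for t and n :: nat
  proof -
    have "(\<integral>x. (\<Prod>k<n. exp (- (t k * x k))) \<partial>distr M sequence_space F) = (\<integral>\<omega>. (\<Prod>k<n. exp (- (t k * F \<omega> k))) \<partial>M)"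
      by (subst integral_distr) auto
    also have "\<dots> = (\<integral>\<omega>. (\<Prod>k<n. exp (- (t k * X k \<omega>))) \<partial>M)"
    proof (rule integral_cong_AE)
      show "AE \<omega> in M. (\<Prod>k<n. exp (- (t k * F \<omega> k))) = (\<Prod>k<n. exp (- (t k * X k \<omega>)))"
        using AE by eventually_elim simp
      show "(\<lambda>\<omega>. \<Prod>k<n. exp (- (t k * F \<omega> k))) \<in> borel_measurable M"
        by (intro borel_measurable_prod borel_measurable_exp[THEN measurable_compose[rotated]] borel_measurable_uminus borel_measurable_times
            borel_measurable_const measurable_compose[OF F measurable_component_singleton]) auto
    qed measurable
    finally show ?thesis using R.joint_Laplace[of t n] that by simp
  qed
  show "AE x in distr M sequence_space F. 0 \<le> x k" for k
  proof (subst AE_distr_iff[OF F])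
    show "{x \<in> space sequence_space. 0 \<le> x k} \<in> sets sequence_space" by measurable
    show "AE \<omega> in M. 0 \<le> F \<omega> k" using AE R.all_nonneg by eventually_elim simp
  qed
qed

text \<open>Both laws have the product transform of independent Mittag-Leffler variables, and
  \<open>Laplace_sequence_unique\<close> compares it at integers. Independence of the coupled
  increments is contained in the product form.\<close>

lemma law_eqI:
  assumes W: "prob_space W" and x: "x \<in> measurable W sequence_space" "\<And>w k. 0 \<le> x w k"
    and Lx: "\<And>t n. (\<And>k. 0 \<le> t k) \<Longrightarrow> (\<integral>w. (\<Prod>k<(n::nat). exp (- (t k * x w k))) \<partial>W) = (\<Prod>k<n. c / (c + t k powr \<theta>))"
    and R: "renewal_process M X \<theta> c" and AE: "AE \<omega> in M. F \<omega> = (\<lambda>k. X k \<omega>)"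
    and F: "F \<in> measurable M sequence_space"
  shows "distr W sequence_space x = distr M sequence_space F"
proof (rule Laplace_sequence_unique)
  interpret W: prob_space W by fact
  have [measurable]: "(\<lambda>x. x k) \<in> borel_measurable sequence_space" for k
    by (rule measurable_component_singleton) simp
  show "prob_space (distr W sequence_space x)" by (rule W.prob_space_distr[OF x(1)])
  show "prob_space (distr M sequence_space F)" by (rule prob_space_distr[OF F])
  show "AE y in distr W sequence_space x. 0 \<le> y k" for k
    by (subst AE_distr_iff[OF x(1)]) (use x(2) in auto)
  show "AE y in distr M sequence_space F. 0 \<le> y k" for k by (rule transfer_renewal_process(2)[OF R AE F])
  fix n and t :: "nat \<Rightarrow> nat"
  have "(\<integral>y. (\<Prod>k<n. exp (- (real (t k) * y k))) \<partial>distr W sequence_space x) = (\<integral>w. (\<Prod>k<n. exp (- (real (t k) * x w k))) \<partial>W)"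
    by (subst integral_distr[OF x(1)]) auto
  also have "\<dots> = (\<Prod>k<n. c / (c + real (t k) powr \<theta>))" by (rule Lx) simp
  also have "\<dots> = (\<integral>y. (\<Prod>k<n. exp (- (real (t k) * y k))) \<partial>distr M sequence_space F)"
    by (rule transfer_renewal_process(1)[OF R AE F, symmetric]) simp
  finally show "(\<integral>y. (\<Prod>k<n. exp (- (real (t k) * y k))) \<partial>distr W sequence_space x) =
    (\<integral>y. (\<Prod>k<n. exp (- (real (t k) * y k))) \<partial>distr M sequence_space F)" .
qed auto

definition data :: "'a \<Rightarrow> ((nat \<Rightarrow> real) \<times> (nat \<Rightarrow> real)) \<times> (nat \<Rightarrow> nat)" where
  "data \<omega> = ((arrivals \<omega>, services \<omega>), classes \<omega>)"

text \<open>Two independence statements combine: the classes are independent of both processes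
  jointly, and the processes of each other. Together they factor the law of the data
  completely.\<close>

lemma law_data:
  "distr M ((sequence_space \<Otimes>\<^sub>M sequence_space) \<Otimes>\<^sub>M class_space) data =
    (distr M sequence_space arrivals \<Otimes>\<^sub>M distr M sequence_space services) \<Otimes>\<^sub>M distr M class_space classes"
proof -
  let ?C = "Pi\<^sub>M {0..} (\<lambda>_. count_space UNIV) :: (real \<Rightarrow> nat) measure"
  define ND where "ND \<omega> = ((\<lambda>t\<in>{0..}. N t \<omega>), (\<lambda>t\<in>{0..}. D t \<omega>))" for \<omega>
  define f where "f w = (interarrivals (fst w), interarrivals (snd w))" for w :: "(real \<Rightarrow> nat) \<times> (real \<Rightarrow> nat)"
  have ind: "indep_random_elements M (?C \<Otimes>\<^sub>M ?C) ND class_space classes"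
    using queue unfolding restless_mittag_leffler_queue_def ND_def[abs_def] classes_def[abs_def] by simp
  have mND: "ND \<in> measurable M (?C \<Otimes>\<^sub>M ?C)" using ind by (simp add: indep_random_elements_def)
  have mf: "f \<in> measurable (?C \<Otimes>\<^sub>M ?C) (sequence_space \<Otimes>\<^sub>M sequence_space)"
    unfolding f_def using measurable_interarrivals by measurable
  have fND: "f (ND \<omega>) = (arrivals \<omega>, services \<omega>)" for \<omega> by (simp add: f_def ND_def arrivals_def services_def)
  have pND: "prob_space (distr M (?C \<Otimes>\<^sub>M ?C) ND)" by (rule prob_space_distr[OF mND])
  have pC: "prob_space (distr M class_space classes)" by (rule prob_space_distr) measurable
  have "distr M ((sequence_space \<Otimes>\<^sub>M sequence_space) \<Otimes>\<^sub>M class_space) data =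
     distr (distr M ((?C \<Otimes>\<^sub>M ?C) \<Otimes>\<^sub>M class_space) (\<lambda>\<omega>. (ND \<omega>, classes \<omega>))) ((sequence_space \<Otimes>\<^sub>M sequence_space) \<Otimes>\<^sub>M class_space) (\<lambda>w. (f (fst w), (\<lambda>c. c) (snd w)))"
    using mND mf by (subst distr_distr) (auto simp: comp_def data_def[abs_def] fND)
  also have "\<dots> = distr (distr M (?C \<Otimes>\<^sub>M ?C) ND \<Otimes>\<^sub>M distr M class_space classes) ((sequence_space \<Otimes>\<^sub>M sequence_space) \<Otimes>\<^sub>M class_space) (\<lambda>w. (f (fst w), (\<lambda>c. c) (snd w)))"
    using distr_indep_random_elements[OF prob_space_axioms ind] by simp
  also have "\<dots> = distr (distr M (?C \<Otimes>\<^sub>M ?C) ND) (sequence_space \<Otimes>\<^sub>M sequence_space) f \<Otimes>\<^sub>M distr (distr M class_space classes) class_space (\<lambda>c. c)"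
    by (rule distr_product[OF pND pC]) (use mf in auto)
  also have "distr (distr M class_space classes) class_space (\<lambda>c. c) = distr M class_space classes"
    by (rule distr_id2) simp
  also have "distr (distr M (?C \<Otimes>\<^sub>M ?C) ND) (sequence_space \<Otimes>\<^sub>M sequence_space) f = distr M (sequence_space \<Otimes>\<^sub>M sequence_space) (\<lambda>\<omega>. (arrivals \<omega>, services \<omega>))"
    using mND mf by (subst distr_distr) (auto simp: comp_def fND)
  also have "\<dots> = distr M sequence_space arrivals \<Otimes>\<^sub>M distr M sequence_space services"
    using indep_var_distribution_eq[THEN iffD1, OF indep_arrivals_services] by simp
  finally show ?thesis .
qed

lemma measurable_data' [measurable]: "data \<in> measurable M ((sequence_space \<Otimes>\<^sub>M sequence_space) \<Otimes>\<^sub>M class_space)"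
  unfolding data_def by measurable

lemma arrivals_renewal:
  obtains X where "renewal_process M X \<alpha> (lam powr \<alpha>)" "AE \<omega> in M. arrivals \<omega> = (\<lambda>k. X k \<omega>)"
    "AE \<omega> in M. \<forall>t\<ge>0. N t \<omega> = renewal_count (arrivals \<omega>) t"
proof -
  have "fractional_poisson_process M \<alpha> lam N" using queue by (simp add: restless_mittag_leffler_queue_def)
  from renewal_structure[OF this \<alpha> lam] obtain X where X: "renewal_process M X \<alpha> (lam powr \<alpha>)"
    "AE \<omega> in M. \<forall>t\<ge>0. N t \<omega> = renewal_count (\<lambda>k. X k \<omega>) t" "AE \<omega> in M. arrivals \<omega> = (\<lambda>k. X k \<omega>)"
    unfolding arrivals_def by blast
  moreover from X(2,3) have "AE \<omega> in M. \<forall>t\<ge>0. N t \<omega> = renewal_count (arrivals \<omega>) t" by eventually_elim simp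
  ultimately show ?thesis using that by blast
qed

lemma services_renewal:
  obtains Z where "renewal_process M Z \<beta> (\<mu> powr \<beta>)" "AE \<omega> in M. services \<omega> = (\<lambda>k. Z k \<omega>)"
    "AE \<omega> in M. \<forall>t\<ge>0. D t \<omega> = renewal_count (services \<omega>) t"
proof -
  have "fractional_poisson_process M \<beta> \<mu> D" using queue by (simp add: restless_mittag_leffler_queue_def)
  from renewal_structure[OF this \<beta> \<mu>] obtain Z where Z: "renewal_process M Z \<beta> (\<mu> powr \<beta>)"
    "AE \<omega> in M. \<forall>t\<ge>0. D t \<omega> = renewal_count (\<lambda>k. Z k \<omega>) t" "AE \<omega> in M. services \<omega> = (\<lambda>k. Z k \<omega>)"
    unfolding services_def by blast
  moreover from Z(2,3) have "AE \<omega> in M. \<forall>t\<ge>0. D t \<omega> = renewal_count (services \<omega>) t" by eventually_elim simp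
  ultimately show ?thesis using that by blast
qed

lemma regular_AE: "AE \<omega> in M. renewal_sequence (arrivals \<omega>) \<and> renewal_sequence (services \<omega>)"
proof -
  obtain X where X: "renewal_process M X \<alpha> (lam powr \<alpha>)" "AE \<omega> in M. arrivals \<omega> = (\<lambda>k. X k \<omega>)" by (rule arrivals_renewal)
  obtain Z where Z: "renewal_process M Z \<beta> (\<mu> powr \<beta>)" "AE \<omega> in M. services \<omega> = (\<lambda>k. Z k \<omega>)" by (rule services_renewal)
  from X(2) Z(2) renewal_process.renewal_sequence_AE[OF X(1)] renewal_process.renewal_sequence_AE[OF Z(1)]
  show ?thesis by eventually_elim simp
qed

text \<open>An arrival epoch has no atoms and is independent of every service epoch, and there are
  countably many pairs. The queue dynamics prescribe no transition for a simultaneous arrival and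
  service, so this case has to be excluded.\<close>

lemma no_simultaneous_jumps:
  "AE \<omega> in M. \<forall>a b. (\<Sum>k<Suc a. arrivals \<omega> k) \<noteq> (\<Sum>k<Suc b. services \<omega> k)"
proof -
  obtain X where X: "renewal_process M X \<alpha> (lam powr \<alpha>)" "AE \<omega> in M. arrivals \<omega> = (\<lambda>k. X k \<omega>)" by (rule arrivals_renewal)
  interpret X: renewal_process M X \<alpha> "lam powr \<alpha>" by (rule X)
  have [measurable]: "(\<lambda>x. x k) \<in> borel_measurable sequence_space" for k
    by (rule measurable_component_singleton) simp
  have "AE \<omega> in M. (\<Sum>k<Suc a. arrivals \<omega> k) \<noteq> (\<Sum>k<Suc b. services \<omega> k)" for a b
  proof -
    have "(\<lambda>x :: nat \<Rightarrow> real. \<Sum>k<n. x k) \<in> borel_measurable sequence_space" for n by measurable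
    from indep_var_compose[OF indep_arrivals_services this this]
    have ind: "indep_var borel (\<lambda>\<omega>. \<Sum>k<Suc a. arrivals \<omega> k) borel (\<lambda>\<omega>. \<Sum>k<Suc b. services \<omega> k)"
      unfolding comp_def .
    show ?thesis
    proof (rule indep_atomless[OF ind, where h = "\<lambda>x. x"])
      fix s
      have "AE \<omega> in M. (\<Sum>k<Suc a. X k \<omega>) \<noteq> s"
        using X.sum_atomless[of a s] by (subst (asm) prob_eq_0) auto
      with X(2) have "AE \<omega> in M. (\<Sum>k<Suc a. arrivals \<omega> k) \<noteq> s" by eventually_elim simp
      moreover have "(\<lambda>\<omega>. \<Sum>k<Suc a. arrivals \<omega> k) \<in> borel_measurable M" using ind by (rule indep_var_rv1)
      ultimately show "prob {\<omega> \<in> space M. (\<Sum>k<Suc a. arrivals \<omega> k) = s} = 0"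
        by (subst prob_eq_0) auto
    qed simp
  qed
  then show ?thesis by (simp add: AE_all_countable del: sum.lessThan_Suc)
qed

text \<open>One null set serves all \<open>u\<close>: off it both sequences are regular, positive
  and without common epochs, so the reflection formula holds at all times, and reflection commutes
  with rescaling of time and space.\<close>

lemma queue_path_AE:
  assumes ij: "i \<le> K" "j \<le> K"
  shows "AE \<omega> in M. \<forall>u>0. (\<lambda>t\<in>{0..}. (real (\<Sum>l=1..i. Q l (u * t) \<omega>) - real (\<Sum>l=1..j. Q l (u * t) \<omega>)) / u powr g)
    = queue_path i j g u (data \<omega>)"
proof -
  obtain X where X: "renewal_process M X \<alpha> (lam powr \<alpha>)" "AE \<omega> in M. arrivals \<omega> = (\<lambda>k. X k \<omega>)"
    "AE \<omega> in M. \<forall>t\<ge>0. N t \<omega> = renewal_count (arrivals \<omega>) t" by (rule arrivals_renewal)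
  obtain Z where Z: "renewal_process M Z \<beta> (\<mu> powr \<beta>)" "AE \<omega> in M. services \<omega> = (\<lambda>k. Z k \<omega>)"
    "AE \<omega> in M. \<forall>t\<ge>0. D t \<omega> = renewal_count (services \<omega>) t" by (rule services_renewal)
  have "AE \<omega> in M. priority_queue_path K (\<lambda>t. N t \<omega>) (\<lambda>t. D t \<omega>) (\<lambda>k. C k \<omega>) (\<lambda>t i. Q i t \<omega>)"
    using queue by (simp add: restless_mittag_leffler_queue_def)
  from this regular_AE no_simultaneous_jumps X(2,3) Z(2,3) renewal_process.positive_AE[OF X(1)] renewal_process.positive_AE[OF Z(1)]
  show ?thesis
  proof eventually_elim
    case (elim \<omega>)
    have x: "renewal_sequence (arrivals \<omega>)" and z: "renewal_sequence (services \<omega>)" using elim by auto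
    have n: "N t \<omega> = renewal_count (arrivals \<omega>) t" and d: "D t \<omega> = renewal_count (services \<omega>) t" if "t \<ge> 0" for t
      using elim that by auto
    have xp: "0 < arrivals \<omega> k" and zp: "0 < services \<omega> k" for k using elim by auto
    define f where "f i s = real (class_count (classes \<omega>) i (renewal_count (arrivals \<omega>) s)) - real (renewal_count (services \<omega>) s)" for i s
    have Q: "real (\<Sum>l=1..i. Q l t \<omega>) = skorokhod_reflection (f i) t" if i: "i \<le> K" and t: "t \<ge> 0" for i t
    proof -
      have "real (\<Sum>l=1..i. Q l t \<omega>) = skorokhod_reflection (\<lambda>s. real (class_count (\<lambda>k. C k \<omega>) i (N s \<omega>)) - real (D s \<omega>)) t"
      proof (rule priority_queue_reflection[OF _ _ _ elim(1) i t])
        show "N s \<omega> \<le> N t \<omega>" if "0 \<le> s" "s \<le> t" for s t using renewal_count_mono[OF x that] n that by simp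
        show "D s \<omega> \<le> D t \<omega>" if "0 \<le> s" "s \<le> t" for s t using renewal_count_mono[OF z that] d that by simp
        show "\<exists>s\<in>{0..t}. N s \<omega> + D s \<omega> = k" if t: "0 \<le> t" and "N t \<omega> + D t \<omega> = Suc k" for t k
        proof -
          have "renewal_count (arrivals \<omega>) t + renewal_count (services \<omega>) t = Suc k" using that n d by simp
          from renewal_unit_steps[OF x z xp zp elim(3)[rule_format] t this]
          obtain s where "s \<in> {0..t}" "renewal_count (arrivals \<omega>) s + renewal_count (services \<omega>) s = k" by blast
          then show ?thesis using n d by (intro bexI[of _ s]) auto
        qed
      qed
      also have "\<dots> = skorokhod_reflection (f i) t"
        by (rule reflection_cong) (use n d t in \<open>auto simp: f_def classes_def\<close>)
      finally show ?thesis .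
    qed
    have cad: "cadlag (f i)" for i
      unfolding f_def[abs_def]
      by (rule cadlag_step_path[OF step_path_compose2[OF step_path_renewal_count[OF x] step_path_renewal_count[OF z],
            where h = "\<lambda>a b. real (class_count (classes \<omega>) i a) - real b"]])
    show ?case
    proof (intro allI impI)
      fix u :: real assume u: "u > 0"
      have R: "real (\<Sum>l=1..i. Q l (u * t) \<omega>) / u powr g = skorokhod_reflection (netput i g u (data \<omega>)) t"
        if i: "i \<le> K" and t: "t \<ge> 0" for i t
      proof -
        have "real (\<Sum>l=1..i. Q l (u * t) \<omega>) / u powr g = skorokhod_reflection (f i) (u * t) / u powr g"
          using Q[OF i, of "u * t"] u t by simp
        also have "\<dots> = skorokhod_reflection (\<lambda>s. f i (u * s) / u powr g) t"
          by (rule reflection_scale[OF cad u _ t]) (use u in simp)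
        also have "(\<lambda>s. f i (u * s) / u powr g) = netput i g u (data \<omega>)"
          using x z by (auto simp: netput_def data_def f_def diff_divide_distrib)
        finally show ?thesis .
      qed
      show "(\<lambda>t\<in>{0..}. (real (\<Sum>l=1..i. Q l (u * t) \<omega>) - real (\<Sum>l=1..j. Q l (u * t) \<omega>)) / u powr g)
        = queue_path i j g u (data \<omega>)"
        unfolding queue_path_def diff_divide_distrib
        by (rule restrict_ext) (use R[OF ij(1)] R[OF ij(2)] in auto)
    qed
  qed
qed

text \<open>The count is a sum of independent indicators with mean \<open>P i\<close>. They equal
  their own squares, so second moments come for free.\<close>

lemma class_count_average:
  assumes i: "i \<le> K"
  shows "AE \<omega> in M. (\<lambda>n. real (class_count (classes \<omega>) i n) / real n) \<longlonglongrightarrow> P i"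
proof -
  have C: "indep_vars (\<lambda>_. count_space UNIV) C UNIV" "\<And>k l. l \<in> {1..K} \<Longrightarrow> prob {\<omega> \<in> space M. C k \<omega> = l} = p l"
    using queue by (auto simp: restless_mittag_leffler_queue_def)
  have C_meas [measurable]: "C k \<in> measurable M (count_space UNIV)" for k using C(1) by (auto simp: indep_vars_def)
  define B where "B k \<omega> = (indicator {1..i} (C k \<omega>) :: real)" for k \<omega>
  have "indep_vars (\<lambda>_. borel) (\<lambda>k. (indicator {1..i} :: nat \<Rightarrow> real) \<circ> C k) UNIV"
    by (rule indep_vars_compose[OF C(1)]) auto
  then have ind: "indep_vars (\<lambda>_. borel) B UNIV" by (simp add: comp_def B_def[abs_def])
  have B_meas [measurable]: "B k \<in> borel_measurable M" for k using ind by (auto simp: indep_vars_def)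
  have B_int: "integrable M (B k)" for k
    by (rule integrable_const_bound[of _ 1]) (auto simp: B_def indicator_def)
  have B_sq: "(B k \<omega>)\<^sup>2 = B k \<omega>" for k \<omega> by (simp add: B_def indicator_def)
  have B_mean: "expectation (B k) = P i" for k
  proof -
    have "B k \<omega> = (\<Sum>l=1..i. indicator {\<omega> \<in> space M. C k \<omega> = l} \<omega>)" if "\<omega> \<in> space M" for \<omega>
      using that by (simp add: B_def indicator_def)
    then have "expectation (B k) = expectation (\<lambda>\<omega>. \<Sum>l=1..i. indicator {\<omega> \<in> space M. C k \<omega> = l} \<omega>)"
      by (intro Bochner_Integration.integral_cong) auto
    also have "\<dots> = (\<Sum>l=1..i. prob {\<omega> \<in> space M. C k \<omega> = l})"
      by (subst Bochner_Integration.integral_sum) (auto intro!: integrable_real_indicator simp: less_top[symmetric])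
    also have "\<dots> = P i" unfolding P_def using C(2) i by (intro sum.cong) auto
    finally show ?thesis .
  qed
  have "AE \<omega> in M. (\<lambda>n. (\<Sum>k<n. B k \<omega>) / real n) \<longlonglongrightarrow> P i"
  proof (rule strong_law_nonneg[OF ind])
    show "integrable M (\<lambda>\<omega>. (B k \<omega>)\<^sup>2)" for k unfolding B_sq by (rule B_int)
    show "variance (B k) = P i - (P i)\<^sup>2" for k
      using variance_eq[OF B_int[of k]] B_int[of k] by (simp add: B_sq B_mean)
  qed (auto simp: B_mean B_def)
  moreover have "real (class_count (classes \<omega>) i n) = (\<Sum>k<n. B k \<omega>)" for n \<omega>
    by (induction n) (auto simp: class_count_Suc B_def classes_def indicator_def)
  ultimately show ?thesis by simp
qed

lemma P_nonneg: "i \<le> K \<Longrightarrow> 0 \<le> P i"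
  unfolding P_def using p(1) by (intro sum_nonneg) (auto intro: less_imp_le)

text \<open>The data have a product law, so on a product of three spaces arrivals, services and
  classes may be replaced separately by copies with the right laws. The third factor is
  \<open>M\<close> itself and carries the original classes.\<close>

lemma coupling_limit:
  fixes W1 :: "'w1 measure" and W2 :: "'w2 measure"
  assumes W1: "prob_space W1" and W2: "prob_space W2"
    and x: "\<And>u. u > 0 \<Longrightarrow> x u \<in> measurable W1 sequence_space" "\<And>u. u > 0 \<Longrightarrow> distr W1 sequence_space (x u) = distr M sequence_space arrivals"
    and z: "\<And>u. u > 0 \<Longrightarrow> z u \<in> measurable W2 sequence_space" "\<And>u. u > 0 \<Longrightarrow> distr W2 sequence_space (z u) = distr M sequence_space services"
    and Y: "Y' \<in> measurable M' (borel_of_topology J1_topology)" "AE \<omega> in M'. Y \<omega> = Y' \<omega>"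
    and V0: "V0 \<in> measurable ((W1 \<Otimes>\<^sub>M W2) \<Otimes>\<^sub>M M) (borel_of_topology J1_topology)"
      "distr ((W1 \<Otimes>\<^sub>M W2) \<Otimes>\<^sub>M M) (borel_of_topology J1_topology) V0 = distr M' (borel_of_topology J1_topology) Y'"
    and conv: "AE w in (W1 \<Otimes>\<^sub>M W2) \<Otimes>\<^sub>M M. \<forall>T>0. \<forall>e>0. \<forall>\<^sub>F u in at_top. \<forall>t\<in>{0..T}.
      \<bar>queue_path i j g u ((x u (fst (fst w)), z u (snd (fst w))), classes (snd w)) t - V0 w t\<bar> < e"
    and ij: "i \<le> K" "j \<le> K"
  shows "converges_weakly J1_topology at_top M
    (\<lambda>u \<omega>. \<lambda>t\<in>{0..}. (real (\<Sum>l=1..i. Q l (u * t) \<omega>) - real (\<Sum>l=1..j. Q l (u * t) \<omega>)) / u powr g) M' Y"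
proof -
  interpret W1: prob_space W1 by fact
  interpret W2: prob_space W2 by fact
  interpret P12: pair_prob_space W1 W2 ..
  interpret PW: pair_prob_space "W1 \<Otimes>\<^sub>M W2" M ..
  let ?J = "borel_of_topology J1_topology"
  let ?D = "(sequence_space \<Otimes>\<^sub>M sequence_space) \<Otimes>\<^sub>M class_space"
  define \<phi> where "\<phi> u w = ((x u (fst (fst w)), z u (snd (fst w))), classes (snd w))" for u and w :: "('w1 \<times> 'w2) \<times> 'a"
  have phi_meas: "\<phi> u \<in> measurable ((W1 \<Otimes>\<^sub>M W2) \<Otimes>\<^sub>M M) ?D" if u: "u > 0" for u
  proof -
    note x(1)[OF u, measurable] z(1)[OF u, measurable]
    show ?thesis unfolding \<phi>_def by measurable
  qed
  have phi_law: "distr ((W1 \<Otimes>\<^sub>M W2) \<Otimes>\<^sub>M M) ?D (\<phi> u) = distr M ?D data" if u: "u > 0" for u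
  proof -
    note x(1)[OF u, measurable] z(1)[OF u, measurable]
    have "distr ((W1 \<Otimes>\<^sub>M W2) \<Otimes>\<^sub>M M) ?D (\<phi> u) =
        distr (W1 \<Otimes>\<^sub>M W2) (sequence_space \<Otimes>\<^sub>M sequence_space) (\<lambda>w. (x u (fst w), z u (snd w))) \<Otimes>\<^sub>M distr M class_space classes"
      using distr_product[OF P12.prob_space_axioms prob_space_axioms, of "\<lambda>w. (x u (fst w), z u (snd w))" _ classes]
      by (simp add: \<phi>_def[abs_def])
    also have "distr (W1 \<Otimes>\<^sub>M W2) (sequence_space \<Otimes>\<^sub>M sequence_space) (\<lambda>w. (x u (fst w), z u (snd w))) =
        distr W1 sequence_space (x u) \<Otimes>\<^sub>M distr W2 sequence_space (z u)"
      by (rule distr_product[OF W1 W2 x(1)[OF u] z(1)[OF u]])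
    finally show ?thesis unfolding x(2)[OF u] z(2)[OF u] law_data .
  qed
  show ?thesis
  proof (rule converges_weakly_coupling[where W = "(W1 \<Otimes>\<^sub>M W2) \<Otimes>\<^sub>M M" and X' = "\<lambda>u \<omega>. queue_path i j g u (data \<omega>)"
        and V = "\<lambda>u w. queue_path i j g u (\<phi> u w)" and Z = V0 and Y' = Y'])
    show "prob_space ((W1 \<Otimes>\<^sub>M W2) \<Otimes>\<^sub>M M)" by (rule PW.prob_space_axioms)
    fix u :: real assume u: "u > 0"
    note q = measurable_queue_path[OF u, of i j g]
    show "(\<lambda>\<omega>. queue_path i j g u (data \<omega>)) \<in> measurable M ?J" by (rule measurable_compose[OF measurable_data' q])
    show "(\<lambda>w. queue_path i j g u (\<phi> u w)) \<in> measurable ((W1 \<Otimes>\<^sub>M W2) \<Otimes>\<^sub>M M) ?J"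
      by (rule measurable_compose[OF phi_meas[OF u] q])
    show "AE \<omega> in M. (\<lambda>t\<in>{0..}. (real (\<Sum>l=1..i. Q l (u * t) \<omega>) - real (\<Sum>l=1..j. Q l (u * t) \<omega>)) / u powr g) = queue_path i j g u (data \<omega>)"
      using queue_path_AE[OF ij, of g] by eventually_elim (use u in blast)
    have "distr ((W1 \<Otimes>\<^sub>M W2) \<Otimes>\<^sub>M M) ?J (\<lambda>w. queue_path i j g u (\<phi> u w)) = distr (distr ((W1 \<Otimes>\<^sub>M W2) \<Otimes>\<^sub>M M) ?D (\<phi> u)) ?J (queue_path i j g u)"
      by (subst distr_distr[OF q phi_meas[OF u]]) (simp add: comp_def)
    also have "\<dots> = distr M ?J (\<lambda>\<omega>. queue_path i j g u (data \<omega>))"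
      unfolding phi_law[OF u] by (subst distr_distr[OF q measurable_data']) (simp add: comp_def)
    finally show "distr ((W1 \<Otimes>\<^sub>M W2) \<Otimes>\<^sub>M M) ?J (\<lambda>w. queue_path i j g u (\<phi> u w)) = distr M ?J (\<lambda>\<omega>. queue_path i j g u (data \<omega>))" .
  qed (use Y V0 conv in \<open>auto simp: \<phi>_def\<close>)
qed

end

section \<open>The scaling limits\<close>

lemma class_count_no_class [simp]: "class_count c 0 m = 0"
  by (simp add: class_count_def)

text \<open>Counts are nondecreasing in \<open>t\<close>, so \<open>t = T\<close> is the worst case;
  passing from \<open>u\<close> to \<open>u * T\<close> costs the constant
  \<open>T powr g\<close>.\<close>

lemma count_small_uniform:
  assumes lim: "((\<lambda>u. real (renewal_count x u) / u powr g) \<longlongrightarrow> 0) at_top" and x: "renewal_sequence x"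
    and T: "T > 0" and e: "e > 0"
  shows "\<forall>\<^sub>F u in at_top. \<forall>t\<in>{0..T}. real (renewal_count x (u * t)) / u powr g < e"
proof -
  have "filterlim (\<lambda>u :: real. u * T) at_top at_top"
    using T by (intro filterlim_at_top_mult_tendsto_pos[OF tendsto_const] filterlim_ident) auto
  from filterlim_compose[OF lim this]
  have "((\<lambda>u. real (renewal_count x (u * T)) / (u * T) powr g) \<longlongrightarrow> 0) at_top" .
  moreover have "e / T powr g > 0" using e T by simp
  ultimately have "\<forall>\<^sub>F u in at_top. real (renewal_count x (u * T)) / (u * T) powr g < e / T powr g"
    by (rule order_tendstoD(2))
  then show ?thesis using eventually_gt_at_top[of 0]
  proof eventually_elim
    case (elim u)
    show ?case
    proof
      fix t assume t: "t \<in> {0..T}"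
      have "renewal_count x (u * t) \<le> renewal_count x (u * T)"
        using t elim T by (intro renewal_count_mono[OF x] mult_left_mono) auto
      then have "real (renewal_count x (u * t)) / u powr g \<le> real (renewal_count x (u * T)) / u powr g"
        by (intro divide_right_mono) auto
      also have "\<dots> = real (renewal_count x (u * T)) / (u * T) powr g * T powr g"
        using elim T by (simp add: powr_mult)
      also have "\<dots> < e / T powr g * T powr g" using elim T by (intro mult_strict_right_mono) auto
        also have "\<dots> = e" using T by simp
      finally show "real (renewal_count x (u * t)) / u powr g < e" .
    qed
  qed
qed

lemma queue_path_converges:
  assumes T: "T > 0" and e: "e > 0" and l: "cadlag l" "cadlag l'"
    and i: "\<And>e. e > 0 \<Longrightarrow> \<forall>\<^sub>F u in at_top. \<forall>t\<in>{0..T}. \<bar>netput i g u (d u) t - l t\<bar> < e"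
    and j: "\<And>e. e > 0 \<Longrightarrow> \<forall>\<^sub>F u in at_top. \<forall>t\<in>{0..T}. \<bar>netput j g u (d u) t - l' t\<bar> < e"
  shows "\<forall>\<^sub>F u in at_top. \<forall>t\<in>{0..T}. \<bar>queue_path i j g u (d u) t - (skorokhod_reflection l t - skorokhod_reflection l' t)\<bar> < e"
proof -
  have "\<forall>\<^sub>F u in at_top. \<forall>t\<in>{0..T}. \<bar>skorokhod_reflection (netput i g u (d u)) t - skorokhod_reflection l t\<bar> < e / 2"
    by (rule reflection_locally_uniform) (use T e l i cadlag_netput in auto)
  moreover have "\<forall>\<^sub>F u in at_top. \<forall>t\<in>{0..T}. \<bar>skorokhod_reflection (netput j g u (d u)) t - skorokhod_reflection l' t\<bar> < e / 2"
    by (rule reflection_locally_uniform) (use T e l j cadlag_netput in auto)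
  ultimately show ?thesis
  proof eventually_elim
    case (elim u)
    show ?case
    proof
      fix t assume t: "t \<in> {0..T}"
      then have "queue_path i j g u (d u) t = skorokhod_reflection (netput i g u (d u)) t - skorokhod_reflection (netput j g u (d u)) t"
        by (simp add: queue_path_def)
      moreover have "\<bar>skorokhod_reflection (netput i g u (d u)) t - skorokhod_reflection l t\<bar> < e / 2"
        "\<bar>skorokhod_reflection (netput j g u (d u)) t - skorokhod_reflection l' t\<bar> < e / 2" using elim t by auto
      ultimately show "\<bar>queue_path i j g u (d u) t - (skorokhod_reflection l t - skorokhod_reflection l' t)\<bar> < e"
        by linarith
    qed
  qed
qed

lemma netput_converges:
  assumes arr: "\<And>e. e > 0 \<Longrightarrow> \<forall>\<^sub>F u in at_top. \<forall>t\<in>{0..T}. \<bar>real (class_count c i (renewal_count (x u) (u * t))) / u powr g - a t\<bar> < e"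
    and dep: "\<And>e. e > 0 \<Longrightarrow> \<forall>\<^sub>F u in at_top. \<forall>t\<in>{0..T}. \<bar>real (renewal_count (z u) (u * t)) / u powr g - b t\<bar> < e"
    and reg: "\<And>u. u > 0 \<Longrightarrow> renewal_sequence (x u) \<and> renewal_sequence (z u)"
    and e: "e > 0"
  shows "\<forall>\<^sub>F u in at_top. \<forall>t\<in>{0..T}. \<bar>netput i g u ((x u, z u), c) t - (a t - b t)\<bar> < e"
proof -
  have e2: "e / 2 > 0" using e by simp
  show ?thesis using arr[OF e2] dep[OF e2] eventually_gt_at_top[of 0]
  proof eventually_elim
    case (elim u)
    show ?case
    proof
      fix t assume t: "t \<in> {0..T}"
      have "netput i g u ((x u, z u), c) t = real (class_count c i (renewal_count (x u) (u * t))) / u powr g - real (renewal_count (z u) (u * t)) / u powr g"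
        using reg elim by (simp add: netput_def)
      moreover have "\<bar>real (class_count c i (renewal_count (x u) (u * t))) / u powr g - a t\<bar> < e / 2"
        "\<bar>real (renewal_count (z u) (u * t)) / u powr g - b t\<bar> < e / 2" using elim t by auto
      ultimately show "\<bar>netput i g u ((x u, z u), c) t - (a t - b t)\<bar> < e" by linarith
    qed
  qed
qed

definition limit_path :: "real \<Rightarrow> real \<Rightarrow> real \<Rightarrow> (real \<Rightarrow> real) \<Rightarrow> (real \<Rightarrow> real) \<Rightarrow> real \<Rightarrow> real" where
  "limit_path a a' b y y' = (\<lambda>t\<in>{0..}. skorokhod_reflection (\<lambda>s. a * y s - b * y' s) t - skorokhod_reflection (\<lambda>s. a' * y s - b * y' s) t)"

abbreviation (input) path_space :: "(real \<Rightarrow> real) measure" where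
  "path_space \<equiv> Pi\<^sub>M {0..} (\<lambda>_. borel)"

text \<open>The limit as a measurable map on pairs of paths in the product sigma-algebra. It
  transfers equality in law from pairs of inverse subordinators to limits, although the pairs live
  on different spaces.\<close>

definition limit_functional :: "real \<Rightarrow> real \<Rightarrow> real \<Rightarrow> (real \<Rightarrow> real) \<times> (real \<Rightarrow> real) \<Rightarrow> real \<Rightarrow> real" where
  "limit_functional a a' b w = (\<lambda>t\<in>{0..}.
     (a * fst w t - b * snd w t - real_of_ereal (INF s\<in>insert t (\<rat> \<inter> {0..t}). ereal (a * fst w s - b * snd w s))) -
     (a' * fst w t - b * snd w t - real_of_ereal (INF s\<in>insert t (\<rat> \<inter> {0..t}). ereal (a' * fst w s - b * snd w s))))"

lemma limit_path_functional:
  assumes "cadlag y" "cadlag y'"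
  shows "limit_path a a' b y y' = limit_functional a a' b (\<lambda>t\<in>{0..}. y t, \<lambda>t\<in>{0..}. y' t)"
proof -
  have "skorokhod_reflection (\<lambda>s. a * y s - b * y' s) t =
    a * y t - b * y' t - real_of_ereal (INF s\<in>insert t (\<rat> \<inter> {0..t}). ereal (a * (\<lambda>t\<in>{0..}. y t) s - b * (\<lambda>t\<in>{0..}. y' t) s))"
    if t: "t \<ge> 0" for t a
  proof -
    have "(INF s\<in>insert t (\<rat> \<inter> {0..t}). ereal (a * y s - b * y' s)) =
        (INF s\<in>insert t (\<rat> \<inter> {0..t}). ereal (a * (\<lambda>t\<in>{0..}. y t) s - b * (\<lambda>t\<in>{0..}. y' t) s))"
      using t by (intro INF_cong) auto
    then show ?thesis
      using reflection_ereal[OF cadlag_diff[OF cadlag_cmult[OF assms(1), of a] cadlag_cmult[OF assms(2), of b]] t] by simp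
  qed
  then show ?thesis unfolding limit_path_def limit_functional_def by (intro restrict_ext) auto
qed

lemma measurable_limit_functional: "limit_functional a a' b \<in> measurable (path_space \<Otimes>\<^sub>M path_space) path_space"
  unfolding limit_functional_def
proof (rule measurable_restrict)
  fix t :: real assume t: "t \<in> {0..}"
  have [measurable]: "(\<lambda>w. fst w s) \<in> borel_measurable (path_space \<Otimes>\<^sub>M path_space)"
    "(\<lambda>w. snd w s) \<in> borel_measurable (path_space \<Otimes>\<^sub>M path_space)" if "s \<ge> 0" for s
    using that by (auto intro!: measurable_compose[OF measurable_fst] measurable_compose[OF measurable_snd] measurable_component_singleton)
  have "(\<lambda>w. a * fst w t - b * snd w t - real_of_ereal (INF s\<in>insert t (\<rat> \<inter> {0..t}). ereal (a * fst w s - b * snd w s)))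
    \<in> borel_measurable (path_space \<Otimes>\<^sub>M path_space)" for a
  proof -
    have "(\<lambda>w. INF s\<in>insert t (\<rat> \<inter> {0..t}). ereal (a * fst w s - b * snd w s)) \<in> borel_measurable (path_space \<Otimes>\<^sub>M path_space)"
    proof (rule borel_measurable_INF)
      show "countable (insert t (\<rat> \<inter> {0..t}))" by (intro countable_insert countable_Int1 countable_rat)
      fix s assume "s \<in> insert t (\<rat> \<inter> {0..t})"
      then have "s \<ge> 0" using t by auto
      then show "(\<lambda>w. ereal (a * fst w s - b * snd w s)) \<in> borel_measurable (path_space \<Otimes>\<^sub>M path_space)" by measurable
    qed
    moreover have "t \<ge> 0" using t by simp
    ultimately show ?thesis by measurable
  qed
  from borel_measurable_diff[OF this[of a] this[of a']] show "(\<lambda>w. a * fst w t - b * snd w t - real_of_ereal (INF s\<in>insert t (\<rat> \<inter> {0..t}). ereal (a * fst w s - b * snd w s)) -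
     (a' * fst w t - b * snd w t - real_of_ereal (INF s\<in>insert t (\<rat> \<inter> {0..t}). ereal (a' * fst w s - b * snd w s))))
    \<in> borel_measurable (path_space \<Otimes>\<^sub>M path_space)" .
qed

lemma limit_path_in_space: "cadlag y \<Longrightarrow> cadlag y' \<Longrightarrow> limit_path a a' b y y' \<in> skorokhod_space"
  unfolding limit_path_def by (intro skorokhod_space_restrict cadlag_diff cadlag_reflection cadlag_cmult)

text \<open>Independence is assumed for \<open>Y\<close> and \<open>Y'\<close>, while the limits are
  built from the regular versions \<open>y\<close> and \<open>y'\<close>. These agree with them at
  all times outside a null set, so the joint law is the same.\<close>

lemma inverse_subordinator_path_law:
  assumes M: "prob_space M" and indep: "prob_space.indep_var M path_space (\<lambda>\<omega>. \<lambda>t\<in>{0..}. Y t \<omega>) path_space (\<lambda>\<omega>. \<lambda>t\<in>{0..}. Y' t \<omega>)"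
    and y: "(\<lambda>\<omega>. \<lambda>t\<in>{0..}. y \<omega> t) \<in> measurable M path_space" "AE \<omega> in M. \<forall>t\<ge>0. Y t \<omega> = y \<omega> t"
    and y': "(\<lambda>\<omega>. \<lambda>t\<in>{0..}. y' \<omega> t) \<in> measurable M path_space" "AE \<omega> in M. \<forall>t\<ge>0. Y' t \<omega> = y' \<omega> t"
  shows "distr M (path_space \<Otimes>\<^sub>M path_space) (\<lambda>\<omega>. (\<lambda>t\<in>{0..}. y \<omega> t, \<lambda>t\<in>{0..}. y' \<omega> t)) =
    distr M path_space (\<lambda>\<omega>. \<lambda>t\<in>{0..}. y \<omega> t) \<Otimes>\<^sub>M distr M path_space (\<lambda>\<omega>. \<lambda>t\<in>{0..}. y' \<omega> t)"
proof -
  interpret prob_space M by fact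
  have Ym: "(\<lambda>\<omega>. \<lambda>t\<in>{0..}. Y t \<omega>) \<in> measurable M path_space" "(\<lambda>\<omega>. \<lambda>t\<in>{0..}. Y' t \<omega>) \<in> measurable M path_space"
    using indep by (auto dest: indep_var_rv1 indep_var_rv2)
  have 1: "AE \<omega> in M. (\<lambda>t\<in>{0..}. y \<omega> t) = (\<lambda>t\<in>{0..}. Y t \<omega>)" using y(2) by eventually_elim (auto intro: restrict_ext)
  have 2: "AE \<omega> in M. (\<lambda>t\<in>{0..}. y' \<omega> t) = (\<lambda>t\<in>{0..}. Y' t \<omega>)" using y'(2) by eventually_elim (auto intro: restrict_ext)
  have "distr M (path_space \<Otimes>\<^sub>M path_space) (\<lambda>\<omega>. (\<lambda>t\<in>{0..}. y \<omega> t, \<lambda>t\<in>{0..}. y' \<omega> t)) =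
      distr M (path_space \<Otimes>\<^sub>M path_space) (\<lambda>\<omega>. (\<lambda>t\<in>{0..}. Y t \<omega>, \<lambda>t\<in>{0..}. Y' t \<omega>))"
  proof (rule distr_cong_AE[OF refl refl])
    show "AE \<omega> in M. (\<lambda>t\<in>{0..}. y \<omega> t, \<lambda>t\<in>{0..}. y' \<omega> t) = (\<lambda>t\<in>{0..}. Y t \<omega>, \<lambda>t\<in>{0..}. Y' t \<omega>)"
      using 1 2 by eventually_elim simp
  qed (intro measurable_Pair y(1) y'(1) Ym)+
  also have "\<dots> = distr M path_space (\<lambda>\<omega>. \<lambda>t\<in>{0..}. Y t \<omega>) \<Otimes>\<^sub>M distr M path_space (\<lambda>\<omega>. \<lambda>t\<in>{0..}. Y' t \<omega>)"
    using indep_var_distribution_eq[THEN iffD1, OF indep] by simp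
  also have "distr M path_space (\<lambda>\<omega>. \<lambda>t\<in>{0..}. Y t \<omega>) = distr M path_space (\<lambda>\<omega>. \<lambda>t\<in>{0..}. y \<omega> t)"
    by (rule distr_cong_AE[OF refl refl _ Ym(1) y(1)]) (use 1 in \<open>auto elim!: eventually_mono\<close>)
  also have "distr M path_space (\<lambda>\<omega>. \<lambda>t\<in>{0..}. Y' t \<omega>) = distr M path_space (\<lambda>\<omega>. \<lambda>t\<in>{0..}. y' \<omega> t)"
    by (rule distr_cong_AE[OF refl refl _ Ym(2) y'(1)]) (use 2 in \<open>auto elim!: eventually_mono\<close>)
  finally show ?thesis .
qed

context mittag_leffler_queue
begin

text \<open>Arrivals and services are coupled to subordinators on separate copies of
  \<open>M'\<close>, so the two limit paths are independent by construction. On \<open>M'\<close>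
  itself the pair has the same law by hypothesis, which identifies the limit found on the product
  space.\<close>

lemma critical_limit:
  fixes M' :: "'b measure"
  assumes M': "prob_space M'" and eq: "\<alpha> = \<beta>"
    and Y: "inverse_stable_subordinator M' \<alpha> Y" and Y': "inverse_stable_subordinator M' \<alpha> Y'"
    and indep: "prob_space.indep_var M' path_space (\<lambda>\<omega>. \<lambda>t\<in>{0..}. Y t \<omega>) path_space (\<lambda>\<omega>. \<lambda>t\<in>{0..}. Y' t \<omega>)"
    and ij: "i \<le> K" "j \<le> K"
  shows "converges_weakly J1_topology at_top M
    (\<lambda>u \<omega>. \<lambda>t\<in>{0..}. (real (\<Sum>l=1..i. Q l (u * t) \<omega>) - real (\<Sum>l=1..j. Q l (u * t) \<omega>)) / u powr \<alpha>) M'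
    (\<lambda>\<omega>. \<lambda>t\<in>{0..}. skorokhod_reflection (\<lambda>s. lam powr \<alpha> * P i * Y s \<omega> - \<mu> powr \<alpha> * Y' s \<omega>) t -
       skorokhod_reflection (\<lambda>s. lam powr \<alpha> * P j * Y s \<omega> - \<mu> powr \<alpha> * Y' s \<omega>) t)"
proof -
  define c1 c2 where "c1 = lam powr \<alpha>" and "c2 = \<mu> powr \<alpha>"
  have c: "c1 > 0" "c2 > 0" using lam \<mu> by (auto simp: c1_def c2_def)
  obtain W1 :: "('b \<times> (nat \<Rightarrow> real)) measure" and x :: "real \<Rightarrow> 'b \<times> (nat \<Rightarrow> real) \<Rightarrow> nat \<Rightarrow> real" and y :: "'b \<Rightarrow> real \<Rightarrow> real" where W1:
    "prob_space W1" "fst \<in> measurable W1 M'" "distr W1 M' fst = M'"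
    "\<forall>u. x u \<in> measurable W1 sequence_space"
    "\<forall>u t n. u > 0 \<longrightarrow> (\<forall>k. 0 \<le> t k) \<longrightarrow> (\<integral>w. (\<Prod>k<(n::nat). exp (- (t k * x u w k))) \<partial>W1) = (\<Prod>k<n. c1 / (c1 + t k powr \<alpha>))"
    "\<forall>u>0. \<forall>w. renewal_sequence (x u w)"
    "\<forall>w. \<forall>T\<ge>0. \<forall>e>0. \<forall>\<^sub>F u in at_top. \<forall>t\<in>{0..T}. \<bar>real (renewal_count (x u w) (u * t)) / u powr \<alpha> - c1 * y (fst w) t\<bar> < e"
    "\<forall>\<omega>. cadlag (y \<omega>)" "\<forall>\<omega> s t. 0 \<le> s \<longrightarrow> s \<le> t \<longrightarrow> y \<omega> s \<le> y \<omega> t" "\<forall>\<omega>. y \<omega> 0 = 0"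
    "\<forall>t. (\<lambda>\<omega>. y \<omega> t) \<in> borel_measurable M'" "AE \<omega> in M'. \<forall>t\<ge>0. Y t \<omega> = y \<omega> t"
    by (rule arrival_coupling[OF M' Y \<alpha> c(1)])
  obtain W2 :: "('b \<times> (nat \<Rightarrow> real)) measure" and z :: "real \<Rightarrow> 'b \<times> (nat \<Rightarrow> real) \<Rightarrow> nat \<Rightarrow> real" and y' :: "'b \<Rightarrow> real \<Rightarrow> real" where W2:
    "prob_space W2" "fst \<in> measurable W2 M'" "distr W2 M' fst = M'"
    "\<forall>u. z u \<in> measurable W2 sequence_space"
    "\<forall>u t n. u > 0 \<longrightarrow> (\<forall>k. 0 \<le> t k) \<longrightarrow> (\<integral>w. (\<Prod>k<(n::nat). exp (- (t k * z u w k))) \<partial>W2) = (\<Prod>k<n. c2 / (c2 + t k powr \<alpha>))"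
    "\<forall>u>0. \<forall>w. renewal_sequence (z u w)"
    "\<forall>w. \<forall>T\<ge>0. \<forall>e>0. \<forall>\<^sub>F u in at_top. \<forall>t\<in>{0..T}. \<bar>real (renewal_count (z u w) (u * t)) / u powr \<alpha> - c2 * y' (fst w) t\<bar> < e"
    "\<forall>\<omega>. cadlag (y' \<omega>)" "\<forall>\<omega> s t. 0 \<le> s \<longrightarrow> s \<le> t \<longrightarrow> y' \<omega> s \<le> y' \<omega> t" "\<forall>\<omega>. y' \<omega> 0 = 0"
    "\<forall>t. (\<lambda>\<omega>. y' \<omega> t) \<in> borel_measurable M'" "AE \<omega> in M'. \<forall>t\<ge>0. Y' t \<omega> = y' \<omega> t"
    by (rule arrival_coupling[OF M' Y' \<alpha> c(2)])
  interpret M': prob_space M' by fact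
  interpret W1: prob_space W1 by (rule W1(1))
  interpret W2: prob_space W2 by (rule W2(1))
  interpret P12: pair_prob_space W1 W2 ..
  let ?J = "borel_of_topology J1_topology"
  let ?W = "(W1 \<Otimes>\<^sub>M W2) \<Otimes>\<^sub>M M"
  obtain X where X: "renewal_process M X \<alpha> (lam powr \<alpha>)" "AE \<omega> in M. arrivals \<omega> = (\<lambda>k. X k \<omega>)" by (rule arrivals_renewal)
  obtain S where S: "renewal_process M S \<beta> (\<mu> powr \<beta>)" "AE \<omega> in M. services \<omega> = (\<lambda>k. S k \<omega>)" by (rule services_renewal)
  note W1m = W1(4)[rule_format] and W2m = W2(4)[rule_format]
  have x_law: "distr W1 sequence_space (x u) = distr M sequence_space arrivals" if u: "u > 0" for u
  proof (rule law_eqI[OF W1(1) W1m[of u] _ _ X measurable_data(1)])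
    show "0 \<le> x u w k" for w k using W1(6)[rule_format, OF u, of w] by (rule renewal_nonneg)
  qed (use W1(5) u in \<open>auto simp: c1_def\<close>)
  have z_law: "distr W2 sequence_space (z u) = distr M sequence_space services" if u: "u > 0" for u
  proof (rule law_eqI[OF W2(1) W2m[of u] _ _ S measurable_data(2)])
    show "0 \<le> z u w k" for w k using W2(6)[rule_format, OF u, of w] by (rule renewal_nonneg)
  qed (use W2(5) u eq in \<open>auto simp: c2_def\<close>)
  define lim where "lim = limit_path (c1 * P i) (c1 * P j) c2"
  define Z where "Z w = lim (y (fst (fst (fst w)))) (y' (fst (snd (fst w))))" for w :: "(('b \<times> (nat \<Rightarrow> real)) \<times> ('b \<times> (nat \<Rightarrow> real))) \<times> 'a"
  define yp where "yp \<omega> = (\<lambda>t\<in>{0..}. y \<omega> t)" for \<omega>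
  define yp' where "yp' \<omega> = (\<lambda>t\<in>{0..}. y' \<omega> t)" for \<omega>
  have yp: "yp \<in> measurable M' path_space" "yp' \<in> measurable M' path_space"
    unfolding yp_def yp'_def using W1(11) W2(11) by (auto intro: measurable_restrict)
  define H where "H = limit_functional (c1 * P i) (c1 * P j) c2"
  have H: "H \<in> measurable (path_space \<Otimes>\<^sub>M path_space) path_space" unfolding H_def by (rule measurable_limit_functional)
  have lim_H: "lim (y \<omega>) (y' \<omega>') = H (yp \<omega>, yp' \<omega>')" for \<omega> \<omega>'
    unfolding lim_def H_def yp_def yp'_def using W1(8) W2(8) by (intro limit_path_functional) auto
  have lim_sp: "lim (y \<omega>) (y' \<omega>') \<in> skorokhod_space" for \<omega> \<omega>'
    unfolding lim_def using W1(8) W2(8) by (intro limit_path_in_space) auto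
  have pairM: "(\<lambda>\<omega>. (yp \<omega>, yp' \<omega>)) \<in> measurable M' (path_space \<Otimes>\<^sub>M path_space)" by (intro measurable_Pair yp)
  have g1: "(\<lambda>w. yp (fst w)) \<in> measurable W1 path_space" by (rule measurable_compose[OF W1(2) yp(1)])
  have g2: "(\<lambda>w. yp' (fst w)) \<in> measurable W2 path_space" by (rule measurable_compose[OF W2(2) yp(2)])
  have pair12: "(\<lambda>w. (yp (fst (fst w)), yp' (fst (snd w)))) \<in> measurable (W1 \<Otimes>\<^sub>M W2) (path_space \<Otimes>\<^sub>M path_space)"
    by (intro measurable_Pair measurable_compose[OF measurable_fst g1] measurable_compose[OF measurable_snd g2])
  have pairW: "(\<lambda>w. (yp (fst (fst (fst w))), yp' (fst (snd (fst w))))) \<in> measurable ?W (path_space \<Otimes>\<^sub>M path_space)"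
    by (rule measurable_compose[OF measurable_fst pair12])
  have Z_path: "Z \<in> measurable ?W path_space" and Y_path: "(\<lambda>\<omega>. lim (y \<omega>) (y' \<omega>)) \<in> measurable M' path_space"
    unfolding Z_def lim_H by (rule measurable_compose[OF pairW H], rule measurable_compose[OF pairM H])
  \<comment> \<open>Both sides are the image under \<open>H\<close> of the product of the laws of
    \<open>yp\<close> and \<open>yp'\<close>.\<close>
  have path_law: "distr ?W path_space Z = distr M' path_space (\<lambda>\<omega>. lim (y \<omega>) (y' \<omega>))"
  proof -
    have "distr ?W path_space Z = distr (distr ?W (W1 \<Otimes>\<^sub>M W2) fst) path_space (\<lambda>w. H (yp (fst (fst w)), yp' (fst (snd w))))"
      by (subst distr_distr[OF measurable_compose[OF pair12 H] measurable_fst]) (simp add: comp_def Z_def[abs_def] lim_H)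
    also have "\<dots> = distr (W1 \<Otimes>\<^sub>M W2) path_space (\<lambda>w. H (yp (fst (fst w)), yp' (fst (snd w))))"
      by (simp add: distr_pair_fst)
    also have "\<dots> = distr (distr (W1 \<Otimes>\<^sub>M W2) (path_space \<Otimes>\<^sub>M path_space) (\<lambda>w. (yp (fst (fst w)), yp' (fst (snd w))))) path_space H"
      by (subst distr_distr[OF H pair12]) (simp add: comp_def)
    also have "distr (W1 \<Otimes>\<^sub>M W2) (path_space \<Otimes>\<^sub>M path_space) (\<lambda>w. (yp (fst (fst w)), yp' (fst (snd w)))) =
        distr W1 path_space (\<lambda>w. yp (fst w)) \<Otimes>\<^sub>M distr W2 path_space (\<lambda>w. yp' (fst w))"
      by (rule distr_product[OF W1(1) W2(1) g1 g2])
    also have "distr W1 path_space (\<lambda>w. yp (fst w)) = distr M' path_space yp"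
      using distr_distr[OF yp(1) W1(2)] W1(3) by (simp add: comp_def)
    also have "distr W2 path_space (\<lambda>w. yp' (fst w)) = distr M' path_space yp'"
      using distr_distr[OF yp(2) W2(2)] W2(3) by (simp add: comp_def)
    also have "distr M' path_space yp \<Otimes>\<^sub>M distr M' path_space yp' = distr M' (path_space \<Otimes>\<^sub>M path_space) (\<lambda>\<omega>. (yp \<omega>, yp' \<omega>))"
      using inverse_subordinator_path_law[OF M' indep yp(1)[unfolded yp_def[abs_def]] W1(12) yp(2)[unfolded yp'_def[abs_def]] W2(12)]
      by (simp add: yp_def[abs_def] yp'_def[abs_def])
    also have "distr (distr M' (path_space \<Otimes>\<^sub>M path_space) (\<lambda>\<omega>. (yp \<omega>, yp' \<omega>))) path_space H = distr M' path_space (\<lambda>\<omega>. lim (y \<omega>) (y' \<omega>))"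
      by (subst distr_distr[OF H pairM]) (simp add: comp_def lim_H)
    finally show ?thesis .
  qed
  have Z_sp: "Z w \<in> skorokhod_space" for w unfolding Z_def by (rule lim_sp)
  have coord: "(\<lambda>f. f t) \<in> borel_measurable path_space" if "t \<ge> 0" for t
    using that by (intro measurable_component_singleton) auto
  show ?thesis
  proof (rule coupling_limit[OF W1(1) W2(1), where x = x and z = z and Y' = "\<lambda>\<omega>. lim (y \<omega>) (y' \<omega>)" and ?V0.0 = Z])
    show "x u \<in> measurable W1 sequence_space" for u by (rule W1m)
    show "z u \<in> measurable W2 sequence_space" for u by (rule W2m)
    show "(\<lambda>\<omega>. lim (y \<omega>) (y' \<omega>)) \<in> measurable M' ?J"
      by (rule measurable_J1[OF lim_sp measurable_compose[OF Y_path coord]])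
    show "Z \<in> measurable ?W ?J" by (rule measurable_J1[OF Z_sp measurable_compose[OF Z_path coord]])
    show "distr ?W ?J Z = distr M' ?J (\<lambda>\<omega>. lim (y \<omega>) (y' \<omega>))"
      by (rule distr_J1_eqI[OF Z_path Y_path Z_sp lim_sp path_law])
    show "AE \<omega> in M'. (\<lambda>t\<in>{0..}. skorokhod_reflection (\<lambda>s. lam powr \<alpha> * P i * Y s \<omega> - \<mu> powr \<alpha> * Y' s \<omega>) t -
       skorokhod_reflection (\<lambda>s. lam powr \<alpha> * P j * Y s \<omega> - \<mu> powr \<alpha> * Y' s \<omega>) t) = lim (y \<omega>) (y' \<omega>)"
      using W1(12) W2(12)
    proof eventually_elim
      case (elim \<omega>)
      then have "skorokhod_reflection (\<lambda>s. lam powr \<alpha> * P i * Y s \<omega> - \<mu> powr \<alpha> * Y' s \<omega>) t =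
          skorokhod_reflection (\<lambda>s. c1 * P i * y \<omega> s - c2 * y' \<omega> s) t" if "t \<ge> 0" for t i
        using that by (intro reflection_cong) (auto simp: c1_def c2_def)
      then show ?case unfolding lim_def limit_path_def by (intro restrict_ext) auto
    qed
    have "AE w in M. (\<lambda>n. real (class_count (classes w) i n) / real n) \<longlonglongrightarrow> P i \<and> (\<lambda>n. real (class_count (classes w) j n) / real n) \<longlonglongrightarrow> P j"
      using class_count_average[OF ij(1)] class_count_average[OF ij(2)] by eventually_elim auto
    from AE_pair_snd[OF P12.prob_space_axioms prob_space_axioms this]
    show "AE w in ?W. \<forall>T>0. \<forall>e>0. \<forall>\<^sub>F u in at_top. \<forall>t\<in>{0..T}.
      \<bar>queue_path i j \<alpha> u ((x u (fst (fst w)), z u (snd (fst w))), classes (snd w)) t - Z w t\<bar> < e"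
    proof eventually_elim
      case (elim w)
      define w1 w2 cl where "w1 = fst (fst w)" and "w2 = snd (fst w)" and "cl = classes (snd w)"
      show ?case
      proof (intro allI impI)
        fix T e :: real assume T: "T > 0" and e: "e > 0"
        have reg: "renewal_sequence (x u w1) \<and> renewal_sequence (z u w2)" if "u > 0" for u using W1(6) W2(6) that by (auto simp del: split_paired_All)
        have arr: "\<forall>\<^sub>F u in at_top. \<forall>t\<in>{0..T}. \<bar>real (class_count cl k (renewal_count (x u w1) (u * t))) / u powr \<alpha> - c1 * P k * y (fst w1) t\<bar> < e"
          if k: "k = i \<or> k = j" and e: "e > 0" for k e
        proof -
          have "\<forall>\<^sub>F u in at_top. \<forall>t\<in>{0..T}. \<bar>real (class_count cl k (renewal_count (x u w1) (u * t))) / u powr \<alpha> - P k * (c1 * y (fst w1) t)\<bar> < e"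
          proof (rule class_count_convergence[where n = "\<lambda>u t. renewal_count (x u w1) (u * t)" and ?Y0.0 = "c1 * y (fst w1) T"])
            show "(\<lambda>m. real (class_count cl k m) / real m) \<longlonglongrightarrow> P k" using elim k by (auto simp: cl_def)
            show "0 \<le> P k" using P_nonneg ij k by auto
            show "\<forall>\<^sub>F u in at_top. \<forall>t\<in>{0..T}. \<bar>real (renewal_count (x u w1) (u * t)) / u powr \<alpha> - c1 * y (fst w1) t\<bar> < e" if "e > 0" for e
              using W1(7) T that by (auto simp del: split_paired_All)
            show "c1 * y (fst w1) t \<le> c1 * y (fst w1) T" if "t \<in> {0..T}" for t
              using W1(9) that c by (intro mult_left_mono) auto
            have "y (fst w1) 0 \<le> y (fst w1) T" using W1(9) T by auto
            then show "0 \<le> c1 * y (fst w1) T" using W1(10) c by simp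
          qed (use \<alpha> e in auto)
          then show ?thesis by (simp add: mult_ac)
        qed
        have dep: "\<forall>\<^sub>F u in at_top. \<forall>t\<in>{0..T}. \<bar>real (renewal_count (z u w2) (u * t)) / u powr \<alpha> - c2 * y' (fst w2) t\<bar> < e" if "e > 0" for e
          using W2(7) T that by (auto simp del: split_paired_All)
        have "\<forall>\<^sub>F u in at_top. \<forall>t\<in>{0..T}. \<bar>queue_path i j \<alpha> u ((x u w1, z u w2), cl) t -
            (skorokhod_reflection (\<lambda>s. c1 * P i * y (fst w1) s - c2 * y' (fst w2) s) t - skorokhod_reflection (\<lambda>s. c1 * P j * y (fst w1) s - c2 * y' (fst w2) s) t)\<bar> < e"
        proof (rule queue_path_converges[OF T e])
          show "cadlag (\<lambda>s. c1 * P i * y (fst w1) s - c2 * y' (fst w2) s)" "cadlag (\<lambda>s. c1 * P j * y (fst w1) s - c2 * y' (fst w2) s)"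
            using W1(8) W2(8) by (auto intro!: cadlag_diff cadlag_cmult)
          show "\<forall>\<^sub>F u in at_top. \<forall>t\<in>{0..T}. \<bar>netput i \<alpha> u ((x u w1, z u w2), cl) t - (c1 * P i * y (fst w1) t - c2 * y' (fst w2) t)\<bar> < e" if "e > 0" for e
            by (rule netput_converges[OF arr dep reg that]) auto
          show "\<forall>\<^sub>F u in at_top. \<forall>t\<in>{0..T}. \<bar>netput j \<alpha> u ((x u w1, z u w2), cl) t - (c1 * P j * y (fst w1) t - c2 * y' (fst w2) t)\<bar> < e" if "e > 0" for e
            by (rule netput_converges[OF arr dep reg that]) auto
        qed
        then show "\<forall>\<^sub>F u in at_top. \<forall>t\<in>{0..T}. \<bar>queue_path i j \<alpha> u ((x u (fst (fst w)), z u (snd (fst w))), classes (snd w)) t - Z w t\<bar> < e"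
          by eventually_elim (auto simp: Z_def lim_def limit_path_def w1_def w2_def cl_def)
      qed
    qed
  qed (use x_law z_law ij in auto)
qed

text \<open>Services vanish at this scale by \<open>count_small\<close>, so they stay uncoupled on
  \<open>M\<close>. The second factor of the product carries them and the third carries the classes,
  which respects the product law of the data. The limiting net input is nondecreasing, and its
  reflection is itself.\<close>

lemma supercritical_limit:
  fixes M' :: "'b measure"
  assumes M': "prob_space M'" and gt: "\<alpha> > \<beta>" and Y: "inverse_stable_subordinator M' \<alpha> Y" and i: "i \<le> K"
  shows "converges_weakly J1_topology at_top M
    (\<lambda>u \<omega>. \<lambda>t\<in>{0..}. (real (\<Sum>l=1..i. Q l (u * t) \<omega>) - real (\<Sum>l=1..0. Q l (u * t) \<omega>)) / u powr \<alpha>) M'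
    (\<lambda>\<omega>. \<lambda>t\<in>{0..}. lam powr \<alpha> * P i * Y t \<omega>)"
proof -
  define c1 where "c1 = lam powr \<alpha>"
  have c: "c1 > 0" using lam by (auto simp: c1_def)
  obtain W1 :: "('b \<times> (nat \<Rightarrow> real)) measure" and x :: "real \<Rightarrow> 'b \<times> (nat \<Rightarrow> real) \<Rightarrow> nat \<Rightarrow> real" and y :: "'b \<Rightarrow> real \<Rightarrow> real" where W1:
    "prob_space W1" "fst \<in> measurable W1 M'" "distr W1 M' fst = M'"
    "\<forall>u. x u \<in> measurable W1 sequence_space"
    "\<forall>u t n. u > 0 \<longrightarrow> (\<forall>k. 0 \<le> t k) \<longrightarrow> (\<integral>w. (\<Prod>k<(n::nat). exp (- (t k * x u w k))) \<partial>W1) = (\<Prod>k<n. c1 / (c1 + t k powr \<alpha>))"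
    "\<forall>u>0. \<forall>w. renewal_sequence (x u w)"
    "\<forall>w. \<forall>T\<ge>0. \<forall>e>0. \<forall>\<^sub>F u in at_top. \<forall>t\<in>{0..T}. \<bar>real (renewal_count (x u w) (u * t)) / u powr \<alpha> - c1 * y (fst w) t\<bar> < e"
    "\<forall>\<omega>. cadlag (y \<omega>)" "\<forall>\<omega> s t. 0 \<le> s \<longrightarrow> s \<le> t \<longrightarrow> y \<omega> s \<le> y \<omega> t" "\<forall>\<omega>. y \<omega> 0 = 0"
    "\<forall>t. (\<lambda>\<omega>. y \<omega> t) \<in> borel_measurable M'" "AE \<omega> in M'. \<forall>t\<ge>0. Y t \<omega> = y \<omega> t"
    by (rule arrival_coupling[OF M' Y \<alpha> c])
  interpret M': prob_space M' by fact
  interpret W1: prob_space W1 by (rule W1(1))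
  interpret P12: pair_prob_space W1 M ..
  let ?J = "borel_of_topology J1_topology"
  let ?W = "(W1 \<Otimes>\<^sub>M M) \<Otimes>\<^sub>M M"
  obtain X where X: "renewal_process M X \<alpha> (lam powr \<alpha>)" "AE \<omega> in M. arrivals \<omega> = (\<lambda>k. X k \<omega>)" by (rule arrivals_renewal)
  obtain S where S: "renewal_process M S \<beta> (\<mu> powr \<beta>)" "AE \<omega> in M. services \<omega> = (\<lambda>k. S k \<omega>)" by (rule services_renewal)
  note W1m = W1(4)[rule_format]
  have x_law: "distr W1 sequence_space (x u) = distr M sequence_space arrivals" if u: "u > 0" for u
  proof (rule law_eqI[OF W1(1) W1m[of u] _ _ X measurable_data(1)])
    show "0 \<le> x u w k" for w k using W1(6)[rule_format, OF u, of w] by (rule renewal_nonneg)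
  qed (use W1(5) u in \<open>auto simp: c1_def\<close>)
  define lim where "lim \<omega> = (\<lambda>t\<in>{0..}. c1 * P i * y \<omega> t)" for \<omega>
  have lim: "lim \<in> measurable M' ?J"
  proof (rule measurable_J1)
    show "lim \<omega> \<in> skorokhod_space" for \<omega>
      unfolding lim_def using W1(8) by (intro skorokhod_space_restrict cadlag_cmult) auto
    show "(\<lambda>\<omega>. lim \<omega> t) \<in> borel_measurable M'" if "t \<ge> 0" for t
      unfolding lim_def using that by (simp, intro borel_measurable_times borel_measurable_const W1(11)[rule_format])
  qed
  have proj: "(\<lambda>w. fst (fst (fst w))) \<in> measurable ?W M'"
    by (rule measurable_compose[OF measurable_compose[OF measurable_fst measurable_fst] W1(2)])
  have "distr ?W M' (\<lambda>w. fst (fst (fst w))) = distr (distr (distr ?W (W1 \<Otimes>\<^sub>M M) fst) W1 fst) M' fst"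
    by (simp add: distr_distr W1(2) measurable_comp[OF measurable_fst W1(2)] comp_def)
  then have proj_law: "distr ?W M' (\<lambda>w. fst (fst (fst w))) = M'" by (simp add: distr_pair_fst W1(3))
  show ?thesis
  proof (rule coupling_limit[OF W1(1) prob_space_axioms, where x = x and z = "\<lambda>_. services" and Y' = lim and ?V0.0 = "\<lambda>w. lim (fst (fst (fst w)))"])
    show "x u \<in> measurable W1 sequence_space" for u by (rule W1m)
    show "lim \<in> measurable M' ?J" by (rule lim)
    show "(\<lambda>w. lim (fst (fst (fst w)))) \<in> measurable ?W ?J" by (rule measurable_compose[OF proj lim])
    show "distr ?W ?J (\<lambda>w. lim (fst (fst (fst w)))) = distr M' ?J lim"
      using distr_distr[OF lim proj] proj_law by (simp add: comp_def)
    show "AE \<omega> in M'. (\<lambda>t\<in>{0..}. lam powr \<alpha> * P i * Y t \<omega>) = lim \<omega>"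
      using W1(12) by eventually_elim (auto simp: lim_def c1_def intro!: restrict_ext)
    have "AE w in M. ((\<lambda>u. real (renewal_count (services w) u) / u powr \<alpha>) \<longlongrightarrow> 0) at_top \<and> renewal_sequence (services w)"
      using renewal_process.count_small[OF S(1) gt] S(2) regular_AE by eventually_elim auto
    then have "AE w in W1 \<Otimes>\<^sub>M M. ((\<lambda>u. real (renewal_count (services (snd w)) u) / u powr \<alpha>) \<longlongrightarrow> 0) at_top \<and> renewal_sequence (services (snd w))"
      by (rule AE_pair_snd[OF W1(1) prob_space_axioms])
    from AE_pair_fst[OF prob_space_axioms this] AE_pair_snd[OF P12.prob_space_axioms prob_space_axioms class_count_average[OF i]]
    show "AE w in ?W. \<forall>T>0. \<forall>e>0. \<forall>\<^sub>F u in at_top. \<forall>t\<in>{0..T}.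
      \<bar>queue_path i 0 \<alpha> u ((x u (fst (fst w)), services (snd (fst w))), classes (snd w)) t - lim (fst (fst (fst w))) t\<bar> < e"
    proof eventually_elim
      case (elim w)
      define w1 s cl where "w1 = fst (fst w)" and "s = services (snd (fst w))" and "cl = classes (snd w)"
      have s: "((\<lambda>u. real (renewal_count s u) / u powr \<alpha>) \<longlongrightarrow> 0) at_top" "renewal_sequence s" using elim by (auto simp: s_def)
      show ?case
      proof (intro allI impI)
        fix T e :: real assume T: "T > 0" and e: "e > 0"
        have reg: "renewal_sequence (x u w1) \<and> renewal_sequence s" if "u > 0" for u using W1(6) s that by (auto simp del: split_paired_All)
        have arr: "\<forall>\<^sub>F u in at_top. \<forall>t\<in>{0..T}. \<bar>real (class_count cl i (renewal_count (x u w1) (u * t))) / u powr \<alpha> - c1 * P i * y (fst w1) t\<bar> < e"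
          if e: "e > 0" for e
        proof -
          have "\<forall>\<^sub>F u in at_top. \<forall>t\<in>{0..T}. \<bar>real (class_count cl i (renewal_count (x u w1) (u * t))) / u powr \<alpha> - P i * (c1 * y (fst w1) t)\<bar> < e"
          proof (rule class_count_convergence[where n = "\<lambda>u t. renewal_count (x u w1) (u * t)" and ?Y0.0 = "c1 * y (fst w1) T"])
            show "(\<lambda>m. real (class_count cl i m) / real m) \<longlonglongrightarrow> P i" using elim by (auto simp: cl_def)
            show "0 \<le> P i" using P_nonneg i by auto
            show "\<forall>\<^sub>F u in at_top. \<forall>t\<in>{0..T}. \<bar>real (renewal_count (x u w1) (u * t)) / u powr \<alpha> - c1 * y (fst w1) t\<bar> < e" if "e > 0" for e
              using W1(7) T that by (auto simp del: split_paired_All)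
            show "c1 * y (fst w1) t \<le> c1 * y (fst w1) T" if "t \<in> {0..T}" for t
              using W1(9) that c by (intro mult_left_mono) auto
            have "y (fst w1) 0 \<le> y (fst w1) T" using W1(9) T by auto
            then show "0 \<le> c1 * y (fst w1) T" using W1(10) c by simp
          qed (use \<alpha> e in auto)
          then show ?thesis by (simp add: mult_ac)
        qed
        have dep: "\<forall>\<^sub>F u in at_top. \<forall>t\<in>{0..T}. \<bar>real (renewal_count s (u * t)) / u powr \<alpha> - 0\<bar> < e" if "e > 0" for e
          using count_small_uniform[OF s T that] by simp
        have "\<forall>\<^sub>F u in at_top. \<forall>t\<in>{0..T}. \<bar>queue_path i 0 \<alpha> u ((x u w1, s), cl) t -
            (skorokhod_reflection (\<lambda>s. c1 * P i * y (fst w1) s - 0) t - skorokhod_reflection (\<lambda>s. 0 - 0) t)\<bar> < e"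
        proof (rule queue_path_converges[OF T e])
          show "cadlag (\<lambda>s. c1 * P i * y (fst w1) s - 0)" "cadlag (\<lambda>s. 0 - 0)"
            using W1(8) by (auto intro!: cadlag_cmult cadlag_const)
          show "\<forall>\<^sub>F u in at_top. \<forall>t\<in>{0..T}. \<bar>netput i \<alpha> u ((x u w1, s), cl) t - (c1 * P i * y (fst w1) t - 0)\<bar> < e" if "e > 0" for e
            by (rule netput_converges[OF arr dep reg that]) auto
          show "\<forall>\<^sub>F u in at_top. \<forall>t\<in>{0..T}. \<bar>netput 0 \<alpha> u ((x u w1, s), cl) t - (0 - 0)\<bar> < e" if "e > 0" for e
            by (rule netput_converges[OF _ dep reg that]) auto
        qed
        moreover have "skorokhod_reflection (\<lambda>s. c1 * P i * y (fst w1) s - 0) t = c1 * P i * y (fst w1) t" if "t \<ge> 0" for t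
        proof -
          have "0 \<le> y (fst w1) s" if "0 \<le> s" for s using W1(9)[rule_format, of 0 s "fst w1"] W1(10) that by simp
          then show ?thesis by (subst reflection_mono[OF that]) (use W1(10) c P_nonneg[OF i] in auto)
        qed
        moreover have "skorokhod_reflection (\<lambda>s. 0 - 0) t = 0" if "t \<ge> 0" for t by (rule reflection_antimono[OF that]) simp
        ultimately show "\<forall>\<^sub>F u in at_top. \<forall>t\<in>{0..T}. \<bar>queue_path i 0 \<alpha> u ((x u (fst (fst w)), services (snd (fst w))), classes (snd w)) t - lim (fst (fst (fst w))) t\<bar> < e"
          by (auto elim!: eventually_mono simp: lim_def w1_def s_def cl_def)
      qed
    qed
  qed (use x_law i in auto)
qed

text \<open>The net inputs with indices \<open>i\<close> and 0 have the same services and differ by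
  arrivals only, which vanish at this scale. The Lipschitz bound then makes the reflections close,
  and the one with index 0 is identically 0.\<close>

lemma subcritical_limit:
  fixes M' :: "'b measure"
  assumes M': "prob_space M'" and gt: "\<beta> > \<alpha>" and i: "i \<le> K"
  shows "converges_weakly J1_topology at_top M
    (\<lambda>u \<omega>. \<lambda>t\<in>{0..}. (real (\<Sum>l=1..i. Q l (u * t) \<omega>) - real (\<Sum>l=1..0. Q l (u * t) \<omega>)) / u powr \<beta>) M'
    (\<lambda>\<omega>. \<lambda>t\<in>{0..}. 0)"
proof -
  interpret M': prob_space M' by fact
  interpret P12: pair_prob_space M M ..
  interpret PW: pair_prob_space "M \<Otimes>\<^sub>M M" M ..
  let ?J = "borel_of_topology J1_topology"
  let ?W = "(M \<Otimes>\<^sub>M M) \<Otimes>\<^sub>M M"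
  obtain X where X: "renewal_process M X \<alpha> (lam powr \<alpha>)" "AE \<omega> in M. arrivals \<omega> = (\<lambda>k. X k \<omega>)" by (rule arrivals_renewal)
  have zero: "(\<lambda>t\<in>{0..}. 0) \<in> space ?J" unfolding space_borel_J1 by (intro skorokhod_space_restrict cadlag_const)
  show ?thesis
  proof (rule coupling_limit[OF prob_space_axioms prob_space_axioms, where x = "\<lambda>_. arrivals" and z = "\<lambda>_. services"
        and Y' = "\<lambda>_. \<lambda>t\<in>{0..}. 0" and ?V0.0 = "\<lambda>_. \<lambda>t\<in>{0..}. 0"])
    show "(\<lambda>_. \<lambda>t\<in>{0..}. 0) \<in> measurable M' ?J" "(\<lambda>_. \<lambda>t\<in>{0..}. 0) \<in> measurable ?W ?J" using zero by auto
    show "distr ?W ?J (\<lambda>_. \<lambda>t\<in>{0..}. 0) = distr M' ?J (\<lambda>_. \<lambda>t\<in>{0..}. 0)" using zero by simp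
    have "AE w in M. ((\<lambda>u. real (renewal_count (arrivals w) u) / u powr \<beta>) \<longlongrightarrow> 0) at_top \<and> renewal_sequence (arrivals w)"
      using renewal_process.count_small[OF X(1) gt] X(2) regular_AE by eventually_elim auto
    from AE_pair_fst[OF prob_space_axioms AE_pair_fst[OF prob_space_axioms this]]
      AE_pair_fst[OF prob_space_axioms AE_pair_snd[OF prob_space_axioms prob_space_axioms regular_AE]]
    show "AE w in ?W. \<forall>T>0. \<forall>e>0. \<forall>\<^sub>F u in at_top. \<forall>t\<in>{0..T}.
      \<bar>queue_path i 0 \<beta> u ((arrivals (fst (fst w)), services (snd (fst w))), classes (snd w)) t - (\<lambda>t\<in>{0..}. 0) t\<bar> < e"
    proof eventually_elim
      case (elim w)
      define x s cl where "x = arrivals (fst (fst w))" and "s = services (snd (fst w))" and "cl = classes (snd w)"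
      have x: "((\<lambda>u. real (renewal_count x u) / u powr \<beta>) \<longlongrightarrow> 0) at_top" "renewal_sequence x" and s: "renewal_sequence s"
        using elim by (auto simp: x_def s_def)
      show ?case
      proof (intro allI impI)
        fix T e :: real assume T: "T > 0" and e: "e > 0"
        \<comment> \<open>A quarter of \<open>e\<close> becomes \<open>e / 2\<close> through the
          Lipschitz bound.\<close>
        have "\<forall>\<^sub>F u in at_top. \<forall>t\<in>{0..T}. real (renewal_count x (u * t)) / u powr \<beta> < e / 4"
          by (rule count_small_uniform[OF x T]) (use e in simp)
        then show "\<forall>\<^sub>F u in at_top. \<forall>t\<in>{0..T}. \<bar>queue_path i 0 \<beta> u ((arrivals (fst (fst w)), services (snd (fst w))), classes (snd w)) t - (\<lambda>t\<in>{0..}. 0) t\<bar> < e"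
          using eventually_gt_at_top[of 0]
        proof eventually_elim
          case (elim u)
          show ?case
          proof
            fix t assume t: "t \<in> {0..T}"
            have np: "netput k \<beta> u ((x, s), cl) r = real (class_count cl k (renewal_count x (u * r))) / u powr \<beta> - real (renewal_count s (u * r)) / u powr \<beta>" for k r
              using x s by (simp add: netput_def)
            have z0: "skorokhod_reflection (netput 0 \<beta> u ((x, s), cl)) t = 0"
            proof (rule reflection_antimono)
              fix r assume "0 \<le> r" "r \<le> t"
              then have "renewal_count s (u * r) \<le> renewal_count s (u * t)"
                using elim by (intro renewal_count_mono[OF s] mult_left_mono) auto
              then show "netput 0 \<beta> u ((x, s), cl) t \<le> netput 0 \<beta> u ((x, s), cl) r"
                by (simp add: np divide_right_mono)
            qed (use t in auto)
            have "\<bar>skorokhod_reflection (netput i \<beta> u ((x, s), cl)) t - skorokhod_reflection (netput 0 \<beta> u ((x, s), cl)) t\<bar> \<le> 2 * (e / 4)"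
            proof (rule reflection_lipschitz)
              fix r assume r: "r \<in> {0..t}"
              have "real (class_count cl i (renewal_count x (u * r))) / u powr \<beta> \<le> real (renewal_count x (u * r)) / u powr \<beta>"
                by (intro divide_right_mono) (auto intro: class_count_le)
              also have "\<dots> < e / 4" using elim r t by auto
              finally show "\<bar>netput i \<beta> u ((x, s), cl) r - netput 0 \<beta> u ((x, s), cl) r\<bar> \<le> e / 4"
                by (simp add: np)
            qed (use t elim in \<open>auto intro!: cadlag_bdd_below cadlag_netput\<close>)
            then show "\<bar>queue_path i 0 \<beta> u ((arrivals (fst (fst w)), services (snd (fst w))), classes (snd w)) t - (\<lambda>t\<in>{0..}. 0) t\<bar> < e"
              using t e z0 by (simp add: queue_path_def x_def s_def cl_def)
          qed
        qed
      qed
    qed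
  qed (use i in auto)
qed

end

text \<open>Needed in the critical case to see that the reflection with index 0, driven by services
  only, vanishes in the limit as well.\<close>

lemma inverse_subordinator_nondecreasing:
  assumes "prob_space M" "inverse_stable_subordinator M \<theta> Y" "\<theta> > 0"
  shows "AE \<omega> in M. \<forall>s t. 0 \<le> s \<longrightarrow> s \<le> t \<longrightarrow> Y s \<omega> \<le> Y t \<omega>"
proof -
  obtain L :: "'a \<Rightarrow> real \<Rightarrow> real" where L: "\<forall>\<omega>. subordinator_path (L \<omega>)"
    "\<forall>s\<ge>0. (\<lambda>\<omega>. L \<omega> s) \<in> borel_measurable M"
    "AE \<omega> in M. \<forall>t\<ge>0. Y t \<omega> = path_inverse (L \<omega>) t"
    "\<forall>\<tau> t n. 0 \<le> \<tau> 0 \<longrightarrow> strict_mono \<tau> \<longrightarrow> (\<forall>k. 0 \<le> t k) \<longrightarrow>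
      (\<integral>\<omega>. (\<Prod>k<n. exp (- (t k * (L \<omega> (\<tau> (Suc k)) - L \<omega> (\<tau> k))))) \<partial>M) =
      (\<Prod>k<(n::nat). exp (- ((\<tau> (Suc k) - \<tau> k) * t k powr \<theta>)))"
    by (rule regular_subordinator[OF assms])
  show ?thesis using L(3)
  proof eventually_elim
    case (elim \<omega>)
    show ?case
    proof (intro allI impI)
      fix s t :: real assume "0 \<le> s" "s \<le> t"
      then show "Y s \<omega> \<le> Y t \<omega>" using elim path_inverse_mono[OF L(1)[rule_format]] by simp
    qed
  qed
qed

lemma converges_weakly_cong_limit:
  assumes "converges_weakly S F M X M' Y" "AE \<omega> in M'. Y \<omega> = Z \<omega>"
  shows "converges_weakly S F M X M' Z"
proof -
  have "has_law M' Z S \<nu>" if law: "has_law M' Y S \<nu>" for \<nu>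
  proof -
    obtain Y' where Y': "Y' \<in> measurable M' (borel_of_topology S)" "AE \<omega> in M'. Y \<omega> = Y' \<omega>"
      "\<nu> = distr M' (borel_of_topology S) Y'" using law unfolding has_law_def by (elim bexE conjE)
    have "AE \<omega> in M'. Z \<omega> = Y' \<omega>" using assms(2) Y'(2) by eventually_elim simp
    then show ?thesis unfolding has_law_def using Y'(1,3) by (intro bexI[of _ Y'] conjI)
  qed
  moreover obtain \<nu> \<nu>\<^sub>0 where "\<forall>\<^sub>F u in F. has_law M (X u) S (\<nu> u)" "has_law M' Y S \<nu>\<^sub>0"
    "\<forall>g. continuous_map S euclideanreal g \<and> bounded (g ` topspace S) \<longrightarrow>
       ((\<lambda>u. \<integral>x. g x \<partial>\<nu> u) \<longlongrightarrow> (\<integral>x. g x \<partial>\<nu>\<^sub>0)) F"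
    using assms(1) unfolding converges_weakly_def by (elim exE conjE)
  ultimately show ?thesis unfolding converges_weakly_def by (intro exI[of _ \<nu>] exI[of _ \<nu>\<^sub>0] conjI)
qed

theorem theorem2p9:
  fixes M :: "'a measure" and M' :: "'b measure"
    and \<alpha> \<beta> lam \<mu> \<gamma> :: real and K :: nat and p P :: "nat \<Rightarrow> real"
    and N D :: "real \<Rightarrow> 'a \<Rightarrow> nat" and C :: "nat \<Rightarrow> 'a \<Rightarrow> nat"
    and Q :: "nat \<Rightarrow> real \<Rightarrow> 'a \<Rightarrow> nat"
    and Y Y' :: "real \<Rightarrow> 'b \<Rightarrow> real"
  assumes "prob_space M" and "prob_space M'"
    and "\<alpha> \<in> {0<..1}" and "\<beta> \<in> {0<..1}" and "lam > 0" and "\<mu> > 0"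
    and "K \<ge> 1" and "\<And>i. i \<in> {1..K} \<Longrightarrow> p i > 0" and "(\<Sum>i=1..K. p i) = 1"
    and P_def: "\<And>i. P i = (\<Sum>l=1..i. p l)"
    and \<gamma>_def: "\<gamma> = max \<alpha> \<beta>"
    and queue: "restless_mittag_leffler_queue M K p \<alpha> lam \<beta> \<mu> N D C Q"
    and "inverse_stable_subordinator M' \<alpha> Y"
    and "inverse_stable_subordinator M' \<alpha> Y'"
    and indep: "prob_space.indep_var M'
           (Pi\<^sub>M {0..} (\<lambda>_. borel)) (\<lambda>\<omega>. \<lambda>t\<in>{0..}. Y t \<omega>)
           (Pi\<^sub>M {0..} (\<lambda>_. borel)) (\<lambda>\<omega>. \<lambda>t\<in>{0..}. Y' t \<omega>)"
  shows "(\<forall>i\<in>{1..K}. converges_weakly J1_topology at_top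
           M (\<lambda>u \<omega>. \<lambda>t\<in>{0..}. real (\<Sum>l=1..i. Q l (u * t) \<omega>) / u powr \<gamma>)
           M' (\<lambda>\<omega>. \<lambda>t\<in>{0..}.
                 if \<alpha> > \<beta> then lam powr \<alpha> * P i * Y t \<omega>
                 else if \<beta> > \<alpha> then 0
                 else skorokhod_reflection (\<lambda>s. lam powr \<alpha> * P i * Y s \<omega> - \<mu> powr \<alpha> * Y' s \<omega>) t)) \<and>
         (\<alpha> = \<beta> \<longrightarrow> (\<forall>i\<in>{1..K}. converges_weakly J1_topology at_top
           M (\<lambda>u \<omega>. \<lambda>t\<in>{0..}. real (Q i (u * t) \<omega>) / u powr \<gamma>)
           M' (\<lambda>\<omega>. \<lambda>t\<in>{0..}.
                 skorokhod_reflection (\<lambda>s. lam powr \<alpha> * P i * Y s \<omega> - \<mu> powr \<alpha> * Y' s \<omega>) t -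
                 skorokhod_reflection (\<lambda>s. lam powr \<alpha> * P (i - 1) * Y s \<omega> - \<mu> powr \<alpha> * Y' s \<omega>) t)))"
proof -
  interpret mittag_leffler_queue M K p P \<alpha> lam \<beta> \<mu> N D C Q
    by (intro mittag_leffler_queue.intro mittag_leffler_queue_axioms.intro) (use assms in auto)
  have first: "converges_weakly J1_topology at_top
           M (\<lambda>u \<omega>. \<lambda>t\<in>{0..}. real (\<Sum>l=1..i. Q l (u * t) \<omega>) / u powr \<gamma>)
           M' (\<lambda>\<omega>. \<lambda>t\<in>{0..}.
                 if \<alpha> > \<beta> then lam powr \<alpha> * P i * Y t \<omega>
                 else if \<beta> > \<alpha> then 0
                 else skorokhod_reflection (\<lambda>s. lam powr \<alpha> * P i * Y s \<omega> - \<mu> powr \<alpha> * Y' s \<omega>) t)"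
    if i: "i \<in> {1..K}" for i
  proof -
    have iK: "i \<le> K" using i by simp
    consider "\<alpha> > \<beta>" | "\<beta> > \<alpha>" | "\<alpha> = \<beta>" by linarith
    then show ?thesis
    proof cases
      case 1
      then show ?thesis using supercritical_limit[OF assms(2) 1 assms(13) iK] by (simp add: \<gamma>_def)
    next
      case 2
      then show ?thesis using subcritical_limit[OF assms(2) 2 iK] by (simp add: \<gamma>_def)
    next
      case 3
      \<comment> \<open>\<open>P 0\<close> is an empty sum, so the second driving path is minus a
        nondecreasing one almost surely and its reflection is 0.\<close>
      have "AE \<omega> in M'. (\<lambda>t\<in>{0..}. skorokhod_reflection (\<lambda>s. lam powr \<alpha> * P i * Y s \<omega> - \<mu> powr \<alpha> * Y' s \<omega>) t -
            skorokhod_reflection (\<lambda>s. lam powr \<alpha> * P 0 * Y s \<omega> - \<mu> powr \<alpha> * Y' s \<omega>) t) =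
          (\<lambda>t\<in>{0..}. skorokhod_reflection (\<lambda>s. lam powr \<alpha> * P i * Y s \<omega> - \<mu> powr \<alpha> * Y' s \<omega>) t)"
        using inverse_subordinator_nondecreasing[OF assms(2) assms(14) \<alpha>(1)]
      proof eventually_elim
        case (elim \<omega>)
        have "skorokhod_reflection (\<lambda>s. lam powr \<alpha> * P 0 * Y s \<omega> - \<mu> powr \<alpha> * Y' s \<omega>) t = 0" if "t \<ge> 0" for t
          by (rule reflection_antimono[OF that]) (use elim P_def in \<open>auto intro!: mult_left_mono\<close>)
        then show ?case by (intro restrict_ext) auto
      qed
      from converges_weakly_cong_limit[OF critical_limit[OF assms(2) 3 assms(13) assms(14) indep iK le0] this]
      show ?thesis using 3 by (simp add: \<gamma>_def)
    qed
  qed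
  have second: "converges_weakly J1_topology at_top
           M (\<lambda>u \<omega>. \<lambda>t\<in>{0..}. real (Q i (u * t) \<omega>) / u powr \<gamma>)
           M' (\<lambda>\<omega>. \<lambda>t\<in>{0..}.
                 skorokhod_reflection (\<lambda>s. lam powr \<alpha> * P i * Y s \<omega> - \<mu> powr \<alpha> * Y' s \<omega>) t -
                 skorokhod_reflection (\<lambda>s. lam powr \<alpha> * P (i - 1) * Y s \<omega> - \<mu> powr \<alpha> * Y' s \<omega>) t)"
    if eq: "\<alpha> = \<beta>" and i: "i \<in> {1..K}" for i
  proof -
    have iK: "i \<le> K" "i - 1 \<le> K" using i by auto
    obtain m where m: "i = Suc m" using i by (cases i) auto
    \<comment> \<open>The cumulative queues telescope to one class; for \<open>i = 1\<close> the
      subtracted sum is empty, in accordance with \<open>P 0 = 0\<close>.\<close>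
    have "real (\<Sum>l=1..i. Q l s \<omega>) - real (\<Sum>l=1..i - 1. Q l s \<omega>) = real (Q i s \<omega>)" for s \<omega>
      by (simp add: m)
    moreover have "\<gamma> = \<alpha>" using eq by (simp add: \<gamma>_def)
    ultimately show ?thesis using critical_limit[OF assms(2) eq assms(13) assms(14) indep iK] by simp
  qed
  show ?thesis using first second by blast
qed

end
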